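(* Let $p,q\ge 1$ be integers and consider the log-linear Poisson GARCH$(p,q)$ model with compact parameter set $\Theta\subset\mathbb{R}^{1+p+q}$, $\theta=(\omega,a_1,\dots,a_p,b_1,\dots,b_q)$ (see context). For $x=(x_{1-(p\vee q)},\dots,x_0)\in\mathbb{R}^{p\vee q}$, $m\in\mathbb{Z}_{\ge 0}$ and $w=(w_{-q+1},\dots,w_m)\in\{0,1\}^{q+m}$, let $\widehat\psi^\theta\langle w\rangle(x):=x_{m+1}$, where $x_1,\dots,x_{m+1}$ are obtained by the recursion $$x_k=\sum_{j=1}^p a_j x_{k-j}+\sum_{j=1}^q b_j w_{k-j}x_{k-j},\qquad 1\le k\le m+1 .$$ Suppose that for all $\theta\in\Theta$, $$\lim_{m\to\infty}\max\{|\widehat\psi^\theta\langle w\rangle(x)| : w\in\{0,1\}^{q+m}\}=0\quad\text{for all }x\in\mathbb{R}^{p\vee q}.$$ Define the polynomials $\mathrm{P}_p(z;a_{1:p})=z^p-\sum_{k=1}^p a_k z^{p-k}$ and $\mathrm{Q}_q(z;b_{1:q})=\sum_{k=0}^{q-1}b_{k+1}z^{q-1-k}$. Then: (i) For all $\theta\in\Theta$, there exists a unique (in law) stationary solution $\{(X_k,Y_k)\}$ to the model equations. Moreover, for any $\tau>0$ and all $\theta\in\Theta$, $\int_{\mathbb{R}} e^{\tau|x|}\,\pi_{\mathsf X}^\theta(\mathrm{d}x)<\infty$, where $\pi_{\mathsf X}^\theta$ is the law of $X_0$ under the stationary distribution. (ii) For any $x_1^{(i)}\in\mathbb{R}$ and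 $y_1^{(i)}\in\mathbb{Z}_{\ge0}$, setting $z^{(i)}=(x_1^{(i)},\dots,x_1^{(i)},\ln(1+y_1^{(i)}),\dots,\ln(1+y_1^{(i)}))\in\mathbb{R}^p\times\mathbb{R}^{q-1}$, the conditional maximum likelihood estimator $\hat\theta_{z^{(i)},n}$ is equivalence-class consistent: for any $\theta_\star\in\Theta$, $$\lim_{n\to\infty}\Delta(\hat\theta_{z^{(i)},n},[\theta_\star])=0\quad \tilde{\mathbb{P}}^{\theta_\star}\text{-a.s.}$$ (iii) If moreover the true parameter $\theta_\star=(\omega^\star,a^\star_{1:p},b^\star_{1:q})\in\Theta$ is such that the polynomials $\mathrm{P}_p(\cdot;a^\star_{1:p})$ and $\mathrm{Q}_q(\cdot;b^\star_{1:q})$ have no common complex roots, then $\hat\theta_{z^{(i)},n}$ is consistent, that is, $\lim_{n\to\infty}\Delta(\hat\theta_{z^{(i)},n},\theta_\star)=0$, $\tilde{\mathbb{P}}^{\theta_\star}$-a.s.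
   Context: Model: for a parameter $\theta=(\omega,a_{1:p},b_{1:q})$, a process $(X_k)_{k>-p}$ valued in $\mathbb{R}$ and $(Y_k)_{k>-q}$ valued in $\mathbb{Z}_{\ge0}$ satisfies the log-linear Poisson GARCH$(p,q)$ model if for all $k\ge0$, conditionally on $\mathcal{F}_k=\sigma(X_{-p+1},\dots,X_k,Y_{-q+1},\dots,Y_{k-1})$, $Y_k$ has the Poisson distribution with mean $e^{X_k}$, and $$X_{k+1}=\omega+\sum_{i=1}^p a_iX_{k+1-i}+\sum_{i=1}^q b_i\ln(1+Y_{k+1-i}).$$ $\Theta$ is a compact set endowed with a metric $\Delta$ (inducing the usual topology). Stationary solution: when it exists and is unique in law, $\mathbb{P}^\theta$ denotes the law of the stationary process $\{(X_k,Y_k):k\in\mathbb{Z}\}$ such that, for all $k\in\mathbb{Z}$, conditionally on $\mathcal{F}_k=\sigma(X_j,j\le k;\,Y_j,j\le k-1)$, $Y_k$ has the Poisson distribution with mean $e^{X_k}$, and $X_{k+1}=\omega+\sum_{i=1}^p a_iX_{k+1-i}+\sum_{i=1}^q b_i\ln(1+Y_{k+1-i})$; $\tilde{\mathbb{P}}^\theta$ denotes the induced law of $\{Y_k:k\in\mathbb{Z}\}$. Write $[\theta]=\{\theta'\in\Theta:\tilde{\mathbb{P}}^{\theta'}=\tilde{\mathbb{P}}^{\theta}\}$, and $\Delta(\theta,A)=\inf_{\theta'\in A}\Delta(\theta,\theta')$. Conditional MLE: given $z=(x_{-p+1},\dots,x_0,u_{-q+1},\dots,u_{-1})\in\mathbb{R}^p\times\mathbb{R}^{q-1}$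 and observations $Y_0,\dots,Y_n$, put $u_k=\ln(1+Y_k)$ for $k\ge0$ and, for $k\ge1$, $x_k=x_k(\theta)=\omega+\sum_{i=1}^pa_ix_{k-i}+\sum_{i=1}^qb_iu_{k-i}$. Then $$\mathsf{L}^\theta_{z,n}=n^{-1}\sum_{k=1}^n\ln g(x_k(\theta);Y_k),\qquad g(x;y)=e^{-e^x}\frac{e^{xy}}{y!},$$ and $\hat\theta_{z,n}\in\operatorname{argmax}_{\theta\in\Theta}\mathsf{L}^\theta_{z,n}$. Notation: $p\vee q=\max(p,q)$. *)

theory Defs
  imports "HOL-Probability.Probability" "HOL-Computational_Algebra.Polynomial"
begin

section \<open>Parameters\<close>

text \<open>
  A parameter is a triple $(\omega, a, b)$, with $a$ and $b$ supported on \<open>{1..p}\<close> and \<open>{1..q}\<close>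
  respectively. On \<open>param_space p q\<close> the product topology of the ambient type is the usual
  topology of \<open>\<real>\<close>-space of dimension \<open>1 + p + q\<close>.
\<close>

type_synonym param = "real \<times> (nat \<Rightarrow> real) \<times> (nat \<Rightarrow> real)"

abbreviation om :: "param \<Rightarrow> real" where "om \<theta> \<equiv> fst \<theta>"
abbreviation ca :: "param \<Rightarrow> nat \<Rightarrow> real" where "ca \<theta> \<equiv> fst (snd \<theta>)"
abbreviation cb :: "param \<Rightarrow> nat \<Rightarrow> real" where "cb \<theta> \<equiv> snd (snd \<theta>)"

definition param_space :: "nat \<Rightarrow> nat \<Rightarrow> param set" where
  "param_space p q =
     {\<theta>. (\<forall>i. i \<notin> {1..p} \<longrightarrow> ca \<theta> i = 0) \<and> (\<forall>i. i \<notin> {1..q} \<longrightarrow> cb \<theta> i = 0)}"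

section \<open>Stationary solutions\<close>

type_synonym path = "int \<Rightarrow> real \<times> nat"

definition path_space :: "path measure" where
  "path_space = PiM UNIV (\<lambda>_. borel \<Otimes>\<^sub>M count_space UNIV)"

definition obs_space :: "(int \<Rightarrow> nat) measure" where
  "obs_space = PiM UNIV (\<lambda>_. count_space UNIV)"

definition past ::
  "'w measure \<Rightarrow> (int \<Rightarrow> 'w \<Rightarrow> real) \<Rightarrow> (int \<Rightarrow> 'w \<Rightarrow> nat) \<Rightarrow> int \<Rightarrow> 'w measure" where
  "past M X Y k = sigma (space M)
     ({X j -` A \<inter> space M | j A. j \<le> k \<and> A \<in> sets borel} \<union>
      {Y j -` B \<inter> space M | j B. j \<le> k - 1})"

text \<open>
  Invariance of the law under the unit shift is invariance under all integer shifts.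
  The conditional law of \<open>Y k\<close> is given by its conditional point masses.
\<close>

definition stationary_solution ::
  "nat \<Rightarrow> nat \<Rightarrow> param \<Rightarrow> 'w measure \<Rightarrow> (int \<Rightarrow> 'w \<Rightarrow> real) \<Rightarrow> (int \<Rightarrow> 'w \<Rightarrow> nat) \<Rightarrow> bool" where
  "stationary_solution p q \<theta> M X Y \<longleftrightarrow>
     prob_space M \<and>
     (\<forall>k. X k \<in> borel_measurable M) \<and>
     (\<forall>k. Y k \<in> measurable M (count_space UNIV)) \<and>
     distr M path_space (\<lambda>w k. (X (k + 1) w, Y (k + 1) w)) =
       distr M path_space (\<lambda>w k. (X k w, Y k w)) \<and>
     (\<forall>k n. AE w in M.
        real_cond_exp M (past M X Y k) (indicator {v \<in> space M. Y k v = n}) w =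
          pmf (poisson_pmf (exp (X k w))) n) \<and>
     (\<forall>k. AE w in M.
        X (k + 1) w = om \<theta>
          + (\<Sum>i = 1..p. ca \<theta> i * X (k + 1 - int i) w)
          + (\<Sum>i = 1..q. cb \<theta> i * ln (1 + real (Y (k + 1 - int i) w))))"

text \<open>
  Laws of stationary solutions, as measures on path space: those under which the coordinate
  process is a stationary solution.
\<close>

definition stationary_law :: "nat \<Rightarrow> nat \<Rightarrow> param \<Rightarrow> path measure \<Rightarrow> bool" where
  "stationary_law p q \<theta> P \<longleftrightarrow>
     sets P = sets path_space \<and>
     stationary_solution p q \<theta> P (\<lambda>k w. fst (w k)) (\<lambda>k w. snd (w k))"

definition law_XY :: "nat \<Rightarrow> nat \<Rightarrow> param \<Rightarrow> path measure" where
  "law_XY p q \<theta> = (THE P. stationary_law p q \<theta> P)"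

definition law_X0 :: "nat \<Rightarrow> nat \<Rightarrow> param \<Rightarrow> real measure" where
  "law_X0 p q \<theta> = distr (law_XY p q \<theta>) borel (\<lambda>w. fst (w 0))"

definition law_Y :: "nat \<Rightarrow> nat \<Rightarrow> param \<Rightarrow> (int \<Rightarrow> nat) measure" where
  "law_Y p q \<theta> = distr (law_XY p q \<theta>) obs_space (\<lambda>w k. snd (w k))"

definition equiv_params :: "nat \<Rightarrow> nat \<Rightarrow> param set \<Rightarrow> param \<Rightarrow> param set" where
  "equiv_params p q \<Theta> \<theta> = {\<theta>' \<in> \<Theta>. law_Y p q \<theta>' = law_Y p q \<theta>}"

definition dist_to_set :: "('a \<Rightarrow> 'a \<Rightarrow> real) \<Rightarrow> 'a \<Rightarrow> 'a set \<Rightarrow> real" where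
  "dist_to_set \<Delta> \<theta> A = (INF \<theta>'\<in>A. \<Delta> \<theta> \<theta>')"

section \<open>The contraction condition\<close>

text \<open>
  Vectors indexed by integer intervals are functions on \<open>int\<close>. The recursion below only uses the
  entries of \<open>x\<close> with index in \<open>{1 - max p q..0}\<close>, and \<open>psi_hat\<close> only uses the entries
  of \<open>w\<close> with index in \<open>{1 - q..m}\<close>.
\<close>

function psi_rec ::
  "nat \<Rightarrow> nat \<Rightarrow> param \<Rightarrow> (int \<Rightarrow> real) \<Rightarrow> (int \<Rightarrow> real) \<Rightarrow> int \<Rightarrow> real" where
  "psi_rec p q \<theta> w x k =
     (if k \<le> 0 then x k
      else (\<Sum>j = 1..p. ca \<theta> j * psi_rec p q \<theta> w x (k - int j))
         + (\<Sum>j = 1..q. cb \<theta> j * w (k - int j) * psi_rec p q \<theta> w x (k - int j)))"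
  by pat_completeness auto
termination
  by (relation "Wellfounded.measure (\<lambda>(p, q, \<theta>, w, x, k). nat k)") auto

declare psi_rec.simps [simp del]

definition psi_hat ::
  "nat \<Rightarrow> nat \<Rightarrow> param \<Rightarrow> nat \<Rightarrow> (int \<Rightarrow> real) \<Rightarrow> (int \<Rightarrow> real) \<Rightarrow> real" where
  "psi_hat p q \<theta> m w x = psi_rec p q \<theta> w x (int m + 1)"

definition binary_words :: "nat \<Rightarrow> nat \<Rightarrow> (int \<Rightarrow> real) set" where
  "binary_words q m = {1 - int q..int m} \<rightarrow>\<^sub>E {0, 1}"

section \<open>Conditional maximum likelihood\<close>

text \<open>
  The initial vector $z$ is given as a pair of functions: \<open>xi\<close>, used at the indices \<open>{1 - p..0}\<close>,
  and \<open>ui\<close>, used at the indices \<open>{1 - q..-1}\<close>.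
\<close>

definition log_obs :: "(int \<Rightarrow> real) \<Rightarrow> (int \<Rightarrow> nat) \<Rightarrow> int \<Rightarrow> real" where
  "log_obs ui y k = (if k < 0 then ui k else ln (1 + real (y k)))"

function filter_rec ::
  "nat \<Rightarrow> nat \<Rightarrow> param \<Rightarrow> (int \<Rightarrow> real) \<Rightarrow> (int \<Rightarrow> real) \<Rightarrow> int \<Rightarrow> real" where
  "filter_rec p q \<theta> xi u k =
     (if k \<le> 0 then xi k
      else om \<theta> + (\<Sum>i = 1..p. ca \<theta> i * filter_rec p q \<theta> xi u (k - int i))
         + (\<Sum>i = 1..q. cb \<theta> i * u (k - int i)))"
  by pat_completeness auto
termination
  by (relation "Wellfounded.measure (\<lambda>(p, q, \<theta>, xi, u, k). nat k)") auto

declare filter_rec.simps [simp del]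

definition g_dens :: "real \<Rightarrow> nat \<Rightarrow> real" where
  "g_dens x y = exp (- exp x) * (exp (x * real y) / fact y)"

definition log_lik ::
  "nat \<Rightarrow> nat \<Rightarrow> (int \<Rightarrow> real) \<times> (int \<Rightarrow> real) \<Rightarrow> nat \<Rightarrow> (int \<Rightarrow> nat) \<Rightarrow> param \<Rightarrow> real" where
  "log_lik p q z n y \<theta> =
     (1 / real n) *
     (\<Sum>k = 1..n. ln (g_dens (filter_rec p q \<theta> (fst z) (log_obs (snd z) y) (int k)) (y (int k))))"

text \<open>
  An arbitrary selection of maximisers; it need not be measurable in the observations.
\<close>

definition is_cond_mle ::
  "nat \<Rightarrow> nat \<Rightarrow> param set \<Rightarrow> (int \<Rightarrow> real) \<times> (int \<Rightarrow> real) \<Rightarrow>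
   (nat \<Rightarrow> (int \<Rightarrow> nat) \<Rightarrow> param) \<Rightarrow> bool" where
  "is_cond_mle p q \<Theta> z \<theta>hat \<longleftrightarrow>
     (\<forall>n\<ge>1. \<forall>y. is_arg_max (log_lik p q z n y) (\<lambda>\<theta>. \<theta> \<in> \<Theta>) (\<theta>hat n y))"

definition const_init :: "real \<Rightarrow> nat \<Rightarrow> (int \<Rightarrow> real) \<times> (int \<Rightarrow> real)" where
  "const_init x1 y1 = ((\<lambda>_. x1), (\<lambda>_. ln (1 + real y1)))"

section \<open>The characteristic polynomials\<close>

definition P_poly :: "nat \<Rightarrow> (nat \<Rightarrow> real) \<Rightarrow> complex poly" where
  "P_poly p a = monom 1 p - (\<Sum>k = 1..p. monom (of_real (a k)) (p - k))"

definition Q_poly :: "nat \<Rightarrow> (nat \<Rightarrow> real) \<Rightarrow> complex poly" where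
  "Q_poly q b = (\<Sum>k<q. monom (of_real (b (k + 1))) (q - 1 - k))"

end

(*
The stationary X_k is a function of the past observations, X_k = c + sum_j h_j ln(1 + Y_(k-1-j))
with geometrically decaying h_j. Stationary solutions therefore correspond to shift-invariant laws
of Y whose conditional law given the past is Poisson with this intensity.

Writing ln(1 + Y_k) as max(X_k, 0) plus noise makes X a linear recursion with coefficients
a_j + b_j w_(k-j), w in {0,1}. The hypothesis makes these recursions contract geometrically,
uniformly in w and on the compact parameter set, while the exponential moments of the noise are
bounded uniformly in X_k; this gives the moment bounds.

Existence: the Cesaro averages of the chain started from an empty past are tight, and their limits
along a subsequence extend to a law on sequences by Kolmogorov's theorem.

Uniqueness and ergodicity: glue the future of one stationary law to an independent past of another.
The filters started from the two pasts merge geometrically, so the likelihood ratio of the two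
futures stays bounded. By Hopf's argument an invariant event then has the same probability, 0 or 1,
under both laws, and the ergodic theorem shows that the laws agree.

Consistency: the contrast of a parameter with the true one has positive mean unless their filters
agree almost surely, in which case the observation laws agree. The ergodic theorem and a finite cover
of the complement of a neighbourhood of the equivalence class conclude (Wald's argument).

Identifiability: if two filters agree, eliminating X between the two recursions leaves a linear
relation among the ln(1 + Y_k) with coefficient polynomial P' Q - P Q'. It vanishes, since no
observation is a function of its past; if P and Q have no common root then P divides P', and equal
degrees give P' = P and Q' = Q.
*)

theory Submission
  imports Defs "HOL-Computational_Algebra.Fundamental_Theorem_Algebra"
begin

section \<open>Time-varying linear recursions\<close>

text \<open>Started from a fixed past, \<open>X\<close> moves on a countable set, and different
  starting points give in general disjoint sets, so laws of \<open>X\<close> from two starting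
  points need not overlap at all. This is why the work is done with laws of \<open>Y\<close> alone:
  there all one-step densities are positive, two pasts give comparable futures, and a window of
  observations has only countably many values. The switching word comes from the Poisson law: ln(1 +
  Y) follows x when the mean exp x is large and stays near 0 when x is very negative. So w is the
  sign of the state, selected by the trajectory itself, and a bound is useful only if it holds for
  all words at once. Full words enter the moment bounds, one parameter at a time; the estimates
  uniform over \<Theta> concern filters driven by given observations, which are linear and
  correspond to the word w = 0. The estimator is an arbitrary, possibly non-measurable selection of
  maximisers, so consistency is drawn from almost sure likelihood inequalities that hold for all
  \<theta> of a neighbourhood simultaneously.\<close>

text \<open>\<open>impulse r c l n\<close> is the value at time \<open>l + n\<close> of the solution of
  \<open>x k = (\<Sum>j=1..r. c k j * x (k - j))\<close> started from \<open>x l = 1\<close> and zeros before \<open>l\<close>.\<close>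

function impulse :: "nat \<Rightarrow> (int \<Rightarrow> nat \<Rightarrow> real) \<Rightarrow> int \<Rightarrow> nat \<Rightarrow> real" where
  "impulse r c l n = (if n = 0 then 1
     else (\<Sum>j\<in>{1..min r n}. c (l + int n) j * impulse r c l (n - j)))"
  by pat_completeness auto
termination by (relation "Wellfounded.measure (\<lambda>(r, c, l, n). n)") auto

declare impulse.simps [simp del]

lemma impulse_0 [simp]: "impulse r c l 0 = 1"
  by (subst impulse.simps) simp

lemma impulse_pos:
  assumes "n > 0"
  shows "impulse r c l n =
    (\<Sum>j=1..r. if j \<le> n then c (l + int n) j * impulse r c l (n - j) else 0)"
proof -
  have "impulse r c l n = (\<Sum>j\<in>{1..min r n}. c (l + int n) j * impulse r c l (n - j))"
    using assms by (subst impulse.simps) simp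
  also have "\<dots> = (\<Sum>j=1..r. if j \<le> n then c (l + int n) j * impulse r c l (n - j) else 0)"
    by (rule sum.mono_neutral_cong_left) auto
  finally show ?thesis .
qed

text \<open>Variation of constants in discrete time: by linearity each forcing term is propagated by
  the impulse response launched at its own time.\<close>

lemma superposition:
  assumes "\<And>k. k \<le> k1 \<Longrightarrow> x k = 0"
    and "\<And>k. k1 < k \<Longrightarrow> k \<le> k1 + int n \<Longrightarrow>
      x k = (\<Sum>j=1..r. c k j * x (k - int j)) + e k"
  shows "x (k1 + int n) = (\<Sum>l=1..n. impulse r c (k1 + int l) (n - l) * e (k1 + int l))"
  using assms(2)
proof (induction n rule: less_induct)
  case (less n)
  show ?case
  proof (cases "n = 0")
    case True
    then show ?thesis using assms(1)[of k1] by simp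
  next
    case False
    define I where "I l m = impulse r c (k1 + int l) m" for l m
    define E where "E l = e (k1 + int l)" for l
    define K where "K = k1 + int n"
    have *: "c K j * x (K - int j) =
        (\<Sum>l=1..n. if j + l \<le> n then c K j * I l (n - l - j) * E l else 0)"
      if j: "j \<in> {1..r}" for j
    proof (cases "j < n")
      case True
      have "x (k1 + int (n - j)) = (\<Sum>l=1..n-j. I l (n - j - l) * E l)"
        unfolding I_def E_def using j True by (intro less.IH less.prems) auto
      moreover have "k1 + int (n - j) = K - int j" using True by (simp add: K_def)
      ultimately have "c K j * x (K - int j) = (\<Sum>l=1..n-j. c K j * I l (n - l - j) * E l)"
        by (simp add: sum_distrib_left mult.assoc add.commute)
      also have "\<dots> = (\<Sum>l=1..n. if j + l \<le> n then c K j * I l (n - l - j) * E l else 0)"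
        by (rule sum.mono_neutral_cong_left) auto
      finally show ?thesis .
    next
      case False
      then have "x (K - int j) = 0" by (intro assms(1)) (auto simp: K_def)
      moreover have "(\<Sum>l=1..n. if j + l \<le> n then c K j * I l (n - l - j) * E l else 0) = 0"
        using False by (intro sum.neutral) auto
      ultimately show ?thesis by simp
    qed
    have "x K = (\<Sum>j=1..r. c K j * x (K - int j)) + E n"
      using less.prems[of K] False by (simp add: K_def E_def)
    also have "(\<Sum>j=1..r. c K j * x (K - int j)) =
        (\<Sum>j=1..r. \<Sum>l=1..n. if j + l \<le> n then c K j * I l (n - l - j) * E l else 0)"
      by (rule sum.cong[OF refl *])
    also have "\<dots> = (\<Sum>l=1..n. \<Sum>j=1..r. if j + l \<le> n then c K j * I l (n - l - j) * E l else 0)"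
      by (rule sum.swap)
    \<comment> \<open>With the sums exchanged, the inner sum over lags is the recursion defining the
      impulse response launched at \<open>k1 + l\<close>. It is empty for \<open>l = n\<close>; that
      term is the forcing \<open>E n\<close> itself.\<close>
    also have "\<dots> = (\<Sum>l=1..n. if l < n then I l (n - l) * E l else 0)"
    proof (rule sum.cong[OF refl])
      fix l assume l: "l \<in> {1..n}"
      show "(\<Sum>j=1..r. if j + l \<le> n then c K j * I l (n - l - j) * E l else 0) =
          (if l < n then I l (n - l) * E l else 0)"
      proof (cases "l < n")
        case True
        have K: "k1 + int l + int (n - l) = K" using True by (simp add: K_def)
        have "I l (n - l) = (\<Sum>j=1..r. if j \<le> n - l then c K j * I l (n - l - j) else 0)"
          unfolding I_def using True by (subst impulse_pos) (simp_all only: K zero_less_diff)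
        then have "I l (n - l) * E l =
            (\<Sum>j=1..r. (if j \<le> n - l then c K j * I l (n - l - j) else 0) * E l)"
          by (simp only: sum_distrib_right)
        also have "\<dots> = (\<Sum>j=1..r. if j + l \<le> n then c K j * I l (n - l - j) * E l else 0)"
          using True by (intro sum.cong) auto
        finally show ?thesis using True by simp
      next
        case False
        then show ?thesis by (intro trans[OF sum.neutral]) auto
      qed
    qed
    also have "\<dots> = (\<Sum>l=1..n-1. I l (n - l) * E l)"
      by (rule sum.mono_neutral_cong_right) auto
    also have "\<dots> + E n = (\<Sum>l=1..n. I l (n - l) * E l)"
    proof -
      have "{1..n} = insert n {1..n-1}" using False by auto
      then show ?thesis using False by (simp add: I_def)
    qed
    finally show ?thesis by (simp add: K_def I_def E_def)
  qed
qed

text \<open>Serves only for the initial stretch of times during which the contraction has not yet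
  taken effect.\<close>

lemma impulse_crude:
  assumes "\<And>k j. \<bar>c k j\<bar> \<le> B"
  shows "\<bar>impulse r c l n\<bar> \<le> (1 + real r * B) ^ n"
proof (induction n rule: less_induct)
  case (less n)
  have B: "0 \<le> B" using assms[of 0 0] by linarith
  show ?case
  proof (cases "n = 0")
    case False
    have "\<bar>impulse r c l n\<bar> \<le>
        (\<Sum>j=1..r. \<bar>if j \<le> n then c (l + int n) j * impulse r c l (n - j) else 0\<bar>)"
      using False by (subst impulse_pos) (auto intro: sum_abs)
    also have "\<dots> \<le> (\<Sum>j=1..r. B * (1 + real r * B) ^ (n - 1))"
    proof (rule sum_mono)
      fix j assume j: "j \<in> {1..r}"
      show "\<bar>if j \<le> n then c (l + int n) j * impulse r c l (n - j) else 0\<bar>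
          \<le> B * (1 + real r * B) ^ (n - 1)"
      proof (cases "j \<le> n")
        case True
        have "\<bar>impulse r c l (n - j)\<bar> \<le> (1 + real r * B) ^ (n - j)"
          using less[of "n - j"] j False by auto
        also have "\<dots> \<le> (1 + real r * B) ^ (n - 1)"
          using j B by (intro power_increasing) auto
        finally have "\<bar>c (l + int n) j\<bar> * \<bar>impulse r c l (n - j)\<bar> \<le> B * (1 + real r * B) ^ (n - 1)"
          using assms B by (intro mult_mono) auto
        then show ?thesis using True by (simp add: abs_mult)
      qed (use B in simp)
    qed
    also have "\<dots> = (real r * B) * (1 + real r * B) ^ (n - 1)" by simp
    also have "\<dots> \<le> (1 + real r * B) * (1 + real r * B) ^ (n - 1)"
      using B by (intro mult_right_mono) auto
    also have "\<dots> = (1 + real r * B) ^ n" using False by (simp add: power_eq_if)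
    finally show ?thesis .
  qed simp
qed

text \<open>The coefficients vary in time, so there is no spectral radius to appeal to. Instead the
  last r values up to time \<open>l + m\<close> are treated as fresh data: erase everything before
  them and let \<open>e\<close> be the defect of the cut trajectory. Beyond the window the recursion
  holds, so \<open>e\<close> lives on r times and is at most (1 + rB)M; each defect travels between
  \<open>m0\<close> and \<open>m0 + r - 1\<close> steps and is multiplied by at most
  \<delta>.\<close>

lemma impulse_window:
  assumes B: "\<And>k j. \<bar>c k j\<bar> \<le> B" and r: "r \<ge> 1"
    and \<delta>: "real r * (1 + real r * B) * \<delta> \<le> 1 / 2"
    and small: "\<And>l i. i < r \<Longrightarrow> \<bar>impulse r c l (m0 + i)\<bar> \<le> \<delta>"
    and M: "\<And>i. i < r \<Longrightarrow> i \<le> m \<Longrightarrow> \<bar>impulse r c l (m - i)\<bar> \<le> M"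
  shows "\<bar>impulse r c l (m + m0)\<bar> \<le> M / 2"
proof (cases "m0 = 0")
  case True
  have B0: "0 \<le> B" using B[of 0 0] by linarith
  \<comment> \<open>With \<open>m0 = 0\<close> the small window would contain the impulse itself, of
    size 1, which contradicts the choice of \<delta>.\<close>
  have "1 \<le> \<delta>" using small[of 0 l] r True by simp
  moreover have "1 \<le> real r * (1 + real r * B)"
    using r B0 mult_mono[of 1 "real r" 1 "1 + real r * B"] by simp
  ultimately have "1 \<le> real r * (1 + real r * B) * \<delta>"
    using mult_mono[of 1 "real r * (1 + real r * B)" 1 \<delta>] by simp
  then show ?thesis using \<delta> by simp
next
  case m0: False
  have B0: "0 \<le> B" using B[of 0 0] by linarith
  have M0: "0 \<le> M" using M[of 0] r by force
  have \<delta>0: "0 \<le> \<delta>" using small[of 0 l] r by force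
  define k1 where "k1 = l + int m - int r"
  define x where "x k = (if l \<le> k \<and> k1 < k then impulse r c l (nat (k - l)) else 0)" for k
  define e where "e k = x k - (\<Sum>j=1..r. c k j * x (k - int j))" for k
  have xM: "\<bar>x k\<bar> \<le> M" if "k \<le> l + int m" for k
  proof (cases "l \<le> k \<and> k1 < k")
    case True
    then have "nat (k - l) = m - nat (l + int m - k)" using that by auto
    moreover have "\<bar>impulse r c l (m - nat (l + int m - k))\<bar> \<le> M"
      using True that by (intro M) (auto simp: k1_def)
    ultimately show ?thesis using True by (simp add: x_def)
  qed (use M0 in \<open>auto simp: x_def\<close>)
  have e0: "e k = 0" if k: "l + int m < k" for k
  proof -
    have "x k = impulse r c l (nat (k - l))" using k by (simp add: x_def k1_def)
    also have "\<dots> = (\<Sum>j=1..r. if j \<le> nat (k - l)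
        then c (l + int (nat (k - l))) j * impulse r c l (nat (k - l) - j) else 0)"
      using k by (subst impulse_pos) auto
    also have "\<dots> = (\<Sum>j=1..r. c k j * x (k - int j))"
    proof (rule sum.cong[OF refl])
      fix j assume j: "j \<in> {1..r}"
      show "(if j \<le> nat (k - l) then c (l + int (nat (k - l))) j * impulse r c l (nat (k - l) - j) else 0)
        = c k j * x (k - int j)"
      proof (cases "int j \<le> k - l")
        case True
        have "nat (k - l) - j = nat (k - int j - l)" using True by linarith
        moreover have "j \<le> nat (k - l)" using True by linarith
        moreover have "k1 < k - int j" "l \<le> k - int j" using j k True by (auto simp: k1_def)
        ultimately show ?thesis using k by (simp add: x_def)
      next
        case False
        then have "\<not> j \<le> nat (k - l)" "\<not> l \<le> k - int j" using k by linarith+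
        then show ?thesis by (simp add: x_def)
      qed
    qed
    finally show ?thesis by (simp add: e_def)
  qed
  have eM: "\<bar>e k\<bar> \<le> (1 + real r * B) * M" if k: "k \<le> l + int m" for k
  proof -
    have "\<bar>\<Sum>j=1..r. c k j * x (k - int j)\<bar> \<le> (\<Sum>j=1..r. \<bar>c k j * x (k - int j)\<bar>)"
      by (rule sum_abs)
    also have "\<dots> \<le> (\<Sum>j=1..r. B * M)"
      unfolding abs_mult using k B B0 by (intro sum_mono mult_mono xM) auto
    finally show ?thesis using xM[OF k] unfolding e_def by (simp add: algebra_simps)
  qed
  have "x (k1 + int (m0 + r)) =
      (\<Sum>i=1..m0+r. impulse r c (k1 + int i) (m0 + r - i) * e (k1 + int i))"
    by (rule superposition) (auto simp: x_def e_def)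
  also have "\<bar>\<dots>\<bar> \<le> (\<Sum>i=1..m0+r. \<bar>impulse r c (k1 + int i) (m0 + r - i) * e (k1 + int i)\<bar>)"
    by (rule sum_abs)
  also have "\<dots> = (\<Sum>i=1..r. \<bar>impulse r c (k1 + int i) (m0 + r - i) * e (k1 + int i)\<bar>)"
    by (rule sum.mono_neutral_right) (auto simp: e0 k1_def)
  also have "\<dots> \<le> (\<Sum>i=1..r. \<delta> * ((1 + real r * B) * M))"
  proof (rule sum_mono)
    fix i assume i: "i \<in> {1..r}"
    have "\<bar>impulse r c (k1 + int i) (m0 + (r - i))\<bar> \<le> \<delta>" using i by (intro small) auto
    moreover have "\<bar>e (k1 + int i)\<bar> \<le> (1 + real r * B) * M" using i by (intro eM) (auto simp: k1_def)
    ultimately show "\<bar>impulse r c (k1 + int i) (m0 + r - i) * e (k1 + int i)\<bar> \<le> \<delta> * ((1 + real r * B) * M)"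
      unfolding abs_mult using i \<delta>0 by (intro mult_mono) auto
  qed
  also have "\<dots> = (real r * (1 + real r * B) * \<delta>) * M" by simp
  also have "\<dots> \<le> 1 / 2 * M" using \<delta> M0 by (rule mult_right_mono)
  finally have "\<bar>x (l + int (m + m0))\<bar> \<le> M / 2" by (simp add: k1_def algebra_simps)
  moreover have "x (l + int (m + m0)) = impulse r c l (m + m0)"
    using r m0 by (simp add: x_def k1_def nat_add_distrib)
  ultimately show ?thesis by simp
qed

text \<open>\<open>impulse_window\<close> halves the response, comparing it with values at most
  \<open>m0 + r - 1\<close> steps earlier; hence the rate \<rho> is chosen to lose a factor 1/2 in
  \<open>m0 + r\<close> steps. The crude growth bound supplies the constant for the first
  \<open>m0 + r\<close> times.\<close>

lemma impulse_decay:
  assumes B: "\<And>k j. \<bar>c k j\<bar> \<le> B" and r: "r \<ge> 1"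
    and \<delta>: "real r * (1 + real r * B) * \<delta> \<le> 1 / 2"
    and small: "\<And>l i. i < r \<Longrightarrow> \<bar>impulse r c l (m0 + i)\<bar> \<le> \<delta>"
    and \<rho>: "0 < \<rho>" "\<rho> \<le> 1" "\<rho> ^ (m0 + r) = 1 / 2"
  shows "\<bar>impulse r c l n\<bar> \<le> 2 * (1 + real r * B) ^ (m0 + r) * \<rho> ^ n"
proof (induction n rule: less_induct)
  case (less n)
  have B0: "0 \<le> B" using B[of 0 0] by linarith
  define C where "C = 2 * (1 + real r * B) ^ (m0 + r)"
  have C0: "0 \<le> C" using B0 by (simp add: C_def)
  have pw: "1 / 2 \<le> \<rho> ^ i" if "i \<le> m0 + r" for i
    using power_decreasing[OF that, of \<rho>] \<rho> by simp
  show ?case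
  proof (cases "n < m0 + r")
    case True
    have "\<bar>impulse r c l n\<bar> \<le> (1 + real r * B) ^ n" by (rule impulse_crude[OF B])
    also have "\<dots> \<le> (1 + real r * B) ^ (m0 + r)" using True B0 by (intro power_increasing) auto
    also have "\<dots> = C * (1 / 2)" by (simp add: C_def)
    also have "\<dots> \<le> C * \<rho> ^ n" using True C0 pw by (intro mult_left_mono) auto
    finally show ?thesis by (simp add: C_def)
  next
    case False
    define m where "m = n - m0"
    have m: "n = m + m0" "r \<le> m" using False by (auto simp: m_def)
    have "\<bar>impulse r c l (m + m0)\<bar> \<le> (2 * C * \<rho> ^ n) / 2"
    proof (rule impulse_window[OF B r \<delta> small])
      fix i assume i: "i < r" "i \<le> m"
      show "\<bar>impulse r c l (m - i)\<bar> \<le> 2 * C * \<rho> ^ n"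
      proof (cases "m0 + i = 0")
        case True
        have "1 \<le> \<delta>" using small[of 0 l] r True by simp
        moreover have "1 \<le> real r * (1 + real r * B)"
          using r B0 mult_mono[of 1 "real r" 1 "1 + real r * B"] by simp
        ultimately have "1 \<le> real r * (1 + real r * B) * \<delta>"
          using mult_mono[of 1 "real r * (1 + real r * B)" 1 \<delta>] by simp
        then show ?thesis using \<delta> by simp
      next
        case False
        have "\<bar>impulse r c l (m - i)\<bar> \<le> C * \<rho> ^ (m - i)"
          unfolding C_def using i False m by (intro less.IH) auto
        \<comment> \<open>The induction hypothesis speaks of a time \<open>m0 + i\<close> steps
          earlier. Catching up costs at most a factor 2, because \<rho> to the power
          \<open>m0 + i\<close> is at least 1/2, and the halving pays for it.\<close>
        also have "\<dots> = 2 * C * (\<rho> ^ (m - i) * (1 / 2))" by simp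
        also have "\<dots> \<le> 2 * C * (\<rho> ^ (m - i) * \<rho> ^ (m0 + i))"
          using C0 \<rho> i by (intro mult_left_mono pw) auto
        also have "\<rho> ^ (m - i) * \<rho> ^ (m0 + i) = \<rho> ^ n"
          using i m by (simp flip: power_add)
        finally show ?thesis .
      qed
    qed
    then show ?thesis by (simp add: m C_def mult_ac)
  qed
qed

text \<open>Initial values are converted into forcing: after cutting the solution off before its r
  initial values, each of these times carries a defect of at most (1 + B) times their absolute sum,
  and \<open>superposition\<close> treats them like the genuine forcing.\<close>

lemma recursion_bound:
  assumes B: "\<And>k j. \<bar>c k j\<bar> \<le> B" and r: "r \<ge> 1"
    and dec: "\<And>l n. \<bar>impulse r c l n\<bar> \<le> C * \<rho> ^ n" and \<rho>: "0 < \<rho>" "\<rho> \<le> 1"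
    and rec: "\<And>k. k0 < k \<Longrightarrow> k \<le> k0 + int n \<Longrightarrow>
      x k = (\<Sum>j=1..r. c k j * x (k - int j)) + e k"
  shows "\<bar>x (k0 + int n)\<bar> \<le> C * (\<Sum>l=1..n. \<rho> ^ (n - l) * \<bar>e (k0 + int l)\<bar>)
    + real r * C * (1 + B) * \<rho> ^ n * (\<Sum>i<r. \<bar>x (k0 - int i)\<bar>)"
proof -
  have B0: "0 \<le> B" using B[of 0 0] by linarith
  have C0: "0 \<le> C" using dec[of 0 0] by simp
  define N where "N = (\<Sum>i<r. \<bar>x (k0 - int i)\<bar>)"
  have N0: "0 \<le> N" unfolding N_def by (intro sum_nonneg) auto
  define k1 where "k1 = k0 - int r"
  define x' where "x' k = (if k1 < k then x k else 0)" for k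
  define e' where "e' k = x' k - (\<Sum>j=1..r. c k j * x' (k - int j))" for k
  have e1: "e' k = e k" if "k0 < k" "k \<le> k0 + int n" for k
  proof -
    have "(\<Sum>j=1..r. c k j * x' (k - int j)) = (\<Sum>j=1..r. c k j * x (k - int j))"
      using that by (intro sum.cong) (auto simp: x'_def k1_def)
    then show ?thesis using rec[OF that] that by (simp add: e'_def x'_def k1_def)
  qed
  have e2: "\<bar>e' k\<bar> \<le> (1 + B) * N" if k: "k1 < k" "k \<le> k0" for k
  proof -
    have "x' k = x (k0 - int (nat (k0 - k)))" using k by (simp add: x'_def)
    moreover have "\<bar>x (k0 - int (nat (k0 - k)))\<bar> \<le> N" unfolding N_def using k
      by (intro member_le_sum[where f = "\<lambda>i. \<bar>x (k0 - int i)\<bar>"]) (auto simp: k1_def)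
    ultimately have "\<bar>x' k\<bar> \<le> N" by simp
    moreover have "\<bar>\<Sum>j=1..r. c k j * x' (k - int j)\<bar> \<le> B * N"
    proof -
      have "\<bar>\<Sum>j=1..r. c k j * x' (k - int j)\<bar> \<le> (\<Sum>j=1..r. \<bar>c k j * x' (k - int j)\<bar>)"
        by (rule sum_abs)
      also have "\<dots> \<le> (\<Sum>j=1..r. B * \<bar>x' (k - int j)\<bar>)"
        unfolding abs_mult by (intro sum_mono mult_right_mono B) auto
      also have "\<dots> = B * (\<Sum>j=1..r. \<bar>x' (k - int j)\<bar>)" by (simp add: sum_distrib_left)
      also have "(\<Sum>j=1..r. \<bar>x' (k - int j)\<bar>) \<le> N"
      proof -
        have "(\<Sum>j=1..r. \<bar>x' (k - int j)\<bar>) = (\<Sum>j\<in>{j\<in>{1..r}. k1 < k - int j}. \<bar>x (k - int j)\<bar>)"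
          by (rule sum.mono_neutral_cong_right) (auto simp: x'_def)
        also have "\<dots> = (\<Sum>i\<in>(\<lambda>j. nat (k0 - k) + j) ` {j\<in>{1..r}. k1 < k - int j}. \<bar>x (k0 - int i)\<bar>)"
          using k by (subst sum.reindex) (auto simp: inj_on_def intro!: sum.cong)
        also have "\<dots> \<le> N" unfolding N_def using k
          by (intro sum_mono2) (auto simp: k1_def)
        finally show ?thesis .
      qed
      finally show ?thesis using B0 by (simp add: mult_left_mono)
    qed
    ultimately show ?thesis unfolding e'_def by (simp add: algebra_simps)
  qed
  have "x' (k1 + int (n + r)) =
      (\<Sum>i=1..n+r. impulse r c (k1 + int i) (n + r - i) * e' (k1 + int i))"
    by (rule superposition) (auto simp: x'_def e'_def)
  also have "\<bar>\<dots>\<bar> \<le> (\<Sum>i=1..n+r. \<bar>impulse r c (k1 + int i) (n + r - i) * e' (k1 + int i)\<bar>)"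
    by (rule sum_abs)
  also have "\<dots> \<le> (\<Sum>i=1..n+r. C * \<rho> ^ (n + r - i) * \<bar>e' (k1 + int i)\<bar>)"
    unfolding abs_mult by (intro sum_mono mult_right_mono dec) auto
  also have "{1..n+r} = {1..r} \<union> {r+1..n+r}" by auto
  also have "(\<Sum>i\<in>{1..r} \<union> {r+1..n+r}. C * \<rho> ^ (n + r - i) * \<bar>e' (k1 + int i)\<bar>) =
     (\<Sum>i=1..r. C * \<rho> ^ (n + r - i) * \<bar>e' (k1 + int i)\<bar>) +
     (\<Sum>i=r+1..n+r. C * \<rho> ^ (n + r - i) * \<bar>e' (k1 + int i)\<bar>)"
    by (rule sum.union_disjoint) auto
  also have "(\<Sum>i=1..r. C * \<rho> ^ (n + r - i) * \<bar>e' (k1 + int i)\<bar>) \<le>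
      (\<Sum>i=1..r. C * \<rho> ^ n * ((1 + B) * N))"
    using \<rho> C0 by (intro sum_mono mult_mono e2 mult_left_mono power_decreasing)
      (auto simp: k1_def)
  also have "\<dots> = real r * C * (1 + B) * \<rho> ^ n * N" by simp
  also have "(\<Sum>i=r+1..n+r. C * \<rho> ^ (n + r - i) * \<bar>e' (k1 + int i)\<bar>) =
      (\<Sum>i=1..n. C * \<rho> ^ (n - i) * \<bar>e (k0 + int i)\<bar>)"
    by (rule sum.reindex_bij_witness[of _ "\<lambda>i. i + r" "\<lambda>i. i - r"])
       (auto simp: k1_def e1 of_nat_diff algebra_simps)
  also have "\<dots> = C * (\<Sum>l=1..n. \<rho> ^ (n - l) * \<bar>e (k0 + int l)\<bar>)"
    by (simp add: sum_distrib_left mult.assoc)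
  also have "x' (k1 + int (n + r)) = x (k0 + int n)"
    using r by (auto simp: x'_def k1_def)
  finally show ?thesis by (simp add: N_def)
qed

section \<open>Impulse responses of the model\<close>

definition switched :: "param \<Rightarrow> (int \<Rightarrow> real) \<Rightarrow> int \<Rightarrow> nat \<Rightarrow> real" where
  "switched \<theta> w k j = ca \<theta> j + cb \<theta> j * w (k - int j)"

definition autoreg :: "param \<Rightarrow> int \<Rightarrow> nat \<Rightarrow> real" where
  "autoreg \<theta> k j = ca \<theta> j"

lemma switched_zero: "switched \<theta> (\<lambda>_. 0) = autoreg \<theta>"
  by (simp add: fun_eq_iff switched_def autoreg_def)

lemma sum_lags_extend:
  fixes a f :: "nat \<Rightarrow> real"
  assumes "\<And>i. i \<notin> {1..p} \<Longrightarrow> a i = 0" "p \<le> r"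
  shows "(\<Sum>i=1..p. a i * f i) = (\<Sum>i=1..r. a i * f i)"
  using assms by (intro sum.mono_neutral_left) auto

lemma param_space_ca: "\<theta> \<in> param_space p q \<Longrightarrow> i \<notin> {1..p} \<Longrightarrow> ca \<theta> i = 0"
  and param_space_cb: "\<theta> \<in> param_space p q \<Longrightarrow> i \<notin> {1..q} \<Longrightarrow> cb \<theta> i = 0"
  by (auto simp: param_space_def)

text \<open>Links the hypothesis to impulse responses: the starting vector is the unit vector at
  time 0, the launch time \<open>l\<close> is absorbed by reading the word from \<open>l\<close> on,
  and only the finitely many letters that the recursion can see have to agree.\<close>

lemma psi_rec_impulse:
  assumes \<theta>: "\<theta> \<in> param_space p q"
    and "\<And>k. 1 - int q \<le> k \<Longrightarrow> k < int n \<Longrightarrow> w' k = w (l + k)"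
  shows "psi_rec p q \<theta> w' (\<lambda>k. if k = 0 then 1 else 0) (int n) = impulse (max p q) (switched \<theta> w) l n"
  using assms(2)
proof (induction n rule: less_induct)
  case (less n)
  define r where "r = max p q"
  define \<psi> where "\<psi> = psi_rec p q \<theta> w' (\<lambda>k. if k = 0 then 1 else 0)"
  have \<psi>0: "\<psi> k = (if k = 0 then 1 else 0)" if "k \<le> 0" for k
    unfolding \<psi>_def using that by (subst psi_rec.simps) simp
  show ?case
  proof (cases "n = 0")
    case True
    then show ?thesis using \<psi>0[of 0] by (simp add: \<psi>_def)
  next
    case False
    have "\<psi> (int n) = (\<Sum>j=1..p. ca \<theta> j * \<psi> (int n - int j))
        + (\<Sum>j=1..q. cb \<theta> j * w' (int n - int j) * \<psi> (int n - int j))"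
      unfolding \<psi>_def using False by (subst psi_rec.simps) simp
    also have "(\<Sum>j=1..q. cb \<theta> j * w' (int n - int j) * \<psi> (int n - int j)) =
       (\<Sum>j=1..q. cb \<theta> j * (w (l + int n - int j) * \<psi> (int n - int j)))"
    proof (rule sum.cong[OF refl])
      fix j assume "j \<in> {1..q}"
      then have "w' (int n - int j) = w (l + (int n - int j))"
        using False by (intro less.prems) auto
      then show "cb \<theta> j * w' (int n - int j) * \<psi> (int n - int j) =
          cb \<theta> j * (w (l + int n - int j) * \<psi> (int n - int j))"
        by (simp add: add_diff_eq)
    qed
    also have "\<dots> = (\<Sum>j=1..r. cb \<theta> j * (w (l + int n - int j) * \<psi> (int n - int j)))"
      by (rule sum_lags_extend) (auto simp: r_def param_space_cb[OF \<theta>])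
    also have "(\<Sum>j=1..p. ca \<theta> j * \<psi> (int n - int j)) = (\<Sum>j=1..r. ca \<theta> j * \<psi> (int n - int j))"
      by (rule sum_lags_extend) (auto simp: r_def param_space_ca[OF \<theta>])
    also have "\<dots> + (\<Sum>j=1..r. cb \<theta> j * (w (l + int n - int j) * \<psi> (int n - int j))) =
      (\<Sum>j=1..r. switched \<theta> w (l + int n) j * \<psi> (int n - int j))"
      by (simp add: sum.distrib[symmetric] switched_def algebra_simps)
    also have "\<dots> = impulse r (switched \<theta> w) l n"
    proof (subst impulse_pos)
      show "(\<Sum>j=1..r. switched \<theta> w (l + int n) j * \<psi> (int n - int j)) =
         (\<Sum>j=1..r. if j \<le> n then switched \<theta> w (l + int n) j * impulse r (switched \<theta> w) l (n - j) else 0)"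
      proof (rule sum.cong[OF refl])
        fix j assume j: "j \<in> {1..r}"
        show "switched \<theta> w (l + int n) j * \<psi> (int n - int j) =
          (if j \<le> n then switched \<theta> w (l + int n) j * impulse r (switched \<theta> w) l (n - j) else 0)"
        proof (cases "j \<le> n")
          case True
          have "\<psi> (int (n - j)) = impulse r (switched \<theta> w) l (n - j)"
            unfolding \<psi>_def r_def using j False by (intro less.IH less.prems) auto
          then show ?thesis using True by (simp add: of_nat_diff)
        next
          case False
          then show ?thesis by (simp add: \<psi>0)
        qed
      qed
    qed (use False in simp)
    finally show ?thesis by (simp add: \<psi>_def r_def)
  qed
qed

definition contracting :: "nat \<Rightarrow> nat \<Rightarrow> param \<Rightarrow> bool" where
  "contracting p q \<theta> \<longleftrightarrow>
    (\<forall>x. (\<lambda>m. Max ((\<lambda>w. \<bar>psi_hat p q \<theta> m w x\<bar>) ` binary_words q m)) \<longlonglongrightarrow> 0)"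

text \<open>The hypothesis controls a maximum over all finite words. Any infinite word, seen from
  any launch time, restricts to one of them, which makes the bound uniform in \<open>w\<close> and
  \<open>l\<close>. The index drops by one because \<open>psi_hat\<close> at m is the value at time
  m + 1.\<close>

lemma contracting_small:
  assumes \<theta>: "\<theta> \<in> param_space p q" and con: "contracting p q \<theta>" and \<delta>: "0 < \<delta>"
  obtains m0 where "\<And>w l n. range w \<subseteq> {0, 1} \<Longrightarrow> m0 \<le> n \<Longrightarrow>
    \<bar>impulse (max p q) (switched \<theta> w) l n\<bar> \<le> \<delta>"
proof -
  define x :: "int \<Rightarrow> real" where "x = (\<lambda>k. if k = 0 then 1 else 0)"
  have "(\<lambda>m. Max ((\<lambda>w. \<bar>psi_hat p q \<theta> m w x\<bar>) ` binary_words q m)) \<longlonglongrightarrow> 0"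
    using con by (auto simp: contracting_def)
  then have "eventually (\<lambda>m. Max ((\<lambda>w. \<bar>psi_hat p q \<theta> m w x\<bar>) ` binary_words q m) < \<delta>) sequentially"
    using \<delta> by (rule order_tendstoD)
  then obtain m1 where m1: "\<And>m. m1 \<le> m \<Longrightarrow> Max ((\<lambda>w. \<bar>psi_hat p q \<theta> m w x\<bar>) ` binary_words q m) < \<delta>"
    by (auto simp: eventually_sequentially)
  show ?thesis
  proof (rule that[of "Suc m1"])
    fix w :: "int \<Rightarrow> real" and l n assume w: "range w \<subseteq> {0, 1}" and n: "Suc m1 \<le> n"
    define m where "m = n - 1"
    have m: "n = Suc m" "m1 \<le> m" using n by (auto simp: m_def)
    define w' where "w' = restrict (\<lambda>k. w (l + k)) {1 - int q..int m}"
    have fin: "finite (binary_words q m)" unfolding binary_words_def by (intro finite_PiE) auto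
    have "w' \<in> binary_words q m" using w by (auto simp: w'_def binary_words_def)
    then have "\<bar>psi_hat p q \<theta> m w' x\<bar> \<le> Max ((\<lambda>w. \<bar>psi_hat p q \<theta> m w x\<bar>) ` binary_words q m)"
      using fin by (intro Max_ge) auto
    then have "\<bar>psi_hat p q \<theta> m w' x\<bar> \<le> \<delta>" using m1[OF m(2)] by linarith
    moreover have "psi_hat p q \<theta> m w' x = psi_rec p q \<theta> w' x (int n)"
      by (simp add: psi_hat_def m add.commute)
    moreover have "\<dots> = impulse (max p q) (switched \<theta> w) l n"
      unfolding x_def by (rule psi_rec_impulse[OF \<theta>]) (auto simp: w'_def m)
    ultimately show "\<bar>impulse (max p q) (switched \<theta> w) l n\<bar> \<le> \<delta>" by simp
  qed
qed

lemma half_root: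
  assumes "n \<ge> (1::nat)"
  obtains \<rho> :: real where "0 < \<rho>" "\<rho> < 1" "\<rho> ^ n = 1 / 2"
proof (rule that[of "root n (1 / 2)"])
  show "root n (1 / 2) ^ n = 1 / 2" using assms by simp
qed (use assms in auto)

text \<open>Upgrades the qualitative limit in the hypothesis to a geometric rate, for one parameter
  and uniformly over all words.\<close>

lemma switched_decay:
  assumes pq: "p \<ge> 1" and \<theta>: "\<theta> \<in> param_space p q" and con: "contracting p q \<theta>"
  obtains B C \<rho> where "0 < \<rho>" "\<rho> < 1" "0 < C"
    "\<And>w k j. range w \<subseteq> {0, 1} \<Longrightarrow> \<bar>switched \<theta> w k j\<bar> \<le> B"
    "\<And>w l n. range w \<subseteq> {0, 1} \<Longrightarrow> \<bar>impulse (max p q) (switched \<theta> w) l n\<bar> \<le> C * \<rho> ^ n"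
proof -
  define r where "r = max p q"
  have r: "1 \<le> r" using pq by (simp add: r_def)
  define B where "B = (\<Sum>j=1..r. \<bar>ca \<theta> j\<bar> + \<bar>cb \<theta> j\<bar>)"
  have B0: "0 \<le> B" unfolding B_def by (intro sum_nonneg) auto
  have B: "\<bar>switched \<theta> w k j\<bar> \<le> B" if w: "range w \<subseteq> {0, 1}" for w k j
  proof -
    have w01: "w (k - int j) = 0 \<or> w (k - int j) = 1" using w by auto
    then have "\<bar>switched \<theta> w k j\<bar> \<le> \<bar>ca \<theta> j\<bar> + \<bar>cb \<theta> j\<bar>" by (auto simp: switched_def)
    also have "\<dots> \<le> B"
    proof (cases "j \<in> {1..r}")
      case True
      then show ?thesis unfolding B_def by (intro member_le_sum[where f = "\<lambda>j. \<bar>ca \<theta> j\<bar> + \<bar>cb \<theta> j\<bar>"]) auto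
    next
      case False
      then show ?thesis using param_space_ca[OF \<theta>, of j] param_space_cb[OF \<theta>, of j] B0 by (auto simp: r_def)
    qed
    finally show ?thesis .
  qed
  \<comment> \<open>So small that r defects of relative size at most 1 + rB, each multiplied by
    \<delta>, add up to at most 1/2.\<close>
  define \<delta> where "\<delta> = 1 / (2 * (real r * (1 + real r * B)))"
  have pos: "0 < real r * (1 + real r * B)" using r B0 by (intro mult_pos_pos add_pos_nonneg) auto
  have "X * (1 / (2 * X)) \<le> 1 / 2" if "0 < X" for X :: real using that by simp
  from this[OF pos] pos have \<delta>: "0 < \<delta>" "real r * (1 + real r * B) * \<delta> \<le> 1 / 2"
    unfolding \<delta>_def by (auto simp only: zero_less_divide_1_iff zero_less_mult_iff)
  obtain m0 where m0: "\<And>w l n. range w \<subseteq> {0, 1} \<Longrightarrow> m0 \<le> n \<Longrightarrow> \<bar>impulse r (switched \<theta> w) l n\<bar> \<le> \<delta>"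
    using contracting_small[OF \<theta> con \<delta>(1)] unfolding r_def by blast
  obtain \<rho> :: real where \<rho>: "0 < \<rho>" "\<rho> < 1" "\<rho> ^ (m0 + r) = 1 / 2" using half_root[of "m0 + r"] r by auto
  show ?thesis
  proof (rule that[OF \<rho>(1,2) _ B])
    show "0 < 2 * (1 + real r * B) ^ (m0 + r)" using B0 by (simp add: add_pos_nonneg)
    fix w :: "int \<Rightarrow> real" and l n assume w: "range w \<subseteq> {0, 1}"
    show "\<bar>impulse (max p q) (switched \<theta> w) l n\<bar> \<le> 2 * (1 + real r * B) ^ (m0 + r) * \<rho> ^ n"
      using B[OF w] m0[OF w] \<rho> r \<delta> unfolding r_def[symmetric] by (intro impulse_decay) auto
  qed
qed

section \<open>Uniform decay over the compact parameter set\<close>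

lemma continuous_ca: "continuous_on UNIV (\<lambda>\<theta>::param. ca \<theta> i)"
  and continuous_cb: "continuous_on UNIV (\<lambda>\<theta>::param. cb \<theta> i)"
  and continuous_om: "continuous_on UNIV (\<lambda>\<theta>::param. om \<theta>)"
proof -
  have *: "continuous_on UNIV (\<lambda>f::nat \<Rightarrow> real. f i)" by (rule continuous_on_product_coordinates)
  have c1: "continuous_on UNIV (\<lambda>\<theta>::param. fst (snd \<theta>))"
    and c2: "continuous_on UNIV (\<lambda>\<theta>::param. snd (snd \<theta>))"
    by (intro continuous_on_fst continuous_on_snd continuous_on_id)+
  show "continuous_on UNIV (\<lambda>\<theta>::param. ca \<theta> i)"
    by (rule continuous_on_compose2[OF * c1]) simp
  show "continuous_on UNIV (\<lambda>\<theta>::param. cb \<theta> i)"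
    by (rule continuous_on_compose2[OF * c2]) simp
  show "continuous_on UNIV (\<lambda>\<theta>::param. om \<theta>)"
    by (intro continuous_on_fst continuous_on_id)
qed

lemma continuous_impulse: "continuous_on UNIV (\<lambda>\<theta>. impulse r (autoreg \<theta>) l n)"
proof (induction n rule: less_induct)
  case (less n)
  show ?case
  proof (cases "n = 0")
    case False
    have "continuous_on UNIV (\<lambda>\<theta>. \<Sum>j\<in>{1..min r n}. autoreg \<theta> (l + int n) j * impulse r (autoreg \<theta>) l (n - j))"
      unfolding autoreg_def[of _ "l + int n"]
      using False by (intro continuous_on_sum continuous_on_mult continuous_ca less) auto
    then show ?thesis using False by (subst impulse.simps) simp
  qed simp
qed

lemma impulse_autoreg_shift: "impulse r (autoreg \<theta>) l n = impulse r (autoreg \<theta>) 0 n"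
proof (induction n rule: less_induct)
  case (less n)
  show ?case
  proof (cases "n = 0")
    case False
    have "impulse r (autoreg \<theta>) l (n - j) = impulse r (autoreg \<theta>) 0 (n - j)" if "j \<in> {1..r}" for j
      using that False by (intro less) auto
    then show ?thesis using False by (subst (1 2) impulse_pos) (auto simp: autoreg_def intro!: sum.cong)
  qed simp
qed

lemma compact_coefficients_bounded:
  assumes "compact \<Theta>" "\<Theta> \<subseteq> param_space p q"
  obtains B where "0 < B" "\<And>\<theta>. \<theta> \<in> \<Theta> \<Longrightarrow> \<bar>om \<theta>\<bar> \<le> B" "\<And>\<theta> i. \<theta> \<in> \<Theta> \<Longrightarrow> \<bar>ca \<theta> i\<bar> \<le> B"
    "\<And>\<theta> i. \<theta> \<in> \<Theta> \<Longrightarrow> \<bar>cb \<theta> i\<bar> \<le> B"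
proof -
  have *: "\<exists>B. \<forall>\<theta>\<in>\<Theta>. \<bar>f \<theta>\<bar> \<le> B" if "continuous_on UNIV f" for f :: "param \<Rightarrow> real"
  proof -
    have "compact (f ` \<Theta>)"
      using assms(1) that by (intro compact_continuous_image) (auto intro: continuous_on_subset)
    then show ?thesis using compact_imp_bounded[of "f ` \<Theta>"] by (auto simp: bounded_iff)
  qed
  obtain Bo where Bo: "\<And>\<theta>. \<theta> \<in> \<Theta> \<Longrightarrow> \<bar>om \<theta>\<bar> \<le> Bo" using *[OF continuous_om] by blast
  obtain Ba where Ba: "\<And>\<theta> i. \<theta> \<in> \<Theta> \<Longrightarrow> \<bar>ca \<theta> i\<bar> \<le> Ba i" using *[OF continuous_ca] by metis
  obtain Bb where Bb: "\<And>\<theta> i. \<theta> \<in> \<Theta> \<Longrightarrow> \<bar>cb \<theta> i\<bar> \<le> Bb i" using *[OF continuous_cb] by metis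
  define B where "B = 1 + \<bar>Bo\<bar> + (\<Sum>i=1..p. \<bar>Ba i\<bar>) + (\<Sum>i=1..q. \<bar>Bb i\<bar>)"
  have nn: "0 \<le> (\<Sum>i=1..p. \<bar>Ba i\<bar>)" "0 \<le> (\<Sum>i=1..q. \<bar>Bb i\<bar>)" by (intro sum_nonneg; simp)+
  have a: "\<bar>ca \<theta> i\<bar> \<le> B" if "\<theta> \<in> \<Theta>" for \<theta> i
  proof (cases "i \<in> {1..p}")
    case True
    then have "\<bar>Ba i\<bar> \<le> (\<Sum>i=1..p. \<bar>Ba i\<bar>)" by (intro member_le_sum[where f = "\<lambda>i. \<bar>Ba i\<bar>"]) auto
    then show ?thesis using Ba[OF that, of i] nn unfolding B_def by linarith
  next
    case False
    have "ca \<theta> i = 0" using param_space_ca[of \<theta> p q i] False that assms(2) by blast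
    then show ?thesis using nn unfolding B_def by simp
  qed
  have b: "\<bar>cb \<theta> i\<bar> \<le> B" if "\<theta> \<in> \<Theta>" for \<theta> i
  proof (cases "i \<in> {1..q}")
    case True
    then have "\<bar>Bb i\<bar> \<le> (\<Sum>i=1..q. \<bar>Bb i\<bar>)" by (intro member_le_sum[where f = "\<lambda>i. \<bar>Bb i\<bar>"]) auto
    then show ?thesis using Bb[OF that, of i] nn unfolding B_def by linarith
  next
    case False
    have "cb \<theta> i = 0" using param_space_cb[of \<theta> p q i] False that assms(2) by blast
    then show ?thesis using nn unfolding B_def by simp
  qed
  have "0 < B" using nn unfolding B_def by linarith
  moreover have "\<bar>om \<theta>\<bar> \<le> B" if "\<theta> \<in> \<Theta>" for \<theta> using Bo[OF that] nn unfolding B_def by linarith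
  ultimately show ?thesis by (intro that[of B] a b)
qed

text \<open>Smallness of one window of r values is finitely many strict inequalities between
  continuous functions of \<theta>, hence an open condition, and one small window already forces
  geometric decay. A finite subcover leaves finitely many constants and rates, of which the maxima
  are taken. The autoregression is time-invariant, so launch time 0 represents all others.\<close>

lemma uniform_decay:
  assumes pq: "p \<ge> 1" and \<Theta>: "compact \<Theta>" "\<Theta> \<subseteq> param_space p q"
    and con: "\<And>\<theta>. \<theta> \<in> \<Theta> \<Longrightarrow> contracting p q \<theta>"
  obtains C \<rho> where "0 < \<rho>" "\<rho> < 1" "0 < C"
    "\<And>\<theta> l n. \<theta> \<in> \<Theta> \<Longrightarrow> \<bar>impulse (max p q) (autoreg \<theta>) l n\<bar> \<le> C * \<rho> ^ n"
proof -
  define r where "r = max p q"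
  have r: "1 \<le> r" using pq by (simp add: r_def)
  obtain B where B0: "0 < B" and B: "\<And>\<theta> i. \<theta> \<in> \<Theta> \<Longrightarrow> \<bar>ca \<theta> i\<bar> \<le> B"
    by (rule compact_coefficients_bounded[OF \<Theta>]) (rule that, assumption+)
  define \<delta> where "\<delta> = 1 / (2 * (real r * (1 + real r * B)))"
  have pos: "0 < real r * (1 + real r * B)" using r B0 by (intro mult_pos_pos add_pos_nonneg) auto
  have "X * (1 / (2 * X)) \<le> 1 / 2" if "0 < X" for X :: real using that by simp
  from this[OF pos] pos have \<delta>: "0 < \<delta>" "real r * (1 + real r * B) * \<delta> \<le> 1 / 2"
    unfolding \<delta>_def by (auto simp only: zero_less_divide_1_iff zero_less_mult_iff)
  define V where "V m = {\<theta>. \<forall>i\<in>{..<r}. \<bar>impulse r (autoreg \<theta>) 0 (m + i)\<bar> < \<delta>}" for m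
  have V_open: "open (V m)" for m
  proof -
    have "V m = (\<Inter>i\<in>{..<r}. {\<theta>. \<bar>impulse r (autoreg \<theta>) 0 (m + i)\<bar> < \<delta>})"
      by (auto simp: V_def)
    moreover have "open {\<theta>. \<bar>impulse r (autoreg \<theta>) 0 (m + i)\<bar> < \<delta>}" for i
      by (intro open_Collect_less continuous_on_rabs continuous_impulse continuous_on_const)
    ultimately show ?thesis by (auto intro!: open_INT)
  qed
  have "\<Theta> \<subseteq> (\<Union>m. V m)"
  proof
    fix \<theta> assume \<theta>: "\<theta> \<in> \<Theta>"
    \<comment> \<open>Half of \<delta> yields the strict inequality that makes the sets
      \<open>V m\<close> open.\<close>
    have "0 < \<delta> / 2" using \<delta> by simp
    then obtain m0 where m0: "\<And>w l n. range w \<subseteq> {0, 1} \<Longrightarrow> m0 \<le> n \<Longrightarrow>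
        \<bar>impulse r (switched \<theta> w) l n\<bar> \<le> \<delta> / 2"
      using contracting_small[of \<theta> p q "\<delta> / 2"] con \<theta> \<Theta> unfolding r_def by blast
    have "\<bar>impulse r (autoreg \<theta>) 0 (m0 + i)\<bar> < \<delta>" for i
      using m0[of "\<lambda>_. 0" "m0 + i" 0] \<delta> by (simp add: switched_zero)
    then show "\<theta> \<in> (\<Union>m. V m)" by (auto simp: V_def)
  qed
  then obtain J where J: "finite J" "\<Theta> \<subseteq> (\<Union>m\<in>J. V m)"
    using compactE_image[OF \<Theta>(1), of UNIV V] V_open by auto
  have loc: "\<exists>C \<rho>. 0 < \<rho> \<and> \<rho> < 1 \<and> 0 < C \<and>
      (\<forall>\<theta>\<in>\<Theta> \<inter> V m. \<forall>l n. \<bar>impulse r (autoreg \<theta>) l n\<bar> \<le> C * \<rho> ^ n)" for m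
  proof -
    obtain \<rho> :: real where \<rho>: "0 < \<rho>" "\<rho> < 1" "\<rho> ^ (m + r) = 1 / 2" using half_root[of "m + r"] r by auto
    have "\<bar>impulse r (autoreg \<theta>) l n\<bar> \<le> 2 * (1 + real r * B) ^ (m + r) * \<rho> ^ n"
      if "\<theta> \<in> \<Theta> \<inter> V m" for \<theta> l n
    proof (rule impulse_decay[OF _ r \<delta>(2)])
      show "\<bar>impulse r (autoreg \<theta>) l (m + i)\<bar> \<le> \<delta>" if "i < r" for l i
        using that \<open>\<theta> \<in> \<Theta> \<inter> V m\<close> by (subst impulse_autoreg_shift) (auto simp: V_def intro: less_imp_le)
    qed (use that B \<rho> in \<open>auto simp: autoreg_def\<close>)
    moreover have "0 < 2 * (1 + real r * B) ^ (m + r)" using B0 by (simp add: add_pos_nonneg)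
    ultimately show ?thesis using \<rho> by blast
  qed
  have "\<exists>C \<rho>. 0 < \<rho> \<and> \<rho> < 1 \<and> 0 < C \<and>
      (\<forall>\<theta>\<in>\<Theta> \<inter> (\<Union>m\<in>J. V m). \<forall>l n. \<bar>impulse r (autoreg \<theta>) l n\<bar> \<le> C * \<rho> ^ n)"
    using J(1)
  proof induction
    case empty
    show ?case by (intro exI[of _ 1] exI[of _ "1/2"]) auto
  next
    case (insert m J)
    obtain C1 \<rho>1 where 1: "0 < \<rho>1" "\<rho>1 < 1" "0 < C1"
      "\<And>\<theta> l n. \<theta> \<in> \<Theta> \<inter> (\<Union>m\<in>J. V m) \<Longrightarrow> \<bar>impulse r (autoreg \<theta>) l n\<bar> \<le> C1 * \<rho>1 ^ n"
      using insert.IH by blast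
    obtain C2 \<rho>2 where 2: "0 < \<rho>2" "\<rho>2 < 1" "0 < C2"
      "\<And>\<theta> l n. \<theta> \<in> \<Theta> \<inter> V m \<Longrightarrow> \<bar>impulse r (autoreg \<theta>) l n\<bar> \<le> C2 * \<rho>2 ^ n"
      using loc[of m] by blast
    have "\<bar>impulse r (autoreg \<theta>) l n\<bar> \<le> max C1 C2 * max \<rho>1 \<rho>2 ^ n"
      if "\<theta> \<in> \<Theta> \<inter> (\<Union>m\<in>insert m J. V m)" for \<theta> l n
    proof -
      have "\<bar>impulse r (autoreg \<theta>) l n\<bar> \<le> C1 * \<rho>1 ^ n \<or> \<bar>impulse r (autoreg \<theta>) l n\<bar> \<le> C2 * \<rho>2 ^ n"
        using that 1(4)[of \<theta> l n] 2(4)[of \<theta> l n] by blast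
      moreover have "C1 * \<rho>1 ^ n \<le> max C1 C2 * max \<rho>1 \<rho>2 ^ n" "C2 * \<rho>2 ^ n \<le> max C1 C2 * max \<rho>1 \<rho>2 ^ n"
        using 1 2 by (intro mult_mono power_mono; simp)+
      ultimately show ?thesis by linarith
    qed
    then show ?case using 1 2 by (intro exI[of _ "max C1 C2"] exI[of _ "max \<rho>1 \<rho>2"]) auto
  qed
  then obtain C \<rho> where *: "0 < \<rho>" "\<rho> < 1" "0 < C"
    "\<And>\<theta> l n. \<theta> \<in> \<Theta> \<inter> (\<Union>m\<in>J. V m) \<Longrightarrow> \<bar>impulse r (autoreg \<theta>) l n\<bar> \<le> C * \<rho> ^ n" by blast
  show ?thesis
  proof (rule that[OF *(1-3)])
    show "\<bar>impulse (max p q) (autoreg \<theta>) l n\<bar> \<le> C * \<rho> ^ n" if "\<theta> \<in> \<Theta>" for \<theta> l n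
      using *(4)[of \<theta> l n] that J(2) by (auto simp: r_def)
  qed
qed

section \<open>Weights of the stationary filter\<close>

text \<open>\<open>hcoef \<theta> j\<close> is the weight of \<open>ln (1 + Y (k - 1 - j))\<close> in the stationary filter.\<close>

function hcoef :: "param \<Rightarrow> nat \<Rightarrow> real" where
  "hcoef \<theta> j = cb \<theta> (Suc j) + (\<Sum>i\<in>{1..j}. ca \<theta> i * hcoef \<theta> (j - i))"
  by pat_completeness auto
termination by (relation "Wellfounded.measure (\<lambda>(\<theta>, n). n)") auto

declare hcoef.simps [simp del]

lemma continuous_hcoef: "continuous_on UNIV (\<lambda>\<theta>. hcoef \<theta> j)"
proof (induction j rule: less_induct)
  case (less j)
  have "continuous_on UNIV (\<lambda>\<theta>. cb \<theta> (Suc j) + (\<Sum>i\<in>{1..j}. ca \<theta> i * hcoef \<theta> (j - i)))"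
    by (intro continuous_on_add continuous_on_sum continuous_on_mult continuous_ca continuous_cb less) auto
  then show ?case by (subst hcoef.simps)
qed

text \<open>The weights solve the autoregression with zero initial values and forcing b at the lags
  1 to q. Only these q terms contribute, each delayed by at most q steps; this is the origin of the
  factor q and of the division by \<rho> to the power q.\<close>

lemma hcoef_bound:
  assumes \<theta>: "\<theta> \<in> param_space p q" and pq: "p \<ge> 1"
    and B: "\<And>i. \<bar>ca \<theta> i\<bar> \<le> B" "\<And>i. \<bar>cb \<theta> i\<bar> \<le> B"
    and dec: "\<And>l n. \<bar>impulse (max p q) (autoreg \<theta>) l n\<bar> \<le> C * \<rho> ^ n" and \<rho>: "0 < \<rho>" "\<rho> < 1"
  shows "\<bar>hcoef \<theta> j\<bar> \<le> C * real q * B / \<rho> ^ q * \<rho> ^ j"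
proof -
  define r where "r = max p q"
  have B0: "0 \<le> B" using B(1)[of 0] by linarith
  have C0: "0 \<le> C" using dec[of 0 0] by simp
  define x where "x k = (if 0 \<le> k then hcoef \<theta> (nat k) else 0)" for k :: int
  define e where "e k = cb \<theta> (nat (k + 1))" for k :: int
  have "\<bar>x (- 1 + int (Suc j))\<bar> \<le> C * (\<Sum>l=1..Suc j. \<rho> ^ (Suc j - l) * \<bar>e (- 1 + int l)\<bar>)
      + real r * C * (1 + B) * \<rho> ^ Suc j * (\<Sum>i<r. \<bar>x (- 1 - int i)\<bar>)"
  proof (rule recursion_bound[where c = "autoreg \<theta>"])
    fix k :: int assume k: "- 1 < k"
    have "x k = e k + (\<Sum>i=1..nat k. ca \<theta> i * hcoef \<theta> (nat k - i))"
      using k by (simp add: x_def e_def nat_add_distrib hcoef.simps[of \<theta> "nat k"])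
    also have "(\<Sum>i=1..nat k. ca \<theta> i * hcoef \<theta> (nat k - i)) = (\<Sum>i=1..nat k. ca \<theta> i * x (k - int i))"
      by (intro sum.cong) (auto simp: x_def nat_diff_distrib)
    also have "\<dots> = (\<Sum>i=1..max r (nat k). ca \<theta> i * x (k - int i))"
      by (rule sum.mono_neutral_left) (auto simp: x_def)
    also have "\<dots> = (\<Sum>i=1..r. ca \<theta> i * x (k - int i))"
      by (rule sum.mono_neutral_right) (auto simp: r_def param_space_ca[OF \<theta>])
    finally show "x k = (\<Sum>j=1..r. autoreg \<theta> k j * x (k - int j)) + e k"
      by (simp add: autoreg_def)
  qed (use B dec \<rho> pq in \<open>auto simp: r_def autoreg_def\<close>)
  also have "(\<Sum>i<r. \<bar>x (- 1 - int i)\<bar>) = 0" by (simp add: x_def)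
  also have "(\<Sum>l=1..Suc j. \<rho> ^ (Suc j - l) * \<bar>e (- 1 + int l)\<bar>) = (\<Sum>l=1..Suc j. \<rho> ^ (Suc j - l) * \<bar>cb \<theta> l\<bar>)"
    by (simp add: e_def)
  also have "\<dots> \<le> (\<Sum>l=1..Suc j. if l \<le> q then B / \<rho> ^ q * \<rho> ^ j else 0)"
  proof (rule sum_mono)
    fix l assume l: "l \<in> {1..Suc j}"
    show "\<rho> ^ (Suc j - l) * \<bar>cb \<theta> l\<bar> \<le> (if l \<le> q then B / \<rho> ^ q * \<rho> ^ j else 0)"
    proof (cases "l \<le> q")
      case True
      have "\<rho> ^ q * \<rho> ^ (Suc j - l) = \<rho> ^ (q + (Suc j - l))" by (simp add: power_add)
      also have "\<dots> \<le> \<rho> ^ j" using \<rho> True l by (intro power_decreasing) auto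
      finally have "\<rho> ^ (Suc j - l) \<le> \<rho> ^ j / \<rho> ^ q" using \<rho> by (simp add: pos_le_divide_eq mult.commute)
      then have "\<rho> ^ (Suc j - l) * \<bar>cb \<theta> l\<bar> \<le> \<rho> ^ j / \<rho> ^ q * B"
        using B \<rho> by (intro mult_mono) auto
      then show ?thesis using True by (simp add: mult.commute)
    qed (use param_space_cb[OF \<theta>] in auto)
  qed
  also have "\<dots> = (\<Sum>l\<in>{1..Suc j} \<inter> {..q}. B / \<rho> ^ q * \<rho> ^ j)"
    by (subst sum.inter_restrict) (auto intro!: sum.cong)
  also have "\<dots> \<le> (\<Sum>l=1..q. B / \<rho> ^ q * \<rho> ^ j)"
    using B0 \<rho> by (intro sum_mono2) auto
  also have "x (- 1 + int (Suc j)) = hcoef \<theta> j" by (simp add: x_def)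
  finally show ?thesis using C0 by (simp add: mult_left_mono mult.assoc)
qed

text \<open>Otherwise the constant 1 would solve the homogeneous recursion without decaying. This
  keeps the denominator of \<open>cst\<close> away from zero.\<close>

lemma sum_ca_neq_1:
  assumes \<theta>: "\<theta> \<in> param_space p q" and pq: "p \<ge> 1"
    and dec: "\<And>l n. \<bar>impulse (max p q) (autoreg \<theta>) l n\<bar> \<le> C * \<rho> ^ n" and \<rho>: "0 < \<rho>" "\<rho> < 1"
  shows "(\<Sum>i=1..p. ca \<theta> i) \<noteq> 1"
proof
  assume sum1: "(\<Sum>i=1..p. ca \<theta> i) = 1"
  define r where "r = max p q"
  define B where "B = (\<Sum>i=1..p. \<bar>ca \<theta> i\<bar>)"
  have B: "\<bar>ca \<theta> i\<bar> \<le> B" for i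
  proof (cases "i \<in> {1..p}")
    case True
    then show ?thesis unfolding B_def by (intro member_le_sum[where f = "\<lambda>i. \<bar>ca \<theta> i\<bar>"]) auto
  next
    case False
    then show ?thesis unfolding B_def using param_space_ca[OF \<theta> False] by (auto intro: sum_nonneg)
  qed
  have s: "(\<Sum>i=1..r. ca \<theta> i * 1) = 1"
    using sum_lags_extend[of p "ca \<theta>" r "\<lambda>_. 1"] param_space_ca[OF \<theta>] sum1 by (simp add: r_def)
  have "\<bar>1::real\<bar> \<le> C * (\<Sum>l=1..n. \<rho> ^ (n - l) * \<bar>0\<bar>) + real r * C * (1 + B) * \<rho> ^ n * (\<Sum>i<r. \<bar>1\<bar>)" for n
    by (rule recursion_bound[where c = "autoreg \<theta>" and x = "\<lambda>_. 1" and e = "\<lambda>_. 0"])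
       (use B dec \<rho> pq s in \<open>auto simp: r_def autoreg_def\<close>)
  then have "1 \<le> (real r * C * (1 + B) * (\<Sum>i<r. \<bar>1\<bar>)) * \<rho> ^ n" for n
    by (simp add: algebra_simps)
  moreover have "(\<lambda>n. (real r * C * (1 + B) * (\<Sum>i<r. \<bar>1\<bar>)) * \<rho> ^ n) \<longlonglongrightarrow> (real r * C * (1 + B) * (\<Sum>i<r. \<bar>1\<bar>)) * 0"
    using \<rho> by (intro tendsto_intros LIMSEQ_power_zero) auto
  ultimately have "1 \<le> (real r * C * (1 + B) * (\<Sum>i<r. \<bar>1\<bar>)) * (0::real)"
    by (intro LIMSEQ_le_const) auto
  then show False by simp
qed

section \<open>Poisson estimates\<close>

lemma pmf_poisson_g_dens: "pmf (poisson_pmf (exp x)) n = g_dens x n"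
  by (simp add: g_dens_def exp_of_nat_mult[symmetric] mult.commute)

lemma g_dens_pos: "0 < g_dens x n"
  by (simp add: g_dens_def)

lemma g_dens_nonneg [simp]: "0 \<le> g_dens x n"
  using g_dens_pos[of x n] by simp

lemma g_dens_le_1: "g_dens x n \<le> 1"
  using pmf_le_1[of "poisson_pmf (exp x)" n] by (simp only: pmf_poisson_g_dens)

lemma ln_g_dens: "ln (g_dens x n) = x * real n - exp x - ln (fact n)"
  by (simp add: g_dens_def ln_mult ln_div)

lemma g_dens_sums: "(\<lambda>n. g_dens x n) sums 1"
proof -
  have "(\<lambda>n. exp x ^ n / fact n * exp (- exp x)) sums (exp (exp x) * exp (- exp x))"
    using exp_converges[of "exp x"] by (intro sums_mult2) (simp add: field_simps scaleR_conv_of_real)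
  then show ?thesis by (simp add: g_dens_def exp_of_nat_mult[symmetric] mult.commute flip: exp_add)
qed

lemma g_dens_mgf_sums: "(\<lambda>n. g_dens x n * exp (s * real n)) sums exp (exp x * (exp s - 1))"
proof -
  have "(\<lambda>n. exp (- exp x) * (exp (x + s) ^ n / fact n)) sums (exp (- exp x) * exp (exp (x + s)))"
    using exp_converges[of "exp (x + s)"] by (intro sums_mult) (simp add: field_simps scaleR_conv_of_real)
  moreover have "exp (- exp x) * (exp (x + s) ^ n / fact n) = g_dens x n * exp (s * real n)" for n
    by (simp add: g_dens_def exp_of_nat_mult[symmetric] exp_add[symmetric] algebra_simps)
  moreover have "exp (- exp x) * exp (exp (x + s)) = exp (exp x * (exp s - 1))"
    by (simp add: exp_add[symmetric] exp_add[of x s] algebra_simps)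
  ultimately show ?thesis by simp
qed

lemma g_dens_Suc: "exp x * g_dens x n = real (Suc n) * g_dens x (Suc n)"
proof -
  have *: "exp (x * real (Suc n)) = exp x * exp (x * real n)"
    by (simp add: algebra_simps flip: exp_add)
  show ?thesis unfolding g_dens_def * fact_Suc by simp
qed

text \<open>The derivative in x is g (n - exp x). The factor exp x is unbounded, but
  \<open>g_dens_Suc\<close> turns exp x times g at n into (n + 1) times g at n + 1, so the bound
  does not involve x.\<close>

lemma g_dens_lipschitz: "\<bar>g_dens x n - g_dens y n\<bar> \<le> (2 * real n + 1) * \<bar>x - y\<bar>"
proof -
  have d: "((\<lambda>x. g_dens x n) has_field_derivative g_dens z n * (real n - exp z)) (at z within UNIV)" for z
    unfolding g_dens_def by (auto intro!: derivative_eq_intros simp: field_simps)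
  have "norm (g_dens z n * (real n - exp z)) \<le> 2 * real n + 1" for z
  proof -
    have "\<bar>g_dens z n * (real n - exp z)\<bar> \<le> g_dens z n * real n + exp z * g_dens z n"
      using abs_triangle_ineq4[of "g_dens z n * real n" "exp z * g_dens z n"]
      by (simp add: algebra_simps abs_mult)
    also have "\<dots> \<le> 1 * real n + real (Suc n) * 1"
      unfolding g_dens_Suc by (intro add_mono mult_mono g_dens_le_1) auto
    finally show ?thesis by simp
  qed
  then show ?thesis
    using field_differentiable_bound[of UNIV "\<lambda>x. g_dens x n" "\<lambda>z. g_dens z n * (real n - exp z)" "2 * real n + 1" x y] d
    by (simp add: norm_minus_commute)
qed

section \<open>Exponential moments of the log-noise, uniform in the intensity\<close>

lemma power_le_fact_exp: "0 \<le> z \<Longrightarrow> z ^ t \<le> fact t * exp (z::real)"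
proof -
  assume z: "0 \<le> z"
  have "(\<Sum>n\<in>{t}. z ^ n / fact n) \<le> (\<Sum>n. z ^ n / fact n)"
    using z summable_exp[of z] by (intro sum_le_suminf) (auto simp: field_simps)
  also have "\<dots> = exp z" by (simp add: exp_def scaleR_conv_of_real field_simps)
  finally show ?thesis by (simp add: field_simps)
qed

lemma fact_ratio_le: "fact (n + t) \<le> fact t * fact n * (1 + real n) ^ t"
proof (induction t)
  case (Suc t)
  have "(fact (n + Suc t) :: real) = (real n + real t + 1) * fact (n + t)"
    by (simp add: algebra_simps)
  also have "\<dots> \<le> ((real t + 1) * (1 + real n)) * (fact t * fact n * (1 + real n) ^ t)"
    by (intro mult_mono Suc.IH) (auto simp: algebra_simps)
  also have "\<dots> = fact (Suc t) * fact n * (1 + real n) ^ Suc t"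
    by (simp add: algebra_simps)
  finally show ?case .
qed simp

text \<open>The centring has to be the positive part of x. For very negative x the observation is
  mostly 0 and ln(1 + n) - x would be large, while for large x the observation concentrates near exp
  x. With the positive part all exponential moments are bounded in x.\<close>

definition log_noise :: "real \<Rightarrow> nat \<Rightarrow> real" where
  "log_noise x n = ln (1 + real n) - max x 0"

text \<open>With \<mu> = exp(max x 0), the exponential is the t-th power of (1 + n)/\<mu>, which is
  at most t! exp((1 + n)/\<mu>), and the Poisson generating function applies. As 1/\<mu> is at most
  1, exp(1/\<mu>) - 1 is at most 2/\<mu>; the exponents 1 and 2 add up to 3.\<close>

lemma log_noise_moment_up:
  "(\<Sum>n. ennreal (g_dens x n * exp (real t * log_noise x n))) \<le> ennreal (fact t * exp 3)"
proof -
  define \<mu> where "\<mu> = exp (max x 0)"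
  have \<mu>: "1 \<le> \<mu>" "exp x \<le> \<mu>" by (auto simp: \<mu>_def)
  have "exp (real t * log_noise x n) = ((1 + real n) / \<mu>) ^ t" for n
    by (simp add: log_noise_def \<mu>_def exp_of_nat_mult exp_diff)
  also have "((1 + real n) / \<mu>) ^ t \<le> fact t * exp ((1 + real n) / \<mu>)" for n
    using \<mu> by (intro power_le_fact_exp) auto
  finally have *: "exp (real t * log_noise x n) \<le> fact t * exp ((1 + real n) / \<mu>)" for n .
  have sums: "(\<lambda>n. fact t * exp (1 / \<mu>) * (g_dens x n * exp (1 / \<mu> * real n))) sums
      (fact t * exp (1 / \<mu>) * exp (exp x * (exp (1 / \<mu>) - 1)))"
    by (intro sums_mult g_dens_mgf_sums)
  have "(\<Sum>n. ennreal (g_dens x n * exp (real t * log_noise x n))) \<le>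
      (\<Sum>n. ennreal (fact t * exp (1 / \<mu>) * (g_dens x n * exp (1 / \<mu> * real n))))"
  proof (intro suminf_le ennreal_leI)
    fix n
    have "g_dens x n * exp (real t * log_noise x n) \<le> g_dens x n * (fact t * exp ((1 + real n) / \<mu>))"
      by (intro mult_left_mono *) auto
    then show "g_dens x n * exp (real t * log_noise x n) \<le> fact t * exp (1 / \<mu>) * (g_dens x n * exp (1 / \<mu> * real n))"
      by (simp add: add_divide_distrib exp_add mult_ac)
  qed auto
  also have "\<dots> = ennreal (fact t * exp (1 / \<mu>) * exp (exp x * (exp (1 / \<mu>) - 1)))"
    by (rule suminf_ennreal_eq[OF _ sums]) auto
  also have "\<dots> \<le> ennreal (fact t * exp 3)"
  proof (rule ennreal_leI)
    have i: "0 \<le> 1 / \<mu>" "1 / \<mu> \<le> 1" using \<mu> by auto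
    have "exp (1 / \<mu>) \<le> 1 + 1 / \<mu> + (1 / \<mu>)\<^sup>2" using exp_bound[OF i] .
    moreover have "(1 / \<mu>)\<^sup>2 \<le> 1 / \<mu>" using i power_decreasing[of 1 2 "1 / \<mu>"] by simp
    ultimately have "exp (1 / \<mu>) - 1 \<le> 2 / \<mu>" by linarith
    then have "exp x * (exp (1 / \<mu>) - 1) \<le> \<mu> * (2 / \<mu>)"
      using \<mu> by (intro mult_mono) auto
    also have "\<dots> = 2" using \<mu> by simp
    finally have "exp (1 / \<mu>) * exp (exp x * (exp (1 / \<mu>) - 1)) \<le> exp 1 * exp 2"
      using i by (intro mult_mono) auto
    also have "\<dots> = exp (3::real)" by (simp flip: exp_add)
    finally show "fact t * exp (1 / \<mu>) * exp (exp x * (exp (1 / \<mu>) - 1)) \<le> fact t * exp 3"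
      by (simp add: mult.assoc)
  qed
  finally show ?thesis .
qed

text \<open>For positive x the factor exp(t x) raises the Poisson weight from index n to n + t, and
  dividing by (1 + n) to the power t compensates the change of factorial up to t!. What remains is
  t! times a tail of the Poisson distribution.\<close>

lemma log_noise_moment_down:
  "(\<Sum>n. ennreal (g_dens x n * exp (- real t * log_noise x n))) \<le> ennreal (fact t)"
proof (cases "x \<le> 0")
  case True
  have "(\<Sum>n. ennreal (g_dens x n * exp (- real t * log_noise x n))) \<le> (\<Sum>n. ennreal (g_dens x n))"
  proof (intro suminf_le ennreal_leI)
    fix n
    have "exp (- real t * log_noise x n) \<le> 1" using True by (simp add: log_noise_def)
    then show "g_dens x n * exp (- real t * log_noise x n) \<le> g_dens x n"
      by (rule mult_left_le) auto
  qed auto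
  also have "\<dots> = ennreal 1" by (rule suminf_ennreal_eq[OF _ g_dens_sums]) auto
  also have "\<dots> \<le> ennreal (fact t)" by (intro ennreal_leI) (simp add: fact_ge_1)
  finally show ?thesis .
next
  case False
  have *: "g_dens x n * exp (- real t * log_noise x n) \<le> fact t * g_dens x (n + t)" for n
  proof -
    have "exp (- real t * log_noise x n) = exp (x * real t) / (1 + real n) ^ t"
    proof -
      have "exp (- real t * log_noise x n) = exp (x * real t) / exp (real t * ln (1 + real n))"
        using False by (simp add: log_noise_def algebra_simps flip: exp_diff)
      then show ?thesis by (simp add: exp_of_nat_mult)
    qed
    then have "g_dens x n * exp (- real t * log_noise x n) =
        exp (- exp x) * exp (x * real (n + t)) * (1 / (fact n * (1 + real n) ^ t))"
      by (simp add: g_dens_def exp_add algebra_simps)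
    also have "1 / (fact n * (1 + real n) ^ t) \<le> fact t / fact (n + t)"
      using fact_ratio_le[of n t] by (simp add: field_simps)
    finally show ?thesis by (simp add: g_dens_def mult_ac)
  qed
  have "(\<Sum>n. ennreal (g_dens x n * exp (- real t * log_noise x n))) \<le> (\<Sum>n. ennreal (fact t * g_dens x (n + t)))"
    by (intro suminf_le ennreal_leI *) auto
  also have "\<dots> = ennreal (\<Sum>n. fact t * g_dens x (n + t))"
    using g_dens_sums[of x] by (intro suminf_ennreal2) (auto intro!: summable_mult simp: summable_iff_shift sums_iff)
  also have "\<dots> \<le> ennreal (fact t)"
  proof (rule ennreal_leI)
    have s: "summable (\<lambda>n. g_dens x n)" "(\<Sum>n. g_dens x n) = 1" using g_dens_sums[of x] by (auto simp: sums_iff)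
    have "(\<Sum>n. g_dens x (n + t)) \<le> 1"
      using suminf_split_initial_segment[OF s(1), of t] s(2) sum_nonneg[of "{..<t}" "g_dens x"] by simp
    moreover have "(\<Sum>n. fact t * g_dens x (n + t)) = fact t * (\<Sum>n. g_dens x (n + t))"
      using s by (intro suminf_mult) (simp add: summable_iff_shift)
    moreover have "fact t * (\<Sum>n. g_dens x (n + t)) \<le> fact t * 1"
      using \<open>(\<Sum>n. g_dens x (n + t)) \<le> 1\<close> by (rule mult_left_mono) simp
    ultimately show "(\<Sum>n. fact t * g_dens x (n + t)) \<le> fact t" by simp
  qed
  finally show ?thesis .
qed

lemma log_noise_moment:
  "(\<Sum>n. ennreal (g_dens x n * exp (real t * \<bar>log_noise x n\<bar>))) \<le> ennreal (fact t * (exp 3 + 1))"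
proof -
  have "(\<Sum>n. ennreal (g_dens x n * exp (real t * \<bar>log_noise x n\<bar>))) \<le>
      (\<Sum>n. ennreal (g_dens x n * exp (real t * log_noise x n)) + ennreal (g_dens x n * exp (- real t * log_noise x n)))"
  proof (intro suminf_le)
    fix n
    have "exp (real t * \<bar>log_noise x n\<bar>) \<le> exp (real t * log_noise x n) + exp (- real t * log_noise x n)"
      by (cases "0 \<le> log_noise x n") (auto simp: abs_if)
    then have "g_dens x n * exp (real t * \<bar>log_noise x n\<bar>) \<le>
        g_dens x n * (exp (real t * log_noise x n) + exp (- real t * log_noise x n))"
      by (rule mult_left_mono) simp
    then show "ennreal (g_dens x n * exp (real t * \<bar>log_noise x n\<bar>)) \<le>
      ennreal (g_dens x n * exp (real t * log_noise x n)) + ennreal (g_dens x n * exp (- real t * log_noise x n))"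
      by (simp add: ennreal_plus[symmetric] distrib_left ennreal_leI del: ennreal_plus)
  qed auto
  also have "\<dots> = (\<Sum>n. ennreal (g_dens x n * exp (real t * log_noise x n))) +
      (\<Sum>n. ennreal (g_dens x n * exp (- real t * log_noise x n)))"
    by (intro suminf_add[symmetric]) auto
  also have "\<dots> \<le> ennreal (fact t * exp 3) + ennreal (fact t)"
    by (intro add_mono log_noise_moment_up log_noise_moment_down)
  also have "\<dots> = ennreal (fact t * (exp 3 + 1))"
    by (subst ennreal_plus[symmetric]) (auto simp: algebra_simps)
  finally show ?thesis .
qed

section \<open>The ergodic theorem\<close>

lemma INFM_Suc_iff: "(\<exists>\<^sub>\<infinity>n. P (Suc n)) \<longleftrightarrow> (\<exists>\<^sub>\<infinity>n. P n)"
  by (simp add: frequently_def cofinite_eq_sequentially eventually_sequentially_Suc[of "\<lambda>n. \<not> P n"])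

locale measure_preserving_map = prob_space M for M :: "'a measure" +
  fixes T :: "'a \<Rightarrow> 'a"
  assumes T_meas [measurable]: "T \<in> measurable M M" and T_distr: "distr M M T = M"
begin

lemma T_space: "x \<in> space M \<Longrightarrow> T x \<in> space M"
  using measurable_space[OF T_meas] .

lemma Tn_meas [measurable]: "(T ^^ n) \<in> measurable M M"
  by (induction n) (auto simp: o_def id_def)

lemma Tn_distr: "distr M M (T ^^ n) = M"
proof (induction n)
  case 0
  have "T ^^ 0 = (\<lambda>x. x)" by (simp add: fun_eq_iff)
  then show ?case by (simp only: distr_id)
next
  case (Suc n)
  have "distr M M (T ^^ Suc n) = distr (distr M M (T ^^ n)) M T"
    by (subst distr_distr) auto
  then show ?case using Suc T_distr by (simp only:)
qed

lemma Tn_space: "x \<in> space M \<Longrightarrow> (T ^^ n) x \<in> space M"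
  using measurable_space[OF Tn_meas] .

lemma integral_Tn:
  fixes f :: "'a \<Rightarrow> real"
  assumes [measurable]: "f \<in> borel_measurable M"
  shows "(\<integral>x. f ((T ^^ n) x) \<partial>M) = (\<integral>x. f x \<partial>M)"
  by (subst (2) Tn_distr[of n, symmetric]) (subst integral_distr, auto)

lemma integrable_Tn:
  fixes f :: "'a \<Rightarrow> real"
  assumes "integrable M f"
  shows "integrable M (\<lambda>x. f ((T ^^ n) x))"
proof -
  have "integrable (distr M M (T ^^ n)) f" using assms by (simp add: Tn_distr)
  then show ?thesis by (subst (asm) integrable_distr_eq) (use assms in auto)
qed

definition bsum :: "('a \<Rightarrow> real) \<Rightarrow> nat \<Rightarrow> 'a \<Rightarrow> real" where
  "bsum f n x = (\<Sum>k<n. f ((T ^^ k) x))"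

lemma bsum_meas [measurable]:
  assumes [measurable]: "f \<in> borel_measurable M"
  shows "bsum f n \<in> borel_measurable M"
  unfolding bsum_def by measurable

lemma bsum_add: "bsum f (m + n) x = bsum f m x + bsum f n ((T ^^ m) x)"
proof (induction n)
  case (Suc n)
  then show ?case by (simp add: bsum_def funpow_add add.commute[of m])
qed (simp add: bsum_def)

lemma bsum_Suc: "bsum f (Suc n) x = f x + bsum f n (T x)"
  using bsum_add[of f 1 n x] by (simp add: bsum_def)

text \<open>The covering argument of Keane and Petersen: blocks along which the average of \<open>f\<close> is
  at least \<open>v - \<epsilon>\<close> have bounded length outside a small set, on which \<open>f\<close> is raised.\<close>

lemma maximal_inequality:
  fixes f v :: "'a \<Rightarrow> real"
  assumes f: "integrable M f" "\<And>x. x \<in> space M \<Longrightarrow> 0 \<le> f x"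
    and v [measurable]: "v \<in> borel_measurable M"
    and vV: "\<And>x. x \<in> space M \<Longrightarrow> 0 \<le> v x" "\<And>x. x \<in> space M \<Longrightarrow> v x \<le> V"
    and inv: "\<And>x. x \<in> space M \<Longrightarrow> v (T x) = v x"
    and hit: "\<And>x \<epsilon>. x \<in> space M \<Longrightarrow> 0 < \<epsilon> \<Longrightarrow> \<exists>n\<ge>1. real n * (v x - \<epsilon>) \<le> bsum f n x"
  shows "(\<integral>x. v x \<partial>M) \<le> (\<integral>x. f x \<partial>M)"
proof (rule field_le_epsilon)
  fix \<epsilon> :: real assume "0 < \<epsilon>"
  define e where "e = \<epsilon> / 3"
  have e: "0 < e" using \<open>0 < \<epsilon>\<close> by (simp add: e_def)
  have fm [measurable]: "f \<in> borel_measurable M" using f by auto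
  have V0: "0 \<le> V" using not_empty vV by fastforce
  have v_int: "integrable M v"
    by (rule integrable_const_bound[of _ V]) (use vV in \<open>auto intro!: AE_I2\<close>)
  define Bad where "Bad N = {x \<in> space M. \<forall>n\<in>{1..N}. bsum f n x < real n * (v x - e)}" for N
  have Bad_meas [measurable]: "Bad N \<in> sets M" for N unfolding Bad_def by measurable
  have "(\<lambda>N. measure M (Bad N)) \<longlonglongrightarrow> measure M (\<Inter>N. Bad N)"
    by (rule finite_Lim_measure_decseq) (auto simp: decseq_def Bad_def)
  moreover have "(\<Inter>N. Bad N) = {}"
  proof (rule ccontr)
    assume "(\<Inter>N. Bad N) \<noteq> {}"
    then obtain x where x: "\<And>N. x \<in> Bad N" by auto
    then have "x \<in> space M" by (auto simp: Bad_def)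
    from hit[OF this e] obtain n where n: "n \<ge> 1" "real n * (v x - e) \<le> bsum f n x" by auto
    have "bsum f n x < real n * (v x - e)" using x[of n] n(1) unfolding Bad_def by auto
    with n(2) show False by linarith
  qed
  ultimately have "(\<lambda>N. V * measure M (Bad N)) \<longlonglongrightarrow> V * 0" by (intro tendsto_intros) auto
  then have "eventually (\<lambda>N. V * measure M (Bad N) < e) sequentially"
    using e by (auto dest: order_tendstoD)
  then obtain N where N: "V * measure M (Bad N) < e" by (auto simp: eventually_sequentially)
  \<comment> \<open>Raised by \<open>V\<close>, a single point of \<open>Bad N\<close> is already a
    block of length 1 with a large enough average. So every point starts a good block of length at
    most the larger of \<open>N\<close> and 1.\<close>
  define f' where "f' x = f x + V * indicator (Bad N) x" for x
  have f'0: "0 \<le> f' x" if "x \<in> space M" for x using f(2)[OF that] V0 by (simp add: f'_def)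
  have f'f: "f x \<le> f' x" for x using V0 by (simp add: f'_def indicator_def)
  have ind_int [simp]: "integrable M (indicat_real (Bad N))"
    by (rule integrable_real_indicator) (auto simp: less_top[symmetric])
  have f'_int: "integrable M f'" unfolding f'_def using f by auto
  have int_f': "(\<integral>x. f' x \<partial>M) = (\<integral>x. f x \<partial>M) + V * measure M (Bad N)"
    unfolding f'_def using f by (subst Bochner_Integration.integral_add) auto
  have invn: "v ((T ^^ m) x) = v x" if "x \<in> space M" for m x
    using that by (induction m) (auto simp: inv Tn_space)
  \<comment> \<open>Good blocks are concatenated until at most \<open>N\<close> steps are left;
    these may contribute nothing, and the loss is at most \<open>N\<close> times
    \<open>V\<close>.\<close>
  have cover: "real L * (v x - e) - real N * V \<le> bsum f' L x" if "x \<in> space M" for L x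
    using that
  proof (induction L arbitrary: x rule: less_induct)
    case (less L)
    have bs0: "0 \<le> bsum f' L x" unfolding bsum_def
      by (intro sum_nonneg f'0 Tn_space less.prems)
    show ?case
    proof (cases "L \<le> N")
      case True
      have "real L * (v x - e) \<le> real L * V" using vV(2)[OF less.prems] e
        by (intro mult_left_mono) auto
      also have "\<dots> \<le> real N * V" using True V0 by (intro mult_right_mono) auto
      finally show ?thesis using bs0 by linarith
    next
      case False
      obtain m where m: "1 \<le> m" "m \<le> L" "real m * (v x - e) \<le> bsum f' m x"
      proof (cases "x \<in> Bad N")
        case True
        have "f' x \<ge> v x - e" using f(2)[OF less.prems] vV(2)[OF less.prems] True e
          by (simp add: f'_def)
        then show ?thesis using False by (intro that[of 1]) (auto simp: bsum_def)
      next
        case nb: False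
        then obtain n where n: "n \<in> {1..N}" "real n * (v x - e) \<le> bsum f n x"
          using less.prems by (force simp: Bad_def not_less)
        moreover have "bsum f n x \<le> bsum f' n x" unfolding bsum_def by (intro sum_mono f'f)
        ultimately show ?thesis using False by (intro that[of n]) auto
      qed
      have "real (L - m) * (v ((T ^^ m) x) - e) - real N * V \<le> bsum f' (L - m) ((T ^^ m) x)"
        using m by (intro less.IH Tn_space less.prems) auto
      moreover have "bsum f' L x = bsum f' m x + bsum f' (L - m) ((T ^^ m) x)"
        using bsum_add[of f' m "L - m" x] m by simp
      ultimately show ?thesis
        using m invn[OF less.prems] by (simp add: of_nat_diff algebra_simps)
    qed
  qed
  have int_bsum: "(\<integral>x. bsum f' L x \<partial>M) = real L * (\<integral>x. f' x \<partial>M)" "integrable M (bsum f' L)" for L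
    unfolding bsum_def using integrable_Tn[OF f'_int] f'_int
    by (simp_all add: integral_Tn)
  obtain L :: nat where L: "L > 0" "real N * V \<le> e * real L"
  proof -
    obtain L :: nat where "real L > real N * V / e" using reals_Archimedean2 by blast
    then show ?thesis using e by (intro that[of "Suc L"]) (auto simp: field_simps)
  qed
  have "real L * ((\<integral>x. v x \<partial>M) - e) - real N * V = (\<integral>x. real L * (v x - e) - real N * V \<partial>M)"
    using v_int by (simp add: prob_space)
  also have "\<dots> \<le> (\<integral>x. bsum f' L x \<partial>M)"
    using v_int int_bsum(2) by (intro integral_mono cover) auto
  also have "\<dots> = real L * ((\<integral>x. f x \<partial>M) + V * measure M (Bad N))"
    by (simp add: int_bsum int_f')
  also have "\<dots> \<le> real L * ((\<integral>x. f x \<partial>M) + e)" using N by (intro mult_left_mono) auto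
  finally have "real L * (\<integral>x. v x \<partial>M) \<le> real L * ((\<integral>x. f x \<partial>M) + 3 * e)"
    using L by (simp add: algebra_simps)
  then show "(\<integral>x. v x \<partial>M) \<le> (\<integral>x. f x \<partial>M) + \<epsilon>" using L by (simp add: e_def)
qed

end

locale ergodic_map = measure_preserving_map +
  assumes ergodic: "\<And>E. E \<in> sets M \<Longrightarrow> (\<And>x. x \<in> space M \<Longrightarrow> T x \<in> E \<longleftrightarrow> x \<in> E) \<Longrightarrow>
    prob E = 0 \<or> prob E = 1"
begin

text \<open>\<open>E\<close> is the event that the limsup of the averages is at least t. It is
  described by levels \<open>ti i\<close> increasing to t, because one application of
  \<open>T\<close> changes the sums by a bounded amount and the gap between consecutive levels
  absorbs it: this makes \<open>E\<close> exactly invariant. The maximal inequality for t times the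
  indicator of \<open>E\<close> gives t P(E) below t, so by ergodicity P(E) = 0.\<close>

lemma averages_upper:
  assumes f: "integrable M f" "\<And>x. x \<in> space M \<Longrightarrow> 0 \<le> f x" and t: "(\<integral>x. f x \<partial>M) < t"
  shows "AE x in M. eventually (\<lambda>n. bsum f n x \<le> real n * t) sequentially"
proof -
  have fm [measurable]: "f \<in> borel_measurable M" using f by auto
  have "0 \<le> (\<integral>x. f x \<partial>M)" using f by (intro integral_nonneg_AE AE_I2) auto
  then have t0: "0 < t" using t by linarith
  define ti where "ti i = t - 1 / real (Suc i)" for i
  have ti_less: "ti i < ti (Suc i)" for i by (simp add: ti_def field_simps)
  define E where "E = {x \<in> space M. \<forall>i. \<exists>\<^sub>\<infinity>n. real n * ti i < bsum f n x}"
  have "E \<in> sets M" unfolding E_def INFM_nat_le by measurable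
  have inv: "T x \<in> E \<longleftrightarrow> x \<in> E" if x: "x \<in> space M" for x
  proof
    assume Tx: "T x \<in> E"
    have "\<exists>\<^sub>\<infinity>n. real n * ti i < bsum f n x" for i
    proof -
      have "eventually (\<lambda>n. real (Suc n) * ti i < real n * ti (Suc i)) sequentially"
      proof -
        have "LIM n sequentially. real n * (ti (Suc i) - ti i) :> at_top"
          using ti_less by (intro filterlim_at_top_mult_tendsto_pos[OF tendsto_const] filterlim_real_sequentially) auto
        then have "eventually (\<lambda>n. ti i < real n * (ti (Suc i) - ti i)) sequentially"
          by (auto simp: filterlim_at_top_dense)
        then show ?thesis by eventually_elim (simp add: algebra_simps)
      qed
      moreover have "\<exists>\<^sub>\<infinity>n. real n * ti (Suc i) < bsum f n (T x)" using Tx by (simp add: E_def)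
      ultimately have "\<exists>\<^sub>\<infinity>n. real n * ti (Suc i) < bsum f n (T x) \<and> real (Suc n) * ti i < real n * ti (Suc i)"
        by (intro frequently_eventually_frequently) (auto simp: cofinite_eq_sequentially)
      then have "\<exists>\<^sub>\<infinity>n. real (Suc n) * ti i < bsum f (Suc n) x"
        by (rule frequently_mono[rotated]) (use f(2)[OF x] in \<open>auto simp: bsum_Suc\<close>)
      then show ?thesis by (subst (asm) INFM_Suc_iff) simp
    qed
    then show "x \<in> E" using x by (simp add: E_def)
  next
    assume xE: "x \<in> E"
    have "\<exists>\<^sub>\<infinity>n. real n * ti i < bsum f n (T x)" for i
    proof -
      have "eventually (\<lambda>n. real n * ti i < real (Suc n) * ti (Suc i) - f x) sequentially"
      proof -
        have "LIM n sequentially. real n * (ti (Suc i) - ti i) :> at_top"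
          using ti_less by (intro filterlim_at_top_mult_tendsto_pos[OF tendsto_const] filterlim_real_sequentially) auto
        then have "eventually (\<lambda>n. f x - ti (Suc i) < real n * (ti (Suc i) - ti i)) sequentially"
          by (auto simp: filterlim_at_top_dense)
        then show ?thesis by eventually_elim (simp add: algebra_simps)
      qed
      moreover have "\<exists>\<^sub>\<infinity>n. real (Suc n) * ti (Suc i) < bsum f (Suc n) x"
        using xE by (subst INFM_Suc_iff[where P = "\<lambda>n. real n * ti (Suc i) < bsum f n x"]) (simp add: E_def)
      ultimately have "\<exists>\<^sub>\<infinity>n. real (Suc n) * ti (Suc i) < bsum f (Suc n) x \<and>
          real n * ti i < real (Suc n) * ti (Suc i) - f x"
        by (intro frequently_eventually_frequently) (auto simp: cofinite_eq_sequentially)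
      then show ?thesis
        by (rule frequently_mono[rotated]) (auto simp: bsum_Suc)
    qed
    then show "T x \<in> E" using T_space[OF x] by (simp add: E_def)
  qed
  have "(\<integral>x. t * indicator E x \<partial>M) \<le> (\<integral>x. f x \<partial>M)"
  proof (rule maximal_inequality[where V = t])
    fix x \<epsilon> assume x: "x \<in> space M" and \<epsilon>: "(0::real) < \<epsilon>"
    show "\<exists>n\<ge>1. real n * (t * indicator E x - \<epsilon>) \<le> bsum f n x"
    proof (cases "x \<in> E")
      case True
      obtain i where i: "1 / real (Suc i) < \<epsilon>" using nat_approx_posE[OF \<epsilon>] by auto
      have "\<exists>\<^sub>\<infinity>n. real n * ti i < bsum f n x" using True by (simp add: E_def)
      then obtain n where n: "n \<ge> 1" "real n * ti i < bsum f n x" by (auto simp: INFM_nat_le)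
      have "real n * (t - \<epsilon>) \<le> real n * ti i" using i by (intro mult_left_mono) (auto simp: ti_def)
      then have "real n * (t - \<epsilon>) \<le> bsum f n x" using n by linarith
      with n True show ?thesis by (intro exI[of _ n]) simp
    next
      case False
      then show ?thesis using f(2)[OF x] \<epsilon> by (intro exI[of _ 1]) (auto simp: bsum_def)
    qed
  next
    fix x assume "x \<in> space M"
    then show "t * indicator E (T x) = t * indicator E x" using inv by (simp add: indicator_def)
  qed (use f t0 \<open>E \<in> sets M\<close> in \<open>auto simp: indicator_def\<close>)
  then have "t * measure M E < t" using t \<open>E \<in> sets M\<close> by (simp add: sets.Int_space_eq2)
  then have "measure M E \<noteq> 1" by auto
  with ergodic[OF \<open>E \<in> sets M\<close> inv] have "measure M E = 0" by blast
  then have "AE x in M. x \<notin> E" using \<open>E \<in> sets M\<close> by (simp add: prob_eq_0)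
  then show ?thesis
  proof (rule AE_mp, intro AE_I2 impI)
    fix x assume "x \<in> space M" "x \<notin> E"
    then obtain i where "\<not> (\<exists>\<^sub>\<infinity>n. real n * ti i < bsum f n x)" by (auto simp: E_def)
    then have "eventually (\<lambda>n. \<not> real n * ti i < bsum f n x) sequentially"
      by (simp add: not_frequently cofinite_eq_sequentially)
    then show "eventually (\<lambda>n. bsum f n x \<le> real n * t) sequentially"
    proof eventually_elim
      case (elim n)
      have "real n * ti i \<le> real n * t" by (intro mult_left_mono) (auto simp: ti_def)
      then show ?case using elim by linarith
    qed
  qed
qed

text \<open>Reflection: \<open>K - f\<close> is again nonnegative, and an upper bound for its
  averages is a lower bound for those of \<open>f\<close>.\<close>

lemma averages_lower_bounded:
  assumes [measurable]: "f \<in> borel_measurable M" and f: "\<And>x. x \<in> space M \<Longrightarrow> 0 \<le> f x" "\<And>x. x \<in> space M \<Longrightarrow> f x \<le> K"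
    and t: "t < (\<integral>x. f x \<partial>M)"
  shows "AE x in M. eventually (\<lambda>n. real n * t \<le> bsum f n x) sequentially"
proof -
  have fi: "integrable M f"
    by (rule integrable_const_bound[of _ K]) (use f in \<open>auto intro!: AE_I2\<close>)
  have "AE x in M. eventually (\<lambda>n. bsum (\<lambda>x. K - f x) n x \<le> real n * (K - t)) sequentially"
    by (rule averages_upper) (use fi f t in \<open>auto simp: prob_space\<close>)
  then show ?thesis
  proof (rule AE_mp, intro AE_I2 impI)
    fix x assume "eventually (\<lambda>n. bsum (\<lambda>x. K - f x) n x \<le> real n * (K - t)) sequentially"
    then show "eventually (\<lambda>n. real n * t \<le> bsum f n x) sequentially"
      by eventually_elim (simp add: bsum_def sum_subtractf algebra_simps)
  qed
qed

text \<open>Truncation only decreases the sums, so a lower bound for the truncated function passes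
  to \<open>f\<close>; the truncation level is chosen by dominated convergence.\<close>

lemma averages_lower:
  assumes f: "integrable M f" "\<And>x. x \<in> space M \<Longrightarrow> 0 \<le> f x" and t: "t < (\<integral>x. f x \<partial>M)"
  shows "AE x in M. eventually (\<lambda>n. real n * t \<le> bsum f n x) sequentially"
proof -
  have fm [measurable]: "f \<in> borel_measurable M" using f by auto
  have "(\<lambda>K. \<integral>x. min (f x) (real K) \<partial>M) \<longlonglongrightarrow> (\<integral>x. f x \<partial>M)"
  proof (rule integral_dominated_convergence[where w = f])
    show "AE x in M. (\<lambda>K. min (f x) (real K)) \<longlonglongrightarrow> f x"
    proof (rule AE_I2)
      fix x
      obtain K0 :: nat where "f x \<le> real K0" using real_arch_simple by blast
      then have "eventually (\<lambda>K. min (f x) (real K) = f x) sequentially"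
        by (auto simp: eventually_sequentially min_def intro!: exI[of _ K0])
      then show "(\<lambda>K. min (f x) (real K)) \<longlonglongrightarrow> f x" by (rule tendsto_eventually)
    qed
  qed (use f in \<open>auto intro!: AE_I2\<close>)
  then have "eventually (\<lambda>K. t < (\<integral>x. min (f x) (real K) \<partial>M)) sequentially"
    using t by (rule order_tendstoD)
  then obtain K where "t < (\<integral>x. min (f x) (real K) \<partial>M)" by (auto simp: eventually_sequentially)
  then have "AE x in M. eventually (\<lambda>n. real n * t \<le> bsum (\<lambda>x. min (f x) (real K)) n x) sequentially"
    by (intro averages_lower_bounded[where K = "real K"]) (use f in auto)
  then show ?thesis
  proof (rule AE_mp, intro AE_I2 impI)
    fix x assume "eventually (\<lambda>n. real n * t \<le> bsum (\<lambda>x. min (f x) (real K)) n x) sequentially"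
    then show "eventually (\<lambda>n. real n * t \<le> bsum f n x) sequentially"
    proof eventually_elim
      case (elim n)
      have "bsum (\<lambda>x. min (f x) (real K)) n x \<le> bsum f n x" unfolding bsum_def by (intro sum_mono) auto
      then show ?case using elim by linarith
    qed
  qed
qed

lemma ergodic_theorem_nonneg:
  assumes f: "integrable M f" "\<And>x. x \<in> space M \<Longrightarrow> 0 \<le> f x"
  shows "AE x in M. (\<lambda>n. bsum f n x / real n) \<longlonglongrightarrow> (\<integral>x. f x \<partial>M)"
proof -
  define I where "I = (\<integral>x. f x \<partial>M)"
  have "AE x in M. \<forall>i. eventually (\<lambda>n. bsum f n x \<le> real n * (I + 1 / real (Suc i))) sequentially \<and>
      eventually (\<lambda>n. real n * (I - 1 / real (Suc i)) \<le> bsum f n x) sequentially"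
    unfolding AE_all_countable I_def by (intro allI AE_conjI averages_upper averages_lower f) auto
  then show ?thesis
  proof (rule AE_mp, intro AE_I2 impI)
    fix x assume *: "\<forall>i. eventually (\<lambda>n. bsum f n x \<le> real n * (I + 1 / real (Suc i))) sequentially \<and>
      eventually (\<lambda>n. real n * (I - 1 / real (Suc i)) \<le> bsum f n x) sequentially"
    have "(\<lambda>n. bsum f n x / real n) \<longlonglongrightarrow> I"
    proof (rule tendstoI)
      fix \<epsilon> :: real assume "0 < \<epsilon>"
      then obtain i where i: "1 / real (Suc i) < \<epsilon>" using nat_approx_posE by auto
      show "eventually (\<lambda>n. dist (bsum f n x / real n) I < \<epsilon>) sequentially"
        using *[rule_format, of i, THEN conjunct1] *[rule_format, of i, THEN conjunct2] eventually_gt_at_top[of 0]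
      proof eventually_elim
        case (elim n)
        then have "bsum f n x / real n \<le> I + 1 / real (Suc i)" "I - 1 / real (Suc i) \<le> bsum f n x / real n"
          by (simp_all only: divide_le_eq le_divide_eq) (auto simp: mult.commute)
        then show ?case using i by (simp only: dist_real_def abs_less_iff) linarith
      qed
    qed
    then show "(\<lambda>n. bsum f n x / real n) \<longlonglongrightarrow> (\<integral>x. f x \<partial>M)" by (simp add: I_def)
  qed
qed

theorem ergodic_theorem:
  fixes f :: "'a \<Rightarrow> real"
  assumes f: "integrable M f"
  shows "AE x in M. (\<lambda>n. bsum f n x / real n) \<longlonglongrightarrow> (\<integral>x. f x \<partial>M)"
proof -
  have eq: "f x = max 0 (f x) - max 0 (- f x)" for x by (simp add: max_def)
  have ip: "integrable M (\<lambda>x. max 0 (f x))" "integrable M (\<lambda>x. max 0 (- f x))" using f by auto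
  have "AE x in M. (\<lambda>n. bsum (\<lambda>x. max 0 (f x)) n x / real n) \<longlonglongrightarrow> (\<integral>x. max 0 (f x) \<partial>M)"
    "AE x in M. (\<lambda>n. bsum (\<lambda>x. max 0 (- f x)) n x / real n) \<longlonglongrightarrow> (\<integral>x. max 0 (- f x) \<partial>M)"
    by (intro ergodic_theorem_nonneg ip; simp)+
  then show ?thesis
  proof eventually_elim
    case (elim x)
    have "bsum f n x = bsum (\<lambda>x. max 0 (f x)) n x - bsum (\<lambda>x. max 0 (- f x)) n x" for n
      unfolding bsum_def sum_subtractf[symmetric] by (simp only: eq[symmetric])
    moreover have "(\<integral>x. f x \<partial>M) = (\<integral>x. max 0 (f x) \<partial>M) - (\<integral>x. max 0 (- f x) \<partial>M)"
      by (subst Bochner_Integration.integral_diff[OF ip, symmetric]) (simp only: eq[symmetric])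
    ultimately show ?case using tendsto_diff[OF elim] by (simp add: diff_divide_distrib)
  qed
qed

end

section \<open>Limits and approximation of measures\<close>

text \<open>Jensen's inequality for the probability weights (1 - \<rho>) \<rho>^j, obtained by
  summing the tangent line inequality of exp at the weighted mean \<open>m\<close>.\<close>

lemma convex_exp_suminf:
  fixes v :: "nat \<Rightarrow> real"
  assumes \<rho>: "0 < \<rho>" "\<rho> < 1" and v: "\<And>j. 0 \<le> v j"
    and s: "summable (\<lambda>j. (1 - \<rho>) * \<rho> ^ j * exp (v j))"
  shows "summable (\<lambda>j. \<rho> ^ j * v j)"
    and "exp (\<Sum>j. (1 - \<rho>) * \<rho> ^ j * v j) \<le> (\<Sum>j. (1 - \<rho>) * \<rho> ^ j * exp (v j))"
proof -
  have s1: "summable (\<lambda>j. (1 - \<rho>) * \<rho> ^ j * v j)"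
  proof (rule summable_comparison_test'[OF s])
    fix j
    have "v j \<le> exp (v j)" using exp_ge_add_one_self[of "v j"] by linarith
    then show "norm ((1 - \<rho>) * \<rho> ^ j * v j) \<le> (1 - \<rho>) * \<rho> ^ j * exp (v j)"
      using \<rho> v[of j] by (simp add: abs_mult mult_left_mono)
  qed
  have "summable (\<lambda>j. (1 / (1 - \<rho>)) * ((1 - \<rho>) * \<rho> ^ j * v j))" by (rule summable_mult[OF s1])
  then show "summable (\<lambda>j. \<rho> ^ j * v j)" using \<rho> by simp
  have w: "(\<lambda>j. (1 - \<rho>) * \<rho> ^ j) sums 1"
    using sums_mult[OF geometric_sums[of \<rho>], of "1 - \<rho>"] \<rho> by simp
  define m where "m = (\<Sum>j. (1 - \<rho>) * \<rho> ^ j * v j)"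
  have m: "(\<lambda>j. (1 - \<rho>) * \<rho> ^ j * v j) sums m" using s1 by (simp add: m_def summable_sums)
  have "(\<lambda>j. exp m * ((1 - m) * ((1 - \<rho>) * \<rho> ^ j) + (1 - \<rho>) * \<rho> ^ j * v j)) sums (exp m * ((1 - m) * 1 + m))"
    by (intro sums_mult sums_add w m)
  then have "exp m = (\<Sum>j. exp m * ((1 - m) * ((1 - \<rho>) * \<rho> ^ j) + (1 - \<rho>) * \<rho> ^ j * v j))"
    and sm: "summable (\<lambda>j. exp m * ((1 - m) * ((1 - \<rho>) * \<rho> ^ j) + (1 - \<rho>) * \<rho> ^ j * v j))"
    by (auto simp: sums_iff)
  note this(1)
  also have "(\<Sum>j. exp m * ((1 - m) * ((1 - \<rho>) * \<rho> ^ j) + (1 - \<rho>) * \<rho> ^ j * v j)) \<le> (\<Sum>j. (1 - \<rho>) * \<rho> ^ j * exp (v j))"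
  proof (rule suminf_le[OF _ sm s])
    fix j
    have "exp m * (1 + (v j - m)) \<le> exp m * exp (v j - m)"
      by (intro mult_left_mono exp_ge_add_one_self) simp
    also have "\<dots> = exp (v j)" by (simp flip: exp_add)
    finally have "(1 - \<rho>) * \<rho> ^ j * (exp m * (1 + (v j - m))) \<le> (1 - \<rho>) * \<rho> ^ j * exp (v j)"
      using \<rho> by (intro mult_left_mono) auto
    then show "exp m * ((1 - m) * ((1 - \<rho>) * \<rho> ^ j) + (1 - \<rho>) * \<rho> ^ j * v j) \<le> (1 - \<rho>) * \<rho> ^ j * exp (v j)"
      by (simp add: algebra_simps)
  qed
  finally show "exp (\<Sum>j. (1 - \<rho>) * \<rho> ^ j * v j) \<le> (\<Sum>j. (1 - \<rho>) * \<rho> ^ j * exp (v j))"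
    by (simp add: m_def)
qed

text \<open>Jensen is applied pointwise and the result is integrated term by term. The moment order
  grows by the factor 1/(1 - \<rho>), the total mass of the weights \<rho>^j.\<close>

lemma exp_moment_weighted_sum:
  fixes V :: "nat \<Rightarrow> 'a \<Rightarrow> real"
  assumes [measurable]: "\<And>j. V j \<in> borel_measurable M" and V: "\<And>j x. 0 \<le> V j x"
    and \<rho>: "0 < \<rho>" "\<rho> < 1" and \<tau>: "0 < \<tau>"
    and C: "\<And>j. (\<integral>\<^sup>+x. ennreal (exp (\<tau> / (1 - \<rho>) * V j x)) \<partial>M) \<le> ennreal C"
  shows "AE x in M. summable (\<lambda>j. \<rho> ^ j * V j x)"
    and "(\<integral>\<^sup>+x. ennreal (exp (\<tau> * (\<Sum>j. \<rho> ^ j * V j x))) \<partial>M) \<le> ennreal C"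
proof -
  define W where "W j x = \<tau> / (1 - \<rho>) * V j x" for j x
  have W0: "0 \<le> W j x" for j x using V \<rho> \<tau> by (simp add: W_def)
  define G where "G x = (\<Sum>j. ennreal ((1 - \<rho>) * \<rho> ^ j * exp (W j x)))" for x
  have G_meas [measurable]: "G \<in> borel_measurable M" unfolding G_def W_def by measurable
  have w: "(\<lambda>j. (1 - \<rho>) * \<rho> ^ j) sums 1"
    using sums_mult[OF geometric_sums[of \<rho>], of "1 - \<rho>"] \<rho> by simp
  have "(\<integral>\<^sup>+x. G x \<partial>M) = (\<Sum>j. \<integral>\<^sup>+x. ennreal ((1 - \<rho>) * \<rho> ^ j * exp (W j x)) \<partial>M)"
    unfolding G_def W_def by (intro nn_integral_suminf) measurable
  also have "\<dots> = (\<Sum>j. ennreal ((1 - \<rho>) * \<rho> ^ j) * (\<integral>\<^sup>+x. ennreal (exp (W j x)) \<partial>M))"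
    using \<rho> by (intro suminf_cong) (subst nn_integral_cmult[symmetric], auto simp: ennreal_mult W_def)
  also have "\<dots> \<le> (\<Sum>j. ennreal ((1 - \<rho>) * \<rho> ^ j) * ennreal C)"
    using C unfolding W_def by (intro suminf_le mult_left_mono) auto
  also have "\<dots> = (\<Sum>j. ennreal ((1 - \<rho>) * \<rho> ^ j)) * ennreal C" by simp
  also have "(\<Sum>j. ennreal ((1 - \<rho>) * \<rho> ^ j)) = ennreal 1"
    using \<rho> by (intro suminf_ennreal_eq[OF _ w]) auto
  finally have GC: "(\<integral>\<^sup>+x. G x \<partial>M) \<le> ennreal C" by simp
  then have "AE x in M. G x \<noteq> \<infinity>" by (intro nn_integral_PInf_AE) (auto simp: top_unique)
  moreover have key: "summable (\<lambda>j. \<rho> ^ j * V j x) \<and> ennreal (exp (\<tau> * (\<Sum>j. \<rho> ^ j * V j x))) \<le> G x"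
    if "G x \<noteq> \<infinity>" for x
  proof -
    have s: "summable (\<lambda>j. (1 - \<rho>) * \<rho> ^ j * exp (W j x))"
      using that \<rho> unfolding G_def by (intro summable_suminf_not_top) auto
    have 1: "summable (\<lambda>j. \<rho> ^ j * W j x)" by (rule convex_exp_suminf(1)[OF \<rho> W0 s])
    have eq: "(1 - \<rho>) / \<tau> * (\<rho> ^ j * W j x) = \<rho> ^ j * V j x" for j
      using \<rho> \<tau> by (simp add: W_def)
    have sV: "summable (\<lambda>j. \<rho> ^ j * V j x)"
      using summable_mult[OF 1, of "(1 - \<rho>) / \<tau>"] by (simp only: eq)
    have "exp (\<Sum>j. (1 - \<rho>) * \<rho> ^ j * W j x) \<le> (\<Sum>j. (1 - \<rho>) * \<rho> ^ j * exp (W j x))"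
      by (rule convex_exp_suminf(2)[OF \<rho> W0 s])
    moreover have "(1 - \<rho>) * \<rho> ^ j * W j x = \<tau> * (\<rho> ^ j * V j x)" for j
      using \<rho> by (simp add: W_def)
    ultimately have "exp (\<tau> * (\<Sum>j. \<rho> ^ j * V j x)) \<le> (\<Sum>j. (1 - \<rho>) * \<rho> ^ j * exp (W j x))"
      using sV by (simp add: suminf_mult)
    then have "ennreal (exp (\<tau> * (\<Sum>j. \<rho> ^ j * V j x))) \<le> ennreal (\<Sum>j. (1 - \<rho>) * \<rho> ^ j * exp (W j x))"
      by (rule ennreal_leI)
    also have "\<dots> = G x" unfolding G_def using \<rho> s by (intro suminf_ennreal2[symmetric]) auto
    finally show ?thesis using sV by simp
  qed
  ultimately show "AE x in M. summable (\<lambda>j. \<rho> ^ j * V j x)" by (auto elim: AE_mp)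
  have "(\<integral>\<^sup>+x. ennreal (exp (\<tau> * (\<Sum>j. \<rho> ^ j * V j x))) \<partial>M) \<le> (\<integral>\<^sup>+x. G x \<partial>M)"
    using key by (intro nn_integral_mono) (metis infinity_ennreal_def top_greatest)
  then show "(\<integral>\<^sup>+x. ennreal (exp (\<tau> * (\<Sum>j. \<rho> ^ j * V j x))) \<partial>M) \<le> ennreal C"
    using GC by (rule order_trans)
qed

text \<open>Fatou gives the limiting masses a total of at most 1, and tightness at least 1. For
  bounded functions, one finite set carries almost all mass under every \<open>P n\<close> and under
  the limit; on it the integral is a finite sum of converging terms.\<close>

lemma tight_pmf_limit:
  fixes P :: "nat \<Rightarrow> 'a pmf"
  assumes lim: "\<And>x. (\<lambda>n. pmf (P n) x) \<longlonglongrightarrow> q x"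
    and tight: "\<And>\<epsilon>. 0 < \<epsilon> \<Longrightarrow> \<exists>S. finite S \<and> (\<forall>n. 1 - \<epsilon> \<le> measure (P n) S)"
  obtains R where "\<And>x. pmf R x = q x"
    "\<And>(f :: 'a \<Rightarrow> real) K. (\<And>x. \<bar>f x\<bar> \<le> K) \<Longrightarrow>
      (\<lambda>n. \<integral>x. f x \<partial>measure_pmf (P n)) \<longlonglongrightarrow> (\<integral>x. f x \<partial>measure_pmf R)"
proof -
  have q0: "0 \<le> q x" for x using lim by (rule LIMSEQ_le_const) (auto intro: pmf_nonneg)
  have "(\<integral>\<^sup>+x. ennreal (q x) \<partial>count_space UNIV) = 1"
  proof (rule antisym)
    have "(\<integral>\<^sup>+x. ennreal (q x) \<partial>count_space UNIV) =
        (\<integral>\<^sup>+x. liminf (\<lambda>n. ennreal (pmf (P n) x)) \<partial>count_space UNIV)"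
      by (intro nn_integral_cong lim_imp_Liminf[symmetric] tendsto_ennrealI lim) auto
    also have "\<dots> \<le> liminf (\<lambda>n. \<integral>\<^sup>+x. ennreal (pmf (P n) x) \<partial>count_space UNIV)"
      by (rule nn_integral_liminf) auto
    also have "\<dots> = 1" by (simp add: nn_integral_pmf measure_pmf.emeasure_space_1[simplified] Liminf_const)
    finally show "(\<integral>\<^sup>+x. ennreal (q x) \<partial>count_space UNIV) \<le> 1" .
    show "1 \<le> (\<integral>\<^sup>+x. ennreal (q x) \<partial>count_space UNIV)"
    proof (rule ennreal_le_epsilon)
      fix \<epsilon> :: real assume \<epsilon>: "0 < \<epsilon>"
      obtain S where S: "finite S" "\<And>n. 1 - \<epsilon> \<le> measure (P n) S" using tight[OF \<epsilon>] by blast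
      have "(\<lambda>n. \<Sum>x\<in>S. pmf (P n) x) \<longlonglongrightarrow> (\<Sum>x\<in>S. q x)" by (intro tendsto_sum lim)
      moreover have "\<And>n. 1 - \<epsilon> \<le> (\<Sum>x\<in>S. pmf (P n) x)" using S by (simp add: measure_measure_pmf_finite)
      ultimately have "1 - \<epsilon> \<le> (\<Sum>x\<in>S. q x)" by (intro LIMSEQ_le_const) auto
      then have "ennreal 1 \<le> ennreal ((\<Sum>x\<in>S. q x) + \<epsilon>)" by (intro ennreal_leI) linarith
      also have "\<dots> = ennreal (\<Sum>x\<in>S. q x) + ennreal \<epsilon>" using \<epsilon> q0 by (intro ennreal_plus sum_nonneg) auto
      also have "ennreal (\<Sum>x\<in>S. q x) = (\<Sum>x\<in>S. ennreal (q x))" using q0 by (simp add: sum_ennreal)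
      also have "\<dots> = (\<integral>\<^sup>+x. ennreal (q x) * indicator S x \<partial>count_space UNIV)"
        using S(1) by (subst nn_integral_count_space'[of S]) auto
      also have "\<dots> \<le> (\<integral>\<^sup>+x. ennreal (q x) \<partial>count_space UNIV)"
        by (intro nn_integral_mono) (auto simp: indicator_def)
      finally show "1 \<le> (\<integral>\<^sup>+x. ennreal (q x) \<partial>count_space UNIV) + ennreal \<epsilon>"
        by (simp add: add_right_mono)
    qed
  qed
  then have R: "pmf (embed_pmf q) x = q x" for x using q0 by (intro pmf_embed_pmf) auto
  show ?thesis
  proof (rule that[OF R])
    fix f :: "'a \<Rightarrow> real" and K assume K: "\<And>x. \<bar>f x\<bar> \<le> K"
    have K0: "0 \<le> K" using K[of undefined] by linarith
    define R where "R = embed_pmf q"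
    have int: "integrable (measure_pmf p) f" for p :: "'a pmf"
      by (rule measure_pmf.integrable_const_bound[where B = K]) (use K in auto)
    have split: "\<bar>(\<integral>x. f x \<partial>measure_pmf p) - (\<Sum>x\<in>S. f x * pmf p x)\<bar> \<le> K * (1 - measure p S)"
      if "finite S" for S and p :: "'a pmf"
    proof -
      have "(\<Sum>x\<in>S. f x * pmf p x) = (\<integral>x. f x * indicator S x \<partial>measure_pmf p)"
        using that by (subst integral_measure_pmf[of S]) (auto simp: indicator_def mult.commute intro!: sum.cong)
      moreover have ii: "integrable (measure_pmf p) (\<lambda>x. f x * indicator S x)"
        using integrable_mult_indicator[OF _ int, of S p] by (simp add: mult.commute)
      ultimately have "(\<integral>x. f x \<partial>measure_pmf p) - (\<Sum>x\<in>S. f x * pmf p x) =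
          (\<integral>x. f x - f x * indicator S x \<partial>measure_pmf p)"
        using int by simp
      also have "\<bar>\<dots>\<bar> \<le> (\<integral>x. \<bar>f x - f x * indicator S x\<bar> \<partial>measure_pmf p)"
        by (rule integral_abs_bound)
      also have "\<dots> \<le> (\<integral>x. K * indicator (- S) x \<partial>measure_pmf p)"
      proof (rule integral_mono)
        show "integrable (measure_pmf p) (\<lambda>x. \<bar>f x - f x * indicator S x\<bar>)"
          using int ii by auto
        show "integrable (measure_pmf p) (\<lambda>x. K * indicator (- S) x)"
          by (rule measure_pmf.integrable_const_bound[where B = K]) (use K0 in \<open>auto simp: indicator_def\<close>)
      qed (use K K0 in \<open>auto simp: indicator_def\<close>)
      also have "\<dots> = K * (1 - measure p S)"
        by (simp add: measure_pmf.prob_compl[of S p, simplified, symmetric] Compl_eq_Diff_UNIV)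
      finally show ?thesis .
    qed
    show "(\<lambda>n. \<integral>x. f x \<partial>measure_pmf (P n)) \<longlonglongrightarrow> (\<integral>x. f x \<partial>measure_pmf (embed_pmf q))"
    proof (rule tendstoI)
      fix \<epsilon> :: real assume \<epsilon>: "0 < \<epsilon>"
      define e where "e = \<epsilon> / (4 * (K + 1))"
      have e: "0 < e" "K * e \<le> \<epsilon> / 4" using \<epsilon> K0 by (auto simp: e_def field_simps)
      obtain S where S: "finite S" "\<And>n. 1 - e \<le> measure (P n) S" using tight[OF e(1)] by blast
      have lims: "(\<lambda>n. \<Sum>x\<in>S. g x * pmf (P n) x) \<longlonglongrightarrow> (\<Sum>x\<in>S. g x * pmf R x)" for g :: "'a \<Rightarrow> real"
        unfolding R_def R by (intro tendsto_sum tendsto_mult tendsto_const lim)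
      have "1 - e \<le> (\<Sum>x\<in>S. 1 * pmf R x)"
        using S by (intro LIMSEQ_le_const[OF lims]) (auto simp: measure_measure_pmf_finite)
      then have SR: "1 - e \<le> measure R S" using S(1) by (simp add: measure_measure_pmf_finite)
      have Ke: "K * (1 - measure p S) \<le> \<epsilon> / 4" if "1 - e \<le> measure p S" for p :: "'a pmf"
        using mult_left_mono[of "1 - measure p S" e K] that K0 e by linarith
      have "eventually (\<lambda>n. dist (\<Sum>x\<in>S. f x * pmf (P n) x) (\<Sum>x\<in>S. f x * pmf R x) < \<epsilon> / 4) sequentially"
        using tendstoD[OF lims, of "\<epsilon> / 4" f] \<epsilon> by simp
      then show "eventually (\<lambda>n. dist (\<integral>x. f x \<partial>measure_pmf (P n)) (\<integral>x. f x \<partial>measure_pmf (embed_pmf q)) < \<epsilon>) sequentially"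
      proof eventually_elim
        case (elim n)
        then show ?case
          using split[OF S(1), of "P n"] split[OF S(1), of R] Ke[OF S(2), of n] Ke[OF SR] \<epsilon>
          unfolding dist_real_def R_def by linarith
      qed
    qed
  qed
qed

section \<open>Approximation of events by finite windows\<close>

definition determined :: "nat \<Rightarrow> (int \<Rightarrow> 'a) set \<Rightarrow> bool" where
  "determined m B \<longleftrightarrow> (\<forall>y y'. (\<forall>k\<in>{- int m..int m}. y k = y' k) \<longrightarrow> (y \<in> B \<longleftrightarrow> y' \<in> B))"

lemma determined_mono: "determined m B \<Longrightarrow> m \<le> m' \<Longrightarrow> determined m' B"
  unfolding determined_def by (meson atLeastatMost_subset_iff neg_le_iff_le of_nat_le_iff subsetD)

lemma space_obs_space [simp]: "space obs_space = UNIV"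
  by (simp add: obs_space_def space_PiM)

text \<open>The approximable events form a \<sigma>-algebra containing the one-coordinate events.
  Both laws are treated at once because the ergodicity argument needs one and the same approximating
  event under each.\<close>

lemma approximation_by_window:
  assumes Q1: "prob_space Q1" "sets Q1 = sets obs_space" and Q2: "prob_space Q2" "sets Q2 = sets obs_space"
    and A: "A \<in> sets obs_space" and \<delta>: "0 < \<delta>"
  shows "\<exists>m B. B \<in> sets obs_space \<and> determined m B \<and>
    measure Q1 ((A - B) \<union> (B - A)) < \<delta> \<and> measure Q2 ((A - B) \<union> (B - A)) < \<delta>"
proof -
  interpret Q1: prob_space Q1 by fact
  interpret Q2: prob_space Q2 by fact
  let ?G = "{{f \<in> \<Pi>\<^sub>E i\<in>UNIV. space (count_space UNIV). f i \<in> A} | i A. i \<in> (UNIV::int set) \<and> A \<in> sets (count_space (UNIV :: nat set))}"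
  have so: "sets obs_space = sigma_sets UNIV ?G"
    unfolding obs_space_def by (subst sets_PiM_single) (simp add: PiE_UNIV_domain)
  from A have "A \<in> sigma_sets UNIV ?G" by (simp only: so)
  then show ?thesis using \<delta>
  proof (induction arbitrary: \<delta> rule: sigma_sets.induct)
    case (Basic a)
    then obtain i :: int and A :: "nat set" where a: "a = {f. f i \<in> A}" by auto
    have "a \<in> sets obs_space" unfolding so using Basic by (intro sigma_sets.Basic)
    moreover have "determined (nat \<bar>i\<bar>) a" unfolding determined_def
    proof (intro allI impI)
      fix y y' :: "int \<Rightarrow> nat" assume "\<forall>k\<in>{- int (nat \<bar>i\<bar>)..int (nat \<bar>i\<bar>)}. y k = y' k"
      moreover have "i \<in> {- int (nat \<bar>i\<bar>)..int (nat \<bar>i\<bar>)}" unfolding atLeastAtMost_iff by linarith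
      ultimately have "y i = y' i" by blast
      then show "y \<in> a \<longleftrightarrow> y' \<in> a" by (simp add: a)
    qed
    ultimately show ?case using Basic by (intro exI[of _ "nat \<bar>i\<bar>"] exI[of _ a]) auto
  next
    case Empty
    then show ?case by (intro exI[of _ 0] exI[of _ "{}"]) (auto simp: determined_def)
  next
    case (Compl a)
    obtain m B where B: "B \<in> sets obs_space" "determined m B"
      "measure Q1 ((a - B) \<union> (B - a)) < \<delta>" "measure Q2 ((a - B) \<union> (B - a)) < \<delta>"
      using Compl.IH[OF Compl.prems] by blast
    have eq: "((UNIV - a) - (- B)) \<union> ((- B) - (UNIV - a)) = (a - B) \<union> (B - a)" by auto
    have "- B \<in> sets obs_space" using sets.compl_sets[OF B(1)] by (simp add: Compl_eq_Diff_UNIV)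
    moreover have "determined m (- B)" using B(2) unfolding determined_def by blast
    moreover have "measure Q1 (((UNIV - a) - (- B)) \<union> ((- B) - (UNIV - a))) < \<delta>"
      "measure Q2 (((UNIV - a) - (- B)) \<union> ((- B) - (UNIV - a))) < \<delta>"
      unfolding eq by (fact B(3,4))+
    ultimately show ?case by (intro exI[of _ m] exI[of _ "- B"] conjI)
  next
    case (Union a)
    have am: "a i \<in> sets obs_space" for i unfolding so using Union.hyps by blast
    \<comment> \<open>The part of the union missed by its first \<open>n\<close> members; it
      decreases to the empty set. Half of \<delta> is spent on it, the other half on approximating
      the \<open>n\<close> members.\<close>
    define U where "U n = (\<Union>i. a i) - (\<Union>i<n. a i)" for n :: nat
    have Um: "U n \<in> sets obs_space" for n unfolding U_def using am by auto
    have Ulim: "(\<lambda>n. measure Q (U n)) \<longlonglongrightarrow> 0" if "prob_space Q" "sets Q = sets obs_space" for Q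
    proof -
      interpret Q: prob_space Q by fact
      have "(\<lambda>n. measure Q (U n)) \<longlonglongrightarrow> measure Q (\<Inter>n. U n)"
        by (rule Q.finite_Lim_measure_decseq) (use Um that in \<open>auto simp: decseq_def U_def\<close>)
      moreover have "(\<Inter>n. U n) = {}" by (auto simp: U_def)
      ultimately show ?thesis by simp
    qed
    have "eventually (\<lambda>n. measure Q1 (U n) < \<delta> / 2 \<and> measure Q2 (U n) < \<delta> / 2) sequentially"
      using order_tendstoD(2)[OF Ulim[OF Q1], of "\<delta> / 2"] order_tendstoD(2)[OF Ulim[OF Q2], of "\<delta> / 2"] Union.prems
      by (auto intro: eventually_conj)
    then obtain n where n: "measure Q1 (U n) < \<delta> / 2" "measure Q2 (U n) < \<delta> / 2"
      by (auto simp: eventually_sequentially)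
    define d where "d = \<delta> / (2 * (real n + 1))"
    have d: "0 < d" "real n * d \<le> \<delta> / 2" using Union.prems by (auto simp: d_def field_simps)
    have "\<forall>i. \<exists>m B. B \<in> sets obs_space \<and> determined m B \<and>
      measure Q1 ((a i - B) \<union> (B - a i)) < d \<and> measure Q2 ((a i - B) \<union> (B - a i)) < d"
      using Union.IH d(1) by blast
    then obtain m B where B: "\<And>i. B i \<in> sets obs_space" "\<And>i. determined (m i) (B i)"
      "\<And>i. measure Q1 ((a i - B i) \<union> (B i - a i)) < d" "\<And>i. measure Q2 ((a i - B i) \<union> (B i - a i)) < d"
      by metis
    define B' where "B' = (\<Union>i<n. B i)"
    define m' where "m' = (\<Sum>i<n. m i)"
    have "determined m' (B i)" if "i < n" for i
      unfolding m'_def by (rule determined_mono[OF B(2)]) (use that in \<open>auto intro: member_le_sum\<close>)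
    then have "determined m' B'" unfolding B'_def determined_def by blast
    moreover have "B' \<in> sets obs_space" unfolding B'_def using B by auto
    moreover have "measure Q (((\<Union>i. a i) - B') \<union> (B' - (\<Union>i. a i))) < \<delta>"
      if Q: "prob_space Q" "sets Q = sets obs_space" and Un: "measure Q (U n) < \<delta> / 2"
        and dd: "\<And>i. measure Q ((a i - B i) \<union> (B i - a i)) < d" for Q
    proof -
      interpret Q: prob_space Q by fact
      define D where "D i = (a i - B i) \<union> (B i - a i)" for i
      have Dm: "D i \<in> sets Q" for i using am B(1) Q by (auto simp: D_def)
      have "measure Q (((\<Union>i. a i) - B') \<union> (B' - (\<Union>i. a i))) \<le> measure Q (U n \<union> (\<Union>i<n. D i))"
        using Dm Um Q by (intro Q.finite_measure_mono) (auto simp: U_def B'_def D_def)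
      also have "\<dots> \<le> measure Q (U n) + measure Q (\<Union>i<n. D i)"
        using Dm Um Q by (intro measure_subadditive) auto
      also have "measure Q (\<Union>i<n. D i) \<le> (\<Sum>i<n. measure Q (D i))"
        using Dm by (intro Q.finite_measure_subadditive_finite) auto
      also have "\<dots> \<le> (\<Sum>i<n. d)" using dd by (intro sum_mono) (auto simp: D_def intro: less_imp_le)
      also have "\<dots> \<le> \<delta> / 2" using d by simp
      finally show ?thesis using Un by linarith
    qed
    ultimately show ?case using Q1 Q2 n B(3,4) by blast
  qed
qed

section \<open>Laws of the observations\<close>

definition lnobs :: "(int \<Rightarrow> nat) \<Rightarrow> int \<Rightarrow> real" where
  "lnobs y k = ln (1 + real (y k))"

definition shift :: "int \<Rightarrow> (int \<Rightarrow> 'a) \<Rightarrow> int \<Rightarrow> 'a" where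
  "shift m y k = y (k + m)"

definition trunc :: "int \<Rightarrow> (int \<Rightarrow> nat) \<Rightarrow> int \<Rightarrow> nat" where
  "trunc k y j = (if j < k then y j else 0)"

text \<open>The fixed point of the recursion when all observations are 0, that is, the value of the
  filter on an all-zero past.\<close>

definition cst :: "nat \<Rightarrow> param \<Rightarrow> real" where
  "cst p \<theta> = om \<theta> / (1 - (\<Sum>i=1..p. ca \<theta> i))"

definition filt :: "nat \<Rightarrow> param \<Rightarrow> int \<Rightarrow> (int \<Rightarrow> nat) \<Rightarrow> real" where
  "filt p \<theta> k y = cst p \<theta> + (\<Sum>j. hcoef \<theta> j * lnobs y (k - 1 - int j))"

text \<open>The domain on which the series in \<open>filt\<close> converges for weights of order
  \<rho>^j. The quantifier over all k makes it a shift-invariant property.\<close>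

definition tempered :: "real \<Rightarrow> (int \<Rightarrow> nat) \<Rightarrow> bool" where
  "tempered \<rho> y \<longleftrightarrow> (\<forall>k. summable (\<lambda>j. \<rho> ^ j * lnobs y (k - int j)))"

text \<open>A function of the observations before time \<open>k\<close> is encoded as a function of \<open>trunc k y\<close>.\<close>

definition obs_law :: "nat \<Rightarrow> param \<Rightarrow> (int \<Rightarrow> nat) measure \<Rightarrow> bool" where
  "obs_law p \<theta> Q \<longleftrightarrow> prob_space Q \<and> sets Q = sets obs_space \<and> distr Q obs_space (shift 1) = Q \<and>
    integrable Q (\<lambda>y. lnobs y 0) \<and>
    (\<forall>n. \<forall>\<phi>\<in>borel_measurable obs_space.
      (\<integral>\<^sup>+y. \<phi> (trunc 0 y) * indicator {y. y 0 = n} y \<partial>Q) =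
      (\<integral>\<^sup>+y. \<phi> (trunc 0 y) * ennreal (g_dens (filt p \<theta> 0 y) n) \<partial>Q))"

lemma lnobs_nonneg [simp]: "0 \<le> lnobs y k"
  by (simp add: lnobs_def)

lemma measurable_obs_component [measurable]: "(\<lambda>y. y k) \<in> measurable obs_space (count_space UNIV)"
  unfolding obs_space_def by measurable

lemma measurable_into_obs:
  assumes "\<And>k. (\<lambda>x. f x k) \<in> measurable M (count_space UNIV)"
  shows "f \<in> measurable M obs_space"
  unfolding obs_space_def by (rule measurable_PiM_single') (use assms in auto)

lemma measurable_shift [measurable]: "shift m \<in> measurable obs_space obs_space"
  by (rule measurable_into_obs) (simp add: shift_def)

lemma measurable_trunc [measurable]: "trunc k \<in> measurable obs_space obs_space"
  by (rule measurable_into_obs) (simp add: trunc_def)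

lemma measurable_upd [measurable]: "(\<lambda>y. y(k := n)) \<in> measurable obs_space obs_space"
  by (rule measurable_into_obs) (simp add: fun_upd_def)

lemma measurable_lnobs [measurable]: "(\<lambda>y. lnobs y k) \<in> borel_measurable obs_space"
  unfolding lnobs_def by measurable

lemma measurable_filt [measurable]: "filt p \<theta> k \<in> borel_measurable obs_space"
  unfolding filt_def by measurable

lemma measurable_g_dens [measurable]: "(\<lambda>x. g_dens x n) \<in> borel_measurable borel"
  unfolding g_dens_def by measurable

lemma lnobs_shift: "lnobs (shift m y) k = lnobs y (k + m)"
  by (simp add: lnobs_def shift_def)

lemma filt_shift: "filt p \<theta> k (shift m y) = filt p \<theta> (k + m) y"
  by (simp add: filt_def lnobs_shift algebra_simps)

lemma filt_cong: "(\<And>j. j < k \<Longrightarrow> y j = y' j) \<Longrightarrow> filt p \<theta> k y = filt p \<theta> k y'"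
  by (simp add: filt_def lnobs_def)

lemma filt_trunc: "j \<le> k \<Longrightarrow> filt p \<theta> j (trunc k y) = filt p \<theta> j y"
  by (rule filt_cong) (simp add: trunc_def)

lemma trunc_trunc: "j \<le> k \<Longrightarrow> trunc j (trunc k y) = trunc j y"
  by (auto simp: trunc_def)

lemma trunc_Suc: "trunc (k + 1) y = (trunc k y)(k := y k)"
  by (auto simp: trunc_def)

lemma shift_trunc: "trunc j (shift m y) = shift m (trunc (j + m) y)"
  by (auto simp: trunc_def shift_def)

lemma shift_shift: "shift m (shift n y) = shift (m + n) y"
  by (auto simp: shift_def algebra_simps)

lemma shift_0 [simp]: "shift 0 y = y"
  by (auto simp: shift_def)

lemma shift_funpow: "(shift 1 ^^ n) y = shift (int n) y"
  by (induction n) (auto simp: shift_shift add.commute)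

lemma distr_shift:
  assumes Q: "sets Q = sets obs_space" "distr Q obs_space (shift 1) = Q"
  shows "distr Q obs_space (shift m) = Q"
proof -
  have [measurable_cong]: "sets Q = sets obs_space" by fact
  have sp: "shift 0 = (\<lambda>y::int \<Rightarrow> nat. y)" by (simp add: fun_eq_iff)
  have pos: "distr Q obs_space (shift (int n)) = Q" for n
  proof (induction n)
    case 0
    have "distr Q obs_space (\<lambda>y. y) = distr Q Q (\<lambda>y. y)" using Q(1) by (intro distr_cong) auto
    then show ?case by (simp add: sp distr_id)
  next
    case (Suc n)
    have "distr Q obs_space (shift (int (Suc n))) = distr (distr Q obs_space (shift (int n))) obs_space (shift 1)"
      by (subst distr_distr) (auto simp: o_def shift_shift add.commute intro!: distr_cong)
    then show ?case using Suc Q(2) by simp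
  qed
  show ?thesis
  proof (cases "0 \<le> m")
    case True
    then show ?thesis using pos[of "nat m"] by simp
  next
    case False
    \<comment> \<open>For a backward shift the law is first replaced by its image under the opposite
      forward shift, which is the same law; the two shifts then cancel.\<close>
    have "distr Q obs_space (shift m) = distr (distr Q obs_space (shift (int (nat (- m))))) obs_space (shift m)"
      by (simp only: pos)
    also have "\<dots> = distr Q obs_space (shift 0)"
      using False by (subst distr_distr) (auto simp: o_def shift_shift intro!: distr_cong)
    also have "\<dots> = Q" using pos[of 0] by simp
    finally show ?thesis .
  qed
qed

lemma obs_lawD:
  assumes "obs_law p \<theta> Q"
  shows "prob_space Q" "sets Q = sets obs_space" "distr Q obs_space (shift 1) = Q"
    "integrable Q (\<lambda>y. lnobs y 0)"
    "\<phi> \<in> borel_measurable obs_space \<Longrightarrow>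
      (\<integral>\<^sup>+y. \<phi> (trunc 0 y) * indicator {y. y 0 = n} y \<partial>Q) =
      (\<integral>\<^sup>+y. \<phi> (trunc 0 y) * ennreal (g_dens (filt p \<theta> 0 y) n) \<partial>Q)"
proof -
  note * = assms[unfolded obs_law_def]
  show "prob_space Q" "sets Q = sets obs_space" "distr Q obs_space (shift 1) = Q"
    "integrable Q (\<lambda>y. lnobs y 0)"
    by (fact *[THEN conjunct1] *[THEN conjunct2, THEN conjunct1]
      *[THEN conjunct2, THEN conjunct2, THEN conjunct1]
      *[THEN conjunct2, THEN conjunct2, THEN conjunct2, THEN conjunct1])+
  show "(\<integral>\<^sup>+y. \<phi> (trunc 0 y) * indicator {y. y 0 = n} y \<partial>Q) =
      (\<integral>\<^sup>+y. \<phi> (trunc 0 y) * ennreal (g_dens (filt p \<theta> 0 y) n) \<partial>Q)"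
    if "\<phi> \<in> borel_measurable obs_space"
    by (fact *[THEN conjunct2, THEN conjunct2, THEN conjunct2, THEN conjunct2, rule_format, OF that])
qed

lemma (in prob_space) weighted_sum:
  fixes V :: "nat \<Rightarrow> 'a \<Rightarrow> real"
  assumes [measurable]: "\<And>j. V j \<in> borel_measurable M" and V: "\<And>j y. 0 \<le> V j y"
    and K: "\<And>j. (\<integral>\<^sup>+y. ennreal (V j y) \<partial>M) \<le> ennreal K" and \<rho>: "0 < \<rho>" "\<rho> < 1" and K0: "0 \<le> K"
  shows "AE y in M. summable (\<lambda>j. \<rho> ^ j * V j y)"
    and "(\<integral>\<^sup>+y. ennreal (\<Sum>j. \<rho> ^ j * V j y) \<partial>M) \<le> ennreal (K / (1 - \<rho>))"
proof -
  have "(\<integral>\<^sup>+y. (\<Sum>j. ennreal (\<rho> ^ j * V j y)) \<partial>M) = (\<Sum>j. \<integral>\<^sup>+y. ennreal (\<rho> ^ j * V j y) \<partial>M)"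
    by (intro nn_integral_suminf) measurable
  also have "\<dots> = (\<Sum>j. ennreal (\<rho> ^ j) * (\<integral>\<^sup>+y. ennreal (V j y) \<partial>M))"
    using V \<rho>(1) by (intro suminf_cong) (subst nn_integral_cmult[symmetric], auto simp: ennreal_mult)
  also have "\<dots> \<le> (\<Sum>j. ennreal (\<rho> ^ j) * ennreal K)"
    by (intro suminf_le mult_left_mono K) auto
  also have "\<dots> = (\<Sum>j. ennreal (\<rho> ^ j * K))"
    using \<rho>(1) K0 by (simp only: ennreal_mult zero_le_power less_imp_le)
  also have "\<dots> = ennreal (K / (1 - \<rho>))"
  proof (rule suminf_ennreal_eq)
    show "(\<lambda>j. \<rho> ^ j * K) sums (K / (1 - \<rho>))"
      using sums_mult2[OF geometric_sums[of \<rho>], of K] \<rho> by simp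
  qed (use \<rho> K0 in auto)
  finally have le: "(\<integral>\<^sup>+y. (\<Sum>j. ennreal (\<rho> ^ j * V j y)) \<partial>M) \<le> ennreal (K / (1 - \<rho>))" .
  then have "(\<integral>\<^sup>+y. (\<Sum>j. ennreal (\<rho> ^ j * V j y)) \<partial>M) \<noteq> \<infinity>" by (auto simp: top_unique)
  then have "AE y in M. (\<Sum>j. ennreal (\<rho> ^ j * V j y)) \<noteq> \<infinity>"
    by (intro nn_integral_PInf_AE) auto
  then show s: "AE y in M. summable (\<lambda>j. \<rho> ^ j * V j y)"
  proof eventually_elim
    case (elim y)
    show ?case
      by (rule summable_suminf_not_top) (use elim V \<rho>(1) in \<open>simp_all\<close>)
  qed
  have "(\<integral>\<^sup>+y. ennreal (\<Sum>j. \<rho> ^ j * V j y) \<partial>M) = (\<integral>\<^sup>+y. (\<Sum>j. ennreal (\<rho> ^ j * V j y)) \<partial>M)"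
  proof (rule nn_integral_cong_AE)
    show "AE y in M. ennreal (\<Sum>j. \<rho> ^ j * V j y) = (\<Sum>j. ennreal (\<rho> ^ j * V j y))"
      using s
    proof eventually_elim
      case (elim y)
      show ?case by (rule suminf_ennreal2[symmetric]) (use elim V \<rho>(1) in simp_all)
    qed
  qed
  then show "(\<integral>\<^sup>+y. ennreal (\<Sum>j. \<rho> ^ j * V j y) \<partial>M) \<le> ennreal (K / (1 - \<rho>))" using le by simp
qed

section \<open>Consequences of stationarity and of the conditional law\<close>

locale obs_process =
  fixes p :: nat and \<theta> :: param and Q :: "(int \<Rightarrow> nat) measure"
  assumes obs_law: "obs_law p \<theta> Q"
begin

sublocale prob_space Q by (rule obs_lawD[OF obs_law])

lemma sets_Q [measurable_cong, simp]: "sets Q = sets obs_space"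
  by (rule obs_lawD[OF obs_law])

lemma space_Q [simp]: "space Q = UNIV"
  using sets_eq_imp_space_eq[OF sets_Q] by simp

lemma distr_shift_Q: "distr Q obs_space (shift m) = Q"
  by (rule distr_shift[OF obs_lawD(2,3)[OF obs_law]])

lemma nn_integral_shift:
  assumes [measurable]: "f \<in> borel_measurable obs_space"
  shows "(\<integral>\<^sup>+y. f (shift m y) \<partial>Q) = (\<integral>\<^sup>+y. f y \<partial>Q)"
  by (subst (2) distr_shift_Q[of m, symmetric]) (subst nn_integral_distr, auto)

lemma AE_shift:
  assumes "AE y in Q. P y" shows "AE y in Q. P (shift m y)"
proof -
  have "AE y in distr Q obs_space (shift m). P y" using assms by (simp only: distr_shift_Q)
  then show ?thesis by (rule AE_distrD[rotated]) simp
qed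

lemma integral_shift:
  fixes f :: "(int \<Rightarrow> nat) \<Rightarrow> real"
  assumes [measurable]: "f \<in> borel_measurable obs_space"
  shows "(\<integral>y. f (shift m y) \<partial>Q) = (\<integral>y. f y \<partial>Q)"
  by (subst (2) distr_shift_Q[of m, symmetric]) (subst integral_distr, auto)

lemma integrable_shift:
  fixes f :: "(int \<Rightarrow> nat) \<Rightarrow> real"
  assumes "integrable Q f" shows "integrable Q (\<lambda>y. f (shift m y))"
proof -
  have "integrable (distr Q obs_space (shift m)) f" using assms by (simp only: distr_shift_Q)
  then show ?thesis by (subst (asm) integrable_distr_eq) (use assms in auto)
qed

lemma integrable_lnobs [simp]: "integrable Q (\<lambda>y. lnobs y k)"
  and expectation_lnobs: "expectation (\<lambda>y. lnobs y k) = expectation (\<lambda>y. lnobs y 0)"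
proof -
  have "integrable Q (\<lambda>y. lnobs y 0)" by (rule obs_lawD[OF obs_law])
  from integrable_shift[OF this, of k] show "integrable Q (\<lambda>y. lnobs y k)" by (simp add: lnobs_shift)
  show "expectation (\<lambda>y. lnobs y k) = expectation (\<lambda>y. lnobs y 0)"
    using integral_shift[of "\<lambda>y. lnobs y 0" k] by (simp add: lnobs_shift)
qed

lemma one_step_indicator:
  assumes [measurable]: "\<phi> \<in> borel_measurable obs_space"
  shows "(\<integral>\<^sup>+y. \<phi> (trunc k y) * indicator {y. y k = n} y \<partial>Q) =
    (\<integral>\<^sup>+y. \<phi> (trunc k y) * ennreal (g_dens (filt p \<theta> k y) n) \<partial>Q)"
proof -
  define \<phi>' where "\<phi>' z = \<phi> (shift (- k) z)" for z
  have [measurable]: "\<phi>' \<in> borel_measurable obs_space" unfolding \<phi>'_def by measurable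
  have *: "\<phi>' (trunc 0 (shift k y)) = \<phi> (trunc k y)" for y
    by (simp add: \<phi>'_def shift_trunc shift_shift)
  have "(\<integral>\<^sup>+y. \<phi>' (trunc 0 y) * indicator {y. y 0 = n} y \<partial>Q) =
      (\<integral>\<^sup>+y. \<phi>' (trunc 0 y) * ennreal (g_dens (filt p \<theta> 0 y) n) \<partial>Q)"
    by (rule obs_lawD(5)[OF obs_law]) fact
  moreover have "(\<integral>\<^sup>+y. \<phi>' (trunc 0 y) * indicator {y. y 0 = n} y \<partial>Q) =
      (\<integral>\<^sup>+y. \<phi>' (trunc 0 (shift k y)) * indicator {y. y 0 = n} (shift k y) \<partial>Q)"
    by (subst nn_integral_shift[symmetric, where m = k]) auto
  moreover have "(\<integral>\<^sup>+y. \<phi>' (trunc 0 y) * ennreal (g_dens (filt p \<theta> 0 y) n) \<partial>Q) =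
      (\<integral>\<^sup>+y. \<phi>' (trunc 0 (shift k y)) * ennreal (g_dens (filt p \<theta> 0 (shift k y)) n) \<partial>Q)"
    by (subst nn_integral_shift[symmetric, where m = k]) auto
  ultimately show ?thesis
    by (simp add: * filt_shift) (simp add: shift_def indicator_def)
qed

text \<open>Splitting over the value of \<open>y k\<close> turns the point-mass identity into a
  disintegration; it plays the part of conditional expectation given the past.\<close>

lemma one_step:
  assumes [measurable]: "\<And>n. \<psi> n \<in> borel_measurable obs_space"
  shows "(\<integral>\<^sup>+y. \<psi> (y k) (trunc k y) \<partial>Q) =
    (\<integral>\<^sup>+y. (\<Sum>n. \<psi> n (trunc k y) * ennreal (g_dens (filt p \<theta> k y) n)) \<partial>Q)"
proof -
  have "(\<integral>\<^sup>+y. \<psi> (y k) (trunc k y) \<partial>Q) = (\<integral>\<^sup>+y. (\<Sum>n. \<psi> n (trunc k y) * indicator {y. y k = n} y) \<partial>Q)"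
  proof (intro nn_integral_cong)
    fix y
    have "(\<lambda>n. \<psi> n (trunc k y) * indicator {y. y k = n} y) sums (\<Sum>n\<in>{y k}. \<psi> n (trunc k y) * indicator {y. y k = n} y)"
      by (rule sums_finite) auto
    then show "\<psi> (y k) (trunc k y) = (\<Sum>n. \<psi> n (trunc k y) * indicator {y. y k = n} y)"
      by (simp add: sums_iff)
  qed
  also have "\<dots> = (\<Sum>n. \<integral>\<^sup>+y. \<psi> n (trunc k y) * indicator {y. y k = n} y \<partial>Q)"
    by (intro nn_integral_suminf) measurable
  also have "\<dots> = (\<Sum>n. \<integral>\<^sup>+y. \<psi> n (trunc k y) * ennreal (g_dens (filt p \<theta> k y) n) \<partial>Q)"
    by (simp add: one_step_indicator)
  also have "\<dots> = (\<integral>\<^sup>+y. (\<Sum>n. \<psi> n (trunc k y) * ennreal (g_dens (filt p \<theta> k y) n)) \<partial>Q)"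
    by (intro nn_integral_suminf[symmetric]) measurable
  finally show ?thesis .
qed

lemma one_step_trunc:
  assumes [measurable]: "\<phi> \<in> borel_measurable obs_space"
  shows "(\<integral>\<^sup>+y. \<phi> (trunc (k + 1) y) \<partial>Q) =
    (\<integral>\<^sup>+y. (\<Sum>n. \<phi> ((trunc k y)(k := n)) * ennreal (g_dens (filt p \<theta> k y) n)) \<partial>Q)"
  unfolding trunc_Suc by (rule one_step[where \<psi> = "\<lambda>n y. \<phi> (y(k := n))"]) measurable

lemma nn_integral_lnobs: "(\<integral>\<^sup>+y. ennreal (lnobs y k) \<partial>Q) = ennreal (expectation (\<lambda>y. lnobs y 0))"
proof -
  have "(\<integral>\<^sup>+y. ennreal (lnobs y k) \<partial>Q) = (\<integral>\<^sup>+y. ennreal (lnobs y 0) \<partial>Q)"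
    using nn_integral_shift[of "\<lambda>y. ennreal (lnobs y 0)" k] by (simp add: lnobs_shift)
  then show ?thesis by (simp add: nn_integral_eq_integral)
qed

lemma expectation_lnobs_nonneg: "0 \<le> expectation (\<lambda>y. lnobs y 0)"
  by (rule integral_nonneg_AE) simp

lemma AE_tempered:
  assumes "0 < \<rho>" "\<rho> < 1"
  shows "AE y in Q. tempered \<rho> y"
  unfolding tempered_def AE_all_countable
  by (intro allI weighted_sum(1)[where K = "expectation (\<lambda>y. lnobs y 0)"] assms)
     (simp_all add: nn_integral_lnobs expectation_lnobs_nonneg)

end

section \<open>The stationary filter\<close>

text \<open>One pair \<open>C\<close>, \<rho> serves the switched impulse responses and the filter
  weights together. The last assumption records \<open>cst\<close> through its fixed-point equation,
  the only form in which the recursion of the filter uses it.\<close>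

locale model =
  fixes p q :: nat and \<theta> :: param and B C \<rho> :: real
  assumes p: "p \<ge> 1" and q: "q \<ge> 1" and \<theta>: "\<theta> \<in> param_space p q"
    and \<rho>: "0 < \<rho>" "\<rho> < 1" and C: "0 < C" and B: "0 < B"
    and bounds: "\<bar>om \<theta>\<bar> \<le> B" "\<And>i. \<bar>ca \<theta> i\<bar> \<le> B" "\<And>i. \<bar>cb \<theta> i\<bar> \<le> B"
    and switched_bound: "\<And>w k j. range w \<subseteq> {0, 1} \<Longrightarrow> \<bar>switched \<theta> w k j\<bar> \<le> B"
    and decay: "\<And>w l n. range w \<subseteq> {0, 1} \<Longrightarrow> \<bar>impulse (max p q) (switched \<theta> w) l n\<bar> \<le> C * \<rho> ^ n"
    and hcoef_decay: "\<And>j. \<bar>hcoef \<theta> j\<bar> \<le> C * \<rho> ^ j"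
    and cst: "cst p \<theta> = om \<theta> + (\<Sum>i=1..p. ca \<theta> i * cst p \<theta>)"

lemma model_exists:
  assumes pq: "p \<ge> 1" "q \<ge> 1" and \<theta>: "\<theta> \<in> param_space p q" and con: "contracting p q \<theta>"
  obtains B C \<rho> where "model p q \<theta> B C \<rho>"
proof -
  obtain B1 where B1: "0 < B1" "\<bar>om \<theta>\<bar> \<le> B1" "\<And>i. \<bar>ca \<theta> i\<bar> \<le> B1" "\<And>i. \<bar>cb \<theta> i\<bar> \<le> B1"
  proof (rule compact_coefficients_bounded[of "{\<theta>}" p q])
    fix B assume *: "0 < B" "\<And>t. t \<in> {\<theta>} \<Longrightarrow> \<bar>om t\<bar> \<le> B" "\<And>t i. t \<in> {\<theta>} \<Longrightarrow> \<bar>ca t i\<bar> \<le> B"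
      "\<And>t i. t \<in> {\<theta>} \<Longrightarrow> \<bar>cb t i\<bar> \<le> B"
    then show thesis by (intro that[of B]) blast+
  qed (use \<theta> in auto)
  obtain B2 C1 \<rho> where d: "0 < \<rho>" "\<rho> < 1" "0 < C1"
    "\<And>w k j. range w \<subseteq> {0, 1} \<Longrightarrow> \<bar>switched \<theta> w k j\<bar> \<le> B2"
    "\<And>w l n. range w \<subseteq> {0, 1} \<Longrightarrow> \<bar>impulse (max p q) (switched \<theta> w) l n\<bar> \<le> C1 * \<rho> ^ n"
    by (rule switched_decay[OF pq(1) \<theta> con]) (rule that, assumption+)
  have ar: "\<bar>impulse (max p q) (autoreg \<theta>) l n\<bar> \<le> C1 * \<rho> ^ n" for l n
    using d(5)[of "\<lambda>_. 0" l n] by (simp add: switched_zero)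
  define C2 where "C2 = C1 * real q * B1 / \<rho> ^ q"
  have h: "\<bar>hcoef \<theta> j\<bar> \<le> C2 * \<rho> ^ j" for j
    unfolding C2_def by (rule hcoef_bound[OF \<theta> pq(1) B1(3,4) ar d(1,2)])
  have s: "(\<Sum>i=1..p. ca \<theta> i) \<noteq> 1" by (rule sum_ca_neq_1[OF \<theta> pq(1) ar d(1,2)])
  show ?thesis
  proof (rule that[of "max B1 B2" "max C1 C2" \<rho>], unfold_locales)
    show "\<bar>impulse (max p q) (switched \<theta> w) l n\<bar> \<le> max C1 C2 * \<rho> ^ n" if "range w \<subseteq> {0, 1}" for w l n
      using d(5)[OF that, of l n] d(1) by (intro order_trans[OF d(5)[OF that]] mult_right_mono) auto
    show "\<bar>hcoef \<theta> j\<bar> \<le> max C1 C2 * \<rho> ^ j" for j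
      using d(1) by (intro order_trans[OF h] mult_right_mono) auto
    show "cst p \<theta> = om \<theta> + (\<Sum>i=1..p. ca \<theta> i * cst p \<theta>)"
    proof -
      have "o' / (1 - a) = o' + a * (o' / (1 - a))" if "a \<noteq> 1" for o' a :: real
        using that by (simp add: field_simps)
      from this[OF s, of "om \<theta>"] show ?thesis
        unfolding cst_def sum_distrib_right[symmetric] .
    qed
    show "\<bar>switched \<theta> w k j\<bar> \<le> max B1 B2" if "range w \<subseteq> {0, 1}" for w k j
      using d(4)[OF that, of k j] by simp
    show "\<bar>ca \<theta> i\<bar> \<le> max B1 B2" "\<bar>cb \<theta> i\<bar> \<le> max B1 B2" for i using B1(3,4)[of i] by auto
  qed (use pq \<theta> d B1 in auto)
qed

lemma weighted_summable_shift:
  assumes "tempered \<rho> y" "0 < \<rho>" and "\<And>j. \<bar>h j\<bar> \<le> C * \<rho> ^ j"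
  shows "summable (\<lambda>j. h j * lnobs y (k - int j))"
proof (rule summable_comparison_test')
  show "summable (\<lambda>j. C * (\<rho> ^ j * lnobs y (k - int j)))"
    using assms(1) by (intro summable_mult) (auto simp: tempered_def)
  show "norm (h j * lnobs y (k - int j)) \<le> C * (\<rho> ^ j * lnobs y (k - int j))" for j
    using mult_right_mono[OF assms(3)[of j], of "lnobs y (k - int j)"] by (simp add: abs_mult mult.assoc)
qed

text \<open>The recursion of \<open>hcoef\<close> is the coefficientwise form of (1 - \<Sum> a_i
  z^i) H(z) = \<Sum> b_(j+1) z^j. Lagged filters are padded with zeros so that all series run over
  the same observations and add termwise. It is stated for any decaying weights, since the estimates
  uniform over \<Theta> use it with constants of their own.\<close>

lemma filt_recursion_of_decay:
  assumes \<theta>: "\<theta> \<in> param_space p q" and \<rho>: "0 < \<rho>" and h: "\<And>j. \<bar>hcoef \<theta> j\<bar> \<le> C * \<rho> ^ j"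
    and cst: "cst p \<theta> = om \<theta> + (\<Sum>i=1..p. ca \<theta> i * cst p \<theta>)" and y: "tempered \<rho> y"
  shows "filt p \<theta> k y = om \<theta> + (\<Sum>i=1..p. ca \<theta> i * filt p \<theta> (k - int i) y)
    + (\<Sum>i=1..q. cb \<theta> i * lnobs y (k - int i))"
proof -
  define u where "u j = lnobs y (k - 1 - int j)" for j
  define S where "S k = (\<Sum>j. hcoef \<theta> j * lnobs y (k - 1 - int j))" for k
  have F: "filt p \<theta> k y = cst p \<theta> + S k" for k by (simp add: filt_def S_def)
  have Ssums: "(\<lambda>j. hcoef \<theta> j * lnobs y (k - 1 - int j)) sums S k" for k
    unfolding S_def by (rule summable_sums[OF weighted_summable_shift[OF y \<rho> h]])
  have lag: "(\<lambda>j. if i \<le> j then hcoef \<theta> (j - i) * u j else 0) sums S (k - int i)" for i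
  proof -
    have "(\<lambda>j. if i \<le> j + i then hcoef \<theta> (j + i - i) * u (j + i) else 0) sums S (k - int i)"
      using Ssums[of "k - int i"] by (simp add: u_def algebra_simps)
    then show ?thesis
      using sums_zero_iff_shift[of i "\<lambda>j. if i \<le> j then hcoef \<theta> (j - i) * u j else 0"] by simp
  qed
  have bsums: "(\<lambda>j. cb \<theta> (Suc j) * u j) sums (\<Sum>i=1..q. cb \<theta> i * lnobs y (k - int i))"
  proof -
    have "(\<lambda>j. cb \<theta> (Suc j) * u j) sums (\<Sum>j<q. cb \<theta> (Suc j) * u j)"
      by (rule sums_finite) (auto simp: param_space_cb[OF \<theta>])
    also have "(\<Sum>j<q. cb \<theta> (Suc j) * u j) = (\<Sum>i=1..q. cb \<theta> i * lnobs y (k - int i))"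
      by (rule sum.reindex_bij_witness[of _ "\<lambda>i. i - 1" Suc]) (auto simp: u_def algebra_simps)
    finally show ?thesis .
  qed
  have "(\<lambda>j. cb \<theta> (Suc j) * u j + (\<Sum>i=1..p. ca \<theta> i * (if i \<le> j then hcoef \<theta> (j - i) * u j else 0))) sums
      ((\<Sum>i=1..q. cb \<theta> i * lnobs y (k - int i)) + (\<Sum>i=1..p. ca \<theta> i * S (k - int i)))"
    by (intro sums_add bsums sums_sum sums_mult lag)
  moreover have "cb \<theta> (Suc j) * u j + (\<Sum>i=1..p. ca \<theta> i * (if i \<le> j then hcoef \<theta> (j - i) * u j else 0))
      = hcoef \<theta> j * u j" for j
  proof -
    have "(\<Sum>i=1..p. ca \<theta> i * (if i \<le> j then hcoef \<theta> (j - i) * u j else 0)) =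
        (\<Sum>i\<in>{1..p} \<inter> {1..j}. ca \<theta> i * (hcoef \<theta> (j - i) * u j))"
      by (rule sum.mono_neutral_cong_right) auto
    also have "\<dots> = (\<Sum>i\<in>{1..j}. ca \<theta> i * (hcoef \<theta> (j - i) * u j))"
      by (rule sum.mono_neutral_left) (auto simp: param_space_ca[OF \<theta>])
    finally show ?thesis
      by (subst (2) hcoef.simps) (simp add: algebra_simps sum_distrib_left)
  qed
  ultimately have "(\<lambda>j. hcoef \<theta> j * u j) sums
      ((\<Sum>i=1..q. cb \<theta> i * lnobs y (k - int i)) + (\<Sum>i=1..p. ca \<theta> i * S (k - int i)))"
    by simp
  then have "S k = (\<Sum>i=1..q. cb \<theta> i * lnobs y (k - int i)) + (\<Sum>i=1..p. ca \<theta> i * S (k - int i))"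
    using Ssums[of k] by (simp add: u_def sums_iff)
  then show ?thesis
    unfolding F by (subst cst) (simp add: distrib_left sum.distrib)
qed

context model
begin

lemma summable_hcoef:
  assumes "tempered \<rho> y"
  shows "summable (\<lambda>j. hcoef \<theta> j * lnobs y (k - int j))"
  by (rule weighted_summable_shift[OF assms \<rho>(1) hcoef_decay])

lemma filt_recursion:
  assumes "tempered \<rho> y"
  shows "filt p \<theta> k y = om \<theta> + (\<Sum>i=1..p. ca \<theta> i * filt p \<theta> (k - int i) y)
    + (\<Sum>i=1..q. cb \<theta> i * lnobs y (k - int i))"
  by (rule filt_recursion_of_decay[OF \<theta> \<rho>(1) hcoef_decay cst assms])

end

section \<open>Stationary solutions and laws of the observations\<close>

context model
begin

lemma autoreg_bound: "\<bar>autoreg \<theta> k j\<bar> \<le> B"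
  using bounds by (simp add: autoreg_def)

lemma autoreg_decay: "\<bar>impulse (max p q) (autoreg \<theta>) l n\<bar> \<le> C * \<rho> ^ n"
  using decay[of "\<lambda>_. 0" l n] by (simp add: switched_zero)

lemma homogeneous_bound:
  assumes "\<And>k. k0 < k \<Longrightarrow> k \<le> k0 + int n \<Longrightarrow> d k = (\<Sum>i=1..p. ca \<theta> i * d (k - int i)) + e k"
  shows "\<bar>d (k0 + int n)\<bar> \<le> C * (\<Sum>l=1..n. \<rho> ^ (n - l) * \<bar>e (k0 + int l)\<bar>)
    + real (max p q) * C * (1 + B) * \<rho> ^ n * (\<Sum>i<max p q. \<bar>d (k0 - int i)\<bar>)"
proof (rule recursion_bound[where c = "autoreg \<theta>"])
  fix k assume k: "k0 < k" "k \<le> k0 + int n"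
  have "(\<Sum>i=1..p. ca \<theta> i * d (k - int i)) = (\<Sum>i=1..max p q. ca \<theta> i * d (k - int i))"
    by (rule sum_lags_extend) (auto simp: param_space_ca[OF \<theta>])
  then show "d k = (\<Sum>j=1..max p q. autoreg \<theta> k j * d (k - int j)) + e k"
    using assms[OF k] by (simp add: autoreg_def)
qed (use autoreg_bound autoreg_decay \<rho> p in auto)

text \<open>Writing \<open>ln (1 + y k)\<close> as the positive part of \<open>x k\<close> plus noise turns the model into a
  switched linear recursion driven by the noise.\<close>

lemma filter_bound:
  fixes x :: "int \<Rightarrow> real" and y :: "int \<Rightarrow> nat"
  assumes rec: "\<And>k. k0 < k \<Longrightarrow> k \<le> k0 + int n \<Longrightarrow> x k = om \<theta> + (\<Sum>i=1..p. ca \<theta> i * x (k - int i))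
      + (\<Sum>i=1..q. cb \<theta> i * lnobs y (k - int i))"
  shows "\<bar>x (k0 + int n)\<bar> \<le> C * (\<Sum>l=1..n. \<rho> ^ (n - l) *
      (B * (1 + (\<Sum>i=1..q. \<bar>log_noise (x (k0 + int l - int i)) (y (k0 + int l - int i))\<bar>))))
    + real (max p q) * C * (1 + B) * \<rho> ^ n * (\<Sum>i<max p q. \<bar>x (k0 - int i)\<bar>)"
proof -
  define r where "r = max p q"
  \<comment> \<open>\<open>s k * x k\<close> is the positive part of \<open>x k\<close>. The word
    depends on the trajectory it drives, which is harmless because the decay is uniform over all
    words.\<close>
  define s :: "int \<Rightarrow> real" where "s k = (if 0 < x k then 1 else 0)" for k
  have s: "range s \<subseteq> {0, 1}" by (auto simp: s_def)
  define \<epsilon> where "\<epsilon> k = log_noise (x k) (y k)" for k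
  have u: "lnobs y k = s k * x k + \<epsilon> k" for k
    by (simp add: lnobs_def \<epsilon>_def log_noise_def s_def)
  define e where "e k = om \<theta> + (\<Sum>i=1..q. cb \<theta> i * \<epsilon> (k - int i))" for k
  have "\<bar>x (k0 + int n)\<bar> \<le> C * (\<Sum>l=1..n. \<rho> ^ (n - l) * \<bar>e (k0 + int l)\<bar>)
    + real r * C * (1 + B) * \<rho> ^ n * (\<Sum>i<r. \<bar>x (k0 - int i)\<bar>)"
  proof (rule recursion_bound[where c = "switched \<theta> s"])
    fix k assume k: "k0 < k" "k \<le> k0 + int n"
    have "(\<Sum>i=1..p. ca \<theta> i * x (k - int i)) = (\<Sum>i=1..r. ca \<theta> i * x (k - int i))"
      by (rule sum_lags_extend) (auto simp: param_space_ca[OF \<theta>] r_def)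
    moreover have "(\<Sum>i=1..q. cb \<theta> i * lnobs y (k - int i)) =
      (\<Sum>i=1..q. cb \<theta> i * (s (k - int i) * x (k - int i))) + (\<Sum>i=1..q. cb \<theta> i * \<epsilon> (k - int i))"
      by (simp add: u distrib_left sum.distrib)
    moreover have "(\<Sum>i=1..q. cb \<theta> i * (s (k - int i) * x (k - int i))) =
      (\<Sum>i=1..r. cb \<theta> i * (s (k - int i) * x (k - int i)))"
      by (rule sum_lags_extend) (auto simp: param_space_cb[OF \<theta>] r_def)
    moreover have "(\<Sum>j=1..r. switched \<theta> s k j * x (k - int j)) =
      (\<Sum>i=1..r. ca \<theta> i * x (k - int i)) + (\<Sum>i=1..r. cb \<theta> i * (s (k - int i) * x (k - int i)))"
      by (simp add: switched_def distrib_right sum.distrib mult.assoc)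
    ultimately show "x k = (\<Sum>j=1..r. switched \<theta> s k j * x (k - int j)) + e k"
      using rec[OF k] by (simp add: e_def)
  qed (use switched_bound[OF s] decay[OF s] \<rho> p in \<open>auto simp: r_def\<close>)
  moreover have "\<bar>e k\<bar> \<le> B * (1 + (\<Sum>i=1..q. \<bar>\<epsilon> (k - int i)\<bar>))" for k
  proof -
    have "\<bar>\<Sum>i=1..q. cb \<theta> i * \<epsilon> (k - int i)\<bar> \<le> (\<Sum>i=1..q. \<bar>cb \<theta> i * \<epsilon> (k - int i)\<bar>)" by (rule sum_abs)
    also have "\<dots> \<le> (\<Sum>i=1..q. B * \<bar>\<epsilon> (k - int i)\<bar>)"
      unfolding abs_mult using bounds by (intro sum_mono mult_right_mono) auto
    finally show ?thesis using bounds(1) by (simp add: e_def distrib_left sum_distrib_left)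
  qed
  then have "(\<Sum>l=1..n. \<rho> ^ (n - l) * \<bar>e (k0 + int l)\<bar>) \<le>
      (\<Sum>l=1..n. \<rho> ^ (n - l) * (B * (1 + (\<Sum>i=1..q. \<bar>\<epsilon> (k0 + int l - int i)\<bar>))))"
    using \<rho> by (intro sum_mono mult_left_mono) auto
  then have "C * (\<Sum>l=1..n. \<rho> ^ (n - l) * \<bar>e (k0 + int l)\<bar>) \<le>
      C * (\<Sum>l=1..n. \<rho> ^ (n - l) * (B * (1 + (\<Sum>i=1..q. \<bar>\<epsilon> (k0 + int l - int i)\<bar>))))"
    using C by (intro mult_left_mono) auto
  ultimately show ?thesis unfolding \<epsilon>_def r_def by linarith
qed

end

definition lift :: "nat \<Rightarrow> param \<Rightarrow> (int \<Rightarrow> nat) \<Rightarrow> path" where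
  "lift p \<theta> y = (\<lambda>k. (filt p \<theta> k y, y k))"

definition obs :: "path \<Rightarrow> int \<Rightarrow> nat" where
  "obs w = (\<lambda>k. snd (w k))"

lemma space_path_space [simp]: "space path_space = UNIV"
  by (simp add: path_space_def space_PiM space_pair_measure)

lemma measurable_path_component [measurable]:
  "(\<lambda>w. fst (w k)) \<in> measurable path_space borel"
  "(\<lambda>w. snd (w k)) \<in> measurable path_space (count_space UNIV)"
  unfolding path_space_def by measurable

lemma measurable_obs [measurable]: "obs \<in> measurable path_space obs_space"
  by (rule measurable_into_obs) (simp add: obs_def)

lemma measurable_into_path:
  assumes [measurable]: "\<And>k. (\<lambda>x. fst (f x k)) \<in> measurable M borel"
    "\<And>k. (\<lambda>x. snd (f x k)) \<in> measurable M (count_space UNIV)"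
  shows "f \<in> measurable M path_space"
  unfolding path_space_def
proof (rule measurable_PiM_single')
  show "(\<lambda>x. f x i) \<in> measurable M (borel \<Otimes>\<^sub>M count_space UNIV)" for i
    by (rule measurable_pair) (auto simp: o_def)
qed (auto simp: space_pair_measure)

lemma measurable_lift [measurable]: "lift p \<theta> \<in> measurable obs_space path_space"
  by (rule measurable_into_path) (auto simp: lift_def)

lemma obs_lift [simp]: "obs (lift p \<theta> y) = y"
  by (simp add: obs_def lift_def)

text \<open>The sum is at most its number of terms times the largest one. This replaces Hoelder's
  inequality for dependent summands.\<close>

lemma exp_sum_le:
  fixes v :: "'a \<Rightarrow> real"
  assumes "finite I" "I \<noteq> {}" "\<And>i. i \<in> I \<Longrightarrow> 0 \<le> v i"
  shows "exp (\<Sum>i\<in>I. v i) \<le> (\<Sum>i\<in>I. exp (real (card I) * v i))"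
proof -
  obtain m where m: "m \<in> I" "v m = Max (v ` I)" using Max_in[of "v ` I"] assms(1,2) by fastforce
  have "(\<Sum>i\<in>I. v i) \<le> (\<Sum>i\<in>I. v m)" using assms(1) m by (intro sum_mono) auto
  then have "exp (\<Sum>i\<in>I. v i) \<le> exp (real (card I) * v m)" by simp
  also have "\<dots> \<le> (\<Sum>i\<in>I. exp (real (card I) * v i))"
    using m assms(1) by (intro member_le_sum[where f = "\<lambda>i. exp (real (card I) * v i)"]) auto
  finally show ?thesis .
qed

section \<open>Exponential moments of stationary solutions\<close>

locale stationary_model = model +
  fixes P :: "path measure"
  assumes P: "stationary_law p q \<theta> P"
begin

abbreviation X :: "int \<Rightarrow> path \<Rightarrow> real" where "X k w \<equiv> fst (w k)"
abbreviation Y :: "int \<Rightarrow> path \<Rightarrow> nat" where "Y k w \<equiv> snd (w k)"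
abbreviation F :: "int \<Rightarrow> path measure" where "F k \<equiv> past P X Y k"

lemma solution: "stationary_solution p q \<theta> P X Y"
  using P by (simp add: stationary_law_def)

sublocale prob_space P using solution by (simp add: stationary_solution_def)

lemma sets_P [measurable_cong, simp]: "sets P = sets path_space"
  using P by (simp add: stationary_law_def)

lemma space_P [simp]: "space P = UNIV"
  using sets_eq_imp_space_eq[OF sets_P] by simp

lemma distr_P_shift: "distr P path_space (shift 1) = P"
proof -
  have "distr P path_space (\<lambda>w k. (X (k + 1) w, Y (k + 1) w)) = distr P path_space (\<lambda>w k. (X k w, Y k w))"
    using solution by (simp add: stationary_solution_def)
  moreover have "(\<lambda>(w::path) k. (X (k + 1) w, Y (k + 1) w)) = shift 1" by (simp add: fun_eq_iff shift_def)
  moreover have "(\<lambda>(w::path) k. (X k w, Y k w)) = (\<lambda>w. w)" by (simp add: fun_eq_iff)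
  moreover have "distr P path_space (\<lambda>w. w) = P"
    using distr_cong[of P P path_space P "\<lambda>w. w" "\<lambda>w. w"] by (simp add: distr_id)
  ultimately show ?thesis by simp
qed

lemma measurable_path_shift: "shift 1 \<in> measurable path_space path_space"
  by (rule measurable_into_path) (auto simp: shift_def)

lemma nn_integral_X:
  assumes [measurable]: "f \<in> borel_measurable borel"
  shows "(\<integral>\<^sup>+w. f (X k w) \<partial>P) = (\<integral>\<^sup>+w. f (X 0 w) \<partial>P)"
proof -
  have step: "(\<integral>\<^sup>+w. f (X (k + 1) w) \<partial>P) = (\<integral>\<^sup>+w. f (X k w) \<partial>P)" for k
  proof -
    have "(\<integral>\<^sup>+w. f (X k w) \<partial>P) = (\<integral>\<^sup>+w. f (X k w) \<partial>distr P path_space (shift 1))"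
      by (simp only: distr_P_shift)
    also have "\<dots> = (\<integral>\<^sup>+w. f (X k (shift 1 w)) \<partial>P)"
      by (rule nn_integral_distr) (use measurable_path_shift in \<open>simp_all cong: measurable_cong_sets\<close>)
    finally show ?thesis by (simp add: shift_def)
  qed
  show ?thesis
  proof (induction k rule: int_induct[where k = 0])
    case (step1 i) then show ?case using step[of i] by simp
  next
    case (step2 i) then show ?case using step[of "i - 1"] by simp
  qed simp
qed

lemma AE_recursion:
  "AE w in P. \<forall>k. X k w = om \<theta> + (\<Sum>i=1..p. ca \<theta> i * X (k - int i) w)
     + (\<Sum>i=1..q. cb \<theta> i * lnobs (obs w) (k - int i))"
  unfolding AE_all_countable
proof
  fix k
  have "AE w in P. X (k - 1 + 1) w = om \<theta> + (\<Sum>i = 1..p. ca \<theta> i * X (k - 1 + 1 - int i) w)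
          + (\<Sum>i = 1..q. cb \<theta> i * ln (1 + real (Y (k - 1 + 1 - int i) w)))"
    using solution unfolding stationary_solution_def by blast
  then show "AE w in P. X k w = om \<theta> + (\<Sum>i=1..p. ca \<theta> i * X (k - int i) w)
     + (\<Sum>i=1..q. cb \<theta> i * lnobs (obs w) (k - int i))"
    by (simp add: lnobs_def obs_def)
qed

lemma space_F [simp]: "space (F k) = UNIV"
  by (simp add: past_def space_measure_of_conv)

lemma sets_F: "sets (F k) = sigma_sets UNIV ({X j -` A \<inter> UNIV | j A. j \<le> k \<and> A \<in> sets borel} \<union>
      {Y j -` B \<inter> UNIV | j B. j \<le> k - 1})"
  unfolding past_def by (subst sets_measure_of) auto

lemma measurable_X_F: "j \<le> k \<Longrightarrow> X j \<in> borel_measurable (F k)"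
  by (rule measurableI) (auto simp: sets_F intro!: sigma_sets.Basic)

lemma measurable_Y_F:
  assumes "j < k" shows "Y j \<in> measurable (F k) (count_space UNIV)"
proof (rule measurableI)
  show "Y j -` A \<inter> space (F k) \<in> sets (F k)" for A
    unfolding sets_F space_F using assms
    by (intro sigma_sets.Basic UnI2 CollectI exI[of _ j] exI[of _ A]) auto
qed simp

lemma subalgebra_F: "subalgebra P (F k)"
proof -
  have "X j -` A \<in> sets path_space" if "A \<in> sets borel" for j A
    using measurable_sets[OF measurable_path_component(1)[of j] that] by simp
  moreover have "Y j -` A \<in> sets path_space" for j A
    using measurable_sets[OF measurable_path_component(2)[of j], of A] by simp
  ultimately have "sets (F k) \<subseteq> sets P" unfolding sets_F sets_P
    by (intro sets.sigma_sets_subset'[of _ path_space UNIV]) (auto simp: space_path_space[symmetric] simp del: space_path_space)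
  then show ?thesis by (simp add: subalgebra_def)
qed

text \<open>\<open>real_cond_exp\<close> is a difference of two nonnegative conditional
  expectations. For an indicator the negative part vanishes and the positive one is almost surely
  finite, so the point masses can be tested against arbitrary nonnegative functions of the
  past.\<close>

lemma conditional_law:
  assumes \<phi>: "\<phi> \<in> borel_measurable (F k)"
  shows "(\<integral>\<^sup>+w. \<phi> w * indicator {w. Y k w = n} w \<partial>P) = (\<integral>\<^sup>+w. \<phi> w * ennreal (g_dens (X k w) n) \<partial>P)"
proof -
  interpret finite_measure_subalgebra P "F k"
    by unfold_locales (rule subalgebra_F)
  define f where "f = (indicator {v \<in> space P. Y k v = n} :: path \<Rightarrow> real)"
  have f_meas [measurable]: "f \<in> borel_measurable P" unfolding f_def by measurable
  define N where "N = nn_cond_exp P (F k) (\<lambda>x. ennreal (f x))"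
  have [measurable]: "N \<in> borel_measurable P" unfolding N_def by measurable
  have "AE w in P. real_cond_exp P (F k) f w = g_dens (X k w) n"
    using solution unfolding stationary_solution_def f_def pmf_poisson_g_dens by blast
  moreover have "AE w in P. nn_cond_exp P (F k) (\<lambda>x. ennreal (- f x)) w = 0"
  proof -
    have "(\<lambda>x. ennreal (- f x)) = (\<lambda>_. 0)" by (auto simp: f_def indicator_def ennreal_neg)
    then show ?thesis using nn_cond_exp_F_meas[of "\<lambda>_. 0"] by simp
  qed
  moreover have "AE w in P. N w \<noteq> \<infinity>"
  proof (rule nn_integral_PInf_AE)
    have "(\<integral>\<^sup>+w. N w \<partial>P) = (\<integral>\<^sup>+w. ennreal (f w) \<partial>P)"
      using nn_cond_exp_intg[of "\<lambda>_. 1" "\<lambda>x. ennreal (f x)"] by (simp add: N_def)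
    also have "\<dots> \<le> (\<integral>\<^sup>+w. 1 \<partial>P)" by (intro nn_integral_mono) (auto simp: f_def indicator_def)
    finally show "(\<integral>\<^sup>+w. N w \<partial>P) \<noteq> \<infinity>" by (auto simp: emeasure_space_1 top_unique simp flip: space_P)
  qed simp
  ultimately have "AE w in P. ennreal (g_dens (X k w) n) = N w"
  proof eventually_elim
    case (elim w)
    then have "g_dens (X k w) n = enn2real (N w)" by (simp add: real_cond_exp_def N_def)
    then show ?case using elim(3) by (simp add: less_top)
  qed
  then have "(\<integral>\<^sup>+w. \<phi> w * ennreal (g_dens (X k w) n) \<partial>P) = (\<integral>\<^sup>+w. \<phi> w * N w \<partial>P)"
    by (intro nn_integral_cong_AE) auto
  also have "\<dots> = (\<integral>\<^sup>+w. \<phi> w * ennreal (f w) \<partial>P)"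
    unfolding N_def by (rule nn_cond_exp_intg[OF \<phi>]) measurable
  also have "\<dots> = (\<integral>\<^sup>+w. \<phi> w * indicator {w. Y k w = n} w \<partial>P)"
    by (intro nn_integral_cong) (auto simp: f_def indicator_def)
  finally show ?thesis by simp
qed

text \<open>Conditioning on the past leaves the Poisson sum \<open>log_noise_moment\<close>, whose
  bound is free of \<open>X k\<close>. Hence nothing about the size of \<open>X\<close> enters, and
  deriving the moments of \<open>X\<close> from this is not circular.\<close>

lemma noise_moment_nat:
  "(\<integral>\<^sup>+w. ennreal (exp (real t * \<bar>log_noise (X k w) (Y k w)\<bar>)) \<partial>P) \<le> ennreal (fact t * (exp 3 + 1))"
proof -
  define \<psi> where "\<psi> n w = ennreal (exp (real t * \<bar>log_noise (X k w) n\<bar>))" for n w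
  have \<psi>F: "\<psi> n \<in> borel_measurable (F k)" for n
    unfolding \<psi>_def log_noise_def using measurable_X_F[of k k] by measurable
  have [measurable]: "\<psi> n \<in> borel_measurable P" for n
    by (rule measurable_from_subalg[OF subalgebra_F \<psi>F])
  have "(\<integral>\<^sup>+w. \<psi> (Y k w) w \<partial>P) = (\<integral>\<^sup>+w. (\<Sum>n. \<psi> n w * indicator {w. Y k w = n} w) \<partial>P)"
  proof (intro nn_integral_cong)
    fix w
    have "(\<lambda>n. \<psi> n w * indicator {w. Y k w = n} w) sums (\<Sum>n\<in>{Y k w}. \<psi> n w * indicator {w. Y k w = n} w)"
      by (rule sums_finite) auto
    then show "\<psi> (Y k w) w = (\<Sum>n. \<psi> n w * indicator {w. Y k w = n} w)" by (simp add: sums_iff)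
  qed
  also have "\<dots> = (\<Sum>n. \<integral>\<^sup>+w. \<psi> n w * indicator {w. Y k w = n} w \<partial>P)"
    by (intro nn_integral_suminf) measurable
  also have "\<dots> = (\<Sum>n. \<integral>\<^sup>+w. \<psi> n w * ennreal (g_dens (X k w) n) \<partial>P)"
    by (simp add: conditional_law[OF \<psi>F])
  also have "\<dots> = (\<integral>\<^sup>+w. (\<Sum>n. \<psi> n w * ennreal (g_dens (X k w) n)) \<partial>P)"
    by (intro nn_integral_suminf[symmetric]) measurable
  also have "\<dots> \<le> (\<integral>\<^sup>+w. ennreal (fact t * (exp 3 + 1)) \<partial>P)"
  proof (intro nn_integral_mono)
    fix w
    have "\<psi> n w * ennreal (g_dens (X k w) n) =
        ennreal (g_dens (X k w) n * exp (real t * \<bar>log_noise (X k w) n\<bar>))" for n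
      by (simp add: \<psi>_def ennreal_mult mult.commute)
    then show "(\<Sum>n. \<psi> n w * ennreal (g_dens (X k w) n)) \<le> ennreal (fact t * (exp 3 + 1))"
      using log_noise_moment[of "X k w" t] by simp
  qed
  also have "\<dots> = ennreal (fact t * (exp 3 + 1))"
    using emeasure_space_1 by simp
  finally show ?thesis by (simp add: \<psi>_def)
qed

lemma noise_moment:
  obtains K where "0 \<le> K"
    "\<And>k. (\<integral>\<^sup>+w. ennreal (exp (\<tau> * \<bar>log_noise (X k w) (Y k w)\<bar>)) \<partial>P) \<le> ennreal K"
proof
  define t where "t = nat \<lceil>\<tau>\<rceil>"
  have "\<tau> \<le> real t" by (simp add: t_def real_nat_ceiling_ge)
  fix k
  have "(\<integral>\<^sup>+w. ennreal (exp (\<tau> * \<bar>log_noise (X k w) (Y k w)\<bar>)) \<partial>P) \<le>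
      (\<integral>\<^sup>+w. ennreal (exp (real t * \<bar>log_noise (X k w) (Y k w)\<bar>)) \<partial>P)"
    using \<open>\<tau> \<le> real t\<close> by (intro nn_integral_mono ennreal_leI) (auto intro: mult_right_mono)
  also have "\<dots> \<le> ennreal (fact t * (exp 3 + 1))" by (rule noise_moment_nat)
  finally show "(\<integral>\<^sup>+w. ennreal (exp (\<tau> * \<bar>log_noise (X k w) (Y k w)\<bar>)) \<partial>P) \<le>
    ennreal (fact (nat \<lceil>\<tau>\<rceil>) * (exp 3 + 1))" by (simp add: t_def)
  show "0 \<le> (fact (nat \<lceil>\<tau>\<rceil>) * (exp 3 + 1) :: real)" by simp
qed

text \<open>Up to the factor \<open>B\<close>, the forcing of \<open>filter_bound\<close> at time
  -j: with the start at -N it is the term of index N - j.\<close>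

definition noise_block :: "nat \<Rightarrow> path \<Rightarrow> real" where
  "noise_block j w = 1 + (\<Sum>i=1..q. \<bar>log_noise (X (- int j - int i) w) (Y (- int j - int i) w)\<bar>)"

lemma noise_block_nonneg: "0 \<le> noise_block j w"
  unfolding noise_block_def by (intro add_nonneg_nonneg sum_nonneg) auto

lemma measurable_log_noise [measurable]:
  "(\<lambda>w. log_noise (X k w) (Y k w)) \<in> borel_measurable path_space"
  unfolding log_noise_def by measurable

lemma measurable_noise_block [measurable]: "noise_block j \<in> borel_measurable path_space"
  unfolding noise_block_def by measurable

lemma noise_block_moment:
  assumes "0 < \<tau>"
  obtains K where "0 \<le> K" "\<And>j. (\<integral>\<^sup>+w. ennreal (exp (\<tau> * noise_block j w)) \<partial>P) \<le> ennreal K"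
proof -
  obtain K where K: "0 \<le> K"
    "\<And>k. (\<integral>\<^sup>+w. ennreal (exp ((real q * \<tau>) * \<bar>log_noise (X k w) (Y k w)\<bar>)) \<partial>P) \<le> ennreal K"
    using noise_moment[of "real q * \<tau>"] by blast
  show ?thesis
  proof (rule that[of "exp \<tau> * (real q * K)"])
    fix j
    define v where "v i w = \<bar>log_noise (X (- int j - int i) w) (Y (- int j - int i) w)\<bar>" for i w
    have [measurable]: "v i \<in> borel_measurable path_space" for i unfolding v_def by measurable
    have "(\<integral>\<^sup>+w. ennreal (exp (\<tau> * noise_block j w)) \<partial>P) \<le>
        (\<integral>\<^sup>+w. ennreal (exp \<tau>) * (\<Sum>i=1..q. ennreal (exp ((real q * \<tau>) * v i w))) \<partial>P)"
    proof (intro nn_integral_mono)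
      fix w
      have "exp (\<Sum>i=1..q. \<tau> * v i w) \<le> (\<Sum>i=1..q. exp (real (card {1..q}) * (\<tau> * v i w)))"
        using q assms by (intro exp_sum_le) (auto simp: v_def)
      then have le: "exp (\<tau> * noise_block j w) \<le> exp \<tau> * (\<Sum>i=1..q. exp ((real q * \<tau>) * v i w))"
        using mult_left_mono[of _ _ "exp \<tau>"]
        by (simp add: noise_block_def v_def[symmetric] distrib_left exp_add sum_distrib_left[symmetric] mult.assoc)
      have "ennreal (exp \<tau>) * (\<Sum>i=1..q. ennreal (exp ((real q * \<tau>) * v i w))) =
          ennreal (exp \<tau> * (\<Sum>i=1..q. exp ((real q * \<tau>) * v i w)))"
        by (subst sum_ennreal) (auto simp only: exp_ge_zero ennreal_mult sum_nonneg)
      then show "ennreal (exp (\<tau> * noise_block j w)) \<le> ennreal (exp \<tau>) * (\<Sum>i=1..q. ennreal (exp ((real q * \<tau>) * v i w)))"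
        using ennreal_leI[OF le] by (simp only:)
    qed
    also have "\<dots> = ennreal (exp \<tau>) * (\<Sum>i=1..q. \<integral>\<^sup>+w. ennreal (exp ((real q * \<tau>) * v i w)) \<partial>P)"
      by (subst nn_integral_cmult) (auto simp: nn_integral_sum simp del: sum_ennreal)
    also have "\<dots> \<le> ennreal (exp \<tau>) * (\<Sum>i=1..q. ennreal K)"
      unfolding v_def by (intro mult_left_mono sum_mono K) auto
    also have "\<dots> = ennreal (exp \<tau> * (real q * K))"
      using K(1) by (simp add: ennreal_mult ennreal_of_nat_eq_real_of_nat)
    finally show "(\<integral>\<^sup>+w. ennreal (exp (\<tau> * noise_block j w)) \<partial>P) \<le> ennreal (exp \<tau> * (real q * K))" .
  qed (use K in simp)
qed

definition envelope :: "path \<Rightarrow> real" where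
  "envelope w = (\<Sum>j. \<rho> ^ j * noise_block j w)"

lemma measurable_envelope [measurable]: "envelope \<in> borel_measurable path_space"
  unfolding envelope_def by measurable

lemma envelope_summable: "AE w in P. summable (\<lambda>j. \<rho> ^ j * noise_block j w)"
proof -
  have "0 < 1 / (1 - \<rho>)" using \<rho> by simp
  then obtain K where K: "\<And>j. (\<integral>\<^sup>+w. ennreal (exp (1 / (1 - \<rho>) * noise_block j w)) \<partial>P) \<le> ennreal K"
    using noise_block_moment[of "1 / (1 - \<rho>)"] by blast
  show ?thesis
    by (rule exp_moment_weighted_sum(1)[OF _ noise_block_nonneg \<rho> _ K]) auto
qed

lemma envelope_moment:
  assumes "0 < \<tau>"
  obtains K where "(\<integral>\<^sup>+w. ennreal (exp (\<tau> * envelope w)) \<partial>P) \<le> ennreal K"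
proof -
  have "0 < \<tau> / (1 - \<rho>)" using \<rho> assms by simp
  then obtain K where K: "\<And>j. (\<integral>\<^sup>+w. ennreal (exp (\<tau> / (1 - \<rho>) * noise_block j w)) \<partial>P) \<le> ennreal K"
    using noise_block_moment[of "\<tau> / (1 - \<rho>)"] by blast
  have "(\<integral>\<^sup>+w. ennreal (exp (\<tau> * envelope w)) \<partial>P) \<le> ennreal K"
    unfolding envelope_def
    by (rule exp_moment_weighted_sum(2)[OF _ noise_block_nonneg \<rho> assms K]) auto
  then show ?thesis by (rule that)
qed

text \<open>Continuity from above. Together with stationarity it makes the values at time -N, damped
  by \<rho>^N, negligible in probability.\<close>

lemma tail_X_tendsto_0:
  assumes "0 < a" "0 < K"
  shows "(\<lambda>N. prob {w. a < K * \<rho> ^ N * \<bar>X 0 w\<bar>}) \<longlonglongrightarrow> 0"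
proof -
  define A where "A N = {w. a < K * \<rho> ^ N * \<bar>X 0 w\<bar>}" for N
  have [measurable]: "A N \<in> sets path_space" for N
  proof -
    have "{w \<in> space path_space. a < K * \<rho> ^ N * \<bar>X 0 w\<bar>} \<in> sets path_space" by measurable
    then show ?thesis by (simp add: A_def)
  qed
  have "(\<lambda>N. prob (A N)) \<longlonglongrightarrow> prob (\<Inter>N. A N)"
  proof (rule finite_Lim_measure_decseq)
    show "decseq A"
    proof (rule decseq_SucI)
      fix N
      have "K * \<rho> ^ Suc N * \<bar>X 0 w\<bar> \<le> K * \<rho> ^ N * \<bar>X 0 w\<bar>" for w
        using \<rho> assms by (intro mult_right_mono mult_left_mono) (auto simp: mult_le_cancel_right1)
      then show "A (Suc N) \<subseteq> A N" unfolding A_def by (auto intro: less_le_trans)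
    qed
  qed auto
  moreover have "(\<Inter>N. A N) = {}"
  proof -
    have "\<exists>N. w \<notin> A N" for w
    proof -
      have "(\<lambda>N. K * \<rho> ^ N * \<bar>X 0 w\<bar>) \<longlonglongrightarrow> K * 0 * \<bar>X 0 w\<bar>"
        using \<rho> by (intro tendsto_intros LIMSEQ_power_zero) auto
      then have "eventually (\<lambda>N. K * \<rho> ^ N * \<bar>X 0 w\<bar> < a) sequentially"
        using assms by (intro order_tendstoD) auto
      then obtain N where "K * \<rho> ^ N * \<bar>X 0 w\<bar> < a" by (auto simp: eventually_sequentially)
      then show ?thesis by (intro exI[of _ N]) (simp add: A_def)
    qed
    then show ?thesis by blast
  qed
  ultimately show ?thesis by (simp add: A_def)
qed

lemma prob_X: "A \<in> sets borel \<Longrightarrow> prob {w. X k w \<in> A} = prob {w. X 0 w \<in> A}"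
proof -
  assume [measurable]: "A \<in> sets borel"
  have "emeasure P {w. X k w \<in> A} = emeasure P {w. X 0 w \<in> A}"
  proof -
    have "{w \<in> space path_space. X k w \<in> A} \<in> sets path_space" for k by measurable
    then have [measurable]: "{w. X k w \<in> A} \<in> sets path_space" for k by simp
    have "emeasure P {w. X k w \<in> A} = (\<integral>\<^sup>+w. indicator A (X k w) \<partial>P)" for k
    proof -
      have "(\<integral>\<^sup>+w. indicator A (X k w) \<partial>P) = (\<integral>\<^sup>+w. indicator {w. X k w \<in> A} w \<partial>P)"
        by (intro nn_integral_cong) (simp add: indicator_def)
      also have "\<dots> = emeasure P {w. X k w \<in> A}" by (rule nn_integral_indicator) simp
      finally show ?thesis by simp
    qed
    then show ?thesis using nn_integral_X[of "indicator A" k] by simp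
  qed
  then show ?thesis by (simp add: measure_def)
qed

text \<open>The recursion is started at -N. No moment of \<open>X\<close> is available yet, so the r
  starting values are controlled in probability only: their law does not depend on N, while their
  factor tends to 0. So the bound fails by more than \<delta> with probability below every positive
  number, and then \<delta> runs through 1/(i + 1).\<close>

lemma X_le_envelope: "AE w in P. \<bar>X 0 w\<bar> \<le> C * B * envelope w"
proof -
  have "AE w in P. \<bar>X 0 w\<bar> \<le> C * B * envelope w + \<delta>" if \<delta>: "0 < \<delta>" for \<delta>
  proof -
    define r where "r = max p q"
    have r: "1 \<le> r" using p by (simp add: r_def)
    define K where "K = real r * C * (1 + B)"
    have K: "0 < K" using r C B by (simp add: K_def add_pos_pos)
    define Bad where "Bad = {w. C * B * envelope w + \<delta> < \<bar>X 0 w\<bar>}"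
    have "{w \<in> space path_space. C * B * envelope w + \<delta> < \<bar>X 0 w\<bar>} \<in> sets path_space" by measurable
    then have [measurable]: "Bad \<in> sets path_space" by (simp add: Bad_def)
    have "prob Bad \<le> real r * prob {w. \<delta> / real r < K * \<rho> ^ N * \<bar>X 0 w\<bar>}" for N
    proof -
      define A where "A i = {w. \<delta> / real r < K * \<rho> ^ N * \<bar>X (- int N - int i) w\<bar>}" for i
      have "{w \<in> space path_space. \<delta> / real r < K * \<rho> ^ N * \<bar>X (- int N - int i) w\<bar>} \<in> sets path_space" for i
        by measurable
      then have [measurable]: "A i \<in> sets path_space" for i by (simp add: A_def)
      have "AE w in P. w \<in> Bad \<longrightarrow> w \<in> (\<Union>i<r. A i)"
        using AE_recursion envelope_summable
      proof eventually_elim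
        case (elim w)
        show ?case
        proof (rule impI, rule ccontr)
          assume bad: "w \<in> Bad" and nA: "w \<notin> (\<Union>i<r. A i)"
          have "\<bar>X (- int N + int N) w\<bar> \<le> C * (\<Sum>l=1..N. \<rho> ^ (N - l) *
            (B * (1 + (\<Sum>i=1..q. \<bar>log_noise (X (- int N + int l - int i) w) (obs w (- int N + int l - int i))\<bar>))))
            + real (max p q) * C * (1 + B) * \<rho> ^ N * (\<Sum>i<max p q. \<bar>X (- int N - int i) w\<bar>)"
            by (rule filter_bound) (use elim(1) in blast)
          also have "(\<Sum>l=1..N. \<rho> ^ (N - l) *
            (B * (1 + (\<Sum>i=1..q. \<bar>log_noise (X (- int N + int l - int i) w) (obs w (- int N + int l - int i))\<bar>)))) =
            (\<Sum>j<N. \<rho> ^ j * (B * noise_block j w))"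
            \<comment> \<open>Time is read backwards from 0, which turns the weights into the
              initial segment of the series \<open>envelope\<close>.\<close>
            by (rule sum.reindex_bij_witness[of _ "\<lambda>j. N - j" "\<lambda>l. N - l"])
               (auto simp: noise_block_def obs_def of_nat_diff)
          also have "\<dots> = B * (\<Sum>j<N. \<rho> ^ j * noise_block j w)" by (simp add: sum_distrib_left mult_ac)
          also have "(\<Sum>j<N. \<rho> ^ j * noise_block j w) \<le> envelope w"
            unfolding envelope_def using elim(2) \<rho> noise_block_nonneg
            by (intro sum_le_suminf) auto
          also have "real (max p q) * C * (1 + B) * \<rho> ^ N * (\<Sum>i<max p q. \<bar>X (- int N - int i) w\<bar>) \<le> \<delta>"
          proof -
            have "K * \<rho> ^ N * (\<Sum>i<r. \<bar>X (- int N - int i) w\<bar>) = (\<Sum>i<r. K * \<rho> ^ N * \<bar>X (- int N - int i) w\<bar>)"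
              by (simp add: sum_distrib_left)
            also have "\<dots> \<le> (\<Sum>i<r. \<delta> / real r)"
              using nA by (intro sum_mono) (auto simp: A_def not_less)
            also have "\<dots> = \<delta>" using r by simp
            finally show ?thesis by (simp add: K_def r_def)
          qed
          finally show False using bad C B by (simp add: Bad_def mult_left_mono mult.assoc)
        qed
      qed
      then have "prob Bad \<le> prob (\<Union>i<r. A i)"
        by (intro finite_measure_mono_AE) auto
      also have "\<dots> \<le> (\<Sum>i<r. prob (A i))" by (intro finite_measure_subadditive_finite) auto
      also have "\<dots> = (\<Sum>i<r. prob {w. \<delta> / real r < K * \<rho> ^ N * \<bar>X 0 w\<bar>})"
      proof (rule sum.cong[OF refl])
        fix i
        have "{x. \<delta> / real r < K * \<rho> ^ N * \<bar>x\<bar>} \<in> sets borel" by measurable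
        from prob_X[OF this, of "- int N - int i"]
        show "prob (A i) = prob {w. \<delta> / real r < K * \<rho> ^ N * \<bar>X 0 w\<bar>}" by (simp add: A_def)
      qed
      finally show ?thesis by simp
    qed
    moreover have "(\<lambda>N. real r * prob {w. \<delta> / real r < K * \<rho> ^ N * \<bar>X 0 w\<bar>}) \<longlonglongrightarrow> real r * 0"
      using \<delta> r K by (intro tendsto_intros tail_X_tendsto_0) auto
    ultimately have "prob Bad \<le> real r * 0" by (intro LIMSEQ_le_const) auto
    then have "prob Bad = 0" by (simp add: measure_le_0_iff)
    then have "AE w in P. w \<notin> Bad" by (simp add: prob_eq_0)
    then show ?thesis by eventually_elim (simp add: Bad_def not_less)
  qed
  then have "AE w in P. \<forall>i. \<bar>X 0 w\<bar> \<le> C * B * envelope w + 1 / real (Suc i)"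
    unfolding AE_all_countable by simp
  then show ?thesis
  proof eventually_elim
    case (elim w)
    show ?case
    proof (rule field_le_epsilon)
      fix e :: real assume "0 < e"
      then obtain i where "1 / real (Suc i) < e" using nat_approx_posE by blast
      then show "\<bar>X 0 w\<bar> \<le> C * B * envelope w + e" using elim[rule_format, of i] by linarith
    qed
  qed
qed

lemma X_moment:
  assumes "0 < \<tau>"
  shows "(\<integral>\<^sup>+w. ennreal (exp (\<tau> * \<bar>X k w\<bar>)) \<partial>P) < \<infinity>"
proof -
  have "0 < \<tau> * (C * B)" using assms C B by simp
  then obtain K where K: "(\<integral>\<^sup>+w. ennreal (exp (\<tau> * (C * B) * envelope w)) \<partial>P) \<le> ennreal K"
    using envelope_moment by blast
  have "(\<integral>\<^sup>+w. ennreal (exp (\<tau> * \<bar>X k w\<bar>)) \<partial>P) = (\<integral>\<^sup>+w. ennreal (exp (\<tau> * \<bar>X 0 w\<bar>)) \<partial>P)"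
    by (rule nn_integral_X[where f = "\<lambda>x. ennreal (exp (\<tau> * \<bar>x\<bar>))"]) measurable
  also have "\<dots> \<le> (\<integral>\<^sup>+w. ennreal (exp (\<tau> * (C * B) * envelope w)) \<partial>P)"
  proof (rule nn_integral_mono_AE)
    show "AE w in P. ennreal (exp (\<tau> * \<bar>X 0 w\<bar>)) \<le> ennreal (exp (\<tau> * (C * B) * envelope w))"
      using X_le_envelope
    proof eventually_elim
      case (elim w)
      show ?case using mult_left_mono[OF elim, of \<tau>] assms by (intro ennreal_leI) (simp add: mult_ac)
    qed
  qed
  also have "\<dots> < \<infinity>" using K by (simp add: le_less_trans)
  finally show ?thesis .
qed

lemma lnobs_moment:
  assumes "0 < \<tau>"
  shows "(\<integral>\<^sup>+w. ennreal (exp (\<tau> * lnobs (obs w) k)) \<partial>P) < \<infinity>"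
proof -
  obtain K where K: "\<And>k. (\<integral>\<^sup>+w. ennreal (exp ((2 * \<tau>) * \<bar>log_noise (X k w) (Y k w)\<bar>)) \<partial>P) \<le> ennreal K"
    using noise_moment[of "2 * \<tau>"] by blast
  have "(\<integral>\<^sup>+w. ennreal (exp (\<tau> * lnobs (obs w) k)) \<partial>P) \<le>
      (\<integral>\<^sup>+w. ennreal (exp ((2 * \<tau>) * \<bar>X k w\<bar>)) + ennreal (exp ((2 * \<tau>) * \<bar>log_noise (X k w) (Y k w)\<bar>)) \<partial>P)"
  proof (rule nn_integral_mono)
    fix w
    define a b where "a = \<bar>X k w\<bar>" and "b = \<bar>log_noise (X k w) (Y k w)\<bar>"
    have "lnobs (obs w) k = max (X k w) 0 + log_noise (X k w) (Y k w)"
      by (simp add: lnobs_def obs_def log_noise_def)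
    also have "\<dots> \<le> a + b" unfolding a_def b_def by (intro add_mono) auto
    also have "\<dots> \<le> 2 * max a b" by (simp add: max_def)
    finally have "lnobs (obs w) k \<le> 2 * max a b" .
    then have "\<tau> * lnobs (obs w) k \<le> \<tau> * (2 * max a b)" using assms by (intro mult_left_mono) auto
    then have "exp (\<tau> * lnobs (obs w) k) \<le> exp ((2 * \<tau>) * max a b)" by simp
    also have "\<dots> \<le> exp ((2 * \<tau>) * a) + exp ((2 * \<tau>) * b)" by (auto simp: max_def)
    finally show "ennreal (exp (\<tau> * lnobs (obs w) k)) \<le> ennreal (exp ((2 * \<tau>) * a)) + ennreal (exp ((2 * \<tau>) * b))"
      by (simp add: ennreal_plus[symmetric] ennreal_leI del: ennreal_plus)
  qed
  also have "\<dots> = (\<integral>\<^sup>+w. ennreal (exp ((2 * \<tau>) * \<bar>X k w\<bar>)) \<partial>P) +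
      (\<integral>\<^sup>+w. ennreal (exp ((2 * \<tau>) * \<bar>log_noise (X k w) (Y k w)\<bar>)) \<partial>P)"
    by (rule nn_integral_add) measurable
  also have "\<dots> < \<infinity>" using X_moment[of "2 * \<tau>" k] K[of k] assms
    by (simp add: le_less_trans)
  finally show ?thesis .
qed

lemma integrable_X: "integrable P (X k)"
proof -
  have "(\<integral>\<^sup>+w. ennreal (norm (X k w)) \<partial>P) \<le> (\<integral>\<^sup>+w. ennreal (exp (1 * \<bar>X k w\<bar>)) \<partial>P)"
  proof (intro nn_integral_mono ennreal_leI)
    show "norm (X k w) \<le> exp (1 * \<bar>X k w\<bar>)" for w
      using exp_ge_add_one_self[of "\<bar>X k w\<bar>"] unfolding real_norm_def mult_1 by linarith
  qed
  also have "\<dots> < \<infinity>" by (rule X_moment) simp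
  finally show ?thesis by (intro integrableI_bounded) auto
qed

lemma integrable_lnobs_obs: "integrable P (\<lambda>w. lnobs (obs w) k)"
proof -
  have "(\<integral>\<^sup>+w. ennreal (norm (lnobs (obs w) k)) \<partial>P) \<le> (\<integral>\<^sup>+w. ennreal (exp (1 * lnobs (obs w) k)) \<partial>P)"
  proof (intro nn_integral_mono ennreal_leI)
    show "norm (lnobs (obs w) k) \<le> exp (1 * lnobs (obs w) k)" for w
      using exp_ge_add_one_self[of "lnobs (obs w) k"]
      unfolding real_norm_def mult_1 abs_of_nonneg[OF lnobs_nonneg] by linarith
  qed
  also have "\<dots> < \<infinity>" by (rule lnobs_moment) simp
  finally show ?thesis by (intro integrableI_bounded) auto
qed

end

section \<open>Identification of the intensity with the filter\<close>

context stationary_model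
begin

lemma nn_integral_path_shift:
  assumes [measurable]: "f \<in> borel_measurable path_space"
  shows "(\<integral>\<^sup>+w. f (shift 1 w) \<partial>P) = (\<integral>\<^sup>+w. f w \<partial>P)"
proof -
  have "(\<integral>\<^sup>+w. f w \<partial>P) = (\<integral>\<^sup>+w. f w \<partial>distr P path_space (shift 1))" by (simp only: distr_P_shift)
  also have "\<dots> = (\<integral>\<^sup>+w. f (shift 1 w) \<partial>P)"
    by (rule nn_integral_distr) (use measurable_path_shift in \<open>simp_all cong: measurable_cong_sets\<close>)
  finally show ?thesis by simp
qed

lemma nn_integral_lnobs_obs: "(\<integral>\<^sup>+w. ennreal (lnobs (obs w) k) \<partial>P) = ennreal (expectation (\<lambda>w. lnobs (obs w) 0))"
proof -
  have step: "(\<integral>\<^sup>+w. ennreal (lnobs (obs w) (k + 1)) \<partial>P) = (\<integral>\<^sup>+w. ennreal (lnobs (obs w) k) \<partial>P)" for k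
    using nn_integral_path_shift[of "\<lambda>w. ennreal (lnobs (obs w) k)"] by (simp add: lnobs_def obs_def shift_def)
  have "(\<integral>\<^sup>+w. ennreal (lnobs (obs w) k) \<partial>P) = (\<integral>\<^sup>+w. ennreal (lnobs (obs w) 0) \<partial>P)"
  proof (induction k rule: int_induct[where k = 0])
    case (step1 i) then show ?case using step[of i] by simp
  next
    case (step2 i) then show ?case using step[of "i - 1"] by simp
  qed simp
  then show ?thesis by (simp add: nn_integral_eq_integral integrable_lnobs_obs)
qed

lemma AE_tempered_obs: "AE w in P. tempered \<rho> (obs w)"
  and filt_moment: "\<exists>K. \<forall>k. (\<integral>\<^sup>+w. ennreal \<bar>filt p \<theta> k (obs w)\<bar> \<partial>P) \<le> ennreal K"
proof -
  define K where "K = expectation (\<lambda>w. lnobs (obs w) 0)"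
  have K: "0 \<le> K" unfolding K_def by (rule integral_nonneg_AE) simp
  have ws: "AE w in P. summable (\<lambda>j. \<rho> ^ j * lnobs (obs w) (k - int j))"
    "(\<integral>\<^sup>+w. ennreal (\<Sum>j. \<rho> ^ j * lnobs (obs w) (k - int j)) \<partial>P) \<le> ennreal (K / (1 - \<rho>))" for k
  proof -
    note * = weighted_sum[where V = "\<lambda>j w. lnobs (obs w) (k - int j)" and K = K, OF _ _ _ \<rho> K]
    show "AE w in P. summable (\<lambda>j. \<rho> ^ j * lnobs (obs w) (k - int j))"
      by (rule *(1)) (simp_all add: nn_integral_lnobs_obs K_def)
    show "(\<integral>\<^sup>+w. ennreal (\<Sum>j. \<rho> ^ j * lnobs (obs w) (k - int j)) \<partial>P) \<le> ennreal (K / (1 - \<rho>))"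
      by (rule *(2)) (simp_all add: nn_integral_lnobs_obs K_def)
  qed
  show tm: "AE w in P. tempered \<rho> (obs w)"
    unfolding tempered_def AE_all_countable using ws(1) by blast
  have "(\<integral>\<^sup>+w. ennreal \<bar>filt p \<theta> k (obs w)\<bar> \<partial>P) \<le> ennreal (\<bar>cst p \<theta>\<bar> + C * (K / (1 - \<rho>)))" for k
  proof -
    have "(\<integral>\<^sup>+w. ennreal \<bar>filt p \<theta> k (obs w)\<bar> \<partial>P) \<le>
      (\<integral>\<^sup>+w. ennreal \<bar>cst p \<theta>\<bar> + ennreal C * ennreal (\<Sum>j. \<rho> ^ j * lnobs (obs w) (k - 1 - int j)) \<partial>P)"
    proof (rule nn_integral_mono_AE)
      show "AE w in P. ennreal \<bar>filt p \<theta> k (obs w)\<bar> \<le>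
        ennreal \<bar>cst p \<theta>\<bar> + ennreal C * ennreal (\<Sum>j. \<rho> ^ j * lnobs (obs w) (k - 1 - int j))"
        using tm
      proof eventually_elim
        case (elim w)
        have s: "summable (\<lambda>j. \<rho> ^ j * lnobs (obs w) (k - 1 - int j))" using elim by (simp add: tempered_def)
        have s2: "summable (\<lambda>j. C * (\<rho> ^ j * lnobs (obs w) (k - 1 - int j)))" using s by (rule summable_mult)
        have "\<bar>\<Sum>j. hcoef \<theta> j * lnobs (obs w) (k - 1 - int j)\<bar> \<le> (\<Sum>j. C * (\<rho> ^ j * lnobs (obs w) (k - 1 - int j)))"
          unfolding real_norm_def[symmetric]
        proof (rule norm_suminf_le[OF _ s2])
          show "norm (hcoef \<theta> j * lnobs (obs w) (k - 1 - int j)) \<le> C * (\<rho> ^ j * lnobs (obs w) (k - 1 - int j))" for j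
            using mult_right_mono[OF hcoef_decay[of j], of "lnobs (obs w) (k - 1 - int j)"]
            by (simp add: abs_mult mult.assoc)
        qed
        also have "\<dots> = C * (\<Sum>j. \<rho> ^ j * lnobs (obs w) (k - 1 - int j))" by (rule suminf_mult[OF s])
        finally have "\<bar>filt p \<theta> k (obs w)\<bar> \<le> \<bar>cst p \<theta>\<bar> + C * (\<Sum>j. \<rho> ^ j * lnobs (obs w) (k - 1 - int j))"
          unfolding filt_def by linarith
        moreover have "0 \<le> (\<Sum>j. \<rho> ^ j * lnobs (obs w) (k - 1 - int j))"
          using s \<rho>(1) by (intro suminf_nonneg) auto
        ultimately show ?case using C
          by (simp add: ennreal_mult[symmetric] ennreal_plus[symmetric] ennreal_leI del: ennreal_plus)
      qed
    qed
    also have "\<dots> = ennreal \<bar>cst p \<theta>\<bar> + ennreal C * (\<integral>\<^sup>+w. ennreal (\<Sum>j. \<rho> ^ j * lnobs (obs w) (k - 1 - int j)) \<partial>P)"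
      using emeasure_space_1 by (subst nn_integral_add) (auto simp: nn_integral_cmult)
    also have "\<dots> \<le> ennreal \<bar>cst p \<theta>\<bar> + ennreal C * ennreal (K / (1 - \<rho>))"
      by (intro add_left_mono mult_left_mono ws) auto
    also have "\<dots> = ennreal (\<bar>cst p \<theta>\<bar> + C * (K / (1 - \<rho>)))"
      using C K \<rho> by (simp add: ennreal_mult[symmetric] ennreal_plus[symmetric] del: ennreal_plus)
    finally show ?thesis .
  qed
  then show "\<exists>K. \<forall>k. (\<integral>\<^sup>+w. ennreal \<bar>filt p \<theta> k (obs w)\<bar> \<partial>P) \<le> ennreal K" by blast
qed

text \<open>Both processes solve the same recursion driven by the same observations, so their
  difference is a homogeneous solution. Its mean absolute value is bounded uniformly in time;
  restarted from k - N it is contracted by \<rho>^N, so the mean is 0.\<close>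

lemma X_eq_filt: "AE w in P. \<forall>k. X k w = filt p \<theta> k (obs w)"
  unfolding AE_all_countable
proof
  fix k
  define d where "d l w = X l w - filt p \<theta> l (obs w)" for l w
  have [measurable]: "d l \<in> borel_measurable path_space" for l unfolding d_def by measurable
  obtain K1 where K1: "\<And>k. (\<integral>\<^sup>+w. ennreal \<bar>filt p \<theta> k (obs w)\<bar> \<partial>P) \<le> ennreal K1" using filt_moment by blast
  have K2: "(\<integral>\<^sup>+w. ennreal \<bar>X k w\<bar> \<partial>P) = ennreal (expectation (\<lambda>w. \<bar>X 0 w\<bar>))" for k
    using nn_integral_X[of "\<lambda>x. ennreal \<bar>x\<bar>" k] integrable_X[of 0] by (simp add: nn_integral_eq_integral)
  define K where "K = expectation (\<lambda>w. \<bar>X 0 w\<bar>) + \<bar>K1\<bar>"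
  have K0: "0 \<le> K" unfolding K_def by (intro add_nonneg_nonneg integral_nonneg_AE) auto
  have dK: "(\<integral>\<^sup>+w. ennreal \<bar>d l w\<bar> \<partial>P) \<le> ennreal K" for l
  proof -
    have "(\<integral>\<^sup>+w. ennreal \<bar>d l w\<bar> \<partial>P) \<le> (\<integral>\<^sup>+w. ennreal \<bar>X l w\<bar> + ennreal \<bar>filt p \<theta> l (obs w)\<bar> \<partial>P)"
      by (intro nn_integral_mono) (simp add: d_def ennreal_plus[symmetric] ennreal_leI del: ennreal_plus)
    also have "\<dots> = (\<integral>\<^sup>+w. ennreal \<bar>X l w\<bar> \<partial>P) + (\<integral>\<^sup>+w. ennreal \<bar>filt p \<theta> l (obs w)\<bar> \<partial>P)"
      by (rule nn_integral_add) measurable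
    also have "\<dots> \<le> ennreal (expectation (\<lambda>w. \<bar>X 0 w\<bar>)) + ennreal \<bar>K1\<bar>"
      unfolding K2 by (intro add_left_mono order_trans[OF K1] ennreal_leI) simp
    also have "\<dots> = ennreal K"
      unfolding K_def by (intro ennreal_plus[symmetric] integral_nonneg_AE) auto
    finally show ?thesis .
  qed
  define r where "r = max p q"
  define A where "A = real r * C * (1 + B)"
  have A: "0 \<le> A" using C B by (simp add: A_def)
  have bd: "(\<integral>\<^sup>+w. ennreal \<bar>d k w\<bar> \<partial>P) \<le> ennreal (A * real r * K * \<rho> ^ N)" for N
  proof -
    have "(\<integral>\<^sup>+w. ennreal \<bar>d k w\<bar> \<partial>P) \<le> (\<integral>\<^sup>+w. ennreal (A * \<rho> ^ N) * (\<Sum>i<r. ennreal \<bar>d (k - int N - int i) w\<bar>) \<partial>P)"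
    proof (rule nn_integral_mono_AE)
      show "AE w in P. ennreal \<bar>d k w\<bar> \<le> ennreal (A * \<rho> ^ N) * (\<Sum>i<r. ennreal \<bar>d (k - int N - int i) w\<bar>)"
        using AE_recursion AE_tempered_obs
      proof eventually_elim
        case (elim w)
        have "\<bar>d (k - int N + int N) w\<bar> \<le> C * (\<Sum>l=1..N. \<rho> ^ (N - l) * \<bar>0\<bar>)
           + real (max p q) * C * (1 + B) * \<rho> ^ N * (\<Sum>i<max p q. \<bar>d (k - int N - int i) w\<bar>)"
        proof (rule homogeneous_bound[where e = "\<lambda>_. 0"])
          fix l
          show "d l w = (\<Sum>i=1..p. ca \<theta> i * d (l - int i) w) + 0"
            unfolding d_def using elim(1)[rule_format, of l] filt_recursion[OF elim(2), of l]
            by (simp add: right_diff_distrib sum_subtractf)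
        qed
        then have "\<bar>d k w\<bar> \<le> A * \<rho> ^ N * (\<Sum>i<r. \<bar>d (k - int N - int i) w\<bar>)"
          by (simp add: A_def r_def)
        then have "ennreal \<bar>d k w\<bar> \<le> ennreal (A * \<rho> ^ N * (\<Sum>i<r. \<bar>d (k - int N - int i) w\<bar>))"
          by (rule ennreal_leI)
        also have "\<dots> = ennreal (A * \<rho> ^ N) * ennreal (\<Sum>i<r. \<bar>d (k - int N - int i) w\<bar>)"
          using A \<rho> by (intro ennreal_mult sum_nonneg) auto
        finally show ?case by (simp add: sum_ennreal)
      qed
    qed
    also have "\<dots> = ennreal (A * \<rho> ^ N) * (\<Sum>i<r. \<integral>\<^sup>+w. ennreal \<bar>d (k - int N - int i) w\<bar> \<partial>P)"
      by (subst nn_integral_cmult) (auto simp: nn_integral_sum simp del: sum_ennreal)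
    also have "\<dots> \<le> ennreal (A * \<rho> ^ N) * (\<Sum>i<r. ennreal K)"
      by (intro mult_left_mono sum_mono dK) auto
    also have "\<dots> = ennreal (A * real r * K * \<rho> ^ N)"
      using A \<rho> K0 by (simp add: ennreal_mult[symmetric] ennreal_of_nat_eq_real_of_nat mult_ac)
    finally show ?thesis .
  qed
  have "(\<lambda>N. ennreal (A * real r * K * \<rho> ^ N)) \<longlonglongrightarrow> ennreal (A * real r * K * 0)"
    using \<rho> by (intro tendsto_ennrealI tendsto_intros LIMSEQ_power_zero) auto
  then have "(\<integral>\<^sup>+w. ennreal \<bar>d k w\<bar> \<partial>P) \<le> ennreal (A * real r * K * 0)"
    by (rule LIMSEQ_le_const) (use bd in auto)
  then have "(\<integral>\<^sup>+w. ennreal \<bar>d k w\<bar> \<partial>P) = 0" by simp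
  then have "AE w in P. ennreal \<bar>d k w\<bar> = 0" by (subst (asm) nn_integral_0_iff_AE) auto
  then show "AE w in P. X k w = filt p \<theta> k (obs w)"
    by eventually_elim (simp add: d_def)
qed

text \<open>A stationary law is thus determined by its marginal on the observations, which reduces
  uniqueness to laws of \<open>Y\<close>.\<close>

lemma P_eq_lift: "P = distr (distr P obs_space obs) path_space (lift p \<theta>)"
proof -
  have "distr (distr P obs_space obs) path_space (lift p \<theta>) = distr P path_space (lift p \<theta> \<circ> obs)"
    by (rule distr_distr) measurable
  also have "\<dots> = distr P path_space (\<lambda>w. w)"
  proof (rule distr_cong_AE)
    show "AE w in P. (lift p \<theta> \<circ> obs) w = w"
      using X_eq_filt by eventually_elim (auto simp: lift_def obs_def fun_eq_iff prod_eq_iff)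
  qed auto
  also have "\<dots> = P"
    using distr_cong[of P P path_space P "\<lambda>w. w" "\<lambda>w. w"] by (simp add: distr_id)
  finally show ?thesis by simp
qed

lemma obs_law_obs: "obs_law p \<theta> (distr P obs_space obs)"
  unfolding obs_law_def
proof (intro conjI allI ballI)
  show "prob_space (distr P obs_space obs)" by (rule prob_space_distr) simp
  show "distr (distr P obs_space obs) obs_space (shift 1) = distr P obs_space obs"
  proof -
    have "distr (distr P obs_space obs) obs_space (shift 1) = distr P obs_space (shift 1 \<circ> obs)"
      by (rule distr_distr) measurable
    also have "shift 1 \<circ> obs = obs \<circ> shift 1" by (auto simp: fun_eq_iff obs_def shift_def)
    also have "distr P obs_space (obs \<circ> shift 1) = distr (distr P path_space (shift 1)) obs_space obs"
      using measurable_path_shift by (intro distr_distr[symmetric]) (auto cong: measurable_cong_sets)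
    finally show ?thesis by (simp only: distr_P_shift)
  qed
  show "integrable (distr P obs_space obs) (\<lambda>y. lnobs y 0)"
    by (subst integrable_distr_eq) (auto intro: integrable_lnobs_obs)
  fix n and \<phi> :: "(int \<Rightarrow> nat) \<Rightarrow> ennreal" assume [measurable]: "\<phi> \<in> borel_measurable obs_space"
  have tr: "(\<lambda>w. trunc 0 (obs w)) \<in> measurable (F 0) obs_space"
  proof (rule measurable_into_obs)
    fix j
    show "(\<lambda>w. trunc 0 (obs w) j) \<in> measurable (F 0) (count_space UNIV)"
    proof (cases "j < 0")
      case True
      then have "(\<lambda>w. trunc 0 (obs w) j) = Y j" by (simp add: trunc_def obs_def fun_eq_iff)
      then show ?thesis using measurable_Y_F[OF True] by simp
    qed (simp add: trunc_def)
  qed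
  have "(\<integral>\<^sup>+y. \<phi> (trunc 0 y) * indicator {y. y 0 = n} y \<partial>distr P obs_space obs) =
      (\<integral>\<^sup>+w. \<phi> (trunc 0 (obs w)) * indicator {w. Y 0 w = n} w \<partial>P)"
    by (subst nn_integral_distr) (auto intro!: nn_integral_cong simp: indicator_def obs_def)
  also have "\<dots> = (\<integral>\<^sup>+w. \<phi> (trunc 0 (obs w)) * ennreal (g_dens (X 0 w) n) \<partial>P)"
    by (rule conditional_law) (rule measurable_compose[OF tr], measurable)
  also have "\<dots> = (\<integral>\<^sup>+w. \<phi> (trunc 0 (obs w)) * ennreal (g_dens (filt p \<theta> 0 (obs w)) n) \<partial>P)"
    by (rule nn_integral_cong_AE) (use X_eq_filt in \<open>eventually_elim, simp\<close>)
  also have "\<dots> = (\<integral>\<^sup>+y. \<phi> (trunc 0 y) * ennreal (g_dens (filt p \<theta> 0 y) n) \<partial>distr P obs_space obs)"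
    by (subst nn_integral_distr) auto
  finally show "(\<integral>\<^sup>+y. \<phi> (trunc 0 y) * indicator {y. y 0 = n} y \<partial>distr P obs_space obs) =
    (\<integral>\<^sup>+y. \<phi> (trunc 0 y) * ennreal (g_dens (filt p \<theta> 0 y) n) \<partial>distr P obs_space obs)" .
qed simp

end

section \<open>From a law of the observations back to a stationary solution\<close>

locale obs_model = model + obs_process
begin

definition L :: "path measure" where "L = distr Q path_space (lift p \<theta>)"

lemma prob_L: "prob_space L"
  unfolding L_def by (rule prob_space_distr) simp

lemma sets_L [measurable_cong, simp]: "sets L = sets path_space"
  by (simp add: L_def)

lemma space_L [simp]: "space L = UNIV"
  by (simp add: L_def)

lemma AE_L:
  assumes [measurable]: "Measurable.pred path_space R"
  shows "(AE w in L. R w) \<longleftrightarrow> (AE y in Q. R (lift p \<theta> y))"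
proof -
  have "{w \<in> space path_space. R w} \<in> sets path_space" by measurable
  then show ?thesis unfolding L_def by (subst AE_distr_iff) auto
qed

text \<open>An event of the past cannot separate paths with the same past. It may therefore be
  evaluated on the lift of \<open>trunc k y\<close> instead of \<open>y\<close>, and this is the
  form of test function for which the law of the observations provides its conditional
  identity.\<close>

lemma past_event_cong:
  assumes A: "A \<in> sets (past L (\<lambda>k w. fst (w k)) (\<lambda>k w. snd (w k)) k)"
    and "\<And>j. j \<le> k \<Longrightarrow> fst (w j) = fst (w' j)" "\<And>j. j < k \<Longrightarrow> snd (w j) = snd (w' j)"
  shows "w \<in> A \<longleftrightarrow> w' \<in> A"
proof -
  let ?G = "{(\<lambda>w::path. fst (w j)) -` A \<inter> UNIV | j A. j \<le> k \<and> A \<in> sets borel} \<union>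
      {(\<lambda>w::path. snd (w j)) -` B \<inter> UNIV | j B. j \<le> k - 1}"
  have "A \<in> sigma_sets UNIV ?G"
    using A unfolding past_def by (subst (asm) sets_measure_of) auto
  then show ?thesis using assms(2,3) by (induction rule: sigma_sets.induct) auto
qed

lemma subalgebra_past: "subalgebra L (past L (\<lambda>k w. fst (w k)) (\<lambda>k w. snd (w k)) k)"
proof -
  have "(\<lambda>w. fst (w j)) -` A \<in> sets path_space" if "A \<in> sets borel" for j and A :: "real set"
    using measurable_sets[OF measurable_path_component(1)[of j] that] by simp
  moreover have "(\<lambda>w. snd (w j)) -` A \<in> sets path_space" for j and A :: "nat set"
    using measurable_sets[OF measurable_path_component(2)[of j], of A] by simp
  ultimately have "sigma_sets UNIV ({(\<lambda>w::path. fst (w j)) -` A \<inter> UNIV | j A. j \<le> k \<and> A \<in> sets borel} \<union>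
      {(\<lambda>w::path. snd (w j)) -` B \<inter> UNIV | j B. j \<le> k - 1}) \<subseteq> sets path_space"
    by (intro sets.sigma_sets_subset'[of _ path_space UNIV])
       (auto simp: space_path_space[symmetric] simp del: space_path_space)
  then have "sets (past L (\<lambda>k w. fst (w k)) (\<lambda>k w. snd (w k)) k) \<subseteq> sets path_space"
    unfolding past_def by (subst sets_measure_of) auto
  then show ?thesis by (simp add: subalgebra_def past_def space_measure_of_conv)
qed

lemma conditional_law_L:
  "AE w in L. real_cond_exp L (past L (\<lambda>k w. fst (w k)) (\<lambda>k w. snd (w k)) k)
    (indicator {v \<in> space L. snd (v k) = n}) w = g_dens (fst (w k)) n"
proof -
  let ?F = "past L (\<lambda>k w. fst (w k)) (\<lambda>k w. snd (w k)) k"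
  interpret L: prob_space L by (rule prob_L)
  interpret finite_measure_subalgebra L ?F
    by unfold_locales (rule subalgebra_past)
  define f where "f = (indicator {v \<in> space L. snd (v k) = n} :: path \<Rightarrow> real)"
  define g where "g w = g_dens (fst (w k)) n" for w :: path
  have f_meas [measurable]: "f \<in> borel_measurable L" unfolding f_def by measurable
  have XF: "(\<lambda>w. fst (w k)) \<in> borel_measurable ?F"
  proof (rule measurableI)
    fix A :: "real set" assume "A \<in> sets borel"
    then show "(\<lambda>w. fst (w k)) -` A \<inter> space ?F \<in> sets ?F"
      unfolding past_def by (subst sets_measure_of)
        (auto simp: space_measure_of_conv intro!: sigma_sets.Basic exI[of _ k])
  qed simp
  have gF: "g \<in> borel_measurable ?F" unfolding g_def using XF by measurable
  have g_meas [measurable]: "g \<in> borel_measurable L" by (rule measurable_from_subalg[OF subalgebra_past gF])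
  have fi: "integrable L f" by (rule L.integrable_const_bound[where B = 1]) (auto simp: f_def indicator_def)
  have gi: "integrable L g" by (rule L.integrable_const_bound[where B = 1]) (auto simp: g_def g_dens_le_1)
  show ?thesis
    unfolding f_def[symmetric] g_def[symmetric]
  proof (rule real_cond_exp_charact[OF _ fi gi gF])
    fix A assume A: "A \<in> sets ?F"
    then have A' [measurable]: "A \<in> sets path_space" using subalgebra_past[of k] by (auto simp: subalgebra_def)
    define \<phi> :: "(int \<Rightarrow> nat) \<Rightarrow> ennreal" where "\<phi> z = indicator A (lift p \<theta> z)" for z
    have [measurable]: "\<phi> \<in> borel_measurable obs_space" unfolding \<phi>_def by measurable
    have \<phi>: "\<phi> (trunc k y) = indicator A (lift p \<theta> y)" for y
      using past_event_cong[OF A, of "lift p \<theta> (trunc k y)" "lift p \<theta> y"]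
      by (auto simp: \<phi>_def indicator_def lift_def filt_trunc trunc_def)
    have "ennreal (\<integral>w\<in>A. f w \<partial>L) = (\<integral>\<^sup>+w. ennreal (indicator A w * f w) \<partial>L)"
      unfolding set_lebesgue_integral_def using integrable_mult_indicator[OF _ fi, of A]
      by (subst nn_integral_eq_integral) (auto simp: f_def)
    also have "\<dots> = (\<integral>\<^sup>+y. \<phi> (trunc k y) * indicator {y. y k = n} y \<partial>Q)"
      unfolding L_def by (subst nn_integral_distr)
        (auto simp: \<phi> f_def L_def[symmetric] lift_def indicator_def intro!: nn_integral_cong)
    also have "\<dots> = (\<integral>\<^sup>+y. \<phi> (trunc k y) * ennreal (g_dens (filt p \<theta> k y) n) \<partial>Q)"
      by (rule one_step_indicator) measurable
    also have "\<dots> = (\<integral>\<^sup>+w. ennreal (indicator A w * g w) \<partial>L)"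
      unfolding L_def by (subst nn_integral_distr)
        (auto simp: \<phi> g_def lift_def indicator_def intro!: nn_integral_cong)
    also have "\<dots> = ennreal (\<integral>w\<in>A. g w \<partial>L)"
      unfolding set_lebesgue_integral_def using integrable_mult_indicator[OF _ gi, of A]
      by (subst nn_integral_eq_integral) (auto simp: g_def)
    finally show "(\<integral>w\<in>A. f w \<partial>L) = (\<integral>w\<in>A. g w \<partial>L)"
      by (subst (asm) ennreal_inj) (auto simp: set_lebesgue_integral_def f_def g_def intro!: integral_nonneg_AE)
  qed
qed

lemma stationary_law_L: "stationary_law p q \<theta> L"
  unfolding stationary_law_def stationary_solution_def
proof (intro conjI allI)
  show "prob_space L" by (rule prob_L)
  show "distr L path_space (\<lambda>w k. (fst (w (k + 1)), snd (w (k + 1)))) = distr L path_space (\<lambda>w k. (fst (w k), snd (w k)))"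
  proof -
    have ms: "shift 1 \<in> measurable path_space path_space"
      by (rule measurable_into_path) (auto simp: shift_def)
    have 1: "(\<lambda>(w::path) k. (fst (w (k + 1)), snd (w (k + 1)))) = shift 1" by (simp add: fun_eq_iff shift_def)
    have 2: "(\<lambda>(w::path) k. (fst (w k), snd (w k))) = (\<lambda>w. w)" by (simp add: fun_eq_iff)
    have "distr L path_space (shift 1) = distr Q path_space (shift 1 \<circ> lift p \<theta>)"
      unfolding L_def using ms by (intro distr_distr) auto
    also have "shift 1 \<circ> lift p \<theta> = lift p \<theta> \<circ> shift 1"
      by (intro ext) (simp add: lift_def filt_shift, simp add: shift_def)
    also have "distr Q path_space (lift p \<theta> \<circ> shift 1) = distr (distr Q obs_space (shift 1)) path_space (lift p \<theta>)"
      by (intro distr_distr[symmetric]) auto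
    also have "\<dots> = L" by (simp only: distr_shift_Q L_def)
    also have "L = distr L path_space (\<lambda>w. w)"
      using distr_cong[of L L path_space L "\<lambda>w. w" "\<lambda>w. w"] by (simp add: distr_id)
    finally show ?thesis unfolding 1 2 .
  qed
  show "AE w in L. real_cond_exp L (past L (\<lambda>k w. fst (w k)) (\<lambda>k w. snd (w k)) k)
      (indicator {v \<in> space L. snd (v k) = n}) w = pmf (poisson_pmf (exp (fst (w k)))) n" for k n
    unfolding pmf_poisson_g_dens by (rule conditional_law_L)
  show "AE w in L. fst (w (k + 1)) = om \<theta> + (\<Sum>i = 1..p. ca \<theta> i * fst (w (k + 1 - int i)))
     + (\<Sum>i = 1..q. cb \<theta> i * ln (1 + real (snd (w (k + 1 - int i)))))" for k
  proof -
    have *: "AE y in Q. fst (lift p \<theta> y (k + 1)) = om \<theta> + (\<Sum>i = 1..p. ca \<theta> i * fst (lift p \<theta> y (k + 1 - int i)))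
     + (\<Sum>i = 1..q. cb \<theta> i * ln (1 + real (snd (lift p \<theta> y (k + 1 - int i)))))"
      using AE_tempered[OF \<rho>]
      by eventually_elim (simp add: lift_def filt_recursion lnobs_def)
    have m: "(\<lambda>w. om \<theta> + (\<Sum>i = 1..p. ca \<theta> i * fst (w (k + 1 - int i)))
        + (\<Sum>i = 1..q. cb \<theta> i * ln (1 + real (snd (w (k + 1 - int i)))))) \<in> borel_measurable path_space"
    proof (intro borel_measurable_add borel_measurable_sum borel_measurable_times borel_measurable_const)
      show "(\<lambda>w. ln (1 + real (snd (w (k + 1 - int i))))) \<in> borel_measurable path_space" for i
        by measurable
    qed measurable
    have "Measurable.pred path_space (\<lambda>w. fst (w (k + 1)) = om \<theta> + (\<Sum>i = 1..p. ca \<theta> i * fst (w (k + 1 - int i)))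
        + (\<Sum>i = 1..q. cb \<theta> i * ln (1 + real (snd (w (k + 1 - int i))))))"
      unfolding pred_def by (intro borel_measurable_eq m) measurable
    from AE_L[OF this] show ?thesis using * by (rule iffD2)
  qed
qed (simp_all)

lemma stationary_model_L: "stationary_model p q \<theta> B C \<rho> L"
  by (intro stationary_model.intro stationary_model_axioms.intro model_axioms stationary_law_L)

lemma lnobs_exp_moment:
  assumes "0 < \<tau>"
  shows "(\<integral>\<^sup>+y. ennreal (exp (\<tau> * lnobs y k)) \<partial>Q) < \<infinity>"
proof -
  interpret S: stationary_model p q \<theta> B C \<rho> L by (rule stationary_model_L)
  have "(\<integral>\<^sup>+w. ennreal (exp (\<tau> * lnobs (obs w) k)) \<partial>L) = (\<integral>\<^sup>+y. ennreal (exp (\<tau> * lnobs y k)) \<partial>Q)"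
    unfolding L_def by (subst nn_integral_distr) auto
  then show ?thesis using S.lnobs_moment[OF assms, of k] by simp
qed

end

context obs_model
begin

lemma filt_exp_moment:
  assumes "0 < \<tau>"
  shows "(\<integral>\<^sup>+y. ennreal (exp (\<tau> * \<bar>filt p \<theta> k y\<bar>)) \<partial>Q) < \<infinity>"
proof -
  interpret S: stationary_model p q \<theta> B C \<rho> L by (rule stationary_model_L)
  have "(\<integral>\<^sup>+w. ennreal (exp (\<tau> * \<bar>fst (w k)\<bar>)) \<partial>L) = (\<integral>\<^sup>+y. ennreal (exp (\<tau> * \<bar>filt p \<theta> k y\<bar>)) \<partial>Q)"
    unfolding L_def by (subst nn_integral_distr) (auto simp: lift_def)
  then show ?thesis using S.X_moment[OF assms, of k] by simp
qed

text \<open>Both summands are dominated by exponentials of quantities with all exponential moments.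
  This is the series that dominates the logarithm of the likelihood ratio between two pasts.\<close>

lemma AE_summable_intensity:
  "AE y in Q. summable (\<lambda>k. \<rho> ^ k * (real (y (int k)) + exp (filt p \<theta> (int k) y)))"
proof -
  define V where "V k y = real (y (int k)) + exp (filt p \<theta> (int k) y)" for k y
  have [measurable]: "V k \<in> borel_measurable obs_space" for k unfolding V_def by measurable
  have shiftV: "V 0 (shift (int k) y) = V k y" for k y
    by (simp add: V_def filt_shift) (simp add: shift_def)
  have "(\<integral>\<^sup>+y. ennreal (V 0 y) \<partial>Q) \<le>
      (\<integral>\<^sup>+y. ennreal (exp (1 * lnobs y 0)) + ennreal (exp (1 * \<bar>filt p \<theta> 0 y\<bar>)) \<partial>Q)"
    by (intro nn_integral_mono)
       (simp add: V_def lnobs_def ennreal_plus[symmetric] ennreal_leI add_mono del: ennreal_plus)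
  also have "\<dots> = (\<integral>\<^sup>+y. ennreal (exp (1 * lnobs y 0)) \<partial>Q) + (\<integral>\<^sup>+y. ennreal (exp (1 * \<bar>filt p \<theta> 0 y\<bar>)) \<partial>Q)"
    by (rule nn_integral_add) measurable
  also have "\<dots> < \<infinity>" using lnobs_exp_moment[of 1 0] filt_exp_moment[of 1 0] by simp
  finally have "(\<integral>\<^sup>+y. ennreal (V 0 y) \<partial>Q) < top" by simp
  then obtain K where K: "(\<integral>\<^sup>+y. ennreal (V 0 y) \<partial>Q) = ennreal K" "0 \<le> K"
    by (cases "\<integral>\<^sup>+y. ennreal (V 0 y) \<partial>Q") auto
  have Vk: "(\<integral>\<^sup>+y. ennreal (V k y) \<partial>Q) = ennreal K" for k
    using nn_integral_shift[of "\<lambda>y. ennreal (V 0 y)" "int k"] K by (simp add: shiftV)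
  have "AE y in Q. summable (\<lambda>k. \<rho> ^ k * V k y)"
  proof (rule weighted_sum(1)[where K = K])
    show "0 \<le> V k y" for k y by (simp add: V_def)
  qed (simp_all add: Vk K \<rho>)
  then show ?thesis by (simp add: V_def)
qed

end

section \<open>Ergodicity and uniqueness\<close>

definition splice :: "(int \<Rightarrow> nat) \<Rightarrow> (int \<Rightarrow> nat) \<Rightarrow> int \<Rightarrow> nat" where
  "splice u v k = (if k < 0 then u k else v k)"

lemma measurable_splice [measurable (raw)]:
  assumes [measurable]: "f \<in> measurable M obs_space" "g \<in> measurable M obs_space"
  shows "(\<lambda>x. splice (f x) (g x)) \<in> measurable M obs_space"
  by (rule measurable_into_obs) (simp add: splice_def)

lemma measurable_g_dens_compose [measurable (raw)]:
  assumes [measurable]: "f \<in> borel_measurable M" "g \<in> measurable M (count_space UNIV)"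
  shows "(\<lambda>x. g_dens (f x) (g x)) \<in> borel_measurable M"
  unfolding g_dens_def by measurable

lemma splice_trunc: "0 \<le> m \<Longrightarrow> trunc m (splice u v) = splice u (trunc m v)"
  by (auto simp: trunc_def splice_def)

lemma splice_upd: "0 \<le> k \<Longrightarrow> splice u (v(k := n)) = (splice u v)(k := n)"
  by (auto simp: splice_def)

lemma trunc_0_splice: "trunc 0 (splice u v) = trunc 0 u"
  by (auto simp: trunc_def splice_def)

text \<open>In every use \<open>u\<close> and \<open>v\<close> coincide from time 0 on, so this
  compares the densities of one future under two different pasts; the observed values are read off
  \<open>u\<close>.\<close>

definition lik_ratio :: "nat \<Rightarrow> param \<Rightarrow> nat \<Rightarrow> (int \<Rightarrow> nat) \<Rightarrow> (int \<Rightarrow> nat) \<Rightarrow> real" where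
  "lik_ratio p \<theta> n u v =
    (\<Prod>k<n. g_dens (filt p \<theta> (int k) u) (u (int k)) / g_dens (filt p \<theta> (int k) v) (u (int k)))"

lemma lik_ratio_pos: "0 < lik_ratio p \<theta> n u v"
  unfolding lik_ratio_def by (intro prod_pos) (simp add: g_dens_pos)

lemma lik_ratio_cong:
  assumes "\<And>j. j < int n \<Longrightarrow> u j = u' j" "\<And>j. j < int n \<Longrightarrow> v j = v' j"
  shows "lik_ratio p \<theta> n u v = lik_ratio p \<theta> n u' v'"
  unfolding lik_ratio_def
proof (rule prod.cong[OF refl])
  fix k assume "k \<in> {..<n}"
  then have "filt p \<theta> (int k) u = filt p \<theta> (int k) u'" "filt p \<theta> (int k) v = filt p \<theta> (int k) v'" "u (int k) = u' (int k)"
    using assms by (auto intro!: filt_cong)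
  then show "g_dens (filt p \<theta> (int k) u) (u (int k)) / g_dens (filt p \<theta> (int k) v) (u (int k)) =
    g_dens (filt p \<theta> (int k) u') (u' (int k)) / g_dens (filt p \<theta> (int k) v') (u' (int k))" by simp
qed

lemma measurable_lik_ratio [measurable (raw)]:
  assumes [measurable]: "f \<in> measurable M obs_space" "g \<in> measurable M obs_space"
  shows "(\<lambda>x. lik_ratio p \<theta> n (f x) (g x)) \<in> borel_measurable M"
  unfolding lik_ratio_def by measurable

locale two_laws = Q1: obs_model p q \<theta> B C \<rho> Q1 + Q2: obs_model p q \<theta> B C \<rho> Q2
  for p q \<theta> B C \<rho> Q1 Q2
begin

text \<open>With \<open>y\<close> drawn from \<open>Q1\<close> and an independent \<open>y'\<close> drawn from \<open>Q2\<close>, the future of \<open>y\<close>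
  glued to either past has a law absolutely continuous with respect to that of the future of \<open>y'\<close>.\<close>

lemma change_of_future:
  fixes H :: "(int \<Rightarrow> nat) \<times> (int \<Rightarrow> nat) \<Rightarrow> ennreal"
  assumes "H \<in> borel_measurable (obs_space \<Otimes>\<^sub>M obs_space)"
  shows "(\<integral>\<^sup>+y'. (\<integral>\<^sup>+y. H (trunc (int n) y, trunc (int n) (splice y' y)) \<partial>Q1) \<partial>Q2) =
    (\<integral>\<^sup>+y. (\<integral>\<^sup>+y'. H (trunc (int n) (splice y y'), trunc (int n) y') *
        ennreal (lik_ratio p \<theta> n (splice y y') y') \<partial>Q2) \<partial>Q1)"
  using assms
proof (induction n arbitrary: H)
  case 0
  note [measurable] = 0
  interpret pair_sigma_finite Q1 Q2 ..
  have [measurable]: "(\<lambda>(y, y'). H (trunc 0 y, trunc 0 y')) \<in> borel_measurable (Q1 \<Otimes>\<^sub>M Q2)"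
    by measurable
  have "(\<integral>\<^sup>+y'. (\<integral>\<^sup>+y. H (trunc 0 y, trunc 0 y') \<partial>Q1) \<partial>Q2) =
    (\<integral>\<^sup>+y. (\<integral>\<^sup>+y'. H (trunc 0 y, trunc 0 y') \<partial>Q2) \<partial>Q1)"
    using Fubini[of "\<lambda>(y, y'). H (trunc 0 y, trunc 0 y')"] by simp
  then show ?case by (simp add: trunc_0_splice lik_ratio_def)
next
  case (Suc n)
  note [measurable] = Suc.prems
  define k where "k = int n"
  have k: "int (Suc n) = k + 1" "0 \<le> k" by (auto simp: k_def)
  \<comment> \<open>Sums out the observation at time k with the density given by the first path. On
    the left this is its true conditional law; on the right the true density belongs to the second
    path, and the new factor of the likelihood ratio converts one into the other.\<close>
  define H' where "H' z = (\<Sum>m. H ((fst z)(k := m), (snd z)(k := m)) * ennreal (g_dens (filt p \<theta> k (fst z)) m))" for z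
  have H'_meas: "H' \<in> borel_measurable (obs_space \<Otimes>\<^sub>M obs_space)"
  proof -
    have u: "(\<lambda>z. (f z)(k := m)) \<in> measurable M obs_space" if "f \<in> measurable M obs_space" for f M m
      using measurable_compose[OF that measurable_upd] .
    have [measurable]: "(\<lambda>z. ((fst z)(k := m), (snd z)(k := m))) \<in> measurable (obs_space \<Otimes>\<^sub>M obs_space) (obs_space \<Otimes>\<^sub>M obs_space)" for m
      by (intro measurable_Pair u measurable_fst measurable_snd)
    show ?thesis unfolding H'_def by measurable
  qed
  have left: "(\<integral>\<^sup>+y. H (trunc (k + 1) y, trunc (k + 1) (splice y' y)) \<partial>Q1) =
      (\<integral>\<^sup>+y. H' (trunc k y, trunc k (splice y' y)) \<partial>Q1)" for y'
  proof -
    define \<phi> where "\<phi> z = H (z, splice y' z)" for z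
    have [measurable]: "\<phi> \<in> borel_measurable obs_space" unfolding \<phi>_def by measurable
    have "(\<integral>\<^sup>+y. \<phi> (trunc (k + 1) y) \<partial>Q1) =
      (\<integral>\<^sup>+y. (\<Sum>m. \<phi> ((trunc k y)(k := m)) * ennreal (g_dens (filt p \<theta> k y) m)) \<partial>Q1)"
      by (rule Q1.one_step_trunc) measurable
    then show ?thesis
      using k by (simp add: \<phi>_def H'_def splice_trunc splice_upd filt_trunc)
  qed
  have right: "(\<integral>\<^sup>+y'. H (trunc (k + 1) (splice y y'), trunc (k + 1) y') *
        ennreal (lik_ratio p \<theta> (Suc n) (splice y y') y') \<partial>Q2) =
      (\<integral>\<^sup>+y'. H' (trunc k (splice y y'), trunc k y') * ennreal (lik_ratio p \<theta> n (splice y y') y') \<partial>Q2)" for y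
  proof -
    define \<phi> where "\<phi> z = H (splice y z, z) * ennreal (lik_ratio p \<theta> (Suc n) (splice y z) z)" for z
    have [measurable]: "\<phi> \<in> borel_measurable obs_space" unfolding \<phi>_def by measurable
    have "lik_ratio p \<theta> (Suc n) (splice y (trunc (k + 1) y')) (trunc (k + 1) y') =
        lik_ratio p \<theta> (Suc n) (splice y y') y'" for y'
      by (rule lik_ratio_cong) (auto simp: trunc_def splice_def k_def)
    then have "(\<integral>\<^sup>+y'. H (trunc (k + 1) (splice y y'), trunc (k + 1) y') *
        ennreal (lik_ratio p \<theta> (Suc n) (splice y y') y') \<partial>Q2) = (\<integral>\<^sup>+y'. \<phi> (trunc (k + 1) y') \<partial>Q2)"
      using k by (simp add: \<phi>_def splice_trunc)
    also have "\<dots> = (\<integral>\<^sup>+y'. (\<Sum>m. \<phi> ((trunc k y')(k := m)) * ennreal (g_dens (filt p \<theta> k y') m)) \<partial>Q2)"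
      by (rule Q2.one_step_trunc) measurable
    also have "\<dots> = (\<integral>\<^sup>+y'. H' (trunc k (splice y y'), trunc k y') * ennreal (lik_ratio p \<theta> n (splice y y') y') \<partial>Q2)"
    proof (intro nn_integral_cong)
      fix y'
      have "\<phi> ((trunc k y')(k := m)) * ennreal (g_dens (filt p \<theta> k y') m) =
        H ((trunc k (splice y y'))(k := m), (trunc k y')(k := m)) * ennreal (g_dens (filt p \<theta> k (trunc k (splice y y'))) m)
          * ennreal (lik_ratio p \<theta> n (splice y y') y')" for m
      proof -
        let ?u = "(splice y (trunc k y'))(k := m)" and ?v = "(trunc k y')(k := m)"
        have 1: "lik_ratio p \<theta> n ?u ?v = lik_ratio p \<theta> n (splice y y') y'"
          by (rule lik_ratio_cong) (auto simp: trunc_def splice_def k_def)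
        have 2: "filt p \<theta> k ?u = filt p \<theta> k (splice y y')" "filt p \<theta> k ?v = filt p \<theta> k y'"
          by (intro filt_cong; auto simp: trunc_def splice_def)+
        have "lik_ratio p \<theta> (Suc n) ?u ?v =
            lik_ratio p \<theta> n (splice y y') y' * (g_dens (filt p \<theta> k (splice y y')) m / g_dens (filt p \<theta> k y') m)"
          unfolding 1[symmetric] 2[symmetric] by (simp add: lik_ratio_def k_def)
        then have "lik_ratio p \<theta> (Suc n) ?u ?v * g_dens (filt p \<theta> k y') m =
            g_dens (filt p \<theta> k (splice y y')) m * lik_ratio p \<theta> n (splice y y') y'"
          using g_dens_pos[of "filt p \<theta> k y'" m] by simp
        then have "ennreal (lik_ratio p \<theta> (Suc n) ?u ?v) * ennreal (g_dens (filt p \<theta> k y') m) =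
            ennreal (g_dens (filt p \<theta> k (splice y y')) m) * ennreal (lik_ratio p \<theta> n (splice y y') y')"
          by (simp add: ennreal_mult[symmetric] less_imp_le[OF lik_ratio_pos])
        then show ?thesis
          using k by (simp add: \<phi>_def splice_upd splice_trunc[symmetric] filt_trunc mult.assoc)
      qed
      then show "(\<Sum>m. \<phi> ((trunc k y')(k := m)) * ennreal (g_dens (filt p \<theta> k y') m)) =
        H' (trunc k (splice y y'), trunc k y') * ennreal (lik_ratio p \<theta> n (splice y y') y')"
        by (simp add: H'_def)
    qed
    finally show ?thesis .
  qed
  show ?case unfolding k(1) left right using Suc.IH[OF H'_meas] by (simp add: k_def)
qed

text \<open>Where the ratio stays below \<open>K\<close>, the first n observations of the glued
  path, past from \<open>Q2\<close> and future from \<open>Q1\<close>, have a law dominated by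
  \<open>K\<close> times that of \<open>Q2\<close>. The bound does not depend on n, which is what
  makes the approximation argument possible.\<close>

lemma bounded_ratio:
  assumes [measurable]: "G \<in> borel_measurable obs_space" and G: "\<And>y. G (trunc (int n) y) = G y" and K: "0 \<le> K"
  shows "(\<integral>\<^sup>+y'. (\<integral>\<^sup>+y. G (splice y' y) * indicator {y. lik_ratio p \<theta> n y (splice y' y) \<le> K} y \<partial>Q1) \<partial>Q2)
    \<le> ennreal K * (\<integral>\<^sup>+y. G y \<partial>Q2)"
proof -
  define H where "H z = G (snd z) * indicator {z. lik_ratio p \<theta> n (fst z) (snd z) \<le> K} z" for z
  have "{z \<in> space (obs_space \<Otimes>\<^sub>M obs_space). lik_ratio p \<theta> n (fst z) (snd z) \<le> K} \<in> sets (obs_space \<Otimes>\<^sub>M obs_space)"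
    by measurable
  then have [measurable]: "{z. lik_ratio p \<theta> n (fst z) (snd z) \<le> K} \<in> sets (obs_space \<Otimes>\<^sub>M obs_space)"
    by (simp add: space_pair_measure)
  have [measurable]: "H \<in> borel_measurable (obs_space \<Otimes>\<^sub>M obs_space)"
    unfolding H_def by measurable
  have lr: "lik_ratio p \<theta> n (trunc (int n) u) (trunc (int n) v) = lik_ratio p \<theta> n u v" for u v
    by (rule lik_ratio_cong) (auto simp: trunc_def)
  have "(\<integral>\<^sup>+y'. (\<integral>\<^sup>+y. G (splice y' y) * indicator {y. lik_ratio p \<theta> n y (splice y' y) \<le> K} y \<partial>Q1) \<partial>Q2) =
     (\<integral>\<^sup>+y'. (\<integral>\<^sup>+y. H (trunc (int n) y, trunc (int n) (splice y' y)) \<partial>Q1) \<partial>Q2)"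
    by (simp add: H_def G lr indicator_def)
  also have "\<dots> = (\<integral>\<^sup>+y. (\<integral>\<^sup>+y'. H (trunc (int n) (splice y y'), trunc (int n) y') *
        ennreal (lik_ratio p \<theta> n (splice y y') y') \<partial>Q2) \<partial>Q1)"
    by (rule change_of_future) measurable
  also have "\<dots> \<le> (\<integral>\<^sup>+y. (\<integral>\<^sup>+y'. ennreal K * G y' \<partial>Q2) \<partial>Q1)"
  proof (intro nn_integral_mono)
    fix y y'
    show "H (trunc (int n) (splice y y'), trunc (int n) y') * ennreal (lik_ratio p \<theta> n (splice y y') y') \<le> ennreal K * G y'"
    proof (cases "lik_ratio p \<theta> n (splice y y') y' \<le> K")
      case True
      then show ?thesis
        using mult_right_mono[OF ennreal_leI[OF True], of "G y'"] by (simp add: H_def G lr mult.commute)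
    qed (simp add: H_def lr)
  qed
  also have "\<dots> = ennreal K * (\<integral>\<^sup>+y. G y \<partial>Q2)"
    using Q1.emeasure_space_1 by (simp add: nn_integral_cmult)
  finally show ?thesis .
qed

text \<open>The two filters differ at time k only through observations before 0, whose weights carry
  the factor \<rho>^k. The k-th factor of the ratio then contributes at most a constant times
  \<rho>^k (y_k + exp x_k) to the logarithm, and these are summable.\<close>

lemma ratio_bounded_pointwise:
  assumes y: "tempered \<rho> y" "tempered \<rho> y'"
    and s: "summable (\<lambda>k. \<rho> ^ k * (real (y (int k)) + exp (filt p \<theta> (int k) y)))"
  shows "\<exists>K::nat. \<forall>n. lik_ratio p \<theta> n y (splice y' y) \<le> real K"
proof -
  define W where "W = (\<Sum>i. \<rho> ^ i * (lnobs y (- 1 - int i) + lnobs y' (- 1 - int i)))"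
  have Ws: "summable (\<lambda>i. \<rho> ^ i * (lnobs y (- 1 - int i) + lnobs y' (- 1 - int i)))"
    unfolding distrib_left using y by (intro summable_add) (simp_all add: tempered_def)
  have W0: "0 \<le> W" unfolding W_def using Q1.\<rho>(1) by (intro suminf_nonneg Ws) auto
  define D where "D k = filt p \<theta> (int k) y - filt p \<theta> (int k) (splice y' y)" for k
  have ts: "tempered \<rho> (splice y' y)"
    unfolding tempered_def
  proof
    fix k
    show "summable (\<lambda>j. \<rho> ^ j * lnobs (splice y' y) (k - int j))"
    proof (rule summable_comparison_test')
      show "summable (\<lambda>j. \<rho> ^ j * lnobs y (k - int j) + \<rho> ^ j * lnobs y' (k - int j))"
        using y by (intro summable_add) (simp_all add: tempered_def)
      show "norm (\<rho> ^ j * lnobs (splice y' y) (k - int j)) \<le> \<rho> ^ j * lnobs y (k - int j) + \<rho> ^ j * lnobs y' (k - int j)" for j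
        using Q1.\<rho>(1) by (simp add: lnobs_def splice_def)
    qed
  qed
  have D: "\<bar>D k\<bar> \<le> C * W * \<rho> ^ k" for k
  proof -
    define d where "d j = hcoef \<theta> j * lnobs y (int k - 1 - int j) - hcoef \<theta> j * lnobs (splice y' y) (int k - 1 - int j)" for j
    have ds: "summable d" unfolding d_def
      by (intro summable_diff Q1.summable_hcoef y ts)
    have "D k = (\<Sum>j. d j)" unfolding D_def filt_def d_def
      by (subst suminf_diff[OF Q1.summable_hcoef[OF y(1)] Q1.summable_hcoef[OF ts], symmetric]) simp
    also have "\<dots> = (\<Sum>i. d (i + k)) + (\<Sum>j<k. d j)" by (rule suminf_split_initial_segment[OF ds])
    also have "(\<Sum>j<k. d j) = 0" by (intro sum.neutral) (auto simp: d_def lnobs_def splice_def)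
    finally have "\<bar>D k\<bar> = norm (\<Sum>i. d (i + k))" by simp
    also have "\<dots> \<le> (\<Sum>i. C * \<rho> ^ k * (\<rho> ^ i * (lnobs y (- 1 - int i) + lnobs y' (- 1 - int i))))"
    proof (rule norm_suminf_le)
      show "summable (\<lambda>i. C * \<rho> ^ k * (\<rho> ^ i * (lnobs y (- 1 - int i) + lnobs y' (- 1 - int i))))"
        by (rule summable_mult[OF Ws])
      fix i
      have "d (i + k) = hcoef \<theta> (i + k) * (lnobs y (- 1 - int i) - lnobs y' (- 1 - int i))"
        by (simp add: d_def lnobs_def splice_def right_diff_distrib)
      also have "norm \<dots> \<le> (C * \<rho> ^ (i + k)) * (lnobs y (- 1 - int i) + lnobs y' (- 1 - int i))"
        unfolding real_norm_def abs_mult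
        using lnobs_nonneg[of y "- 1 - int i"] lnobs_nonneg[of y' "- 1 - int i"]
        by (intro mult_mono Q1.hcoef_decay) (auto simp: abs_le_iff intro: order_trans[OF _ Q1.hcoef_decay])
      finally show "norm (d (i + k)) \<le> C * \<rho> ^ k * (\<rho> ^ i * (lnobs y (- 1 - int i) + lnobs y' (- 1 - int i)))"
        by (simp add: power_add mult_ac)
    qed
    also have "\<dots> = C * \<rho> ^ k * W" unfolding W_def by (rule suminf_mult[OF Ws])
    finally show ?thesis by (simp add: mult_ac)
  qed
  define A where "A = C * W"
  have A0: "0 \<le> A" using W0 Q1.C by (simp add: A_def)
  define V where "V k = real (y (int k)) + exp (filt p \<theta> (int k) y)" for k
  have V0: "0 \<le> V k" for k by (simp add: V_def)
  have lnr: "ln (lik_ratio p \<theta> n y (splice y' y)) \<le> A * exp A * (\<Sum>k. \<rho> ^ k * V k)" for n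
  proof -
    have "ln (lik_ratio p \<theta> n y (splice y' y)) = (\<Sum>k<n. ln (g_dens (filt p \<theta> (int k) y) (y (int k)) /
        g_dens (filt p \<theta> (int k) (splice y' y)) (y (int k))))"
      unfolding lik_ratio_def by (subst ln_prod) (auto simp: less_imp_neq[OF g_dens_pos, symmetric])
    also have "\<dots> \<le> (\<Sum>k<n. A * exp A * (\<rho> ^ k * V k))"
    proof (rule sum_mono)
      fix k
      define x x' where "x = filt p \<theta> (int k) y" and "x' = filt p \<theta> (int k) (splice y' y)"
      have Dk: "\<bar>x - x'\<bar> \<le> A * \<rho> ^ k" using D[of k] by (simp add: D_def x_def x'_def A_def)
      have DA: "A * \<rho> ^ k \<le> A" using A0 Q1.\<rho> by (simp add: mult_left_le power_le_one)
      \<comment> \<open>Only the upper side is wanted. The intensity on the right is moved from x'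
        to x at the price of the factor exp A, since the filters differ by at most A.\<close>
      have "exp x' - exp x \<le> A * \<rho> ^ k * (exp A * exp x)"
      proof (cases "x' \<le> x")
        case True
        then have "exp x' - exp x \<le> 0" by simp
        also have "0 \<le> A * \<rho> ^ k * (exp A * exp x)" using A0 Q1.\<rho> by simp
        finally show ?thesis .
      next
        case False
        have "exp x' - exp x = exp x' * (1 - exp (x - x'))" by (simp add: right_diff_distrib flip: exp_add)
        also have "\<dots> \<le> exp x' * (x' - x)"
        proof (rule mult_left_mono)
          show "1 - exp (x - x') \<le> x' - x" using exp_ge_add_one_self[of "x - x'"] by linarith
        qed simp
        also have "\<dots> \<le> (exp A * exp x) * (A * \<rho> ^ k)"
          using Dk DA False by (intro mult_mono) (auto simp flip: exp_add)
        finally show ?thesis by (simp add: mult_ac)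
      qed
      moreover have "(x - x') * real (y (int k)) \<le> A * \<rho> ^ k * (exp A * real (y (int k)))"
      proof -
        have "(x - x') * real (y (int k)) \<le> (A * \<rho> ^ k) * real (y (int k))"
          using Dk by (intro mult_right_mono) auto
        also have "\<dots> \<le> A * \<rho> ^ k * (exp A * real (y (int k)))"
          using A0 Q1.\<rho> by (intro mult_left_mono) (auto simp: mult_le_cancel_right1)
        finally show ?thesis .
      qed
      moreover have "ln (g_dens x (y (int k)) / g_dens x' (y (int k))) =
          (x - x') * real (y (int k)) + (exp x' - exp x)"
        by (simp add: ln_div less_imp_neq[OF g_dens_pos, symmetric] ln_g_dens algebra_simps)
      ultimately show "ln (g_dens (filt p \<theta> (int k) y) (y (int k)) / g_dens (filt p \<theta> (int k) (splice y' y)) (y (int k)))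
          \<le> A * exp A * (\<rho> ^ k * V k)"
        unfolding x_def[symmetric] x'_def[symmetric] V_def by (simp add: algebra_simps)
    qed
    also have "\<dots> = A * exp A * (\<Sum>k<n. \<rho> ^ k * V k)" by (simp add: sum_distrib_left)
    also have "\<dots> \<le> A * exp A * (\<Sum>k. \<rho> ^ k * V k)"
      using s A0 V0 Q1.\<rho>(1) by (intro mult_left_mono sum_le_suminf) (auto simp: V_def)
    finally show ?thesis .
  qed
  obtain K :: nat where K: "exp (A * exp A * (\<Sum>k. \<rho> ^ k * V k)) \<le> real K" using real_arch_simple by blast
  have "lik_ratio p \<theta> n y (splice y' y) \<le> real K" for n
  proof -
    have "lik_ratio p \<theta> n y (splice y' y) = exp (ln (lik_ratio p \<theta> n y (splice y' y)))"
      by (simp add: lik_ratio_pos)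
    also have "\<dots> \<le> exp (A * exp A * (\<Sum>k. \<rho> ^ k * V k))" using lnr by simp
    finally show ?thesis using K by simp
  qed
  then show ?thesis by blast
qed

text \<open>Hopf's argument: an invariant event is approximated both by an event of the future of \<open>y\<close>
  and by an event of the past of \<open>y'\<close>.\<close>

lemma invariant_events_agree:
  assumes E [measurable]: "E \<in> sets obs_space" and inv: "\<And>y. shift 1 y \<in> E \<longleftrightarrow> y \<in> E"
  shows "measure Q1 E = measure Q2 E \<and> (measure Q1 E = 0 \<or> measure Q1 E = 1)"
proof -
  have invm: "shift m y \<in> E \<longleftrightarrow> y \<in> E" for m y
  proof -
    have pos: "shift (int n) y \<in> E \<longleftrightarrow> y \<in> E" for n y
    proof (induction n)
      case (Suc n)
      have "shift (int (Suc n)) y = shift 1 (shift (int n) y)" by (simp add: shift_shift)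
      then show ?case using inv Suc by simp
    qed simp
    show ?thesis
    proof (cases "0 \<le> m")
      case True then show ?thesis using pos[of "nat m" y] by simp
    next
      case False
      have "shift (int (nat (- m))) (shift m y) = y" using False by (simp add: shift_shift)
      then show ?thesis using pos[of "nat (- m)" "shift m y"] by simp
    qed
  qed
  interpret pair_sigma_finite Q1 Q2 ..
  define W where "W = Q1 \<Otimes>\<^sub>M Q2"
  have setsW [measurable_cong]: "sets W = sets (obs_space \<Otimes>\<^sub>M obs_space)" unfolding W_def by (rule sets_pair_measure_cong) auto
  have spW [simp]: "space W = UNIV" by (simp add: W_def space_pair_measure)
  define D where "D = {z. (fst z \<in> E) \<noteq> (snd z \<in> E)}"
  define S where "S K = {z. \<forall>n. lik_ratio p \<theta> n (fst z) (splice (snd z) (fst z)) \<le> real K}" for K :: nat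
  have "{z \<in> space (obs_space \<Otimes>\<^sub>M obs_space). (fst z \<in> E) \<noteq> (snd z \<in> E)} \<in> sets (obs_space \<Otimes>\<^sub>M obs_space)" by measurable
  then have D_meas [measurable]: "D \<in> sets (obs_space \<Otimes>\<^sub>M obs_space)" by (simp add: D_def space_pair_measure)
  have "{z \<in> space (obs_space \<Otimes>\<^sub>M obs_space). \<forall>n. lik_ratio p \<theta> n (fst z) (splice (snd z) (fst z)) \<le> real K} \<in> sets (obs_space \<Otimes>\<^sub>M obs_space)" for K
    by measurable
  then have S_meas [measurable]: "S K \<in> sets (obs_space \<Otimes>\<^sub>M obs_space)" for K by (simp add: S_def space_pair_measure)
  have DS: "emeasure W (D \<inter> S K) = 0" for K
  proof -
    have "emeasure W (D \<inter> S K) \<le> ennreal \<epsilon>" if \<epsilon>: "0 < \<epsilon>" for \<epsilon>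
    proof -
      \<comment> \<open>Calibrated so that the two approximation errors \<delta> and the glued error
        2 K \<delta> add up to \<epsilon>.\<close>
      define \<delta> where "\<delta> = \<epsilon> / (2 + 2 * real K)"
      have \<delta>: "0 < \<delta>" using \<epsilon> by (simp add: \<delta>_def add_pos_nonneg)
      obtain m A where A [measurable]: "A \<in> sets obs_space" and Ad: "determined m A"
        and A1: "measure Q1 ((E - A) \<union> (A - E)) < \<delta>" and A2: "measure Q2 ((E - A) \<union> (A - E)) < \<delta>"
        using approximation_by_window[OF Q1.prob_space_axioms Q1.sets_Q Q2.prob_space_axioms Q2.sets_Q E \<delta>] by blast
      \<comment> \<open>Shifted by m, the window from -m to m becomes the times 0 to 2m, all before
        \<open>n\<close>; shifted by -m-1 it becomes the times -2m-1 to -1. By invariance both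
        shifts of the window event approximate \<open>E\<close>.\<close>
      define n where "n = 2 * m + 1"
      define fut where "fut y \<longleftrightarrow> shift (int m) y \<in> A" for y
      define pas where "pas y \<longleftrightarrow> shift (- int m - 1) y \<in> A" for y
      have shm: "shift i -` A \<in> sets obs_space" for i using measurable_sets[OF measurable_shift A] by simp
      have pf: "Measurable.pred obs_space fut" "Measurable.pred obs_space pas"
        unfolding fut_def pas_def pred_def using shm by (simp_all add: vimage_def)
      note [measurable] = pf
      have fut_cong: "fut y = fut y'" if "\<And>j. 0 \<le> j \<Longrightarrow> j < int n \<Longrightarrow> y j = y' j" for y y'
        unfolding fut_def using Ad[unfolded determined_def, rule_format, of "shift (int m) y" "shift (int m) y'"] that
        by (simp add: shift_def n_def)
      have pas_cong: "pas y = pas y'" if "\<And>j. j < 0 \<Longrightarrow> y j = y' j" for y y'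
        unfolding pas_def using Ad[unfolded determined_def, rule_format, of "shift (- int m - 1) y" "shift (- int m - 1) y'"] that
        by (simp add: shift_def)
      have dev: "emeasure Q {y. (y \<in> E) \<noteq> (shift i y \<in> A)} < ennreal \<delta>"
        if Q: "obs_process p \<theta> Q" and l: "measure Q ((E - A) \<union> (A - E)) < \<delta>" for Q i
      proof -
        interpret Q: obs_process p \<theta> Q by fact
        have "emeasure Q {y. (y \<in> E) \<noteq> (shift i y \<in> A)} = (\<integral>\<^sup>+y. indicator ((E - A) \<union> (A - E)) (shift i y) \<partial>Q)"
        proof -
          have "{y \<in> space obs_space. (y \<in> E) \<noteq> (y \<in> shift i -` A)} \<in> sets obs_space" using shm by measurable
          then have "{y. (y \<in> E) \<noteq> (shift i y \<in> A)} \<in> sets Q" by simp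
          then have "emeasure Q {y. (y \<in> E) \<noteq> (shift i y \<in> A)} = (\<integral>\<^sup>+y. indicator {y. (y \<in> E) \<noteq> (shift i y \<in> A)} y \<partial>Q)"
            by (rule nn_integral_indicator[symmetric])
          also have "\<dots> = (\<integral>\<^sup>+y. indicator ((E - A) \<union> (A - E)) (shift i y) \<partial>Q)"
            by (intro nn_integral_cong) (auto simp: indicator_def invm)
          finally show ?thesis .
        qed
        also have "\<dots> = (\<integral>\<^sup>+y. indicator ((E - A) \<union> (A - E)) y \<partial>Q)" by (rule Q.nn_integral_shift) measurable
        also have "\<dots> = ennreal (measure Q ((E - A) \<union> (A - E)))"
          by (subst nn_integral_indicator) (auto simp: Q.emeasure_eq_measure)
        also have "\<dots> < ennreal \<delta>" using l by (simp add: ennreal_less_iff)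
        finally show ?thesis .
      qed
      define A1s where "A1s = {y. (y \<in> E) \<noteq> fut y}"
      define A2s where "A2s = {y. (y \<in> E) \<noteq> pas y}"
      define A3s where "A3s = {y. (y \<in> E) \<noteq> fut y}"
      have "{y \<in> space obs_space. (y \<in> E) \<noteq> fut y} \<in> sets obs_space" "{y \<in> space obs_space. (y \<in> E) \<noteq> pas y} \<in> sets obs_space"
        by measurable
      then have m12 [measurable]: "A1s \<in> sets obs_space" "A2s \<in> sets obs_space" by (simp_all add: A1s_def A2s_def)
      have e1: "emeasure Q1 A1s \<le> ennreal \<delta>" unfolding A1s_def fut_def
        by (intro less_imp_le dev A1) unfold_locales
      have e2: "emeasure Q2 A2s \<le> ennreal \<delta>" "emeasure Q2 A1s \<le> ennreal \<delta>" unfolding A1s_def A2s_def fut_def pas_def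
        by (intro less_imp_le dev A2; unfold_locales)+
      define G :: "(int \<Rightarrow> nat) \<Rightarrow> ennreal" where "G y = indicator {y. fut y \<noteq> pas y} y" for y
      have "{y \<in> space obs_space. fut y \<noteq> pas y} \<in> sets obs_space" by measurable
      then have mfp [measurable]: "{y. fut y \<noteq> pas y} \<in> sets obs_space" by simp
      have G_meas [measurable]: "G \<in> borel_measurable obs_space" unfolding G_def by measurable
      have Gtr: "G (trunc (int n) y) = G y" for y
        using fut_cong[of "trunc (int n) y" y] pas_cong[of "trunc (int n) y" y] by (simp add: G_def indicator_def trunc_def)
      have GE: "(\<integral>\<^sup>+y. G y \<partial>Q2) \<le> ennreal (2 * \<delta>)"
      proof -
        have "(\<integral>\<^sup>+y. G y \<partial>Q2) \<le> (\<integral>\<^sup>+y. indicator A1s y + indicator A2s y \<partial>Q2)"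
          by (intro nn_integral_mono) (auto simp: G_def A1s_def A2s_def indicator_def)
        also have "\<dots> = emeasure Q2 A1s + emeasure Q2 A2s" by (subst nn_integral_add) auto
        also have "\<dots> \<le> ennreal \<delta> + ennreal \<delta>" by (intro add_mono e2)
        also have "\<dots> = ennreal (2 * \<delta>)" using \<delta> by (simp add: ennreal_plus[symmetric] del: ennreal_plus)
        finally show ?thesis .
      qed
      \<comment> \<open>On the glued path both tests are read at once: the future test sees
        \<open>y\<close>, the past test sees \<open>y'\<close>. Under \<open>Q2\<close> the tests of
        a single path rarely disagree, as both approximate \<open>E\<close>, and
        \<open>bounded_ratio\<close> carries this over to the glued path.\<close>
      define R where "R = {z. fut (fst z) \<noteq> pas (snd z) \<and> lik_ratio p \<theta> n (fst z) (splice (snd z) (fst z)) \<le> real K}"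
      have "{z \<in> space (obs_space \<Otimes>\<^sub>M obs_space). fut (fst z) \<noteq> pas (snd z) \<and> lik_ratio p \<theta> n (fst z) (splice (snd z) (fst z)) \<le> real K}
          \<in> sets (obs_space \<Otimes>\<^sub>M obs_space)" by measurable
      then have R_meas [measurable]: "R \<in> sets (obs_space \<Otimes>\<^sub>M obs_space)" by (simp add: R_def space_pair_measure)
      have eR: "emeasure W R \<le> ennreal (2 * real K * \<delta>)"
      proof -
        have "emeasure W R = (\<integral>\<^sup>+z. indicator R z \<partial>W)" by (rule nn_integral_indicator[symmetric]) simp
        also have "\<dots> = (\<integral>\<^sup>+y'. (\<integral>\<^sup>+y. indicator R (y, y') \<partial>Q1) \<partial>Q2)"
          unfolding W_def by (rule nn_integral_snd[symmetric]) measurable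
        also have "\<dots> = (\<integral>\<^sup>+y'. (\<integral>\<^sup>+y. G (splice y' y) * indicator {y. lik_ratio p \<theta> n y (splice y' y) \<le> real K} y \<partial>Q1) \<partial>Q2)"
        proof (intro nn_integral_cong)
          fix y y'
          show "indicator R (y, y') = G (splice y' y) * indicator {y. lik_ratio p \<theta> n y (splice y' y) \<le> real K} y"
            using fut_cong[of "splice y' y" y] pas_cong[of "splice y' y" y']
            by (simp add: R_def G_def indicator_def splice_def[of y' y])
        qed
        also have "\<dots> \<le> ennreal (real K) * (\<integral>\<^sup>+y. G y \<partial>Q2)" by (rule bounded_ratio) (auto simp: Gtr)
        also have "\<dots> \<le> ennreal (real K) * ennreal (2 * \<delta>)" by (intro mult_left_mono GE) auto
        also have "\<dots> = ennreal (2 * real K * \<delta>)" using \<delta> by (simp add: ennreal_mult[symmetric] mult_ac)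
        finally show ?thesis .
      qed
      have univ: "UNIV \<in> sets obs_space" using sets.top[of obs_space] by simp
      then have [measurable]: "A1s \<times> UNIV \<in> sets (obs_space \<Otimes>\<^sub>M obs_space)" "UNIV \<times> A2s \<in> sets (obs_space \<Otimes>\<^sub>M obs_space)"
        by (intro pair_measureI m12 univ)+
      \<comment> \<open>If \<open>y\<close> and \<open>y'\<close> disagree about \<open>E\<close>,
        then either one of the two tests misjudges its path or the two tests disagree.\<close>
      have "D \<inter> S K \<subseteq> (A1s \<times> UNIV) \<union> (UNIV \<times> A2s) \<union> R"
        by (auto simp: D_def S_def A1s_def A2s_def R_def)
      then have "emeasure W (D \<inter> S K) \<le> emeasure W ((A1s \<times> UNIV) \<union> (UNIV \<times> A2s) \<union> R)"
        by (intro emeasure_mono) (auto simp: setsW)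
      also have "\<dots> \<le> emeasure W ((A1s \<times> UNIV) \<union> (UNIV \<times> A2s)) + emeasure W R"
        by (intro emeasure_subadditive) (auto simp: setsW)
      also have "\<dots> \<le> emeasure W (A1s \<times> UNIV) + emeasure W (UNIV \<times> A2s) + emeasure W R"
        by (intro add_right_mono emeasure_subadditive) (auto simp: setsW)
      also have "emeasure W (A1s \<times> UNIV) = emeasure Q1 A1s"
        unfolding W_def using Q2.emeasure_space_1 univ by (subst Q2.emeasure_pair_measure_Times) auto
      also have "emeasure W (UNIV \<times> A2s) = emeasure Q2 A2s"
        unfolding W_def using Q1.emeasure_space_1 univ by (subst Q2.emeasure_pair_measure_Times) auto
      also have "emeasure Q1 A1s + emeasure Q2 A2s + emeasure W R \<le> ennreal \<delta> + ennreal \<delta> + ennreal (2 * real K * \<delta>)"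
        by (intro add_mono e1 e2 eR)
      also have "\<dots> = ennreal \<epsilon>"
      proof -
        have "\<delta> + \<delta> + 2 * real K * \<delta> = \<delta> * (2 + 2 * real K)" by (simp add: algebra_simps)
        also have "\<dots> = \<epsilon>" by (simp add: \<delta>_def add_pos_nonneg less_imp_neq[symmetric])
        finally show ?thesis using \<delta> by (simp add: ennreal_plus[symmetric] del: ennreal_plus)
      qed
      finally show ?thesis .
    qed
    then have "emeasure W (D \<inter> S K) \<le> 0 + ennreal \<epsilon>" if "0 < \<epsilon>" for \<epsilon> using that by simp
    then have "emeasure W (D \<inter> S K) \<le> 0" by (rule ennreal_le_epsilon)
    then show ?thesis by simp
  qed
  have "AE z in W. z \<in> (\<Union>K. S K)"
  proof -
    have "AE y in Q1. tempered \<rho> y \<and> summable (\<lambda>k. \<rho> ^ k * (real (y (int k)) + exp (filt p \<theta> (int k) y)))"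
      using Q1.AE_tempered[OF Q1.\<rho>] Q1.AE_summable_intensity by (rule AE_conjI)
    then have "AE y in Q1. AE y' in Q2. (y, y') \<in> (\<Union>K. S K)"
    proof eventually_elim
      case (elim y)
      show ?case using Q2.AE_tempered[OF Q1.\<rho>]
      proof eventually_elim
        case (elim y')
        show ?case using ratio_bounded_pointwise[of y y'] \<open>tempered \<rho> y \<and> _\<close> elim by (auto simp: S_def)
      qed
    qed
    moreover have "{z \<in> space W. z \<in> (\<Union>K. S K)} = (\<Union>K. S K)" by auto
    then have "{z \<in> space W. z \<in> (\<Union>K. S K)} \<in> sets W"
      using S_meas by (simp only: setsW) (intro sets.countable_UN, auto)
    ultimately show ?thesis unfolding W_def by (intro AE_pair_measure)
  qed
  moreover have "AE z in W. z \<notin> D \<inter> S K" for K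
    using DS[of K] by (intro AE_not_in) (auto simp: null_sets_def setsW)
  then have "AE z in W. \<forall>K. z \<notin> D \<inter> S K" unfolding AE_all_countable by blast
  ultimately have "AE z in W. z \<notin> D" by eventually_elim auto
  moreover have "D \<in> sets W" by (simp add: setsW)
  ultimately have D0: "emeasure W D = 0" by (simp add: AE_iff_measurable[OF _ refl])
  \<comment> \<open>Independent samples almost surely agree about \<open>E\<close>, so both mixed
    products vanish; this leaves only the common values 0 and 1.\<close>
  have "emeasure Q1 E * emeasure Q2 (- E) = 0" "emeasure Q1 (- E) * emeasure Q2 E = 0"
  proof -
    have cE: "- E \<in> sets obs_space" using sets.compl_sets[OF E] by (simp add: Compl_eq_Diff_UNIV)
    have "emeasure W (E \<times> (- E)) \<le> emeasure W D" "emeasure W ((- E) \<times> E) \<le> emeasure W D"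
      by (rule emeasure_mono[OF _ \<open>D \<in> sets W\<close>], force simp: D_def)+
    moreover have "emeasure W (E \<times> (- E)) = emeasure Q1 E * emeasure Q2 (- E)"
      "emeasure W ((- E) \<times> E) = emeasure Q1 (- E) * emeasure Q2 E"
      unfolding W_def using cE by (subst Q2.emeasure_pair_measure_Times; simp)+
    ultimately show "emeasure Q1 E * emeasure Q2 (- E) = 0" "emeasure Q1 (- E) * emeasure Q2 E = 0"
      using D0 by simp_all
  qed
  then have "measure Q1 E * measure Q2 (- E) = 0" "measure Q1 (- E) * measure Q2 E = 0"
    by (auto simp: measure_def)
  moreover have "measure Q1 (- E) = 1 - measure Q1 E" "measure Q2 (- E) = 1 - measure Q2 E"
    using Q1.prob_compl[of E] Q2.prob_compl[of E] by (simp_all add: Compl_eq_Diff_UNIV)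
  ultimately have "measure Q1 E = 0 \<or> measure Q2 E = 1" "measure Q1 E = 1 \<or> measure Q2 E = 0" by auto
  then show ?thesis by fastforce
qed

end

text \<open>Convergence through countable quantifiers, so that the set of convergent sequences is
  visibly measurable.\<close>

lemma LIMSEQ_iff_inverse_Suc:
  "X \<longlonglongrightarrow> c \<longleftrightarrow> (\<forall>i. \<exists>N. \<forall>n\<ge>N. \<bar>X n - c\<bar> \<le> 1 / real (Suc i))"
proof
  assume "X \<longlonglongrightarrow> c"
  then show "\<forall>i. \<exists>N. \<forall>n\<ge>N. \<bar>X n - c\<bar> \<le> 1 / real (Suc i)"
  proof (intro allI)
    fix i
    have "eventually (\<lambda>n. dist (X n) c < 1 / real (Suc i)) sequentially"
      using \<open>X \<longlonglongrightarrow> c\<close> by (rule tendstoD) simp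
    then show "\<exists>N. \<forall>n\<ge>N. \<bar>X n - c\<bar> \<le> 1 / real (Suc i)"
      unfolding eventually_sequentially dist_real_def by (meson less_imp_le)
  qed
next
  assume *: "\<forall>i. \<exists>N. \<forall>n\<ge>N. \<bar>X n - c\<bar> \<le> 1 / real (Suc i)"
  show "X \<longlonglongrightarrow> c"
  proof (rule tendstoI)
    fix e :: real assume "0 < e"
    then obtain i where i: "1 / real (Suc i) < e" using nat_approx_posE by blast
    obtain N where "\<forall>n\<ge>N. \<bar>X n - c\<bar> \<le> 1 / real (Suc i)" using * by blast
    then show "eventually (\<lambda>n. dist (X n) c < e) sequentially"
      unfolding eventually_sequentially dist_real_def using i by (meson le_less_trans)
  qed
qed

text \<open>Ergodicity is the case of two independent copies of one law.\<close>

lemma (in obs_model) ergodic_map_shift: "ergodic_map Q (shift 1)"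
proof -
  interpret T: two_laws p q \<theta> B C \<rho> Q Q ..
  show ?thesis
  proof unfold_locales
    show "shift 1 \<in> measurable Q Q" by measurable
    have "distr Q Q (shift 1) = distr Q obs_space (shift 1)" by (rule distr_cong) auto
    then show "distr Q Q (shift 1) = Q" by (simp only: distr_shift_Q)
    fix E assume "E \<in> sets Q" "\<And>x. x \<in> space Q \<Longrightarrow> shift 1 x \<in> E \<longleftrightarrow> x \<in> E"
    then show "prob E = 0 \<or> prob E = 1" using T.invariant_events_agree[of E] by simp
  qed
qed

text \<open>The paths along which the frequency of \<open>A\<close> tends to its
  \<open>Q1\<close>-probability form an invariant event, since dropping one term does not change the
  limit. It has probability 1 under \<open>Q1\<close>, hence under \<open>Q2\<close>, where the
  frequency tends to the \<open>Q2\<close>-probability of \<open>A\<close>.\<close>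

lemma (in two_laws) unique: "Q1 = Q2"
proof (rule measure_eqI)
  fix A assume "A \<in> sets Q1"
  then have A [measurable]: "A \<in> sets obs_space" by simp
  interpret E1: ergodic_map Q1 "shift 1" by (rule Q1.ergodic_map_shift)
  interpret E2: ergodic_map Q2 "shift 1" by (rule Q2.ergodic_map_shift)
  define f where "f = indicat_real A"
  have [measurable]: "f \<in> borel_measurable obs_space" unfolding f_def by measurable
  have i1: "integrable Q1 f" unfolding f_def by (rule Q1.integrable_const_bound[where B = 1]) auto
  have i2: "integrable Q2 f" unfolding f_def by (rule Q2.integrable_const_bound[where B = 1]) auto
  define X where "X y n = E1.bsum f n y / real n" for y n
  have X_meas [measurable]: "(\<lambda>y. X y n) \<in> borel_measurable obs_space" for n
    unfolding X_def using E1.bsum_meas[of f n] by (simp cong: measurable_cong_sets)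
  define c where "c = measure Q1 A"
  define E where "E = {y. X y \<longlonglongrightarrow> c}"
  have "{y \<in> space obs_space. \<forall>i. \<exists>N. \<forall>n\<ge>N. \<bar>X y n - c\<bar> \<le> 1 / real (Suc i)} \<in> sets obs_space"
    by measurable
  then have E [measurable]: "E \<in> sets obs_space" by (simp add: E_def LIMSEQ_iff_inverse_Suc)
  have inv: "shift 1 y \<in> E \<longleftrightarrow> y \<in> E" for y
  proof -
    have step: "X y (Suc n) = f y / real (Suc n) + X (shift 1 y) n * (real n / real (Suc n))" for n
      by (cases "n = 0") (auto simp: X_def E1.bsum_Suc add_divide_distrib, simp add: E1.bsum_def)
    have r: "(\<lambda>n. real n / real (Suc n)) \<longlonglongrightarrow> 1" by (rule LIMSEQ_n_over_Suc_n)
    have z: "(\<lambda>n. f y / real (Suc n)) \<longlonglongrightarrow> 0"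
      using tendsto_mult[OF tendsto_const[of "f y"] LIMSEQ_inverse_real_of_nat] by (simp add: divide_inverse)
    have r': "(\<lambda>n. real (Suc n) / real n) \<longlonglongrightarrow> 1" by (rule LIMSEQ_Suc_n_over_n)
    show ?thesis
    proof
      assume "shift 1 y \<in> E"
      then have "(\<lambda>n. f y / real (Suc n) + X (shift 1 y) n * (real n / real (Suc n))) \<longlonglongrightarrow> 0 + c * 1"
        unfolding E_def by (intro tendsto_intros z r) auto
      then have "(\<lambda>n. X y (Suc n)) \<longlonglongrightarrow> c" by (simp add: step)
      then show "y \<in> E" by (simp add: E_def filterlim_sequentially_Suc)
    next
      assume "y \<in> E"
      then have "(\<lambda>n. X y (Suc n)) \<longlonglongrightarrow> c" by (simp add: E_def filterlim_sequentially_Suc)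
      then have l: "(\<lambda>n. (X y (Suc n) - f y / real (Suc n)) * (real (Suc n) / real n)) \<longlonglongrightarrow> (c - 0) * 1"
        by (intro tendsto_intros z r')
      have "eventually (\<lambda>n. (X y (Suc n) - f y / real (Suc n)) * (real (Suc n) / real n) = X (shift 1 y) n) sequentially"
        using eventually_gt_at_top[of 0] by eventually_elim (simp only: step, simp)
      from Lim_transform_eventually[OF l this] show "shift 1 y \<in> E" by (simp add: E_def)
    qed
  qed
  have a1: "AE y in Q1. X y \<longlonglongrightarrow> c"
    using E1.ergodic_theorem[OF i1] A unfolding X_def c_def by (simp add: f_def)
  then have "AE y in Q1. y \<in> E" by (simp add: E_def)
  then have "measure Q1 E = 1" by (subst Q1.prob_eq_1) auto
  then have "measure Q2 E = 1" using invariant_events_agree[OF E inv] by simp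
  then have "AE y in Q2. y \<in> E" by (subst (asm) Q2.prob_eq_1) auto
  moreover have "AE y in Q2. X y \<longlonglongrightarrow> measure Q2 A"
    using E2.ergodic_theorem[OF i2] A unfolding X_def by (simp add: f_def)
  ultimately have "AE y in Q2. c = measure Q2 A"
    by eventually_elim (auto simp: E_def intro: LIMSEQ_unique)
  then have "c = measure Q2 A" by simp
  then show "emeasure Q1 A = emeasure Q2 A"
    by (simp add: c_def Q1.emeasure_eq_measure Q2.emeasure_eq_measure)
qed simp

section \<open>Existence\<close>

text \<open>The diagonal extraction, obtained from compactness of a countable power of the unit
  interval after enumerating \<open>S\<close>.\<close>

lemma bounded_array_subsequence:
  fixes f :: "nat \<Rightarrow> 'a \<Rightarrow> real"
  assumes "countable S" and f: "\<And>n x. x \<in> S \<Longrightarrow> f n x \<in> {0..1}"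
  obtains r where "strict_mono (r :: nat \<Rightarrow> nat)" "\<And>x. x \<in> S \<Longrightarrow> \<exists>l. (\<lambda>n. f (r n) x) \<longlonglongrightarrow> l"
proof -
  define K :: "(nat \<Rightarrow> real) set" where "K = PiE UNIV (\<lambda>_. {0..1})"
  have "compactin (product_topology (\<lambda>_. euclidean) UNIV) K"
    unfolding K_def by (simp add: compactin_PiE)
  then have "compact K" by (simp add: euclidean_product_topology)
  then have sc: "seq_compact K" by (simp add: compact_eq_seq_compact_metric)
  define g where "g n i = (if i \<in> to_nat_on S ` S then f n (from_nat_into S i) else 0)" for n i
  have "g n \<in> K" for n
    using f assms(1) by (auto simp: K_def g_def PiE_UNIV_domain)
  then obtain l r where r: "strict_mono (r :: nat \<Rightarrow> nat)" "(g \<circ> r) \<longlonglongrightarrow> l"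
    using sc unfolding seq_compact_def by blast
  show ?thesis
  proof (rule that[OF r(1)])
    fix x assume x: "x \<in> S"
    define i where "i = to_nat_on S x"
    have "continuous_on UNIV (\<lambda>h :: nat \<Rightarrow> real. h i)" by (rule continuous_on_product_coordinates)
    then have "isCont (\<lambda>h :: nat \<Rightarrow> real. h i) l"
      by (rule continuous_on_eq_continuous_at[OF open_UNIV, THEN iffD1, rule_format]) simp
    then have "(\<lambda>n. (g \<circ> r) n i) \<longlonglongrightarrow> l i" using r(2) by (rule isCont_tendsto_compose)
    moreover have "(g \<circ> r) n i = f (r n) x" for n
      using x assms(1) by (simp add: g_def i_def from_nat_into_to_nat_on)
    ultimately show "\<exists>l. (\<lambda>n. f (r n) x) \<longlonglongrightarrow> l" by auto
  qed
qed

text \<open>Filling with zeros keeps windows in the type of full sequences, so functions of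
  sequences apply to them directly while the range stays countable.\<close>

definition win :: "nat \<Rightarrow> (int \<Rightarrow> nat) \<Rightarrow> int \<Rightarrow> nat" where
  "win m y j = (if j \<in> {- int m..int m} then y j else 0)"

lemma win_win: "m \<le> m' \<Longrightarrow> win m (win m' y) = win m y"
  by (auto simp: win_def fun_eq_iff)

lemma win_idem [simp]: "win m (win m y) = win m y"
  by (simp add: win_win)

lemma measurable_win [measurable]: "win m \<in> measurable obs_space obs_space"
  by (rule measurable_into_obs) (simp add: win_def)

lemma countable_windows: "countable (range (win m))"
proof -
  have "countable (PiE {- int m..int m} (\<lambda>_. UNIV :: nat set))" by (rule countable_PiE) auto
  moreover have "range (win m) \<subseteq> (\<lambda>f j. if j \<in> {- int m..int m} then f j else 0) ` PiE {- int m..int m} (\<lambda>_. UNIV)"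
  proof
    fix z assume "z \<in> range (win m)"
    then obtain y where z: "z = win m y" by auto
    show "z \<in> (\<lambda>f j. if j \<in> {- int m..int m} then f j else 0) ` PiE {- int m..int m} (\<lambda>_. UNIV)"
      by (rule image_eqI[of _ _ "restrict y {- int m..int m}"]) (auto simp: z win_def fun_eq_iff)
  qed
  ultimately show ?thesis by (meson countable_image countable_subset)
qed

section \<open>The chain started from an all-zero past, and its averages\<close>

context model
begin

lemma tempered_finite_support:
  assumes "\<And>j. j < 0 \<Longrightarrow> y j = 0"
  shows "tempered \<rho> y"
  unfolding tempered_def
proof
  fix k
  show "summable (\<lambda>j. \<rho> ^ j * lnobs y (k - int j))"
    by (rule summable_finite[of "{..nat k}"]) (auto simp: lnobs_def assms)
qed

text \<open>The joint law of the observations at times 0 to N - 1, zero elsewhere. The all-zero past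
  puts the filter at \<open>cst\<close>, and finitely supported sequences keep everything discrete
  and all series finite.\<close>

primrec chain :: "nat \<Rightarrow> (int \<Rightarrow> nat) pmf" where
  "chain 0 = return_pmf (\<lambda>_. 0)"
| "chain (Suc k) = bind_pmf (chain k) (\<lambda>y. map_pmf (\<lambda>n. y(int k := n)) (poisson_pmf (exp (filt p \<theta> (int k) y))))"

lemma chain_support: "y \<in> set_pmf (chain N) \<Longrightarrow> j < 0 \<or> int N \<le> j \<Longrightarrow> y j = 0"
proof (induction N arbitrary: y)
  case (Suc N)
  then obtain y' n where "y' \<in> set_pmf (chain N)" "y = y'(int N := n)" by auto
  then show ?case using Suc.IH[of y'] Suc.prems by auto
qed simp

lemma chain_trunc: "m \<le> N \<Longrightarrow> map_pmf (trunc (int m)) (chain N) = chain m"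
proof (induction N)
  case 0
  then show ?case by (simp add: trunc_def)
next
  case (Suc N)
  have id: "map_pmf (trunc (int M)) (chain M) = chain M" for M
  proof -
    have "map_pmf (trunc (int M)) (chain M) = map_pmf (\<lambda>y. y) (chain M)"
      by (intro map_pmf_cong) (auto simp: trunc_def fun_eq_iff chain_support)
    then show ?thesis by simp
  qed
  show ?case
  proof (cases "m = Suc N")
    case False
    then have m: "m \<le> N" using Suc.prems by simp
    have tr: "trunc (int m) (y(int N := n)) = trunc (int m) y" for y n
      using m by (auto simp: trunc_def fun_eq_iff)
    have "map_pmf (trunc (int m)) (chain (Suc N)) = bind_pmf (chain N) (\<lambda>y. return_pmf (trunc (int m) y))"
      by (simp add: map_bind_pmf pmf.map_comp o_def tr map_pmf_const)
    also have "\<dots> = map_pmf (trunc (int m)) (chain N)" by (simp add: map_pmf_def)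
    finally show ?thesis using Suc.IH m by simp
  next
    case True
    show ?thesis unfolding True by (rule id)
  qed
qed

lemma nn_integral_chain_trunc:
  assumes "m \<le> N" "\<And>y. h (trunc (int m) y) = h y"
  shows "(\<integral>\<^sup>+y. h y \<partial>chain N) = (\<integral>\<^sup>+y. h y \<partial>chain m)"
proof -
  have "(\<integral>\<^sup>+y. h y \<partial>chain m) = (\<integral>\<^sup>+y. h (trunc (int m) y) \<partial>chain N)"
    by (subst chain_trunc[OF assms(1), symmetric]) (simp add: nn_integral_map_pmf)
  then show ?thesis by (simp add: assms(2))
qed

lemma chain_one_step:
  fixes \<psi> :: "nat \<Rightarrow> (int \<Rightarrow> nat) \<Rightarrow> ennreal"
  assumes k: "k < N"
  shows "(\<integral>\<^sup>+y. \<psi> (y (int k)) (trunc (int k) y) \<partial>chain N) =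
    (\<integral>\<^sup>+y. (\<Sum>n. \<psi> n (trunc (int k) y) * ennreal (g_dens (filt p \<theta> (int k) y) n)) \<partial>chain N)"
proof -
  have "(\<integral>\<^sup>+y. \<psi> (y (int k)) (trunc (int k) y) \<partial>chain N) = (\<integral>\<^sup>+y. \<psi> (y (int k)) (trunc (int k) y) \<partial>chain (Suc k))"
    using k by (intro nn_integral_chain_trunc) (auto simp: trunc_trunc, simp add: trunc_def)
  also have "\<dots> = (\<integral>\<^sup>+y. (\<Sum>n. \<psi> n (trunc (int k) y) * ennreal (g_dens (filt p \<theta> (int k) y) n)) \<partial>chain k)"
  proof -
    have tr: "trunc (int k) (y(int k := n)) = trunc (int k) y" for y n
      by (auto simp: trunc_def fun_eq_iff)
    show ?thesis
      by (simp add: nn_integral_bind_pmf nn_integral_map_pmf tr nn_integral_measure_pmf[of "poisson_pmf _"]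
          nn_integral_count_space_nat pmf_poisson_g_dens mult.commute del: pmf_poisson)
  qed
  also have "\<dots> = (\<integral>\<^sup>+y. (\<Sum>n. \<psi> n (trunc (int k) y) * ennreal (g_dens (filt p \<theta> (int k) y) n)) \<partial>chain N)"
    using k by (intro nn_integral_chain_trunc[symmetric]) (auto simp: trunc_trunc filt_trunc)
  finally show ?thesis .
qed

lemma chain_one_step_indicator:
  fixes \<phi> :: "(int \<Rightarrow> nat) \<Rightarrow> ennreal"
  assumes k: "k < N"
  shows "(\<integral>\<^sup>+y. \<phi> (trunc (int k) y) * indicator {y. y (int k) = n} y \<partial>chain N) =
    (\<integral>\<^sup>+y. \<phi> (trunc (int k) y) * ennreal (g_dens (filt p \<theta> (int k) y) n) \<partial>chain N)"
proof -
  have s: "(\<Sum>i. (\<phi> z * indicator {n} i) * ennreal (g_dens x i)) = \<phi> z * ennreal (g_dens x n)" for z x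
  proof -
    have "(\<lambda>i. (\<phi> z * indicator {n} i) * ennreal (g_dens x i)) sums (\<Sum>i\<in>{n}. (\<phi> z * indicator {n} i) * ennreal (g_dens x i))"
      by (rule sums_finite) auto
    then show ?thesis by (simp add: sums_iff)
  qed
  have "(\<integral>\<^sup>+y. \<phi> (trunc (int k) y) * indicator {y. y (int k) = n} y \<partial>chain N) =
    (\<integral>\<^sup>+y. \<phi> (trunc (int k) y) * indicator {n} (y (int k)) \<partial>chain N)"
    by (intro nn_integral_cong) (auto simp: indicator_def)
  also have "\<dots> = (\<integral>\<^sup>+y. \<phi> (trunc (int k) y) * ennreal (g_dens (filt p \<theta> (int k) y) n) \<partial>chain N)"
    using chain_one_step[OF k, of "\<lambda>m z. \<phi> z * indicator {n} m"] by (simp add: s)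
  finally show ?thesis .
qed

definition noise :: "int \<Rightarrow> (int \<Rightarrow> nat) \<Rightarrow> real" where
  "noise k y = \<bar>log_noise (filt p \<theta> k y) (y k)\<bar>"

text \<open>The first part bounds the mean noise inside the chain. The second covers the lags
  reaching before time 0, where the filter equals \<open>cst\<close> and the observation is
  0.\<close>

definition noise_const :: real where
  "noise_const = (exp 3 + 1) + \<bar>log_noise (cst p \<theta>) 0\<bar>"

lemma filt_before_start:
  assumes "\<And>j. j < 0 \<Longrightarrow> y j = 0" "k \<le> 0"
  shows "filt p \<theta> k y = cst p \<theta>"
  using assms by (simp add: filt_def lnobs_def)

lemma chain_noise:
  assumes "k < int N"
  shows "(\<integral>\<^sup>+y. ennreal (noise k y) \<partial>chain N) \<le> ennreal noise_const"
proof (cases "0 \<le> k")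
  case True
  define \<psi> where "\<psi> n y = ennreal \<bar>log_noise (filt p \<theta> k y) n\<bar>" for n y
  have k: "int (nat k) = k" "nat k < N" using True assms by auto
  have "(\<integral>\<^sup>+y. ennreal (noise k y) \<partial>chain N) = (\<integral>\<^sup>+y. \<psi> (y k) (trunc k y) \<partial>chain N)"
    by (simp add: noise_def \<psi>_def filt_trunc)
  also have "\<dots> = (\<integral>\<^sup>+y. (\<Sum>n. \<psi> n (trunc k y) * ennreal (g_dens (filt p \<theta> k y) n)) \<partial>chain N)"
    using chain_one_step[OF k(2), of \<psi>] by (simp only: k(1))
  also have "\<dots> \<le> (\<integral>\<^sup>+y. ennreal (exp 3 + 1) \<partial>chain N)"
  proof (intro nn_integral_mono)
    fix y
    have "(\<Sum>n. \<psi> n (trunc k y) * ennreal (g_dens (filt p \<theta> k y) n)) \<le>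
        (\<Sum>n. ennreal (g_dens (filt p \<theta> k y) n * exp (real 1 * \<bar>log_noise (filt p \<theta> k y) n\<bar>)))"
    proof (intro suminf_le)
      fix n
      define a where "a = \<bar>log_noise (filt p \<theta> k y) n\<bar>"
      have "a \<le> exp a" using exp_ge_add_one_self[of a] by linarith
      then have "a * g_dens (filt p \<theta> k y) n \<le> g_dens (filt p \<theta> k y) n * exp (real 1 * a)"
        by (simp add: mult.commute mult_right_mono)
      then show "\<psi> n (trunc k y) * ennreal (g_dens (filt p \<theta> k y) n) \<le>
          ennreal (g_dens (filt p \<theta> k y) n * exp (real 1 * \<bar>log_noise (filt p \<theta> k y) n\<bar>))"
        by (simp add: \<psi>_def filt_trunc ennreal_mult[symmetric] ennreal_leI a_def)
    qed auto
    also have "\<dots> \<le> ennreal (fact 1 * (exp 3 + 1))" by (rule log_noise_moment)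
    finally show "(\<Sum>n. \<psi> n (trunc k y) * ennreal (g_dens (filt p \<theta> k y) n)) \<le> ennreal (exp 3 + 1)" by simp
  qed
  also have "\<dots> = ennreal (exp 3 + 1)" by (simp add: measure_pmf.emeasure_space_1[simplified])
  also have "\<dots> \<le> ennreal noise_const" by (intro ennreal_leI) (simp add: noise_const_def)
  finally show ?thesis .
next
  case False
  have "(\<integral>\<^sup>+y. ennreal (noise k y) \<partial>chain N) \<le> (\<integral>\<^sup>+y. ennreal noise_const \<partial>chain N)"
  proof (rule nn_integral_mono_AE, rule AE_pmfI)
    fix y assume "y \<in> set_pmf (chain N)"
    then have "y j = 0" if "j < 0" for j using chain_support that by blast
    then show "ennreal (noise k y) \<le> ennreal noise_const"
      using False by (intro ennreal_leI) (simp add: noise_def noise_const_def filt_before_start add_nonneg_nonneg)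
  qed
  then show ?thesis by (simp add: measure_pmf.emeasure_space_1[simplified])
qed

text \<open>What \<open>filter_bound\<close> gives in mean when started at time 0: the geometric sum
  of the mean forcing, plus the effect of initial values all equal to \<open>cst\<close>.\<close>

definition filt_const :: real where
  "filt_const = C * (B * (1 + real q * noise_const) / (1 - \<rho>)) +
     real (max p q) * C * (1 + B) * (real (max p q) * \<bar>cst p \<theta>\<bar>)"

lemma noise_const_nonneg: "0 \<le> noise_const"
  by (simp add: noise_const_def add_nonneg_nonneg)

lemma geometric_sum_le:
  "(\<Sum>l=1..n. \<rho> ^ (n - l)) \<le> 1 / (1 - \<rho>)"
proof -
  have "(\<Sum>l=1..n. \<rho> ^ (n - l)) = (\<Sum>i<n. \<rho> ^ i)"
    by (rule sum.reindex_bij_witness[of _ "\<lambda>i. n - i" "\<lambda>l. n - l"]) auto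
  also have "\<dots> \<le> (\<Sum>i. \<rho> ^ i)" using \<rho> by (intro sum_le_suminf summable_geometric) auto
  also have "\<dots> = 1 / (1 - \<rho>)" using \<rho> by (simp add: suminf_geometric)
  finally show ?thesis .
qed

lemma chain_filt:
  assumes "n \<le> N"
  shows "(\<integral>\<^sup>+y. ennreal \<bar>filt p \<theta> (int n) y\<bar> \<partial>chain N) \<le> ennreal filt_const"
proof -
  define r where "r = max p q"
  define T where "T = real r * C * (1 + B) * (real r * \<bar>cst p \<theta>\<bar>)"
  have T0: "0 \<le> T" using C B by (simp add: T_def)
  have "(\<integral>\<^sup>+y. ennreal \<bar>filt p \<theta> (int n) y\<bar> \<partial>chain N) \<le>
      (\<integral>\<^sup>+y. ennreal T + (\<Sum>l=1..n. ennreal (C * \<rho> ^ (n - l) * B) * (1 + (\<Sum>i=1..q. ennreal (noise (int l - int i) y)))) \<partial>chain N)"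
  proof (rule nn_integral_mono_AE, rule AE_pmfI)
    fix y assume "y \<in> set_pmf (chain N)"
    then have y0: "y j = 0" if "j < 0" for j using chain_support that by blast
    have "\<bar>filt p \<theta> (0 + int n) y\<bar> \<le> C * (\<Sum>l=1..n. \<rho> ^ (n - l) *
      (B * (1 + (\<Sum>i=1..q. \<bar>log_noise (filt p \<theta> (0 + int l - int i) y) (y (0 + int l - int i))\<bar>))))
    + real (max p q) * C * (1 + B) * \<rho> ^ n * (\<Sum>i<max p q. \<bar>filt p \<theta> (0 - int i) y\<bar>)"
      by (rule filter_bound, rule filt_recursion[OF tempered_finite_support[OF y0]])
    also have "real (max p q) * C * (1 + B) * \<rho> ^ n * (\<Sum>i<max p q. \<bar>filt p \<theta> (0 - int i) y\<bar>) \<le> T"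
    proof -
      have "(\<Sum>i<r. \<bar>filt p \<theta> (0 - int i) y\<bar>) = real r * \<bar>cst p \<theta>\<bar>"
        using y0 by (simp add: filt_before_start)
      moreover have "real r * C * (1 + B) * \<rho> ^ n \<le> real r * C * (1 + B) * 1"
        using C B \<rho> by (intro mult_left_mono) (auto simp: power_le_one)
      ultimately show ?thesis
        using mult_right_mono[of "real r * C * (1 + B) * \<rho> ^ n" "real r * C * (1 + B)" "real r * \<bar>cst p \<theta>\<bar>"]
        by (simp add: T_def r_def)
    qed
    also have "C * (\<Sum>l=1..n. \<rho> ^ (n - l) *
      (B * (1 + (\<Sum>i=1..q. \<bar>log_noise (filt p \<theta> (0 + int l - int i) y) (y (0 + int l - int i))\<bar>)))) =
      (\<Sum>l=1..n. (C * \<rho> ^ (n - l) * B) * (1 + (\<Sum>i=1..q. noise (int l - int i) y)))"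
      by (simp add: sum_distrib_left noise_def mult_ac)
    finally have "ennreal \<bar>filt p \<theta> (int n) y\<bar> \<le>
        ennreal (T + (\<Sum>l=1..n. (C * \<rho> ^ (n - l) * B) * (1 + (\<Sum>i=1..q. noise (int l - int i) y))))"
      by (intro ennreal_leI) simp
    also have "\<dots> = ennreal T + (\<Sum>l=1..n. ennreal (C * \<rho> ^ (n - l) * B) * (1 + (\<Sum>i=1..q. ennreal (noise (int l - int i) y))))"
    proof -
      have nn: "0 \<le> (\<Sum>i=1..q. noise (int l - int i) y)" for l by (intro sum_nonneg) (simp add: noise_def)
      have "ennreal ((C * \<rho> ^ (n - l) * B) * (1 + (\<Sum>i=1..q. noise (int l - int i) y))) =
          ennreal (C * \<rho> ^ (n - l) * B) * (1 + (\<Sum>i=1..q. ennreal (noise (int l - int i) y)))" for l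
        using C B \<rho> nn[of l] by (subst ennreal_mult) (auto simp: ennreal_plus sum_ennreal noise_def)
      moreover have "0 \<le> (C * \<rho> ^ (n - l) * B) * (1 + (\<Sum>i=1..q. noise (int l - int i) y))" for l
        using C B \<rho> nn[of l] by auto
      ultimately show ?thesis using T0
        by (subst ennreal_plus) (auto intro!: sum_nonneg simp: sum_ennreal[symmetric] simp del: sum_ennreal)
    qed
    finally show "ennreal \<bar>filt p \<theta> (int n) y\<bar> \<le> ennreal T +
      (\<Sum>l=1..n. ennreal (C * \<rho> ^ (n - l) * B) * (1 + (\<Sum>i=1..q. ennreal (noise (int l - int i) y))))" .
  qed
  also have "\<dots> = ennreal T + (\<Sum>l=1..n. ennreal (C * \<rho> ^ (n - l) * B) *
      (1 + (\<Sum>i=1..q. \<integral>\<^sup>+y. ennreal (noise (int l - int i) y) \<partial>chain N)))"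
    by (simp add: nn_integral_add nn_integral_sum nn_integral_cmult measure_pmf.emeasure_space_1[simplified] del: sum_ennreal)
  also have "\<dots> \<le> ennreal T + (\<Sum>l=1..n. ennreal (C * \<rho> ^ (n - l) * B) * (1 + (\<Sum>i=1..q. ennreal noise_const)))"
    using assms by (intro add_left_mono sum_mono mult_left_mono chain_noise) auto
  also have "\<dots> = ennreal (T + (\<Sum>l=1..n. (C * \<rho> ^ (n - l) * B) * (1 + real q * noise_const)))"
  proof -
    have "1 + (\<Sum>i=1..q. ennreal noise_const) = ennreal (1 + real q * noise_const)"
      using noise_const_nonneg by (simp add: ennreal_plus ennreal_mult ennreal_of_nat_eq_real_of_nat)
    then show ?thesis using T0 C B \<rho> noise_const_nonneg
      by (simp add: ennreal_mult[symmetric] sum_nonneg ennreal_plus[symmetric] del: ennreal_plus)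
  qed
  also have "\<dots> \<le> ennreal filt_const"
  proof (rule ennreal_leI)
    have "(\<Sum>l=1..n. (C * \<rho> ^ (n - l) * B) * (1 + real q * noise_const)) =
        C * (B * (1 + real q * noise_const)) * (\<Sum>l=1..n. \<rho> ^ (n - l))"
      by (simp add: sum_distrib_left mult_ac)
    also have "\<dots> \<le> C * (B * (1 + real q * noise_const)) * (1 / (1 - \<rho>))"
      using C B noise_const_nonneg by (intro mult_left_mono geometric_sum_le) auto
    finally show "T + (\<Sum>l=1..n. (C * \<rho> ^ (n - l) * B) * (1 + real q * noise_const)) \<le> filt_const"
      by (simp add: filt_const_def T_def r_def)
  qed
  finally show ?thesis .
qed

definition obs_const :: real where
  "obs_const = filt_const + noise_const"

lemma filt_const_nonneg: "0 \<le> filt_const"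
  using C B \<rho> noise_const_nonneg by (simp add: filt_const_def add_nonneg_nonneg)

lemma obs_const_nonneg: "0 \<le> obs_const"
  using filt_const_nonneg noise_const_nonneg by (simp add: obs_const_def)

lemma chain_lnobs: "(\<integral>\<^sup>+y. ennreal (lnobs y k) \<partial>chain N) \<le> ennreal obs_const"
proof (cases "0 \<le> k \<and> k < int N")
  case True
  then have k: "k = int (nat k)" "nat k \<le> N" by auto
  have "(\<integral>\<^sup>+y. ennreal (lnobs y k) \<partial>chain N) \<le> (\<integral>\<^sup>+y. ennreal \<bar>filt p \<theta> k y\<bar> + ennreal (noise k y) \<partial>chain N)"
  proof (intro nn_integral_mono)
    fix y
    have "lnobs y k = max (filt p \<theta> k y) 0 + log_noise (filt p \<theta> k y) (y k)"
      by (simp add: log_noise_def lnobs_def)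
    also have "\<dots> \<le> \<bar>filt p \<theta> k y\<bar> + noise k y" unfolding noise_def by (intro add_mono) auto
    finally show "ennreal (lnobs y k) \<le> ennreal \<bar>filt p \<theta> k y\<bar> + ennreal (noise k y)"
      by (simp add: noise_def ennreal_plus[symmetric] ennreal_leI del: ennreal_plus)
  qed
  also have "\<dots> = (\<integral>\<^sup>+y. ennreal \<bar>filt p \<theta> k y\<bar> \<partial>chain N) + (\<integral>\<^sup>+y. ennreal (noise k y) \<partial>chain N)"
    by (rule nn_integral_add) auto
  also have "\<dots> \<le> ennreal filt_const + ennreal noise_const"
    using chain_filt[OF k(2)] chain_noise[of k N] True k(1) by (intro add_mono) auto
  also have "\<dots> = ennreal obs_const"
    using filt_const_nonneg noise_const_nonneg by (simp add: obs_const_def ennreal_plus)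
  finally show ?thesis .
next
  case False
  have "(\<integral>\<^sup>+y. ennreal (lnobs y k) \<partial>chain N) = (\<integral>\<^sup>+y. 0 \<partial>chain N)"
  proof (rule nn_integral_cong_AE, rule AE_pmfI)
    fix y assume "y \<in> set_pmf (chain N)"
    then have "y k = 0" using False by (intro chain_support) auto
    then show "ennreal (lnobs y k) = 0" by (simp add: lnobs_def)
  qed
  then show ?thesis by simp
qed

text \<open>The origin is moved to a uniformly chosen time k at most n. The chain has n + 1
  observations, so the new origin always carries a genuine observation and the conditional law at
  time 0 holds exactly, not merely in the limit.\<close>

definition cesaro :: "nat \<Rightarrow> (int \<Rightarrow> nat) pmf" where
  "cesaro n = bind_pmf (pmf_of_set {..n}) (\<lambda>k. map_pmf (shift (int k)) (chain (Suc n)))"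

lemma nn_integral_cesaro:
  "(\<integral>\<^sup>+y. f y \<partial>cesaro n) = (\<Sum>k\<le>n. \<integral>\<^sup>+y. f (shift (int k) y) \<partial>chain (Suc n)) / ennreal (real (Suc n))"
  by (simp add: cesaro_def nn_integral_bind_pmf nn_integral_map_pmf nn_integral_pmf_of_set ennreal_of_nat_eq_real_of_nat)

lemma integral_cesaro:
  fixes f :: "(int \<Rightarrow> nat) \<Rightarrow> real"
  assumes f: "\<And>y. \<bar>f y\<bar> \<le> K"
  shows "(\<integral>y. f y \<partial>cesaro n) = (\<Sum>k\<le>n. \<integral>y. f (shift (int k) y) \<partial>chain (Suc n)) / real (Suc n)"
proof -
  have "(\<integral>y. f y \<partial>cesaro n) = (\<integral>k. (\<integral>y. f (shift (int k) y) \<partial>chain (Suc n)) \<partial>pmf_of_set {..n})"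
    unfolding cesaro_def measure_pmf_bind
    by (subst integral_bind[where K = "count_space UNIV" and B = K and B' = 1])
       (use f in \<open>auto simp: measure_pmf.emeasure_space_1[simplified] intro!: measure_pmf_in_subprob_algebra\<close>)
  then show ?thesis by (simp add: integral_pmf_of_set)
qed

lemma cesaro_lnobs: "(\<integral>\<^sup>+y. ennreal (lnobs y j) \<partial>cesaro n) \<le> ennreal obs_const"
proof -
  have "(\<Sum>k\<le>n. \<integral>\<^sup>+y. ennreal (lnobs (shift (int k) y) j) \<partial>chain (Suc n)) \<le> (\<Sum>k\<le>n. ennreal obs_const)"
    unfolding lnobs_shift by (intro sum_mono chain_lnobs)
  also have "\<dots> = ennreal (real (Suc n) * obs_const)"
    using obs_const_nonneg by (simp add: ennreal_mult ennreal_of_nat_eq_real_of_nat)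
  finally have "(\<integral>\<^sup>+y. ennreal (lnobs y j) \<partial>cesaro n) \<le> ennreal (real (Suc n) * obs_const) / ennreal (real (Suc n))"
    unfolding nn_integral_cesaro by (intro divide_right_mono_ennreal)
  also have "\<dots> = ennreal obs_const"
    using obs_const_nonneg by (subst divide_ennreal) (auto simp del: of_nat_Suc)
  finally show ?thesis .
qed

lemma cesaro_one_step:
  fixes \<phi> :: "(int \<Rightarrow> nat) \<Rightarrow> ennreal"
  shows "(\<integral>\<^sup>+y. \<phi> (trunc 0 y) * indicator {y. y 0 = i} y \<partial>cesaro n) =
    (\<integral>\<^sup>+y. \<phi> (trunc 0 y) * ennreal (g_dens (filt p \<theta> 0 y) i) \<partial>cesaro n)"
proof -
  have "(\<integral>\<^sup>+y. \<phi> (trunc 0 (shift (int k) y)) * indicator {y. y 0 = i} (shift (int k) y) \<partial>chain (Suc n)) =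
    (\<integral>\<^sup>+y. \<phi> (trunc 0 (shift (int k) y)) * ennreal (g_dens (filt p \<theta> 0 (shift (int k) y)) i) \<partial>chain (Suc n))"
    if "k \<le> n" for k
  proof -
    have "indicator {y. y 0 = i} (shift (int k) y) = (indicator {y. y (int k) = i} y :: ennreal)" for y
      by (simp add: indicator_def shift_def)
    then show ?thesis
      using chain_one_step_indicator[of k "Suc n" "\<lambda>z. \<phi> (shift (int k) z)" i] that
      by (simp add: shift_trunc filt_shift)
  qed
  then show ?thesis unfolding nn_integral_cesaro by simp
qed

text \<open>The shift moves the averaged origins by one; the sums telescope and only the two end
  terms survive.\<close>

lemma cesaro_shift:
  fixes f :: "(int \<Rightarrow> nat) \<Rightarrow> real"
  assumes f: "\<And>y. \<bar>f y\<bar> \<le> K"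
  shows "\<bar>(\<integral>y. f (shift 1 y) \<partial>cesaro n) - (\<integral>y. f y \<partial>cesaro n)\<bar> \<le> 2 * K / real (Suc n)"
proof -
  define a where "a k = (\<integral>y. f (shift (int k) y) \<partial>chain (Suc n))" for k
  have aK: "\<bar>a k\<bar> \<le> K" for k
  proof -
    have i: "integrable (chain (Suc n)) (\<lambda>y. f (shift (int k) y))"
      by (rule measure_pmf.integrable_const_bound[where B = K]) (use f in auto)
    have "\<bar>a k\<bar> \<le> (\<integral>y. \<bar>f (shift (int k) y)\<bar> \<partial>chain (Suc n))" unfolding a_def by (rule integral_abs_bound)
    also have "\<dots> \<le> (\<integral>y. K \<partial>chain (Suc n))" using i f by (intro integral_mono) auto
    finally show ?thesis by simp
  qed
  have tele: "(\<Sum>k\<le>m. b (Suc k)) - (\<Sum>k\<le>m. b k) = b (Suc m) - b 0" for m and b :: "nat \<Rightarrow> real"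
    by (induction m) auto
  have 1: "shift 1 (shift (int k) y) = shift (int (Suc k)) y" for k and y :: "int \<Rightarrow> nat"
    by (simp add: shift_shift)
  have "(\<integral>y. f (shift 1 y) \<partial>cesaro n) - (\<integral>y. f y \<partial>cesaro n) =
      ((\<Sum>k\<le>n. a (Suc k)) - (\<Sum>k\<le>n. a k)) / real (Suc n)"
    using integral_cesaro[of "\<lambda>y. f (shift 1 y)" K n] integral_cesaro[of f K n] f
    by (simp add: a_def 1 diff_divide_distrib)
  also have "(\<Sum>k\<le>n. a (Suc k)) - (\<Sum>k\<le>n. a k) = a (Suc n) - a 0"
    by (rule tele)
  also have "\<bar>(a (Suc n) - a 0) / real (Suc n)\<bar> \<le> 2 * K / real (Suc n)"
    using aK[of "Suc n"] aK[of 0] by (simp add: abs_divide divide_right_mono del: of_nat_Suc)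
  finally show ?thesis .
qed

lemma cesaro_tight:
  assumes \<epsilon>: "0 < \<epsilon>"
  shows "\<exists>S. finite S \<and> (\<forall>n. 1 - \<epsilon> \<le> measure (map_pmf (win m) (cesaro n)) S)"
proof -
  define W where "W = {- int m..int m}"
  have cardW: "card W = 2 * m + 1" by (simp add: W_def)
  \<comment> \<open>Level for Markov's inequality applied to ln(1 + y_j): the 2m + 1 coordinates of
    the window each exceed it with probability at most \<open>obs_const / b\<close>, together at
    most \<epsilon>. Adding 1 keeps \<open>b\<close> positive.\<close>
  define b where "b = (2 * real m + 1) * obs_const / \<epsilon> + 1"
  have b: "0 < b" using \<epsilon> obs_const_nonneg by (simp add: b_def add_nonneg_pos)
  obtain N :: nat where N: "exp b \<le> real N" using real_arch_simple by blast
  define S where "S = (\<lambda>f j. if j \<in> W then f j else 0) ` PiE W (\<lambda>_. {..N})"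
  have "finite S" unfolding S_def by (intro finite_imageI finite_PiE) (auto simp: W_def)
  moreover have "1 - \<epsilon> \<le> measure (map_pmf (win m) (cesaro n)) S" for n
  proof -
    have tail: "measure (cesaro n) {y. N < y j} \<le> obs_const / b" for j
    proof -
      have "ennreal b * emeasure (cesaro n) {y. N < y j} = (\<integral>\<^sup>+y. ennreal b * indicator {y. N < y j} y \<partial>cesaro n)"
        by (subst nn_integral_cmult_indicator) auto
      also have "\<dots> \<le> (\<integral>\<^sup>+y. ennreal (lnobs y j) \<partial>cesaro n)"
      proof (intro nn_integral_mono)
        fix y
        have "b \<le> lnobs y j" if "N < y j"
        proof -
          have "exp b \<le> 1 + real (y j)" using N that by linarith
          then have "ln (exp b) \<le> ln (1 + real (y j))" by (subst ln_le_cancel_iff) (auto intro: add_pos_nonneg)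
          then show ?thesis by (simp add: lnobs_def)
        qed
        then show "ennreal b * indicator {y. N < y j} y \<le> ennreal (lnobs y j)"
          by (auto simp: indicator_def ennreal_leI)
      qed
      also have "\<dots> \<le> ennreal obs_const" by (rule cesaro_lnobs)
      finally have "b * measure (cesaro n) {y. N < y j} \<le> obs_const"
        using b obs_const_nonneg by (simp add: measure_pmf.emeasure_eq_measure ennreal_mult[symmetric])
      then show ?thesis using b by (simp add: pos_le_divide_eq mult.commute)
    qed
    have sub: "{y. win m y \<notin> S} \<subseteq> (\<Union>j\<in>W. {y. N < y j})"
    proof
      fix y assume y: "y \<in> {y. win m y \<notin> S}"
      show "y \<in> (\<Union>j\<in>W. {y. N < y j})"
      proof (rule ccontr)
        assume "y \<notin> (\<Union>j\<in>W. {y. N < y j})"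
        then have "restrict y W \<in> PiE W (\<lambda>_. {..N})" by (auto simp: not_less)
        then have "win m y \<in> S" unfolding S_def
          by (intro image_eqI[of _ _ "restrict y W"]) (auto simp: win_def W_def fun_eq_iff)
        then show False using y by simp
      qed
    qed
    have "measure (cesaro n) {y. win m y \<notin> S} \<le> measure (cesaro n) (\<Union>j\<in>W. {y. N < y j})"
      using sub by (intro measure_pmf.finite_measure_mono) auto
    also have "\<dots> \<le> (\<Sum>j\<in>W. measure (cesaro n) {y. N < y j})"
      by (intro measure_pmf.finite_measure_subadditive_finite) (auto simp: W_def)
    also have "\<dots> \<le> (\<Sum>j\<in>W. obs_const / b)" by (intro sum_mono tail)
    also have "\<dots> = (2 * real m + 1) * obs_const / b" by (simp add: cardW)
    also have "\<dots> \<le> \<epsilon>"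
    proof -
      have "(2 * real m + 1) * obs_const \<le> \<epsilon> * b" using \<epsilon> by (simp add: b_def field_simps)
      then show ?thesis using b by (simp add: pos_divide_le_eq)
    qed
    finally have "measure (cesaro n) {y. win m y \<notin> S} \<le> \<epsilon>" .
    moreover have "measure (cesaro n) {y. win m y \<notin> S} = 1 - measure (cesaro n) {y. win m y \<in> S}"
      using measure_pmf.prob_compl[of "{y. win m y \<in> S}" "cesaro n"] by (simp add: set_diff_eq)
    moreover have "measure (map_pmf (win m) (cesaro n)) S = measure (cesaro n) {y. win m y \<in> S}"
      by (simp add: measure_map_pmf vimage_def)
    ultimately show ?thesis by simp
  qed
  ultimately show ?thesis by blast
qed

text \<open>Pairs of a window size and a window content form a countable set, so one subsequence
  serves all windows. Tightness upgrades convergence of point masses to convergence for bounded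
  functions.\<close>

lemma window_limit:
  obtains r R where "strict_mono (r :: nat \<Rightarrow> nat)"
    "\<And>m (f :: (int \<Rightarrow> nat) \<Rightarrow> real) K. (\<And>y. \<bar>f y\<bar> \<le> K) \<Longrightarrow>
      (\<lambda>n. \<integral>y. f (win m y) \<partial>cesaro (r n)) \<longlonglongrightarrow> (\<integral>y. f y \<partial>measure_pmf (R m))"
proof -
  define S where "S = (SIGMA m:UNIV. range (win m))"
  have "countable S" unfolding S_def by (intro countable_SIGMA countable_windows) auto
  then obtain r where r: "strict_mono (r :: nat \<Rightarrow> nat)"
    "\<And>z. z \<in> S \<Longrightarrow> \<exists>l. (\<lambda>n. pmf (map_pmf (win (fst z)) (cesaro (r n))) (snd z)) \<longlonglongrightarrow> l"
    by (rule bounded_array_subsequence[of S "\<lambda>n z. pmf (map_pmf (win (fst z)) (cesaro n)) (snd z)"])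
       (auto simp: pmf_le_1)
  have "\<exists>l. (\<lambda>n. pmf (map_pmf (win m) (cesaro (r n))) y) \<longlonglongrightarrow> l" for m y
  proof (cases "y \<in> range (win m)")
    case True
    then show ?thesis using r(2)[of "(m, y)"] by (auto simp: S_def)
  next
    case False
    then have "pmf (map_pmf (win m) (cesaro (r n))) y = 0" for n by (auto simp: pmf_eq_0_set_pmf)
    then show ?thesis by auto
  qed
  then obtain q' where q': "\<And>m y. (\<lambda>n. pmf (map_pmf (win m) (cesaro (r n))) y) \<longlonglongrightarrow> q' m y" by metis
  have "\<exists>R. \<forall>(f :: (int \<Rightarrow> nat) \<Rightarrow> real) K. (\<forall>y. \<bar>f y\<bar> \<le> K) \<longrightarrow>
      (\<lambda>n. \<integral>y. f y \<partial>measure_pmf (map_pmf (win m) (cesaro (r n)))) \<longlonglongrightarrow> (\<integral>y. f y \<partial>measure_pmf R)" for m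
  proof -
    have t: "\<exists>S. finite S \<and> (\<forall>n. 1 - \<epsilon> \<le> measure (map_pmf (win m) (cesaro (r n))) S)" if "0 < \<epsilon>" for \<epsilon>
      using cesaro_tight[OF that, of m] by blast
    show ?thesis by (rule tight_pmf_limit[OF q' t]) blast+
  qed
  then obtain R where R: "\<And>m (f :: (int \<Rightarrow> nat) \<Rightarrow> real) K. (\<And>y. \<bar>f y\<bar> \<le> K) \<Longrightarrow>
      (\<lambda>n. \<integral>y. f y \<partial>measure_pmf (map_pmf (win m) (cesaro (r n)))) \<longlonglongrightarrow> (\<integral>y. f y \<partial>measure_pmf (R m))"
    by metis
  show ?thesis
  proof (rule that[OF r(1), of R])
    fix m K and f :: "(int \<Rightarrow> nat) \<Rightarrow> real" assume "\<And>y. \<bar>f y\<bar> \<le> K"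
    from R[of f K m, OF this] show "(\<lambda>n. \<integral>y. f (win m y) \<partial>cesaro (r n)) \<longlonglongrightarrow> (\<integral>y. f y \<partial>measure_pmf (R m))"
      by simp
  qed
qed

text \<open>The filter looks at the infinite past and is no window function, so window limits do not
  reach it directly. Cutting the past at M changes it by C \<rho>^M times a weighted sum of mean at
  most \<open>obs_const / (1 - \<rho>)\<close>. The law \<open>N\<close> is left general so that the
  same error bound covers the averages and their limit.\<close>

lemma truncation_error:
  fixes a :: "(int \<Rightarrow> nat) \<Rightarrow> real"
  assumes "prob_space N" and [measurable]: "\<And>k. (\<lambda>y. lnobs y k) \<in> borel_measurable N" "filt p \<theta> 0 \<in> borel_measurable N"
    "(\<lambda>y. filt p \<theta> 0 (win M y)) \<in> borel_measurable N" "a \<in> borel_measurable N"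
    and m: "\<And>k. (\<integral>\<^sup>+y. ennreal (lnobs y k) \<partial>N) \<le> ennreal obs_const" and a: "\<And>y. 0 \<le> a y" "\<And>y. a y \<le> 1"
  shows "\<bar>(\<integral>y. a y * g_dens (filt p \<theta> 0 y) i \<partial>N) - (\<integral>y. a y * g_dens (filt p \<theta> 0 (win M y)) i \<partial>N)\<bar>
     \<le> (2 * real i + 1) * C * (obs_const / (1 - \<rho>)) * \<rho> ^ M"
proof -
  interpret N: prob_space N by fact
  define V where "V j y = lnobs y (- 1 - int M - int j)" for j y
  have [measurable]: "V j \<in> borel_measurable N" for j unfolding V_def by measurable
  have sV: "AE y in N. summable (\<lambda>j. \<rho> ^ j * V j y)"
    and eV: "(\<integral>\<^sup>+y. ennreal (\<Sum>j. \<rho> ^ j * V j y) \<partial>N) \<le> ennreal (obs_const / (1 - \<rho>))"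
    by (rule N.weighted_sum[where K = obs_const]; use m \<rho> obs_const_nonneg in \<open>simp add: V_def\<close>)+
  have t: "AE y in N. tempered \<rho> y"
    unfolding tempered_def AE_all_countable
    by (intro allI N.weighted_sum(1)[where K = obs_const] \<rho>) (simp_all add: m obs_const_nonneg)
  define Z where "Z y = (\<Sum>j. \<rho> ^ j * V j y)" for y
  have Zm [measurable]: "Z \<in> borel_measurable N" unfolding Z_def by measurable
  have bd: "\<bar>filt p \<theta> 0 y - filt p \<theta> 0 (win M y)\<bar> \<le> C * \<rho> ^ M * Z y"
    if y: "tempered \<rho> y" and s: "summable (\<lambda>j. \<rho> ^ j * V j y)" for y
  proof -
    have tw: "tempered \<rho> (win M y)" unfolding tempered_def
    proof
      fix k
      show "summable (\<lambda>j. \<rho> ^ j * lnobs (win M y) (k - int j))"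
      proof (rule summable_comparison_test')
        show "summable (\<lambda>j. \<rho> ^ j * lnobs y (k - int j))" using y by (simp add: tempered_def)
        show "norm (\<rho> ^ j * lnobs (win M y) (k - int j)) \<le> \<rho> ^ j * lnobs y (k - int j)" for j
          using \<rho>(1) by (simp add: lnobs_def win_def)
      qed
    qed
    define d where "d j = hcoef \<theta> j * lnobs y (0 - 1 - int j) - hcoef \<theta> j * lnobs (win M y) (0 - 1 - int j)" for j
    have ds: "summable d" unfolding d_def by (intro summable_diff summable_hcoef y tw)
    have "filt p \<theta> 0 y - filt p \<theta> 0 (win M y) = (\<Sum>j. d j)" unfolding filt_def d_def
      by (subst suminf_diff[OF summable_hcoef[OF y] summable_hcoef[OF tw], symmetric]) simp
    also have "\<dots> = (\<Sum>j. d (j + M)) + (\<Sum>j<M. d j)" by (rule suminf_split_initial_segment[OF ds])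
    also have "(\<Sum>j<M. d j) = 0" by (intro sum.neutral) (auto simp: d_def lnobs_def win_def)
    finally have "\<bar>filt p \<theta> 0 y - filt p \<theta> 0 (win M y)\<bar> = norm (\<Sum>j. d (j + M))" by simp
    also have "\<dots> \<le> (\<Sum>j. C * \<rho> ^ M * (\<rho> ^ j * V j y))"
    proof (rule norm_suminf_le)
      show "summable (\<lambda>j. C * \<rho> ^ M * (\<rho> ^ j * V j y))" by (rule summable_mult[OF s])
      fix j
      have "d (j + M) = hcoef \<theta> (j + M) * V j y"
        by (simp add: d_def V_def lnobs_def win_def algebra_simps)
      also have "norm \<dots> \<le> (C * \<rho> ^ (j + M)) * V j y"
        unfolding real_norm_def abs_mult using hcoef_decay[of "j + M"]
        by (simp add: V_def mult_right_mono)
      finally show "norm (d (j + M)) \<le> C * \<rho> ^ M * (\<rho> ^ j * V j y)" by (simp add: power_add mult_ac)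
    qed
    also have "\<dots> = C * \<rho> ^ M * Z y" unfolding Z_def by (rule suminf_mult[OF s])
    finally show ?thesis .
  qed
  have Z0: "AE y in N. 0 \<le> Z y" using sV
    by eventually_elim (use \<rho>(1) in \<open>auto simp: Z_def V_def intro!: suminf_nonneg\<close>)
  have Zi: "integrable N Z"
  proof (rule integrableI_nonneg[OF Zm Z0])
    show "(\<integral>\<^sup>+y. ennreal (Z y) \<partial>N) < \<infinity>" using eV by (simp add: Z_def le_less_trans)
  qed
  have EZ: "N.expectation Z \<le> obs_const / (1 - \<rho>)"
  proof -
    have "ennreal (N.expectation Z) \<le> ennreal (obs_const / (1 - \<rho>))"
      using eV nn_integral_eq_integral[OF Zi Z0] unfolding Z_def[symmetric] by simp
    then show ?thesis using obs_const_nonneg \<rho> by (simp add: ennreal_le_iff)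
  qed
  define G where "G y = a y * g_dens (filt p \<theta> 0 y) i - a y * g_dens (filt p \<theta> 0 (win M y)) i" for y
  have i1: "integrable N (\<lambda>y. a y * g_dens (filt p \<theta> 0 y) i)"
    and i2: "integrable N (\<lambda>y. a y * g_dens (filt p \<theta> 0 (win M y)) i)"
    by (rule N.integrable_const_bound[where B = 1]; use a in \<open>auto simp: abs_mult intro!: AE_I2 mult_le_one g_dens_le_1\<close>)+
  have "\<bar>(\<integral>y. a y * g_dens (filt p \<theta> 0 y) i \<partial>N) - (\<integral>y. a y * g_dens (filt p \<theta> 0 (win M y)) i \<partial>N)\<bar> = \<bar>\<integral>y. G y \<partial>N\<bar>"
    unfolding G_def using i1 i2 by simp
  also have "\<dots> \<le> (\<integral>y. \<bar>G y\<bar> \<partial>N)" by (rule integral_abs_bound)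
  also have "\<dots> \<le> (\<integral>y. (2 * real i + 1) * C * \<rho> ^ M * Z y \<partial>N)"
  proof (rule integral_mono_AE)
    show "integrable N (\<lambda>y. \<bar>G y\<bar>)" unfolding G_def using i1 i2 by auto
    show "integrable N (\<lambda>y. (2 * real i + 1) * C * \<rho> ^ M * Z y)" using Zi by simp
    show "AE y in N. \<bar>G y\<bar> \<le> (2 * real i + 1) * C * \<rho> ^ M * Z y"
      using t sV
    proof eventually_elim
      case (elim y)
      have "\<bar>G y\<bar> = a y * \<bar>g_dens (filt p \<theta> 0 y) i - g_dens (filt p \<theta> 0 (win M y)) i\<bar>"
        using a(1)[of y] by (simp add: G_def abs_mult flip: right_diff_distrib)
      also have "\<dots> \<le> 1 * ((2 * real i + 1) * (C * \<rho> ^ M * Z y))"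
        using a g_dens_lipschitz[of "filt p \<theta> 0 y" i "filt p \<theta> 0 (win M y)"] bd[OF elim]
        by (intro mult_mono order_trans[OF g_dens_lipschitz] mult_left_mono) auto
      finally show ?case by (simp add: mult_ac)
    qed
  qed
  also have "\<dots> = (2 * real i + 1) * C * \<rho> ^ M * N.expectation Z" by simp
  also have "\<dots> \<le> (2 * real i + 1) * C * \<rho> ^ M * (obs_const / (1 - \<rho>))"
    using EZ C \<rho> by (intro mult_left_mono) auto
  finally show ?thesis by (simp add: mult_ac)
qed

end

section \<open>Extension of the window limits to a law on sequences\<close>

locale window_limits = model +
  fixes r :: "nat \<Rightarrow> nat" and R :: "nat \<Rightarrow> (int \<Rightarrow> nat) pmf"
  assumes r: "strict_mono r"
    and lim: "\<And>m (f :: (int \<Rightarrow> nat) \<Rightarrow> real) K. (\<And>y. \<bar>f y\<bar> \<le> K) \<Longrightarrow>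
      (\<lambda>n. \<integral>y. f (win m y) \<partial>cesaro (r n)) \<longlonglongrightarrow> (\<integral>y. f y \<partial>measure_pmf (R m))"
begin

lemma R_consistent:
  assumes "m \<le> m'"
  shows "map_pmf (win m) (R m') = R m"
proof (rule pmf_eqI)
  fix x
  have 1: "(\<lambda>n. \<integral>y. indicat_real {z. win m z = x} (win m' y) \<partial>cesaro (r n)) \<longlonglongrightarrow> (\<integral>y. indicat_real {z. win m z = x} y \<partial>R m')"
    by (rule lim[of _ 1]) (auto simp: indicator_def)
  have 2: "(\<lambda>n. \<integral>y. indicat_real {x} (win m y) \<partial>cesaro (r n)) \<longlonglongrightarrow> (\<integral>y. indicat_real {x} y \<partial>R m)"
    by (rule lim[of _ 1]) (auto simp: indicator_def)
  have "indicat_real {z. win m z = x} (win m' y) = indicat_real {x} (win m y)" for y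
    using assms by (simp add: indicator_def win_win)
  then have "(\<integral>y. indicat_real {z. win m z = x} y \<partial>R m') = (\<integral>y. indicat_real {x} y \<partial>R m)"
    using LIMSEQ_unique[OF 1] 2 by simp
  then show "pmf (map_pmf (win m) (R m')) x = pmf (R m) x"
    by (simp add: pmf_map vimage_def measure_pmf_single)
qed

text \<open>The sum is a convenient bound for the largest absolute value and is also meaningful for
  the empty set.\<close>

definition rad :: "int set \<Rightarrow> nat" where
  "rad J = (\<Sum>j\<in>J. nat \<bar>j\<bar>)"

lemma rad_window: "finite J \<Longrightarrow> J \<subseteq> {- int (rad J)..int (rad J)}"
proof
  fix j assume J: "finite J" "j \<in> J"
  then have "nat \<bar>j\<bar> \<le> rad J" unfolding rad_def by (intro member_le_sum) auto
  then show "j \<in> {- int (rad J)..int (rad J)}" unfolding atLeastAtMost_iff by linarith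
qed

text \<open>Kolmogorov's theorem is stated for Polish coordinates; the natural numbers are embedded into
  the reals.\<close>

definition fidi :: "int set \<Rightarrow> (int \<Rightarrow> real) measure" where
  "fidi J = distr (R (rad J)) (PiM J (\<lambda>_. borel)) (\<lambda>y. restrict (\<lambda>j. real (y j)) J)"

lemma fidi_eq:
  assumes "finite J" "J \<subseteq> {- int m..int m}"
  shows "fidi J = distr (R m) (PiM J (\<lambda>_. borel)) (\<lambda>y. restrict (\<lambda>j. real (y j)) J)"
proof -
  define M where "M = max m (rad J)"
  have *: "distr (R n) (PiM J (\<lambda>_. borel)) (\<lambda>y. restrict (\<lambda>j. real (y j)) J) =
      distr (R M) (PiM J (\<lambda>_. borel)) (\<lambda>y. restrict (\<lambda>j. real (y j)) J)"
    if "n \<le> M" "J \<subseteq> {- int n..int n}" for n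
  proof -
    have "distr (R n) (PiM J (\<lambda>_. borel)) (\<lambda>y. restrict (\<lambda>j. real (y j)) J) =
      distr (distr (R M) (count_space UNIV) (win n)) (PiM J (\<lambda>_. borel)) (\<lambda>y. restrict (\<lambda>j. real (y j)) J)"
      by (simp add: R_consistent[OF that(1), symmetric] map_pmf_rep_eq)
    also have "\<dots> = distr (R M) (PiM J (\<lambda>_. borel)) ((\<lambda>y. restrict (\<lambda>j. real (y j)) J) \<circ> win n)"
      by (rule distr_distr) (auto simp: space_PiM)
    also have "(\<lambda>y. restrict (\<lambda>j. real (y j)) J) \<circ> win n = (\<lambda>y. restrict (\<lambda>j. real (y j)) J)"
      using that(2) by (auto simp: fun_eq_iff win_def restrict_def)
    finally show ?thesis .
  qed
  show ?thesis unfolding fidi_def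
    using *[of "rad J"] *[of m] rad_window[OF assms(1)] assms(2) by (simp add: M_def)
qed

sublocale F: polish_projective UNIV fidi
proof (intro polish_projective.intro projective_family.intro)
  fix J H :: "int set" assume H: "J \<subseteq> H" "finite H" "H \<subseteq> UNIV"
  then have J: "finite J" "J \<subseteq> {- int (rad H)..int (rad H)}"
    using rad_window[OF H(2)] by (auto intro: finite_subset)
  have "distr (fidi H) (PiM J (\<lambda>_. borel)) (\<lambda>f. restrict f J) =
    distr (R (rad H)) (PiM J (\<lambda>_. borel)) ((\<lambda>f. restrict f J) \<circ> (\<lambda>y. restrict (\<lambda>j. real (y j)) H))"
    unfolding fidi_def by (rule distr_distr) (use H in \<open>auto simp: space_PiM intro!: measurable_restrict_subset\<close>)
  also have "(\<lambda>f. restrict f J) \<circ> (\<lambda>y. restrict (\<lambda>j. real (y j)) H) = (\<lambda>y. restrict (\<lambda>j. real (y j)) J)"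
    using H by (auto simp: fun_eq_iff restrict_def)
  finally show "fidi J = distr (fidi H) (PiM J (\<lambda>_. borel)) (\<lambda>f. restrict f J)"
    using fidi_eq[OF J] by (simp only:)
next
  fix J :: "int set" assume "finite J" "J \<subseteq> UNIV"
  show "prob_space (fidi J)" unfolding fidi_def
    by (rule measure_pmf.prob_space_distr) (auto simp: space_PiM)
qed

definition Q :: "(int \<Rightarrow> nat) measure" where
  "Q = distr F.lim obs_space (\<lambda>x j. nat \<lfloor>x j\<rfloor>)"

lemma measurable_decode: "(\<lambda>x j. nat \<lfloor>x j\<rfloor>) \<in> measurable F.lim obs_space"
proof (rule measurable_into_obs)
  fix k
  have "(\<lambda>x. x k) \<in> borel_measurable F.lim"
    using measurable_component_singleton[of k UNIV "\<lambda>_. borel"]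
    by (simp add: measurable_cong_sets[OF F.sets_lim refl])
  then show "(\<lambda>x. nat \<lfloor>x k\<rfloor>) \<in> measurable F.lim (count_space UNIV)" by measurable
qed

lemma prob_Q: "prob_space Q"
  unfolding Q_def by (rule F.P.prob_space_distr) (rule measurable_decode)

lemma sets_Q [measurable_cong, simp]: "sets Q = sets obs_space"
  by (simp add: Q_def)

lemma space_Q [simp]: "space Q = UNIV"
  by (simp add: Q_def)

lemma window_event [measurable]: "{y. win m y = x} \<in> sets obs_space"
proof (cases "win m x = x")
  case True
  have "{y \<in> space obs_space. \<forall>j\<in>{- int m..int m}. y j = x j} \<in> sets obs_space" by measurable
  also have "{y \<in> space obs_space. \<forall>j\<in>{- int m..int m}. y j = x j} = {y. win m y = x}"
  proof (intro set_eqI iffI)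
    fix y assume *: "y \<in> {y \<in> space obs_space. \<forall>j\<in>{- int m..int m}. y j = x j}"
    have "win m y = win m x" using * by (auto simp: win_def fun_eq_iff)
    then show "y \<in> {y. win m y = x}" using True by simp
  next
    fix y assume "y \<in> {y. win m y = x}"
    then have "x = win m y" by simp
    then show "y \<in> {y \<in> space obs_space. \<forall>j\<in>{- int m..int m}. y j = x j}" by (simp add: win_def)
  qed
  finally show ?thesis .
next
  case False
  then have "{y. win m y = x} = {}" by (metis (mono_tags, lifting) empty_Collect_eq win_idem)
  then show ?thesis by simp
qed

lemma Q_window: "emeasure Q {y. win m y = x} = ennreal (pmf (R m) x)"
proof (cases "win m x = x")
  case True
  define W where "W = {- int m..int m}"
  define X where "X = {z \<in> space (PiM W (\<lambda>_. borel :: real measure)). \<forall>j\<in>W. nat \<lfloor>z j\<rfloor> = x j}"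
  have fW: "finite W" by (simp add: W_def)
  have wx: "win m y = x \<longleftrightarrow> (\<forall>j\<in>W. y j = x j)" for y
  proof
    assume "win m y = x"
    then have "x = win m y" by simp
    then show "\<forall>j\<in>W. y j = x j" by (simp add: win_def W_def)
  next
    assume "\<forall>j\<in>W. y j = x j"
    then have "win m y = win m x" by (auto simp: win_def W_def fun_eq_iff)
    then show "win m y = x" using True by simp
  qed
  have Xm: "X \<in> sets (PiM W (\<lambda>_. borel))"
  proof -
    have "Measurable.pred (PiM W (\<lambda>_. borel :: real measure)) (\<lambda>z. nat \<lfloor>z j\<rfloor> = x j)" if "j \<in> W" for j
    proof -
      have "Measurable.pred borel (\<lambda>t :: real. nat \<lfloor>t\<rfloor> = x j)" by measurable
      from measurable_compose[OF measurable_component_singleton[OF that] this] show ?thesis by simp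
    qed
    then show ?thesis unfolding X_def using fW by (intro sets.sets_Collect_finite_All) (auto simp: pred_def)
  qed
  have "emeasure Q {y. win m y = x} = emeasure F.lim ((\<lambda>x j. nat \<lfloor>x j\<rfloor>) -` {y. win m y = x} \<inter> space F.lim)"
    unfolding Q_def by (rule emeasure_distr[OF measurable_decode]) measurable
  also have "(\<lambda>x j. nat \<lfloor>x j\<rfloor>) -` {y. win m y = x} \<inter> space F.lim = prod_emb UNIV (\<lambda>_. borel) W X"
    by (auto simp: prod_emb_def X_def wx F.space_lim space_PiM)
  also have "emeasure F.lim (prod_emb UNIV (\<lambda>_. borel) W X) = emeasure (fidi W) X"
    by (rule F.emeasure_lim_emb) (use fW Xm in auto)
  also have "\<dots> = emeasure (R m) ((\<lambda>y. restrict (\<lambda>j. real (y j)) W) -` X \<inter> space (R m))"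
    unfolding fidi_eq[OF fW eq_refl[OF W_def]] by (rule emeasure_distr) (use Xm in \<open>auto simp: space_PiM\<close>)
  also have "(\<lambda>y. restrict (\<lambda>j. real (y j)) W) -` X \<inter> space (R m) = win m -` {x}"
    by (rule set_eqI) (simp add: X_def wx space_PiM)
  also have "emeasure (R m) (win m -` {x}) = emeasure (map_pmf (win m) (R m)) {x}" by simp
  also have "\<dots> = ennreal (pmf (R m) x)" by (simp only: R_consistent[OF order_refl] emeasure_pmf_single)
  finally show ?thesis .
next
  case False
  then have "{y. win m y = x} = {}" by (metis (mono_tags, lifting) empty_Collect_eq win_idem)
  moreover have "pmf (R m) x = 0"
  proof -
    have "x \<notin> set_pmf (map_pmf (win m) (R m))" using False by auto
    then show ?thesis unfolding R_consistent[OF order_refl] by (simp add: pmf_eq_0_set_pmf)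
  qed
  ultimately show ?thesis by simp
qed

text \<open>Through the window map both measures live on a countable set, so equality of the atoms,
  given by \<open>Q_window\<close>, suffices.\<close>

lemma Q_window_integral:
  fixes f :: "(int \<Rightarrow> nat) \<Rightarrow> real"
  shows "(\<integral>y. f (win m y) \<partial>Q) = (\<integral>y. f y \<partial>R m)"
proof -
  let ?A = "range (win m)"
  have wQ: "win m \<in> measurable Q (count_space ?A)"
  proof (rule measurableI)
    fix X assume "X \<in> sets (count_space ?A)"
    then have "countable X" using countable_subset[OF _ countable_windows] by auto
    then have "(\<Union>a\<in>X. {y. win m y = a}) \<in> sets obs_space" by (intro sets.countable_UN') auto
    moreover have "win m -` X \<inter> space Q = (\<Union>a\<in>X. {y. win m y = a})" by auto
    ultimately show "win m -` X \<inter> space Q \<in> sets Q" by simp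
  qed simp
  have wR: "win m \<in> measurable (measure_pmf (R m)) (count_space ?A)" by simp
  have eq: "distr Q (count_space ?A) (win m) = distr (R m) (count_space ?A) (win m)"
  proof (rule measure_eqI_countable[OF _ _ countable_windows])
    fix a assume a: "a \<in> ?A"
    have "emeasure (distr Q (count_space ?A) (win m)) {a} = emeasure Q {y. win m y = a}"
      using a by (subst emeasure_distr[OF wQ]) (auto simp: vimage_def)
    moreover have "emeasure (distr (R m) (count_space ?A) (win m)) {a} = emeasure (map_pmf (win m) (R m)) {a}"
      using a by (subst emeasure_distr[OF wR]) auto
    ultimately show "emeasure (distr Q (count_space ?A) (win m)) {a} = emeasure (distr (R m) (count_space ?A) (win m)) {a}"
      by (simp only: Q_window R_consistent[OF order_refl] emeasure_pmf_single)
  qed auto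
  have "(\<integral>y. f (win m y) \<partial>Q) = (\<integral>z. f z \<partial>distr Q (count_space ?A) (win m))"
    by (rule integral_distr[symmetric, OF wQ]) simp
  also have "\<dots> = (\<integral>y. f (win m y) \<partial>R m)" unfolding eq by (rule integral_distr[OF wR]) simp
  also have "\<dots> = (\<integral>y. f y \<partial>map_pmf (win m) (R m))" by simp
  finally show ?thesis by (simp only: R_consistent[OF order_refl])
qed

lemma Q_lim:
  fixes f :: "(int \<Rightarrow> nat) \<Rightarrow> real"
  assumes "\<And>y. f (win m y) = f y" "\<And>y. \<bar>f y\<bar> \<le> K"
  shows "(\<lambda>n. \<integral>y. f y \<partial>cesaro (r n)) \<longlonglongrightarrow> (\<integral>y. f y \<partial>Q)"
  using lim[of f K m, OF assms(2)] Q_window_integral[of f m] by (simp add: assms(1))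

text \<open>The logarithm is unbounded, so the limit is taken for its truncations, which inherit the
  bound of the averages; Fatou's lemma removes the truncation.\<close>

lemma Q_lnobs: "(\<integral>\<^sup>+y. ennreal (lnobs y k) \<partial>Q) \<le> ennreal obs_const"
proof -
  interpret Q: prob_space Q by (rule prob_Q)
  define f where "f N y = min (lnobs y k) (real N)" for N :: nat and y
  have [measurable]: "f N \<in> borel_measurable Q" for N unfolding f_def by measurable
  have f0: "0 \<le> f N y" "f N y \<le> real N" "f N y \<le> lnobs y k" for N y by (auto simp: f_def)
  have fQ: "(\<integral>\<^sup>+y. ennreal (f N y) \<partial>Q) \<le> ennreal obs_const" for N
  proof -
    have "(\<lambda>n. \<integral>y. f N y \<partial>cesaro (r n)) \<longlonglongrightarrow> (\<integral>y. f N y \<partial>Q)"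
      by (rule Q_lim[of "f N" "nat \<bar>k\<bar>" "real N"]) (use f0 in \<open>auto simp: f_def win_def lnobs_def\<close>)
    moreover have "(\<integral>y. f N y \<partial>cesaro n) \<le> obs_const" for n
    proof -
      have i: "integrable (cesaro n) (f N)"
        by (rule measure_pmf.integrable_const_bound[where B = "real N"]) (use f0 in auto)
      have "ennreal (\<integral>y. f N y \<partial>cesaro n) = (\<integral>\<^sup>+y. ennreal (f N y) \<partial>cesaro n)"
        by (rule nn_integral_eq_integral[symmetric, OF i]) (use f0 in auto)
      also have "\<dots> \<le> (\<integral>\<^sup>+y. ennreal (lnobs y k) \<partial>cesaro n)" by (intro nn_integral_mono ennreal_leI f0)
      also have "\<dots> \<le> ennreal obs_const" by (rule cesaro_lnobs)
      finally show ?thesis using obs_const_nonneg by (simp add: ennreal_le_iff)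
    qed
    ultimately have "(\<integral>y. f N y \<partial>Q) \<le> obs_const" by (intro LIMSEQ_le_const2) auto
    moreover have i: "integrable Q (f N)"
      by (rule Q.integrable_const_bound[where B = "real N"]) (use f0 in auto)
    have "(\<integral>\<^sup>+y. ennreal (f N y) \<partial>Q) = ennreal (\<integral>y. f N y \<partial>Q)"
      by (rule nn_integral_eq_integral[OF i]) (use f0 in auto)
    ultimately show ?thesis by (simp add: ennreal_leI)
  qed
  have "(\<integral>\<^sup>+y. ennreal (lnobs y k) \<partial>Q) = (\<integral>\<^sup>+y. liminf (\<lambda>N. ennreal (f N y)) \<partial>Q)"
  proof (intro nn_integral_cong)
    fix y
    obtain N0 :: nat where N0: "lnobs y k \<le> real N0" using real_arch_simple by blast
    have "eventually (\<lambda>N. ennreal (f N y) = ennreal (lnobs y k)) sequentially"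
      using eventually_ge_at_top[of N0] by eventually_elim (use N0 in \<open>auto simp: f_def min_def\<close>)
    then have "(\<lambda>N. ennreal (f N y)) \<longlonglongrightarrow> ennreal (lnobs y k)" by (rule tendsto_eventually)
    then show "ennreal (lnobs y k) = liminf (\<lambda>N. ennreal (f N y))" by (intro lim_imp_Liminf[symmetric]) auto
  qed
  also have "\<dots> \<le> liminf (\<lambda>N. \<integral>\<^sup>+y. ennreal (f N y) \<partial>Q)" by (rule nn_integral_liminf) measurable
  also have "\<dots> \<le> liminf (\<lambda>N. ennreal obs_const)" by (intro Liminf_mono always_eventually allI fQ)
  also have "\<dots> = ennreal obs_const" by (simp add: Liminf_const)
  finally show ?thesis .
qed

lemma cylinder_window:
  fixes F :: "int \<Rightarrow> nat set"
  assumes "finite J"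
  shows "(\<forall>j\<in>J. win (rad J) y j \<in> F j) \<longleftrightarrow> (\<forall>j\<in>J. y j \<in> F j)"
  using rad_window[OF assms] by (auto simp: win_def subset_iff)

lemma obs_measure_eqI:
  fixes M1 M2 :: "(int \<Rightarrow> nat) measure"
  assumes "sets M1 = sets obs_space" "sets M2 = sets obs_space" "finite_measure M1"
    and eq: "\<And>J F. finite J \<Longrightarrow> emeasure M1 {y. \<forall>j\<in>J. y j \<in> F j} = emeasure M2 {y. \<forall>j\<in>J. y j \<in> F j}"
  shows "M1 = M2"
proof (rule measure_eqI_PiM_infinite[where I = UNIV and M = "\<lambda>_. count_space UNIV"])
  fix A :: "int \<Rightarrow> nat set" and J :: "int set" assume "finite J"
  moreover have "prod_emb UNIV (\<lambda>_. count_space UNIV) J (Pi\<^sub>E J A) = {y. \<forall>j\<in>J. y j \<in> A j}"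
    by (auto simp: prod_emb_def PiE_iff)
  ultimately show "emeasure M1 (prod_emb UNIV (\<lambda>_. count_space UNIV) J (Pi\<^sub>E J A)) =
      emeasure M2 (prod_emb UNIV (\<lambda>_. count_space UNIV) J (Pi\<^sub>E J A))" using eq by simp
qed (use assms in \<open>auto simp: obs_space_def\<close>)

lemma Q_shift: "distr Q obs_space (shift 1) = Q"
proof (rule obs_measure_eqI)
  interpret Q: prob_space Q by (rule prob_Q)
  show "finite_measure (distr Q obs_space (shift 1))" by (rule Q.finite_measure_distr) simp
  fix J :: "int set" and F :: "int \<Rightarrow> nat set" assume J: "finite J"
  define A where "A = {y :: int \<Rightarrow> nat. \<forall>j\<in>J. y j \<in> F j}"
  have "{y \<in> space obs_space. \<forall>j\<in>J. y j \<in> F j} \<in> sets obs_space" using J by measurable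
  then have Am [measurable]: "A \<in> sets obs_space" by (simp add: A_def)
  define f where "f = indicat_real A"
  have f1: "\<bar>f y\<bar> \<le> 1" for y by (simp add: f_def indicator_def)
  have 1: "(\<lambda>n. \<integral>y. f y \<partial>cesaro (r n)) \<longlonglongrightarrow> (\<integral>y. f y \<partial>Q)"
  proof (rule Q_lim[OF _ f1])
    show "f (win (rad J) y) = f y" for y using cylinder_window[OF J, of y F] by (simp add: f_def A_def indicator_def)
  qed
  define J' where "J' = (\<lambda>j. j + 1) ` J"
  have 2: "(\<lambda>n. \<integral>y. f (shift 1 y) \<partial>cesaro (r n)) \<longlonglongrightarrow> (\<integral>y. f (shift 1 y) \<partial>Q)"
  proof (rule Q_lim[where K = 1])
    have "finite J'" using J by (simp add: J'_def)
    show "f (shift 1 (win (rad J') y)) = f (shift 1 y)" for y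
      using cylinder_window[OF \<open>finite J'\<close>, of y "\<lambda>j. F (j - 1)"]
      by (simp add: f_def A_def indicator_def J'_def shift_def)
  qed (rule f1)
  have "(\<lambda>n. (\<integral>y. f (shift 1 y) \<partial>cesaro (r n)) - (\<integral>y. f y \<partial>cesaro (r n))) \<longlonglongrightarrow> 0"
  proof (rule Lim_null_comparison)
    show "eventually (\<lambda>n. norm ((\<integral>y. f (shift 1 y) \<partial>cesaro (r n)) - (\<integral>y. f y \<partial>cesaro (r n))) \<le> 2 * 1 / real (Suc (r n))) sequentially"
      unfolding real_norm_def by (intro always_eventually allI cesaro_shift f1)
    have "(\<lambda>n. 2 * inverse (real (Suc n))) \<longlonglongrightarrow> 2 * 0" by (intro tendsto_intros LIMSEQ_inverse_real_of_nat)
    then have "(\<lambda>n. 2 * 1 / real (Suc n)) \<longlonglongrightarrow> 0" by (simp add: divide_inverse)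
    from LIMSEQ_subseq_LIMSEQ[OF this r] show "(\<lambda>n. 2 * 1 / real (Suc (r n))) \<longlonglongrightarrow> 0" by (simp add: o_def)
  qed
  from LIMSEQ_unique[OF this tendsto_diff[OF 2 1]]
  have "(\<integral>y. f (shift 1 y) \<partial>Q) = (\<integral>y. f y \<partial>Q)" by simp
  moreover have "(\<integral>y. f (shift 1 y) \<partial>Q) = (\<integral>y. f y \<partial>distr Q obs_space (shift 1))"
    by (rule integral_distr[symmetric]) (auto simp: f_def)
  ultimately have "measure (distr Q obs_space (shift 1)) A = measure Q A"
    using Am by (simp add: f_def)
  then show "emeasure (distr Q obs_space (shift 1)) {y. \<forall>j\<in>J. y j \<in> F j} = emeasure Q {y. \<forall>j\<in>J. y j \<in> F j}"
    using \<open>finite_measure (distr Q obs_space (shift 1))\<close>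
    by (simp add: A_def[symmetric] Q.emeasure_eq_measure finite_measure.emeasure_eq_measure)
qed simp_all

text \<open>The identity is exact for the averages. Its left side is a window function and passes to
  the limit; on the right the filter is replaced by that of a window of radius M, at the same cost c
  \<rho>^M under the averages and under \<open>Q\<close>. Letting M grow removes both
  errors.\<close>

lemma Q_conditional_cylinder:
  fixes J :: "int set" and F :: "int \<Rightarrow> nat set"
  assumes J: "finite J"
  defines "a \<equiv> \<lambda>y. indicat_real {y. \<forall>j\<in>J. y j \<in> F j} (trunc 0 y)"
  shows "(\<integral>y. a y * indicat_real {y. y 0 = i} y \<partial>Q) = (\<integral>y. a y * g_dens (filt p \<theta> 0 y) i \<partial>Q)"
proof -
  interpret Q: prob_space Q by (rule prob_Q)
  define A where "A = {y :: int \<Rightarrow> nat. \<forall>j\<in>J. y j \<in> F j}"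
  have "{y \<in> space obs_space. \<forall>j\<in>J. y j \<in> F j} \<in> sets obs_space" using J by measurable
  then have Am [measurable]: "A \<in> sets obs_space" by (simp add: A_def)
  have am [measurable]: "a \<in> borel_measurable obs_space" unfolding a_def A_def[symmetric] by measurable
  have a01: "0 \<le> a y" "a y \<le> 1" for y by (auto simp: a_def indicator_def)
  have tw: "trunc 0 (win m y) = win m (trunc 0 y)" for m y by (auto simp: trunc_def win_def fun_eq_iff)
  have aw: "a (win m y) = a y" if "rad J \<le> m" for m y
  proof -
    have sub: "J \<subseteq> {- int m..int m}" using rad_window[OF J] that by fastforce
    have "win m (trunc 0 y) j = trunc 0 y j" if "j \<in> J" for j using sub that by (auto simp: win_def)
    then show ?thesis unfolding a_def tw by (simp add: indicator_def)
  qed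
  have step: "(\<integral>y. a y * indicat_real {y. y 0 = i} y \<partial>cesaro n) = (\<integral>y. a y * g_dens (filt p \<theta> 0 y) i \<partial>cesaro n)" for n
  proof -
    have i1: "integrable (cesaro n) (\<lambda>y. a y * indicat_real {y. y 0 = i} y)"
      by (rule measure_pmf.integrable_const_bound[where B = 1]) (use a01 in \<open>auto simp: indicator_def abs_mult\<close>)
    have i2: "integrable (cesaro n) (\<lambda>y. a y * g_dens (filt p \<theta> 0 y) i)"
      by (rule measure_pmf.integrable_const_bound[where B = 1]) (use a01 in \<open>auto simp: abs_mult intro!: mult_le_one g_dens_le_1\<close>)
    have "ennreal (\<integral>y. a y * indicat_real {y. y 0 = i} y \<partial>cesaro n) = (\<integral>\<^sup>+y. ennreal (a y * indicat_real {y. y 0 = i} y) \<partial>cesaro n)"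
      by (rule nn_integral_eq_integral[symmetric, OF i1]) (use a01 in auto)
    also have "\<dots> = (\<integral>\<^sup>+y. indicator A (trunc 0 y) * indicator {y. y 0 = i} y \<partial>cesaro n)"
      by (intro nn_integral_cong) (auto simp: a_def A_def indicator_def)
    also have "\<dots> = (\<integral>\<^sup>+y. indicator A (trunc 0 y) * ennreal (g_dens (filt p \<theta> 0 y) i) \<partial>cesaro n)"
      by (rule cesaro_one_step)
    also have "\<dots> = (\<integral>\<^sup>+y. ennreal (a y * g_dens (filt p \<theta> 0 y) i) \<partial>cesaro n)"
      by (intro nn_integral_cong) (auto simp: a_def A_def indicator_def)
    also have "\<dots> = ennreal (\<integral>y. a y * g_dens (filt p \<theta> 0 y) i \<partial>cesaro n)"
      by (rule nn_integral_eq_integral[OF i2]) (use a01 in auto)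
    finally show ?thesis
      by (subst (asm) ennreal_inj) (use a01 in \<open>auto intro!: integral_nonneg_AE\<close>)
  qed
  have left: "(\<lambda>n. \<integral>y. a y * indicat_real {y. y 0 = i} y \<partial>cesaro (r n)) \<longlonglongrightarrow> (\<integral>y. a y * indicat_real {y. y 0 = i} y \<partial>Q)"
  proof (rule Q_lim[where m = "rad J" and K = 1])
    show "a (win (rad J) y) * indicat_real {y. y 0 = i} (win (rad J) y) = a y * indicat_real {y. y 0 = i} y" for y
      by (simp add: aw) (simp add: indicator_def win_def)
    show "\<bar>a y * indicat_real {y. y 0 = i} y\<bar> \<le> 1" for y using a01[of y] by (auto simp: indicator_def)
  qed
  define c where "c = (2 * real i + 1) * C * (obs_const / (1 - \<rho>))"
  define I where "I = (\<integral>y. a y * indicat_real {y. y 0 = i} y \<partial>Q)"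
  define I' where "I' = (\<integral>y. a y * g_dens (filt p \<theta> 0 y) i \<partial>Q)"
  have main: "\<bar>I - I'\<bar> \<le> 2 * c * \<rho> ^ M" if M: "rad J \<le> M" for M
  proof -
    define b where "b y = a y * g_dens (filt p \<theta> 0 (win M y)) i" for y
    have right: "(\<lambda>n. \<integral>y. b y \<partial>cesaro (r n)) \<longlonglongrightarrow> (\<integral>y. b y \<partial>Q)"
    proof (rule Q_lim[where m = M and K = 1])
      show "b (win M y) = b y" for y by (simp add: b_def aw[OF M])
      show "\<bar>b y\<bar> \<le> 1" for y using a01[of y] by (simp add: b_def abs_mult mult_le_one g_dens_le_1)
    qed
    have e1: "\<bar>(\<integral>y. a y * g_dens (filt p \<theta> 0 y) i \<partial>cesaro n) - (\<integral>y. b y \<partial>cesaro n)\<bar> \<le> c * \<rho> ^ M" for n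
      unfolding b_def c_def
      by (rule truncation_error) (use a01 in \<open>auto simp: measure_pmf.prob_space_axioms cesaro_lnobs\<close>)
    have e2: "\<bar>I' - (\<integral>y. b y \<partial>Q)\<bar> \<le> c * \<rho> ^ M"
      unfolding b_def c_def I'_def
      by (rule truncation_error) (use a01 in \<open>auto simp: prob_Q Q_lnobs\<close>)
    have "(\<lambda>n. \<bar>(\<integral>y. a y * indicat_real {y. y 0 = i} y \<partial>cesaro (r n)) - (\<integral>y. b y \<partial>cesaro (r n))\<bar>) \<longlonglongrightarrow> \<bar>I - (\<integral>y. b y \<partial>Q)\<bar>"
      unfolding I_def by (intro tendsto_intros left right)
    then have "\<bar>I - (\<integral>y. b y \<partial>Q)\<bar> \<le> c * \<rho> ^ M"
      by (rule LIMSEQ_le_const2) (use e1 in \<open>auto simp: step\<close>)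
    then show ?thesis using e2 by linarith
  qed
  have "(\<lambda>M. 2 * c * \<rho> ^ M) \<longlonglongrightarrow> 2 * c * 0" using \<rho> by (intro tendsto_intros LIMSEQ_power_zero) auto
  then have "\<bar>I - I'\<bar> \<le> 2 * c * 0" by (rule LIMSEQ_le_const) (use main in blast)
  then show ?thesis by (simp add: I_def I'_def)
qed

lemma obs_law_Q: "obs_law p \<theta> Q"
  unfolding obs_law_def
proof (intro conjI allI ballI)
  interpret Q: prob_space Q by (rule prob_Q)
  show "prob_space Q" by (rule prob_Q)
  show "distr Q obs_space (shift 1) = Q" by (rule Q_shift)
  show "integrable Q (\<lambda>y. lnobs y 0)"
  proof (rule integrableI_nonneg)
    show "(\<integral>\<^sup>+y. ennreal (lnobs y 0) \<partial>Q) < \<infinity>" using Q_lnobs[of 0] by (simp add: le_less_trans)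
  qed auto
  fix i and \<phi> :: "(int \<Rightarrow> nat) \<Rightarrow> ennreal" assume [measurable]: "\<phi> \<in> borel_measurable obs_space"
  define g1 where "g1 y = indicat_real {y. y 0 = i} y" for y :: "int \<Rightarrow> nat"
  define g2 where "g2 y = g_dens (filt p \<theta> 0 y) i" for y
  have "{y \<in> space obs_space. y 0 = i} \<in> sets obs_space" by measurable
  then have [measurable]: "{y. y 0 = i} \<in> sets obs_space" by simp
  have [measurable]: "g1 \<in> borel_measurable obs_space" "g2 \<in> borel_measurable obs_space"
    unfolding g1_def g2_def by measurable
  \<comment> \<open>The two sides of the conditional identity become measures on truncated
    sequences. They agree on cylinders, hence everywhere, and so integrate every test function
    equally.\<close>
  define N where "N g = distr (density Q (\<lambda>y. ennreal (g y))) obs_space (trunc 0)" for g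
  have N_int: "(\<integral>\<^sup>+z. \<psi> z \<partial>N g) = (\<integral>\<^sup>+y. ennreal (g y) * \<psi> (trunc 0 y) \<partial>Q)"
    if [measurable]: "g \<in> borel_measurable obs_space" "\<psi> \<in> borel_measurable obs_space" for g \<psi>
    unfolding N_def by (subst nn_integral_distr) (auto simp: nn_integral_density)
  have N_em: "emeasure (N g) {y. \<forall>j\<in>J. y j \<in> F j} = ennreal (\<integral>y. indicat_real {y. \<forall>j\<in>J. y j \<in> F j} (trunc 0 y) * g y \<partial>Q)"
    if [measurable]: "g \<in> borel_measurable obs_space" and g: "\<And>y. 0 \<le> g y" "\<And>y. g y \<le> 1" and J: "finite J"
    for g and J :: "int set" and F :: "int \<Rightarrow> nat set"
  proof -
    define A where "A = {y :: int \<Rightarrow> nat. \<forall>j\<in>J. y j \<in> F j}"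
    have "{y \<in> space obs_space. \<forall>j\<in>J. y j \<in> F j} \<in> sets obs_space" using J by measurable
    then have Am [measurable]: "A \<in> sets obs_space" by (simp add: A_def)
    have ii: "integrable Q (\<lambda>y. indicat_real A (trunc 0 y) * g y)"
      by (rule Q.integrable_const_bound[where B = 1]) (use g in \<open>auto simp: indicator_def\<close>)
    have "emeasure (N g) A = (\<integral>\<^sup>+z. indicator A z \<partial>N g)" by (simp add: N_def)
    also have "\<dots> = (\<integral>\<^sup>+y. ennreal (g y) * indicator A (trunc 0 y) \<partial>Q)" by (rule N_int) measurable
    also have "\<dots> = (\<integral>\<^sup>+y. ennreal (indicat_real A (trunc 0 y) * g y) \<partial>Q)"
      by (intro nn_integral_cong) (auto simp: indicator_def)
    also have "\<dots> = ennreal (\<integral>y. indicat_real A (trunc 0 y) * g y \<partial>Q)"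
      by (rule nn_integral_eq_integral[OF ii]) (use g in auto)
    finally show ?thesis by (simp add: A_def)
  qed
  have "N g1 = N g2"
  proof (rule obs_measure_eqI)
    show "finite_measure (N g1)"
    proof (rule finite_measureI)
      have "emeasure (N g1) {y. \<forall>j\<in>{}. y j \<in> {}} \<noteq> \<infinity>"
        by (subst N_em) (auto simp: g1_def indicator_def)
      then show "emeasure (N g1) (space (N g1)) \<noteq> \<infinity>" by (simp add: N_def)
    qed
    fix J :: "int set" and F :: "int \<Rightarrow> nat set" assume J: "finite J"
    show "emeasure (N g1) {y. \<forall>j\<in>J. y j \<in> F j} = emeasure (N g2) {y. \<forall>j\<in>J. y j \<in> F j}"
      using Q_conditional_cylinder[OF J, of F i]
      by (subst (1 2) N_em) (auto simp: J g1_def g2_def g_dens_le_1)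
  qed (simp_all add: N_def)
  then have "(\<integral>\<^sup>+z. \<phi> z \<partial>N g1) = (\<integral>\<^sup>+z. \<phi> z \<partial>N g2)" by simp
  then show "(\<integral>\<^sup>+y. \<phi> (trunc 0 y) * indicator {y. y 0 = i} y \<partial>Q) =
      (\<integral>\<^sup>+y. \<phi> (trunc 0 y) * ennreal (g_dens (filt p \<theta> 0 y) i) \<partial>Q)"
    by (simp add: N_int g1_def g2_def mult.commute ennreal_indicator)
qed (rule sets_Q)

end

lemma (in model) obs_law_exists: "\<exists>Q. obs_law p \<theta> Q"
proof (rule window_limit)
  fix r R
  assume *: "strict_mono (r :: nat \<Rightarrow> nat)"
    "\<And>m (f :: (int \<Rightarrow> nat) \<Rightarrow> real) K. (\<And>y. \<bar>f y\<bar> \<le> K) \<Longrightarrow>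
      (\<lambda>n. \<integral>y. f (win m y) \<partial>cesaro (r n)) \<longlonglongrightarrow> (\<integral>y. f y \<partial>measure_pmf (R m))"
  interpret window_limits p q \<theta> B C \<rho> r R
  proof unfold_locales
    show "strict_mono r" by (rule *(1))
    fix m K and f :: "(int \<Rightarrow> nat) \<Rightarrow> real" assume "\<And>y. \<bar>f y\<bar> \<le> K"
    from *(2)[OF this] show "(\<lambda>n. \<integral>y. f (win m y) \<partial>cesaro (r n)) \<longlonglongrightarrow> (\<integral>y. f y \<partial>measure_pmf (R m))" .
  qed
  show ?thesis using obs_law_Q by blast
qed

section \<open>Consistency\<close>

text \<open>One random quantity that dominates, up to a constant, the filters of all \<theta> in
  \<Theta>; the summand 1 takes care of \<open>cst\<close>.\<close>

definition env :: "real \<Rightarrow> int \<Rightarrow> (int \<Rightarrow> nat) \<Rightarrow> real" where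
  "env \<rho> k y = 1 + (\<Sum>j. \<rho> ^ j * lnobs y (k - 1 - int j))"

lemma env_shift: "env \<rho> k (shift m y) = env \<rho> (k + m) y"
  by (simp add: env_def lnobs_shift algebra_simps)

lemma measurable_env [measurable]: "env \<rho> k \<in> borel_measurable obs_space"
  unfolding env_def by measurable

lemma env_ge_1:
  assumes "tempered \<rho> y" "0 < \<rho>"
  shows "1 \<le> env \<rho> k y"
  unfolding env_def using assms by (auto intro!: suminf_nonneg simp: tempered_def)

lemma exp_diff_le:
  assumes "x' \<le> (x::real)"
  shows "exp x - exp x' \<le> exp x * (x - x')"
proof -
  have "exp x - exp x' = exp x * (1 - exp (x' - x))" by (simp add: right_diff_distrib flip: exp_add)
  also have "\<dots> \<le> exp x * (x - x')"
  proof (rule mult_left_mono)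
    show "1 - exp (x' - x) \<le> x - x'" using exp_ge_add_one_self[of "x' - x"] by linarith
  qed simp
  finally show ?thesis .
qed

lemma ln_g_dens_lipschitz:
  assumes "\<bar>x\<bar> \<le> K" "\<bar>x'\<bar> \<le> K"
  shows "\<bar>ln (g_dens x m) - ln (g_dens x' m)\<bar> \<le> \<bar>x - x'\<bar> * (real m + exp K)"
proof -
  have *: "\<bar>exp x - exp x'\<bar> \<le> \<bar>x - x'\<bar> * exp K" if "\<bar>x\<bar> \<le> K" "x' \<le> x" for x x'
  proof -
    have "exp x - exp x' \<le> exp x * (x - x')" by (rule exp_diff_le[OF that(2)])
    also have "\<dots> \<le> exp K * (x - x')" using that by (intro mult_right_mono) auto
    finally show ?thesis using that(2) by (simp add: mult.commute)
  qed
  have e: "\<bar>exp x - exp x'\<bar> \<le> \<bar>x - x'\<bar> * exp K"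
    using *[of x x'] *[of x' x] assms by (cases "x' \<le> x") (auto simp: abs_minus_commute)
  have "ln (g_dens x m) - ln (g_dens x' m) = (x - x') * real m - (exp x - exp x')"
    by (simp add: ln_g_dens algebra_simps)
  also have "\<bar>\<dots>\<bar> \<le> \<bar>x - x'\<bar> * real m + \<bar>exp x - exp x'\<bar>"
    using abs_triangle_ineq4[of "(x - x') * real m" "exp x - exp x'"] by (simp add: abs_mult)
  finally show ?thesis using e by (simp add: distrib_left)
qed

text \<open>Two rates are kept: the weights decay like \<rho>0^j, but differences of weights are
  measured against the slower \<rho>^j. The gap makes late weights of all parameters negligible on
  the scale \<rho>^j, so nearby parameters have uniformly close weights.\<close>

locale compact_params =
  fixes p q :: nat and \<Theta> :: "param set" and B C \<rho>0 \<rho> :: real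
  assumes p: "p \<ge> 1" and q: "q \<ge> 1"
    and \<Theta>_sub: "\<Theta> \<subseteq> param_space p q" and \<Theta>_compact: "compact \<Theta>"
    and \<rho>0: "0 < \<rho>0" "\<rho>0 < \<rho>" and \<rho>1: "\<rho> < 1" and C: "0 < C" and B: "0 < B"
    and ca_bound: "\<And>\<theta> i. \<theta> \<in> \<Theta> \<Longrightarrow> \<bar>ca \<theta> i\<bar> \<le> B"
    and cb_bound: "\<And>\<theta> i. \<theta> \<in> \<Theta> \<Longrightarrow> \<bar>cb \<theta> i\<bar> \<le> B"
    and decay: "\<And>\<theta> l n. \<theta> \<in> \<Theta> \<Longrightarrow> \<bar>impulse (max p q) (autoreg \<theta>) l n\<bar> \<le> C * \<rho> ^ n"
    and hcoef_decay0: "\<And>\<theta> j. \<theta> \<in> \<Theta> \<Longrightarrow> \<bar>hcoef \<theta> j\<bar> \<le> C * \<rho>0 ^ j"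
    and cst_bound: "\<And>\<theta>. \<theta> \<in> \<Theta> \<Longrightarrow> \<bar>cst p \<theta>\<bar> \<le> C"
    and cst_eq: "\<And>\<theta>. \<theta> \<in> \<Theta> \<Longrightarrow> cst p \<theta> = om \<theta> + (\<Sum>i=1..p. ca \<theta> i * cst p \<theta>)"
    and cst_cont: "continuous_on \<Theta> (cst p)"
begin

lemma \<rho>: "0 < \<rho>" "\<rho> < 1"
  using \<rho>0 \<rho>1 by auto

lemma hcoef_decay: "\<theta> \<in> \<Theta> \<Longrightarrow> \<bar>hcoef \<theta> j\<bar> \<le> C * \<rho> ^ j"
  using \<rho>0 C by (intro order_trans[OF hcoef_decay0] mult_left_mono power_mono) auto

lemma env_summable:
  "tempered \<rho> y \<Longrightarrow> summable (\<lambda>j. \<rho> ^ j * lnobs y (k - 1 - int j))"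
  by (simp add: tempered_def)

lemma weighted_le_env:
  assumes y: "tempered \<rho> y" and h: "\<And>j. \<bar>h j\<bar> \<le> \<eta> * \<rho> ^ j" and c: "\<bar>c\<bar> \<le> \<eta>"
  shows "\<bar>c + (\<Sum>j. h j * lnobs y (k - 1 - int j))\<bar> \<le> \<eta> * env \<rho> k y"
proof -
  have "\<bar>\<Sum>j. h j * lnobs y (k - 1 - int j)\<bar> \<le> (\<Sum>j. \<eta> * (\<rho> ^ j * lnobs y (k - 1 - int j)))"
    unfolding real_norm_def[symmetric]
  proof (rule norm_suminf_le)
    show "norm (h j * lnobs y (k - 1 - int j)) \<le> \<eta> * (\<rho> ^ j * lnobs y (k - 1 - int j))" for j
      using mult_right_mono[OF h[of j], of "lnobs y (k - 1 - int j)"] by (simp add: abs_mult mult.assoc)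
  qed (intro summable_mult env_summable y)
  also have "\<dots> = \<eta> * (\<Sum>j. \<rho> ^ j * lnobs y (k - 1 - int j))"
    by (rule suminf_mult[OF env_summable[OF y]])
  finally show ?thesis using c unfolding env_def by (simp add: distrib_left)
qed

lemma filt_le_env:
  assumes "\<theta> \<in> \<Theta>" "tempered \<rho> y"
  shows "\<bar>filt p \<theta> k y\<bar> \<le> C * env \<rho> k y"
  unfolding filt_def by (rule weighted_le_env) (use assms hcoef_decay cst_bound in auto)

lemma filt_diff_le_env:
  assumes \<theta>: "\<theta> \<in> \<Theta>" "\<theta>' \<in> \<Theta>" and y: "tempered \<rho> y" and "\<bar>cst p \<theta> - cst p \<theta>'\<bar> \<le> \<eta>"
    and "\<And>j. \<bar>hcoef \<theta> j - hcoef \<theta>' j\<bar> \<le> \<eta> * \<rho> ^ j"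
  shows "\<bar>filt p \<theta> k y - filt p \<theta>' k y\<bar> \<le> \<eta> * env \<rho> k y"
proof -
  note s = weighted_summable_shift[OF y \<rho>(1) hcoef_decay, of _ "k - 1"]
  have "filt p \<theta> k y - filt p \<theta>' k y = (cst p \<theta> - cst p \<theta>') +
      (\<Sum>j. (hcoef \<theta> j - hcoef \<theta>' j) * lnobs y (k - 1 - int j))"
    unfolding filt_def left_diff_distrib using suminf_diff[OF s[OF \<theta>(1)] s[OF \<theta>(2)]] by simp
  then show ?thesis using weighted_le_env[OF y assms(5,4), of k] by simp
qed

text \<open>Infinitely many inequalities reduce to finitely many: from some index on they hold by
  the gap between the two rates, and below it by continuity of each weight.\<close>

lemma coefficient_neighbourhood:
  assumes \<theta>0: "\<theta>0 \<in> \<Theta>" and \<eta>: "0 < \<eta>"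
  obtains V where "open V" "\<theta>0 \<in> V" "\<And>\<theta>. \<theta> \<in> \<Theta> \<inter> V \<Longrightarrow> \<bar>cst p \<theta> - cst p \<theta>0\<bar> \<le> \<eta>"
    "\<And>\<theta> j. \<theta> \<in> \<Theta> \<inter> V \<Longrightarrow> \<bar>hcoef \<theta> j - hcoef \<theta>0 j\<bar> \<le> \<eta> * \<rho> ^ j"
proof -
  have "(\<lambda>j. 2 * C * (\<rho>0 / \<rho>) ^ j) \<longlonglongrightarrow> 2 * C * 0"
    using \<rho>0 by (intro tendsto_intros LIMSEQ_power_zero) auto
  then have "eventually (\<lambda>j. 2 * C * (\<rho>0 / \<rho>) ^ j < \<eta>) sequentially"
    using \<eta> by (intro order_tendstoD) auto
  then obtain J where J: "\<And>j. J \<le> j \<Longrightarrow> 2 * C * (\<rho>0 / \<rho>) ^ j < \<eta>" by (auto simp: eventually_sequentially)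
  define V1 where "V1 = (\<Inter>j\<in>{..<J}. {\<theta>. \<bar>hcoef \<theta> j - hcoef \<theta>0 j\<bar> < \<eta> * \<rho> ^ j})"
  have "open {\<theta>. \<bar>hcoef \<theta> j - hcoef \<theta>0 j\<bar> < \<eta> * \<rho> ^ j}" for j
    by (intro open_Collect_less continuous_on_rabs continuous_on_diff continuous_hcoef continuous_on_const)
  then have V1: "open V1" unfolding V1_def by (intro open_INT) auto
  \<comment> \<open>\<open>cst\<close> is known to be continuous on \<Theta>, where its denominator
    does not vanish, so its preimage is open relative to \<Theta> and has to be extended to an open
    set.\<close>
  obtain V2 where V2: "open V2" "V2 \<inter> \<Theta> = cst p -` {t. \<bar>t - cst p \<theta>0\<bar> < \<eta>} \<inter> \<Theta>"
  proof -
    have "open {t::real. \<bar>t - cst p \<theta>0\<bar> < \<eta>}" by (intro open_Collect_less continuous_intros)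
    then show thesis using cst_cont that unfolding continuous_on_open_invariant by blast
  qed
  show ?thesis
  proof (rule that[of "V1 \<inter> V2"])
    show "open (V1 \<inter> V2)" using V1 V2 by auto
    have "\<theta>0 \<in> V1" using \<eta> \<rho> by (simp add: V1_def)
    moreover have "\<theta>0 \<in> V2 \<inter> \<Theta>" unfolding V2(2) using \<theta>0 \<eta> by simp
    ultimately show "\<theta>0 \<in> V1 \<inter> V2" by blast
    fix \<theta> assume \<theta>: "\<theta> \<in> \<Theta> \<inter> (V1 \<inter> V2)"
    have "\<theta> \<in> V2 \<inter> \<Theta>" using \<theta> by blast
    then show "\<bar>cst p \<theta> - cst p \<theta>0\<bar> \<le> \<eta>" unfolding V2(2) by simp
    show "\<bar>hcoef \<theta> j - hcoef \<theta>0 j\<bar> \<le> \<eta> * \<rho> ^ j" for j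
    proof (cases "j < J")
      case True
      have "\<theta> \<in> V1" using \<theta> by blast
      then show ?thesis using True unfolding V1_def by (simp add: less_imp_le)
    next
      case False
      have "\<bar>hcoef \<theta> j - hcoef \<theta>0 j\<bar> \<le> C * \<rho>0 ^ j + C * \<rho>0 ^ j"
        using hcoef_decay0[of \<theta> j] hcoef_decay0[of \<theta>0 j] \<theta> \<theta>0 by (intro order_trans[OF abs_triangle_ineq4] add_mono) auto
      also have "\<dots> = 2 * C * (\<rho>0 / \<rho>) ^ j * \<rho> ^ j" using \<rho> by (simp add: power_divide)
      also have "\<dots> \<le> \<eta> * \<rho> ^ j" using J[of j] False \<rho> by (intro mult_right_mono) auto
      finally show ?thesis .
    qed
  qed
qed

text \<open>The first summand collects the lags that reach negative times, where the artificial
  value \<open>u1\<close> stands in for an observation; the second the difference of the filters at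
  the r starting times. It depends on the path but not on \<theta>.\<close>

definition init_err :: "real \<Rightarrow> real \<Rightarrow> (int \<Rightarrow> nat) \<Rightarrow> real" where
  "init_err x1 u1 y = C * (real q / \<rho> ^ q * (B * (\<Sum>m=1..q. lnobs y (- int m) + \<bar>u1\<bar>))) +
    real (max p q) * C * (1 + B) * (\<Sum>i<max p q. C * env \<rho> (- int i) y + \<bar>x1\<bar>)"

lemma init_err_nonneg:
  assumes "tempered \<rho> y"
  shows "0 \<le> init_err x1 u1 y"
proof -
  have "0 \<le> env \<rho> k y" for k using env_ge_1[OF assms \<rho>(1), of k] by linarith
  then show ?thesis unfolding init_err_def using C B \<rho>
    by (intro add_nonneg_nonneg mult_nonneg_nonneg sum_nonneg divide_nonneg_nonneg) auto
qed

text \<open>The difference of the two filters solves the autoregression with a forcing that vanishes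
  from time q on, because all lagged observations are then genuine.\<close>

lemma filter_rec_close:
  assumes \<theta>: "\<theta> \<in> \<Theta>" and y: "tempered \<rho> y"
  shows "\<bar>filt p \<theta> (int n) y - filter_rec p q \<theta> (\<lambda>_. x1) (log_obs (\<lambda>_. u1) y) (int n)\<bar>
    \<le> \<rho> ^ n * init_err x1 u1 y"
proof -
  define x where "x = filter_rec p q \<theta> (\<lambda>_. x1) (log_obs (\<lambda>_. u1) y)"
  define u where "u = log_obs (\<lambda>_. u1) y"
  define d where "d k = filt p \<theta> k y - x k" for k
  define e where "e k = (\<Sum>i=1..q. cb \<theta> i * (lnobs y (k - int i) - u (k - int i)))" for k
  define r where "r = max p q"
  define T where "T = (\<Sum>m=1..q. lnobs y (- int m) + \<bar>u1\<bar>)"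
  have T0: "0 \<le> T" unfolding T_def by (intro sum_nonneg) simp
  have \<theta>p: "\<theta> \<in> param_space p q" using \<theta> \<Theta>_sub by blast
  have x0: "x k = x1" if "k \<le> 0" for k unfolding x_def using that by (subst filter_rec.simps) simp
  have "\<bar>d (0 + int n)\<bar> \<le> C * (\<Sum>l=1..n. \<rho> ^ (n - l) * \<bar>e (0 + int l)\<bar>)
    + real r * C * (1 + B) * \<rho> ^ n * (\<Sum>i<r. \<bar>d (0 - int i)\<bar>)"
  proof (rule recursion_bound[where c = "autoreg \<theta>"])
    fix k :: int assume k: "0 < k"
    have xk: "x k = om \<theta> + (\<Sum>i=1..p. ca \<theta> i * x (k - int i)) + (\<Sum>i=1..q. cb \<theta> i * u (k - int i))"
      unfolding x_def u_def using k by (subst filter_rec.simps) simp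
    have fk: "filt p \<theta> k y = om \<theta> + (\<Sum>i=1..p. ca \<theta> i * filt p \<theta> (k - int i) y)
      + (\<Sum>i=1..q. cb \<theta> i * lnobs y (k - int i))"
      by (rule filt_recursion_of_decay[OF \<theta>p \<rho>(1) hcoef_decay[OF \<theta>] cst_eq[OF \<theta>] y])
    have "d k = (\<Sum>i=1..p. ca \<theta> i * d (k - int i)) + e k"
      unfolding d_def e_def xk fk by (simp add: right_diff_distrib sum_subtractf)
    also have "(\<Sum>i=1..p. ca \<theta> i * d (k - int i)) = (\<Sum>i=1..r. ca \<theta> i * d (k - int i))"
      by (rule sum_lags_extend) (auto simp: r_def param_space_ca[OF \<theta>p])
    finally show "d k = (\<Sum>j=1..r. autoreg \<theta> k j * d (k - int j)) + e k"
      by (simp add: autoreg_def)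
  qed (use ca_bound[OF \<theta>] decay[OF \<theta>] \<rho> p in \<open>auto simp: r_def autoreg_def\<close>)
  moreover have "(\<Sum>l=1..n. \<rho> ^ (n - l) * \<bar>e (0 + int l)\<bar>) \<le> \<rho> ^ n * (real q / \<rho> ^ q * (B * T))"
  proof -
    have el: "\<bar>e (int l)\<bar> \<le> B * T" for l
    proof -
      have "\<bar>e (int l)\<bar> \<le> (\<Sum>i=1..q. \<bar>cb \<theta> i * (lnobs y (int l - int i) - u (int l - int i))\<bar>)"
        unfolding e_def by (rule sum_abs)
      also have "\<dots> = (\<Sum>i\<in>{Suc l..q} \<inter> {1..q}. \<bar>cb \<theta> i * (lnobs y (int l - int i) - u (int l - int i))\<bar>)"
        by (rule sum.mono_neutral_right) (auto simp: u_def log_obs_def lnobs_def)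
      also have "\<dots> \<le> (\<Sum>i\<in>{Suc l..q} \<inter> {1..q}. B * (lnobs y (int l - int i) + \<bar>u1\<bar>))"
      proof (rule sum_mono)
        fix i assume i: "i \<in> {Suc l..q} \<inter> {1..q}"
        then have "u (int l - int i) = u1" by (simp add: u_def log_obs_def)
        then have "\<bar>lnobs y (int l - int i) - u (int l - int i)\<bar> \<le> lnobs y (int l - int i) + \<bar>u1\<bar>"
          using abs_triangle_ineq4[of "lnobs y (int l - int i)" u1] by simp
        then show "\<bar>cb \<theta> i * (lnobs y (int l - int i) - u (int l - int i))\<bar> \<le> B * (lnobs y (int l - int i) + \<bar>u1\<bar>)"
          unfolding abs_mult using cb_bound[OF \<theta>, of i] B by (intro mult_mono) auto
      qed
      also have "\<dots> = (\<Sum>m\<in>{1..q - l}. B * (lnobs y (- int m) + \<bar>u1\<bar>))"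
        by (rule sum.reindex_bij_witness[of _ "\<lambda>m. m + l" "\<lambda>i. i - l"]) (auto simp: of_nat_diff)
      also have "\<dots> \<le> (\<Sum>m\<in>{1..q}. B * (lnobs y (- int m) + \<bar>u1\<bar>))"
        using B by (intro sum_mono2) auto
      finally show ?thesis by (simp add: T_def sum_distrib_left)
    qed
    have e0: "e (int l) = 0" if "q \<le> l" for l
      unfolding e_def using that by (intro sum.neutral) (auto simp: u_def log_obs_def lnobs_def)
    have "(\<Sum>l=1..n. \<rho> ^ (n - l) * \<bar>e (0 + int l)\<bar>) \<le> (\<Sum>l=1..n. if l \<le> q then \<rho> ^ n / \<rho> ^ q * (B * T) else 0)"
    proof (rule sum_mono)
      fix l assume l: "l \<in> {1..n}"
      show "\<rho> ^ (n - l) * \<bar>e (0 + int l)\<bar> \<le> (if l \<le> q then \<rho> ^ n / \<rho> ^ q * (B * T) else 0)"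
      proof (cases "l \<le> q")
        case True
        have "\<rho> ^ q * \<rho> ^ (n - l) = \<rho> ^ (q + (n - l))" by (simp add: power_add)
        also have "\<dots> \<le> \<rho> ^ n" using \<rho> True l by (intro power_decreasing) auto
        finally have "\<rho> ^ (n - l) \<le> \<rho> ^ n / \<rho> ^ q" using \<rho> by (simp add: pos_le_divide_eq mult.commute)
        then have "\<rho> ^ (n - l) * \<bar>e (0 + int l)\<bar> \<le> \<rho> ^ n / \<rho> ^ q * (B * T)"
          using el[of l] \<rho> by (intro mult_mono) auto
        then show ?thesis using True by simp
      qed (simp add: e0)
    qed
    also have "\<dots> = (\<Sum>l\<in>{1..n} \<inter> {..q}. \<rho> ^ n / \<rho> ^ q * (B * T))"
      by (subst sum.inter_restrict) (auto intro!: sum.cong)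
    also have "\<dots> \<le> (\<Sum>l=1..q. \<rho> ^ n / \<rho> ^ q * (B * T))"
      using B \<rho> T0 by (intro sum_mono2) auto
    finally show ?thesis by (simp add: mult_ac)
  qed
  then have "C * (\<Sum>l=1..n. \<rho> ^ (n - l) * \<bar>e (0 + int l)\<bar>) \<le> C * (\<rho> ^ n * (real q / \<rho> ^ q * (B * T)))"
    using C by (intro mult_left_mono) auto
  moreover have "(\<Sum>i<r. \<bar>d (0 - int i)\<bar>) \<le> (\<Sum>i<r. C * env \<rho> (- int i) y + \<bar>x1\<bar>)"
  proof (rule sum_mono)
    fix i
    show "\<bar>d (0 - int i)\<bar> \<le> C * env \<rho> (- int i) y + \<bar>x1\<bar>"
      using filt_le_env[OF \<theta> y, of "- int i"] x0[of "- int i"] by (simp add: d_def)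
  qed
  then have "real r * C * (1 + B) * \<rho> ^ n * (\<Sum>i<r. \<bar>d (0 - int i)\<bar>) \<le>
      real r * C * (1 + B) * \<rho> ^ n * (\<Sum>i<r. C * env \<rho> (- int i) y + \<bar>x1\<bar>)"
    using C B \<rho> by (intro mult_left_mono) auto
  ultimately have "\<bar>d (int n)\<bar> \<le> C * (\<rho> ^ n * (real q / \<rho> ^ q * (B * T))) +
      real r * C * (1 + B) * \<rho> ^ n * (\<Sum>i<r. C * env \<rho> (- int i) y + \<bar>x1\<bar>)" by simp
  also have "\<dots> = \<rho> ^ n * init_err x1 u1 y"
    by (simp add: init_err_def T_def r_def algebra_simps)
  finally show ?thesis by (simp add: d_def x_def)
qed

definition stat_lik :: "nat \<Rightarrow> (int \<Rightarrow> nat) \<Rightarrow> param \<Rightarrow> real" where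
  "stat_lik n y \<theta> = (\<Sum>k=1..n. ln (g_dens (filt p \<theta> (int k) y) (y (int k))))"

text \<open>The total effect of the initial values on the likelihood is bounded uniformly in n and
  \<theta>, since the k-th term is damped by \<rho>^k; after division by n it disappears.\<close>

lemma log_lik_close:
  assumes y: "tempered \<rho> y" and s: "summable (\<lambda>k. \<rho> ^ k * (real (y (int k)) + exp (C * env \<rho> (int k) y)))"
  shows "\<exists>A. \<forall>n\<ge>1. \<forall>\<theta>\<in>\<Theta>. \<bar>real n * log_lik p q (const_init x1 y1) n y \<theta> - stat_lik n y \<theta>\<bar> \<le> A"
proof -
  define u1 where "u1 = ln (1 + real y1)"
  define W where "W = init_err x1 u1 y"
  have W0: "0 \<le> W" unfolding W_def by (rule init_err_nonneg[OF y])
  define S where "S = (\<Sum>k. \<rho> ^ k * (real (y (int k)) + exp (C * env \<rho> (int k) y)))"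
  have "\<bar>real n * log_lik p q (const_init x1 y1) n y \<theta> - stat_lik n y \<theta>\<bar> \<le> W * exp W * S"
    if \<theta>: "\<theta> \<in> \<Theta>" and n: "1 \<le> n" for n \<theta>
  proof -
    define x where "x k = filter_rec p q \<theta> (\<lambda>_. x1) (log_obs (\<lambda>_. u1) y) (int k)" for k
    have "real n * log_lik p q (const_init x1 y1) n y \<theta> - stat_lik n y \<theta> =
        (\<Sum>k=1..n. ln (g_dens (x k) (y (int k))) - ln (g_dens (filt p \<theta> (int k) y) (y (int k))))"
      using n by (simp add: log_lik_def const_init_def stat_lik_def x_def u1_def sum_subtractf)
    also have "\<bar>\<dots>\<bar> \<le> (\<Sum>k=1..n. \<bar>ln (g_dens (x k) (y (int k))) - ln (g_dens (filt p \<theta> (int k) y) (y (int k)))\<bar>)"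
      by (rule sum_abs)
    also have "\<dots> \<le> (\<Sum>k=1..n. W * exp W * (\<rho> ^ k * (real (y (int k)) + exp (C * env \<rho> (int k) y))))"
    proof (rule sum_mono)
      fix k
      let ?f = "filt p \<theta> (int k) y" and ?E = "exp (C * env \<rho> (int k) y)"
      have d: "\<bar>x k - ?f\<bar> \<le> \<rho> ^ k * W"
        using filter_rec_close[OF \<theta> y, of k x1 u1] by (simp add: x_def W_def abs_minus_commute)
      have "\<rho> ^ k * W \<le> 1 * W" using W0 \<rho> by (intro mult_right_mono) (auto simp: power_le_one)
      then have b: "\<bar>x k\<bar> \<le> C * env \<rho> (int k) y + W" "\<bar>?f\<bar> \<le> C * env \<rho> (int k) y + W"
        using d filt_le_env[OF \<theta> y, of "int k"] W0 by linarith+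
      have "\<bar>ln (g_dens (x k) (y (int k))) - ln (g_dens ?f (y (int k)))\<bar> \<le>
          \<bar>x k - ?f\<bar> * (real (y (int k)) + exp (C * env \<rho> (int k) y + W))"
        by (rule ln_g_dens_lipschitz[OF b])
      also have "\<dots> \<le> (\<rho> ^ k * W) * (exp W * (real (y (int k)) + ?E))"
      proof (rule mult_mono[OF d])
        have "real (y (int k)) \<le> exp W * real (y (int k))" using W0 by (simp add: mult_le_cancel_right1)
        then show "real (y (int k)) + exp (C * env \<rho> (int k) y + W) \<le> exp W * (real (y (int k)) + ?E)"
          by (simp add: exp_add distrib_left mult.commute)
      qed (use W0 \<rho> in auto)
      finally show "\<bar>ln (g_dens (x k) (y (int k))) - ln (g_dens ?f (y (int k)))\<bar> \<le>
          W * exp W * (\<rho> ^ k * (real (y (int k)) + ?E))" by (simp add: mult_ac)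
    qed
    also have "\<dots> = W * exp W * (\<Sum>k=1..n. \<rho> ^ k * (real (y (int k)) + exp (C * env \<rho> (int k) y)))"
      by (simp add: sum_distrib_left)
    also have "\<dots> \<le> W * exp W * S"
      unfolding S_def using W0 \<rho> by (intro mult_left_mono sum_le_suminf s) (auto intro!: mult_nonneg_nonneg add_nonneg_nonneg)
    finally show ?thesis .
  qed
  then show ?thesis by blast
qed

end

lemma compact_params_exists:
  assumes pq: "p \<ge> 1" "q \<ge> 1" and \<Theta>: "\<Theta> \<subseteq> param_space p q" "compact \<Theta>"
    and con: "\<And>\<theta>. \<theta> \<in> \<Theta> \<Longrightarrow> contracting p q \<theta>"
  obtains B C \<rho>0 \<rho> where "compact_params p q \<Theta> B C \<rho>0 \<rho>"
proof -
  obtain B where B: "0 < B" "\<And>\<theta>. \<theta> \<in> \<Theta> \<Longrightarrow> \<bar>om \<theta>\<bar> \<le> B" "\<And>\<theta> i. \<theta> \<in> \<Theta> \<Longrightarrow> \<bar>ca \<theta> i\<bar> \<le> B"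
    "\<And>\<theta> i. \<theta> \<in> \<Theta> \<Longrightarrow> \<bar>cb \<theta> i\<bar> \<le> B"
    by (rule compact_coefficients_bounded[OF \<Theta>(2,1)]) (rule that, assumption+)
  obtain C1 \<rho>0 where d: "0 < \<rho>0" "\<rho>0 < 1" "0 < C1"
    "\<And>\<theta> l n. \<theta> \<in> \<Theta> \<Longrightarrow> \<bar>impulse (max p q) (autoreg \<theta>) l n\<bar> \<le> C1 * \<rho>0 ^ n"
    by (rule uniform_decay[OF pq(1) \<Theta>(2,1) con]) (assumption, rule that, assumption+)
  have \<Theta>p: "\<theta> \<in> param_space p q" if "\<theta> \<in> \<Theta>" for \<theta> using \<Theta> that by blast
  have s: "(\<Sum>i=1..p. ca \<theta> i) \<noteq> 1" if "\<theta> \<in> \<Theta>" for \<theta>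
    by (rule sum_ca_neq_1[OF \<Theta>p[OF that] pq(1) d(4)[OF that] d(1,2)])
  have cc: "continuous_on \<Theta> (cst p)"
    unfolding cst_def[abs_def]
    using s by (intro continuous_on_divide continuous_on_diff continuous_on_const continuous_on_sum
        continuous_on_subset[OF continuous_om] continuous_on_subset[OF continuous_ca]) auto
  have "compact (cst p ` \<Theta>)" using cc \<Theta>(2) by (rule compact_continuous_image)
  then obtain C3 where C3: "\<And>\<theta>. \<theta> \<in> \<Theta> \<Longrightarrow> \<bar>cst p \<theta>\<bar> \<le> C3"
    using compact_imp_bounded[of "cst p ` \<Theta>"] by (auto simp: bounded_iff)
  define C2 where "C2 = C1 * real q * B / \<rho>0 ^ q"
  define C where "C = max C1 (max C2 C3)"
  \<comment> \<open>The midpoint of \<rho>0 and 1: any rate strictly between them would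
    serve.\<close>
  define \<rho> where "\<rho> = (1 + \<rho>0) / 2"
  have \<rho>: "\<rho>0 < \<rho>" "\<rho> < 1" using d by (auto simp: \<rho>_def)
  show ?thesis
  proof (rule that[of B C \<rho>0 \<rho>], unfold_locales)
    show "0 < C" using d by (simp add: C_def)
    fix \<theta> assume \<theta>: "\<theta> \<in> \<Theta>"
    have "C1 * \<rho>0 ^ n \<le> C * \<rho> ^ n" for n
      using d \<rho> by (intro mult_mono power_mono) (auto simp: C_def)
    then show "\<bar>impulse (max p q) (autoreg \<theta>) l n\<bar> \<le> C * \<rho> ^ n" for l n
      using d(4)[OF \<theta>, of l n] by (rule order_trans[rotated])
    have "\<bar>hcoef \<theta> j\<bar> \<le> C2 * \<rho>0 ^ j" for j
      unfolding C2_def by (rule hcoef_bound[OF \<Theta>p[OF \<theta>] pq(1) B(3)[OF \<theta>] B(4)[OF \<theta>] d(4)[OF \<theta>] d(1,2)])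
    moreover have "C2 * \<rho>0 ^ j \<le> C * \<rho>0 ^ j" for j using d by (intro mult_right_mono) (auto simp: C_def)
    ultimately show "\<bar>hcoef \<theta> j\<bar> \<le> C * \<rho>0 ^ j" for j by (rule order_trans)
    show "\<bar>cst p \<theta>\<bar> \<le> C" using C3[OF \<theta>] by (simp add: C_def)
    have "o' / (1 - a) = o' + a * (o' / (1 - a))" if "a \<noteq> 1" for o' a :: real
      using that by (simp add: field_simps)
    from this[OF s[OF \<theta>], of "om \<theta>"] show "cst p \<theta> = om \<theta> + (\<Sum>i=1..p. ca \<theta> i * cst p \<theta>)"
      unfolding cst_def sum_distrib_right[symmetric] .
  qed (fact pq \<Theta> d \<rho> B cc)+
qed

text \<open>The equality case of 1 + x \<le> exp x: squaring this inequality at x/2 leaves the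
  surplus x^2/4.\<close>

lemma exp_eq_one_plus:
  assumes "exp x = 1 + (x::real)" shows "x = 0"
proof (rule ccontr)
  assume x: "x \<noteq> 0"
  show False
  proof (cases "1 + x / 2 \<ge> 0")
    case True
    have "(1 + x / 2)\<^sup>2 \<le> (exp (x / 2))\<^sup>2" using True by (intro power_mono exp_ge_add_one_self)
    also have "\<dots> = exp x" by (simp add: power2_eq_square flip: exp_add)
    finally have "1 + x + x\<^sup>2 / 4 \<le> 1 + x" using assms by (simp add: power2_eq_square algebra_simps)
    then have "x\<^sup>2 \<le> 0" by simp
    then show False using x by simp
  next
    case False
    then have "1 + x < 0" by linarith
    then show False using assms exp_gt_zero[of x] by linarith
  qed
qed

section \<open>Mean contrast and comparison of likelihoods\<close>

locale mle_model = compact_params + obs_process p \<theta>s Q for \<theta>s Q +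
  assumes \<theta>s: "\<theta>s \<in> \<Theta>"
    and lnobs_moment: "\<And>\<tau>. 0 < \<tau> \<Longrightarrow> (\<integral>\<^sup>+y. ennreal (exp (\<tau> * lnobs y 0)) \<partial>Q) < \<infinity>"
    and ergodic_shift: "ergodic_map Q (shift 1)"
begin

lemma lnobs_moment_bound:
  assumes "0 < \<tau>"
  obtains K where "0 \<le> K" "\<And>k. (\<integral>\<^sup>+y. ennreal (exp (\<tau> * lnobs y k)) \<partial>Q) \<le> ennreal K"
proof -
  have "(\<integral>\<^sup>+y. ennreal (exp (\<tau> * lnobs y k)) \<partial>Q) = (\<integral>\<^sup>+y. ennreal (exp (\<tau> * lnobs y 0)) \<partial>Q)" for k
    using nn_integral_shift[of "\<lambda>y. ennreal (exp (\<tau> * lnobs y 0))" k] by (simp add: lnobs_shift)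
  moreover obtain K where "0 \<le> K" "(\<integral>\<^sup>+y. ennreal (exp (\<tau> * lnobs y 0)) \<partial>Q) = ennreal K"
    using lnobs_moment[OF assms] by (cases "\<integral>\<^sup>+y. ennreal (exp (\<tau> * lnobs y 0)) \<partial>Q") auto
  ultimately show ?thesis using that[of K] by simp
qed

lemma env_moment:
  assumes \<tau>: "0 < \<tau>"
  shows "(\<integral>\<^sup>+y. ennreal (exp (\<tau> * env \<rho> 0 y)) \<partial>Q) < \<infinity>"
proof -
  have "0 < \<tau> / (1 - \<rho>)" using \<tau> \<rho> by simp
  then obtain K where K: "0 \<le> K" "\<And>k. (\<integral>\<^sup>+y. ennreal (exp (\<tau> / (1 - \<rho>) * lnobs y k)) \<partial>Q) \<le> ennreal K"
    using lnobs_moment_bound by blast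
  have "(\<integral>\<^sup>+y. ennreal (exp (\<tau> * (\<Sum>j. \<rho> ^ j * lnobs y (0 - 1 - int j)))) \<partial>Q) \<le> ennreal K"
    by (rule exp_moment_weighted_sum(2)[where V = "\<lambda>j y. lnobs y (0 - 1 - int j)", OF _ _ \<rho> \<tau> K(2)]) auto
  then have "ennreal (exp \<tau>) * (\<integral>\<^sup>+y. ennreal (exp (\<tau> * (\<Sum>j. \<rho> ^ j * lnobs y (0 - 1 - int j)))) \<partial>Q) \<le> ennreal (exp \<tau>) * ennreal K"
    by (intro mult_left_mono) auto
  moreover have "(\<integral>\<^sup>+y. ennreal (exp (\<tau> * env \<rho> 0 y)) \<partial>Q) =
      ennreal (exp \<tau>) * (\<integral>\<^sup>+y. ennreal (exp (\<tau> * (\<Sum>j. \<rho> ^ j * lnobs y (0 - 1 - int j)))) \<partial>Q)"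
    by (subst nn_integral_cmult[symmetric]) (auto simp: env_def distrib_left exp_add ennreal_mult)
  moreover have "ennreal (exp \<tau>) * ennreal K < \<infinity>" by (simp add: ennreal_mult_less_top)
  ultimately show ?thesis by (simp add: le_less_trans)
qed

text \<open>If two filters differ by at most \<eta> times \<open>env\<close>, then
  \<open>ln_g_dens_lipschitz\<close> bounds the change of the log-likelihood of one observation by
  \<eta> times this.\<close>

definition majorant :: "(int \<Rightarrow> nat) \<Rightarrow> real" where
  "majorant y = env \<rho> 0 y * (real (y 0) + exp (C * env \<rho> 0 y))"

lemma measurable_majorant [measurable]: "majorant \<in> borel_measurable obs_space"
  unfolding majorant_def by measurable

lemma AE_tempered_\<rho>: "AE y in Q. tempered \<rho> y"
  by (rule AE_tempered[OF \<rho>])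

lemma integrable_majorant: "integrable Q majorant"
proof (rule integrableI_nonneg)
  show "AE y in Q. 0 \<le> majorant y"
    using AE_tempered_\<rho>
  proof eventually_elim
    case (elim y)
    show ?case using env_ge_1[OF elim \<rho>(1), of 0] by (simp add: majorant_def add_nonneg_nonneg)
  qed
  have "(\<integral>\<^sup>+y. ennreal (majorant y) \<partial>Q) \<le> (\<integral>\<^sup>+y. ennreal (exp (2 * env \<rho> 0 y)) + (ennreal (exp (2 * lnobs y 0)) +
      ennreal (exp ((C + 1) * env \<rho> 0 y))) \<partial>Q)"
  proof (rule nn_integral_mono_AE)
    show "AE y in Q. ennreal (majorant y) \<le> ennreal (exp (2 * env \<rho> 0 y)) + (ennreal (exp (2 * lnobs y 0)) +
      ennreal (exp ((C + 1) * env \<rho> 0 y)))"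
      using AE_tempered_\<rho>
    proof eventually_elim
      case (elim y)
      define Z L where "Z = env \<rho> 0 y" and "L = lnobs y 0"
      have Z: "0 \<le> Z" "Z \<le> exp Z"
        using env_ge_1[OF elim \<rho>(1), of 0] exp_ge_add_one_self[of Z] unfolding Z_def by linarith+
      have yL: "real (y 0) \<le> exp L" by (simp add: L_def lnobs_def)
      have "majorant y = Z * real (y 0) + Z * exp (C * Z)" by (simp add: majorant_def Z_def distrib_left)
      also have "\<dots> \<le> exp Z * exp L + exp Z * exp (C * Z)" using Z yL by (intro add_mono mult_mono) auto
      also have "exp Z * exp L \<le> exp (2 * Z) + exp (2 * L)"
      proof (cases "Z \<le> L")
        case True
        then have "exp Z * exp L \<le> exp (2 * L)" by (simp flip: exp_add)
        then show ?thesis using exp_ge_zero[of "2 * Z"] by linarith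
      next
        case False
        then have "exp Z * exp L \<le> exp (2 * Z)" by (simp flip: exp_add)
        then show ?thesis using exp_ge_zero[of "2 * L"] by linarith
      qed
      also have "exp Z * exp (C * Z) = exp ((C + 1) * Z)" by (simp add: algebra_simps flip: exp_add)
      finally show ?case
        by (simp add: Z_def L_def ennreal_plus[symmetric] ennreal_leI add.assoc del: ennreal_plus)
    qed
  qed
  also have "\<dots> = (\<integral>\<^sup>+y. ennreal (exp (2 * env \<rho> 0 y)) \<partial>Q) + ((\<integral>\<^sup>+y. ennreal (exp (2 * lnobs y 0)) \<partial>Q) +
      (\<integral>\<^sup>+y. ennreal (exp ((C + 1) * env \<rho> 0 y)) \<partial>Q))"
    by (simp add: nn_integral_add)
  also have "\<dots> < \<infinity>" using env_moment[of 2] lnobs_moment[of 2] env_moment[of "C + 1"] C by simp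
  finally show "(\<integral>\<^sup>+y. ennreal (majorant y) \<partial>Q) < \<infinity>" .
qed simp

lemma AE_summable_env:
  "AE y in Q. summable (\<lambda>k. \<rho> ^ k * (real (y (int k)) + exp (C * env \<rho> (int k) y)))"
proof -
  define V where "V k y = real (y (int k)) + exp (C * env \<rho> (int k) y)" for k y
  have [measurable]: "V k \<in> borel_measurable obs_space" for k unfolding V_def by measurable
  have shiftV: "V 0 (shift (int k) y) = V k y" for k y
    by (simp add: V_def env_shift) (simp add: shift_def)
  have "(\<integral>\<^sup>+y. ennreal (V 0 y) \<partial>Q) \<le> (\<integral>\<^sup>+y. ennreal (exp (1 * lnobs y 0)) + ennreal (exp (C * env \<rho> 0 y)) \<partial>Q)"
    by (intro nn_integral_mono)
       (simp add: V_def lnobs_def ennreal_plus[symmetric] ennreal_leI add_mono del: ennreal_plus)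
  also have "\<dots> = (\<integral>\<^sup>+y. ennreal (exp (1 * lnobs y 0)) \<partial>Q) + (\<integral>\<^sup>+y. ennreal (exp (C * env \<rho> 0 y)) \<partial>Q)"
    by (rule nn_integral_add) measurable
  also have "\<dots> < \<infinity>" using lnobs_moment[of 1] env_moment[of C] C by simp
  finally have "(\<integral>\<^sup>+y. ennreal (V 0 y) \<partial>Q) < top" by simp
  then obtain K where K: "(\<integral>\<^sup>+y. ennreal (V 0 y) \<partial>Q) = ennreal K" "0 \<le> K"
    by (cases "\<integral>\<^sup>+y. ennreal (V 0 y) \<partial>Q") auto
  have Vk: "(\<integral>\<^sup>+y. ennreal (V k y) \<partial>Q) = ennreal K" for k
    using nn_integral_shift[of "\<lambda>y. ennreal (V 0 y)" "int k"] K by (simp add: shiftV)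
  have "AE y in Q. summable (\<lambda>k. \<rho> ^ k * V k y)"
  proof (rule weighted_sum(1)[where K = K])
    show "0 \<le> V k y" for k y by (simp add: V_def)
  qed (simp_all add: Vk K \<rho>)
  then show ?thesis by (simp add: V_def)
qed

definition contrast :: "param \<Rightarrow> (int \<Rightarrow> nat) \<Rightarrow> real" where
  "contrast \<theta> y = ln (g_dens (filt p \<theta>s 0 y) (y 0)) - ln (g_dens (filt p \<theta> 0 y) (y 0))"

lemma measurable_contrast [measurable]: "contrast \<theta> \<in> borel_measurable obs_space"
  unfolding contrast_def by measurable

lemma integrable_contrast:
  assumes \<theta>: "\<theta> \<in> \<Theta>"
  shows "integrable Q (contrast \<theta>)"
proof (rule Bochner_Integration.integrable_bound)
  show "integrable Q (\<lambda>y. 2 * C * majorant y)" using integrable_majorant by simp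
  show "AE y in Q. norm (contrast \<theta> y) \<le> norm (2 * C * majorant y)"
    using AE_tempered_\<rho>
  proof eventually_elim
    case (elim y)
    define Z where "Z = env \<rho> 0 y"
    have Z: "0 \<le> Z" using env_ge_1[OF elim \<rho>(1), of 0] by (simp add: Z_def)
    have b: "\<bar>filt p \<theta>s 0 y\<bar> \<le> C * Z" "\<bar>filt p \<theta> 0 y\<bar> \<le> C * Z"
      using filt_le_env[OF \<theta>s elim, of 0] filt_le_env[OF \<theta> elim, of 0] by (auto simp: Z_def)
    have "\<bar>contrast \<theta> y\<bar> \<le> \<bar>filt p \<theta>s 0 y - filt p \<theta> 0 y\<bar> * (real (y 0) + exp (C * Z))"
      unfolding contrast_def by (rule ln_g_dens_lipschitz[OF b])
    also have "\<dots> \<le> (2 * C * Z) * (real (y 0) + exp (C * Z))"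
      using b by (intro mult_right_mono) auto
    also have "\<dots> = 2 * C * majorant y" by (simp add: majorant_def Z_def)
    finally show ?case by simp
  qed
qed simp

text \<open>The likelihood ratio has mean one, so \<open>f \<ge> 1 - exp (- f)\<close> makes the mean contrast
  nonnegative, and it vanishes only if the likelihood ratio is constant.\<close>

lemma contrast_pos:
  assumes \<theta>: "\<theta> \<in> \<Theta>" and neq: "\<not> (AE y in Q. filt p \<theta> 0 y = filt p \<theta>s 0 y)"
  shows "0 < expectation (contrast \<theta>)"
proof (rule ccontr)
  assume np: "\<not> 0 < expectation (contrast \<theta>)"
  have "(\<integral>\<^sup>+y. ennreal (exp (- contrast \<theta> y)) \<partial>Q) = 1"
  proof -
    define \<psi> where "\<psi> n z = ennreal (g_dens (filt p \<theta> 0 z) n / g_dens (filt p \<theta>s 0 z) n)" for n z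
    have [measurable]: "\<psi> n \<in> borel_measurable obs_space" for n unfolding \<psi>_def by measurable
    have "(\<integral>\<^sup>+y. ennreal (exp (- contrast \<theta> y)) \<partial>Q) = (\<integral>\<^sup>+y. \<psi> (y 0) (trunc 0 y) \<partial>Q)"
      by (intro nn_integral_cong) (simp add: \<psi>_def contrast_def filt_trunc exp_diff g_dens_pos)
    also have "\<dots> = (\<integral>\<^sup>+y. (\<Sum>n. \<psi> n (trunc 0 y) * ennreal (g_dens (filt p \<theta>s 0 y) n)) \<partial>Q)"
      by (rule one_step) measurable
    also have "\<dots> = (\<integral>\<^sup>+y. 1 \<partial>Q)"
    proof (intro nn_integral_cong)
      fix y
      have "\<psi> n (trunc 0 y) * ennreal (g_dens (filt p \<theta>s 0 y) n) = ennreal (g_dens (filt p \<theta> 0 y) n)" for n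
        using g_dens_pos[of "filt p \<theta>s 0 y" n] by (simp add: \<psi>_def filt_trunc ennreal_mult[symmetric])
      moreover have "(\<Sum>n. ennreal (g_dens (filt p \<theta> 0 y) n)) = ennreal 1"
        by (rule suminf_ennreal_eq[OF _ g_dens_sums]) simp
      ultimately show "(\<Sum>n. \<psi> n (trunc 0 y) * ennreal (g_dens (filt p \<theta>s 0 y) n)) = 1" by simp
    qed
    finally show ?thesis using emeasure_space_1 by simp
  qed
  note en = this
  have ei: "integrable Q (\<lambda>y. exp (- contrast \<theta> y))"
    by (rule integrableI_nonneg) (simp_all add: en)
  have e1: "expectation (\<lambda>y. exp (- contrast \<theta> y)) = 1"
    using nn_integral_eq_integral[OF ei] en by simp
  define h where "h y = contrast \<theta> y - 1 + exp (- contrast \<theta> y)" for y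
  have hi: "integrable Q h" unfolding h_def using ei integrable_contrast[OF \<theta>] by simp
  have h0: "0 \<le> h y" for y using exp_ge_add_one_self[of "- contrast \<theta> y"] by (simp add: h_def)
  have "expectation h = expectation (contrast \<theta>)"
    unfolding h_def using ei integrable_contrast[OF \<theta>] e1 by (simp add: prob_space[simplified])
  then have "expectation h \<le> 0" using np by simp
  moreover have "0 \<le> expectation h" using h0 by (intro integral_nonneg_AE) auto
  ultimately have "expectation h = 0" by simp
  then have "AE y in Q. h y = 0" using integral_nonneg_eq_0_iff_AE[OF hi] h0 by simp
  then have c0: "AE y in Q. contrast \<theta> y = 0"
  proof eventually_elim
    case (elim y)
    then have "exp (- contrast \<theta> y) = 1 + (- contrast \<theta> y)" by (simp add: h_def)
    from exp_eq_one_plus[OF this] show ?case by simp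
  qed
  \<comment> \<open>At \<open>y 0 = 0\<close> the log-density is -exp x, so a vanishing contrast
    there forces equal filters. Given the past, the value 0 has positive probability; the set of
    pasts with different filters is therefore null.\<close>
  define N where "N = {z. filt p \<theta> 0 z \<noteq> filt p \<theta>s 0 z}"
  have "{z \<in> space obs_space. filt p \<theta> 0 z \<noteq> filt p \<theta>s 0 z} \<in> sets obs_space"
    by (intro borel_measurable_neq measurable_filt)
  then have [measurable]: "N \<in> sets obs_space" by (simp add: N_def)
  have "{y \<in> space obs_space. y 0 = 0} \<in> sets obs_space" by measurable
  then have [measurable]: "{y. y 0 = 0} \<in> sets obs_space" by simp
  have "(\<integral>\<^sup>+y. indicator N (trunc 0 y) * indicator {y. y 0 = 0} y \<partial>Q) = (\<integral>\<^sup>+y. 0 \<partial>Q)"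
  proof (rule nn_integral_cong_AE)
    show "AE y in Q. indicator N (trunc 0 y) * indicator {y. y 0 = 0} y = (0::ennreal)"
      using c0
    proof eventually_elim
      case (elim y)
      have "filt p \<theta> 0 y = filt p \<theta>s 0 y" if "y 0 = 0"
        using elim that by (simp add: contrast_def ln_g_dens)
      then show ?case by (auto simp: N_def indicator_def filt_trunc)
    qed
  qed
  moreover have "(\<integral>\<^sup>+y. indicator N (trunc 0 y) * indicator {y. y 0 = 0} y \<partial>Q) =
      (\<integral>\<^sup>+y. indicator N (trunc 0 y) * ennreal (g_dens (filt p \<theta>s 0 y) 0) \<partial>Q)"
    by (rule one_step_indicator) measurable
  ultimately have "(\<integral>\<^sup>+y. indicator N (trunc 0 y) * ennreal (g_dens (filt p \<theta>s 0 y) 0) \<partial>Q) = 0" by simp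
  moreover have "(\<lambda>y. indicator N (trunc 0 y) * ennreal (g_dens (filt p \<theta>s 0 y) 0)) \<in> borel_measurable Q"
    by measurable
  ultimately have "AE y in Q. indicator N (trunc 0 y) * ennreal (g_dens (filt p \<theta>s 0 y) 0) = 0"
    by (simp only: nn_integral_0_iff_AE)
  then have "AE y in Q. filt p \<theta> 0 y = filt p \<theta>s 0 y"
  proof eventually_elim
    case (elim y)
    then show ?case using g_dens_pos[of "filt p \<theta>s 0 y" 0] by (auto simp: N_def indicator_def filt_trunc split: if_splits)
  qed
  then show False using neq by blast
qed

lemma law_of_large_numbers:
  assumes "integrable Q f"
  shows "AE y in Q. (\<lambda>n. (\<Sum>k=1..n. f (shift (int k) y)) / real n) \<longlonglongrightarrow> expectation f"
proof -
  interpret E: ergodic_map Q "shift 1" by (rule ergodic_shift)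
  have "AE y in Q. (\<lambda>n. E.bsum f n (shift 1 y) / real n) \<longlonglongrightarrow> expectation f"
    by (rule AE_shift[OF E.ergodic_theorem[OF assms]])
  moreover have "E.bsum f n (shift 1 y) = (\<Sum>k=1..n. f (shift (int k) y))" for n y
    unfolding E.bsum_def shift_funpow shift_shift
    by (rule sum.reindex_bij_witness[of _ "\<lambda>k. k - 1" Suc]) (auto simp: add.commute)
  ultimately show ?thesis by simp
qed

text \<open>Within \<open>V\<close> a parameter can gain on \<theta>0 at most \<eta> times
  \<open>majorant\<close> per observation, on average less than the mean contrast of \<theta>0; the
  initial values account for at most twice \<open>A\<close> in total. The comparison is pathwise and
  simultaneous for all \<theta> in \<open>V\<close>.\<close>

lemma separation:
  assumes \<theta>0: "\<theta>0 \<in> \<Theta>" and neq: "\<not> (AE y in Q. filt p \<theta>0 0 y = filt p \<theta>s 0 y)"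
  obtains V where "open V" "\<theta>0 \<in> V"
    "AE y in Q. eventually (\<lambda>n. \<forall>\<theta>\<in>\<Theta> \<inter> V. log_lik p q (const_init x1 y1) n y \<theta> < log_lik p q (const_init x1 y1) n y \<theta>s) sequentially"
proof -
  define \<kappa> where "\<kappa> = expectation (contrast \<theta>0)"
  have \<kappa>: "0 < \<kappa>" unfolding \<kappa>_def by (rule contrast_pos[OF \<theta>0 neq])
  define D where "D = \<bar>expectation majorant\<bar>"
  \<comment> \<open>Makes the mean gain at most half the mean contrast; adding 1 to \<open>D\<close>
    avoids a division by zero.\<close>
  define \<eta> where "\<eta> = \<kappa> / (2 * (D + 1))"
  have D0: "0 \<le> D" by (simp add: D_def)
  have \<eta>: "0 < \<eta>" using \<kappa> D0 by (simp add: \<eta>_def)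
  have "\<eta> * D < \<kappa>"
  proof -
    have "\<eta> * D \<le> \<eta> * (D + 1)" using \<eta> by simp
    also have "\<dots> = \<kappa> / 2" using D0 by (simp add: \<eta>_def field_simps)
    finally show ?thesis using \<kappa> by linarith
  qed
  moreover have "\<eta> * expectation majorant \<le> \<eta> * D" using \<eta> by (simp add: D_def)
  ultimately have gap: "0 < \<kappa> - \<eta> * expectation majorant - 0" by linarith
  obtain V where V: "open V" "\<theta>0 \<in> V" "\<And>\<theta>. \<theta> \<in> \<Theta> \<inter> V \<Longrightarrow> \<bar>cst p \<theta> - cst p \<theta>0\<bar> \<le> \<eta>"
    "\<And>\<theta> j. \<theta> \<in> \<Theta> \<inter> V \<Longrightarrow> \<bar>hcoef \<theta> j - hcoef \<theta>0 j\<bar> \<le> \<eta> * \<rho> ^ j"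
    by (rule coefficient_neighbourhood[OF \<theta>0 \<eta>]) (rule that, assumption+)
  show ?thesis
  proof (rule that[OF V(1,2)])
    show "AE y in Q. eventually (\<lambda>n. \<forall>\<theta>\<in>\<Theta> \<inter> V. log_lik p q (const_init x1 y1) n y \<theta> < log_lik p q (const_init x1 y1) n y \<theta>s) sequentially"
      using AE_tempered_\<rho> AE_summable_env law_of_large_numbers[OF integrable_contrast[OF \<theta>0]] law_of_large_numbers[OF integrable_majorant]
    proof eventually_elim
      case (elim y)
      note y = elim(1)
      obtain A where A: "\<And>n \<theta>. 1 \<le> n \<Longrightarrow> \<theta> \<in> \<Theta> \<Longrightarrow> \<bar>real n * log_lik p q (const_init x1 y1) n y \<theta> - stat_lik n y \<theta>\<bar> \<le> A"
        using log_lik_close[OF elim(1,2), of x1 y1] by blast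
      define a where "a n = (\<Sum>k=1..n. contrast \<theta>0 (shift (int k) y)) / real n" for n
      define b where "b n = (\<Sum>k=1..n. majorant (shift (int k) y)) / real n" for n
      have "(\<lambda>n. 2 * A * inverse (real n)) \<longlonglongrightarrow> 2 * A * 0" by (intro tendsto_intros lim_inverse_n)
      then have "(\<lambda>n. a n - \<eta> * b n - 2 * A * inverse (real n)) \<longlonglongrightarrow> \<kappa> - \<eta> * expectation majorant - 0"
        unfolding a_def b_def \<kappa>_def using elim(3,4) by (intro tendsto_intros) simp_all
      then have "eventually (\<lambda>n. 0 < a n - \<eta> * b n - 2 * A * inverse (real n)) sequentially"
        using gap by (rule order_tendstoD)
      then show ?case using eventually_ge_at_top[of 1]
      proof eventually_elim
        case (elim n)
        show ?case
        proof
          fix \<theta> assume \<theta>: "\<theta> \<in> \<Theta> \<inter> V"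
          have \<theta>': "\<theta> \<in> \<Theta>" using \<theta> by blast
          have n: "0 < real n" using elim(2) by simp
          have an: "real n * a n = (\<Sum>k=1..n. contrast \<theta>0 (shift (int k) y))"
            "real n * b n = (\<Sum>k=1..n. majorant (shift (int k) y))"
            using n by (simp_all add: a_def b_def)
          have "real n * (a n - \<eta> * b n) = real n * a n - \<eta> * (real n * b n)" by (simp add: algebra_simps)
          also have "\<dots> = (\<Sum>k=1..n. contrast \<theta>0 (shift (int k) y) - \<eta> * majorant (shift (int k) y))"
            unfolding an by (simp add: sum_subtractf sum_distrib_left)
          also have "\<dots> \<le> (\<Sum>k=1..n. ln (g_dens (filt p \<theta>s (int k) y) (y (int k))) - ln (g_dens (filt p \<theta> (int k) y) (y (int k))))"
          proof (rule sum_mono)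
            fix k
            define Z where "Z = env \<rho> (int k) y"
            have b: "\<bar>filt p \<theta>0 (int k) y\<bar> \<le> C * Z" "\<bar>filt p \<theta> (int k) y\<bar> \<le> C * Z"
              unfolding Z_def by (rule filt_le_env[OF \<theta>0 y], rule filt_le_env[OF \<theta>' y])
            have "\<bar>filt p \<theta> (int k) y - filt p \<theta>0 (int k) y\<bar> \<le> \<eta> * Z"
              unfolding Z_def by (rule filt_diff_le_env[OF \<theta>' \<theta>0 y V(3)[OF \<theta>] V(4)[OF \<theta>]])
            then have d: "\<bar>filt p \<theta>0 (int k) y - filt p \<theta> (int k) y\<bar> \<le> \<eta> * Z"
              by (simp only: abs_minus_commute)
            have "\<bar>ln (g_dens (filt p \<theta>0 (int k) y) (y (int k))) - ln (g_dens (filt p \<theta> (int k) y) (y (int k)))\<bar> \<le>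
               \<bar>filt p \<theta>0 (int k) y - filt p \<theta> (int k) y\<bar> * (real (y (int k)) + exp (C * Z))"
              by (rule ln_g_dens_lipschitz[OF b])
            also have "\<dots> \<le> (\<eta> * Z) * (real (y (int k)) + exp (C * Z))"
              by (rule mult_right_mono[OF d]) (simp add: add_nonneg_nonneg)
            also have "\<dots> = \<eta> * majorant (shift (int k) y)"
              by (simp add: majorant_def env_shift Z_def) (simp add: shift_def)
            finally have l: "\<bar>ln (g_dens (filt p \<theta>0 (int k) y) (y (int k))) - ln (g_dens (filt p \<theta> (int k) y) (y (int k)))\<bar> \<le> \<eta> * majorant (shift (int k) y)" .
            have "contrast \<theta>0 (shift (int k) y) =
               ln (g_dens (filt p \<theta>s (int k) y) (y (int k))) - ln (g_dens (filt p \<theta>0 (int k) y) (y (int k)))"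
              by (simp add: contrast_def filt_shift) (simp add: shift_def)
            then show "contrast \<theta>0 (shift (int k) y) - \<eta> * majorant (shift (int k) y) \<le>
               ln (g_dens (filt p \<theta>s (int k) y) (y (int k))) - ln (g_dens (filt p \<theta> (int k) y) (y (int k)))"
              using l by linarith
          qed
          also have "\<dots> = stat_lik n y \<theta>s - stat_lik n y \<theta>" by (simp add: stat_lik_def sum_subtractf)
          finally have "real n * (a n - \<eta> * b n) - 2 * A \<le>
              real n * log_lik p q (const_init x1 y1) n y \<theta>s - real n * log_lik p q (const_init x1 y1) n y \<theta>"
            using A[OF elim(2) \<theta>'] A[OF elim(2) \<theta>s] by linarith
          moreover have "0 < real n * (a n - \<eta> * b n) - 2 * A"
          proof -
            have "0 < real n * (a n - \<eta> * b n - 2 * A * inverse (real n))" using elim(1) n by simp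
            moreover have "real n * (a n - \<eta> * b n - 2 * A * inverse (real n)) = real n * (a n - \<eta> * b n) - 2 * A"
              using n by (simp add: field_simps)
            ultimately show ?thesis by simp
          qed
          ultimately have "real n * log_lik p q (const_init x1 y1) n y \<theta> < real n * log_lik p q (const_init x1 y1) n y \<theta>s" by linarith
          then show "log_lik p q (const_init x1 y1) n y \<theta> < log_lik p q (const_init x1 y1) n y \<theta>s"
            using n by simp
        qed
      qed
    qed
  qed
qed

text \<open>A maximiser must do at least as well as \<theta>s, whereas eventually every parameter
  outside \<open>U\<close> does strictly worse. The exceptional null set comes from the finite cover
  and does not depend on the selection of maximisers.\<close>

theorem mle_eventually_in_neighbourhood:
  assumes mle: "is_cond_mle p q \<Theta> (const_init x1 y1) \<theta>hat" and U: "open U"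
    and eq: "\<And>\<theta>. \<theta> \<in> \<Theta> \<Longrightarrow> (AE y in Q. filt p \<theta> 0 y = filt p \<theta>s 0 y) \<Longrightarrow> \<theta> \<in> U"
  shows "AE y in Q. eventually (\<lambda>n. \<theta>hat n y \<in> \<Theta> \<inter> U) sequentially"
proof -
  define L where "L n y \<theta> = log_lik p q (const_init x1 y1) n y \<theta>" for n y \<theta>
  define K where "K = \<Theta> - U"
  have K: "compact K" unfolding K_def by (rule compact_diff[OF \<Theta>_compact U])
  have "\<forall>\<theta>0\<in>K. \<exists>V. open V \<and> \<theta>0 \<in> V \<and>
    (AE y in Q. eventually (\<lambda>n. \<forall>\<theta>\<in>\<Theta> \<inter> V. L n y \<theta> < L n y \<theta>s) sequentially)"
  proof
    fix \<theta>0 assume "\<theta>0 \<in> K"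
    then have "\<theta>0 \<in> \<Theta>" "\<not> (AE y in Q. filt p \<theta>0 0 y = filt p \<theta>s 0 y)"
      using eq[of \<theta>0] unfolding K_def by blast+
    from separation[OF this, of x1 y1] show "\<exists>V. open V \<and> \<theta>0 \<in> V \<and>
      (AE y in Q. eventually (\<lambda>n. \<forall>\<theta>\<in>\<Theta> \<inter> V. L n y \<theta> < L n y \<theta>s) sequentially)"
      unfolding L_def by blast
  qed
  from bchoice[OF this] obtain V where V': "\<forall>\<theta>0\<in>K. open (V \<theta>0) \<and> \<theta>0 \<in> V \<theta>0 \<and>
    (AE y in Q. eventually (\<lambda>n. \<forall>\<theta>\<in>\<Theta> \<inter> V \<theta>0. L n y \<theta> < L n y \<theta>s) sequentially)" ..
  have V: "open (V \<theta>0)" "\<theta>0 \<in> V \<theta>0"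
    "AE y in Q. eventually (\<lambda>n. \<forall>\<theta>\<in>\<Theta> \<inter> V \<theta>0. L n y \<theta> < L n y \<theta>s) sequentially" if "\<theta>0 \<in> K" for \<theta>0
    using bspec[OF V' that] by simp_all
  obtain F where F: "F \<subseteq> K" "finite F" "K \<subseteq> (\<Union>\<theta>0\<in>F. V \<theta>0)"
    using compactE_image[OF K, of K V] V(1,2) by blast
  have "AE y in Q. \<forall>\<theta>0\<in>F. eventually (\<lambda>n. \<forall>\<theta>\<in>\<Theta> \<inter> V \<theta>0. L n y \<theta> < L n y \<theta>s) sequentially"
  proof (rule AE_finite_allI[OF F(2)])
    fix \<theta>0 assume "\<theta>0 \<in> F"
    then show "AE y in Q. eventually (\<lambda>n. \<forall>\<theta>\<in>\<Theta> \<inter> V \<theta>0. L n y \<theta> < L n y \<theta>s) sequentially"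
      using F(1) V(3) by blast
  qed
  then show ?thesis
  proof eventually_elim
    case (elim y)
    have "eventually (\<lambda>n. \<forall>\<theta>0\<in>F. \<forall>\<theta>\<in>\<Theta> \<inter> V \<theta>0. L n y \<theta> < L n y \<theta>s) sequentially"
      using F(2) elim by (simp add: eventually_ball_finite)
    then show ?case using eventually_ge_at_top[of 1]
    proof eventually_elim
      case (elim n)
      have "is_arg_max (L n y) (\<lambda>\<theta>. \<theta> \<in> \<Theta>) (\<theta>hat n y)"
        using mle elim(2) unfolding is_cond_mle_def L_def[abs_def] by blast
      then have m: "\<theta>hat n y \<in> \<Theta>" "\<not> L n y (\<theta>hat n y) < L n y \<theta>s"
        using \<theta>s unfolding is_arg_max_def by blast+
      have "\<theta>hat n y \<in> U"
      proof (rule ccontr)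
        assume "\<theta>hat n y \<notin> U"
        then have "\<theta>hat n y \<in> K" using m(1) by (simp add: K_def)
        then obtain \<theta>0 where "\<theta>0 \<in> F" "\<theta>hat n y \<in> V \<theta>0" using F(3) by blast
        then show False using elim(1) m by blast
      qed
      then show ?case using m(1) by blast
    qed
  qed
qed

end

section \<open>Identifiability\<close>

text \<open>The polynomial \<open>c\<close> evaluated at the backward shift, so that products of
  polynomials become compositions of operators.\<close>

definition lag_op :: "real poly \<Rightarrow> (int \<Rightarrow> real) \<Rightarrow> int \<Rightarrow> real" where
  "lag_op c x k = (\<Sum>i\<le>degree c. coeff c i * x (k - int i))"

lemma lag_op_eq:
  assumes "degree c \<le> N"
  shows "lag_op c x k = (\<Sum>i\<le>N. coeff c i * x (k - int i))"
  unfolding lag_op_def using assms by (intro sum.mono_neutral_left) (auto simp: coeff_eq_0)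

lemma lag_op_0 [simp]: "lag_op 0 x k = 0"
  by (simp add: lag_op_def)

lemma lag_op_add: "lag_op (c + d) x k = lag_op c x k + lag_op d x k"
proof -
  define N where "N = max (degree c) (degree d)"
  have "degree c \<le> N" "degree d \<le> N" "degree (c + d) \<le> N" by (auto simp: N_def degree_add_le)
  then show ?thesis by (simp add: lag_op_eq[of _ N] distrib_right sum.distrib)
qed

lemma lag_op_smult: "lag_op (smult a c) x k = a * lag_op c x k"
proof -
  have "degree (smult a c) \<le> degree c" by simp
  then show ?thesis by (simp add: lag_op_eq[of _ "degree c"] sum_distrib_left mult.assoc)
qed

lemma lag_op_uminus: "lag_op (- c) x k = - lag_op c x k"
  using lag_op_smult[of "-1" c x k] by simp

lemma lag_op_diff: "lag_op (c - d) x k = lag_op c x k - lag_op d x k"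
  using lag_op_add[of c "- d" x k] by (simp add: lag_op_uminus)

lemma lag_op_sum: "lag_op (\<Sum>i\<in>I. c i) x k = (\<Sum>i\<in>I. lag_op (c i) x k)"
  by (induction I rule: infinite_finite_induct) (auto simp: lag_op_add)

lemma lag_op_monom: "lag_op (monom a i) x k = a * x (k - int i)"
proof -
  have "lag_op (monom a i) x k = (\<Sum>j\<le>i. coeff (monom a i) j * x (k - int j))"
    by (rule lag_op_eq) (rule degree_monom_le)
  also have "\<dots> = (\<Sum>j\<in>{i}. coeff (monom a i) j * x (k - int j))"
    by (rule sum.mono_neutral_right) auto
  finally show ?thesis by simp
qed

lemma lag_op_pCons: "lag_op (pCons a c) x k = a * x k + lag_op c x (k - 1)"
proof -
  have "lag_op (pCons a c) x k = (\<Sum>i\<le>Suc (degree c). coeff (pCons a c) i * x (k - int i))"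
    by (rule lag_op_eq) (rule degree_pCons_le)
  also have "\<dots> = a * x k + (\<Sum>i\<le>degree c. coeff c i * x (k - 1 - int i))"
    by (subst sum.atMost_Suc_shift) (simp add: algebra_simps)
  finally show ?thesis by (simp add: lag_op_def)
qed

lemma lag_op_mult: "lag_op (c * d) x k = lag_op c (lag_op d x) k"
proof (induction c arbitrary: k rule: pCons_induct)
  case (pCons a c)
  have "lag_op (pCons a c * d) x k = lag_op (smult a d + pCons 0 (c * d)) x k" by simp
  then show ?case using pCons.IH by (simp add: lag_op_add lag_op_smult lag_op_pCons)
qed simp

lemma lag_op_fun_add: "lag_op c (\<lambda>k. x k + z k) k = lag_op c x k + lag_op c z k"
  by (simp add: lag_op_def distrib_left sum.distrib)

lemma lag_op_const: "lag_op c (\<lambda>_. a) k = a * poly c 1"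
  by (simp add: lag_op_def poly_altdef sum_distrib_left mult.commute)

text \<open>Reciprocal of the characteristic polynomial: P(z) is z^p times this at 1/z, just as Q(z)
  is z^q times \<open>ma_poly\<close> at 1/z.\<close>

definition ar_poly :: "nat \<Rightarrow> (nat \<Rightarrow> real) \<Rightarrow> real poly" where
  "ar_poly p a = 1 - (\<Sum>i=1..p. monom (a i) i)"

definition ma_poly :: "nat \<Rightarrow> (nat \<Rightarrow> real) \<Rightarrow> real poly" where
  "ma_poly q b = (\<Sum>i=1..q. monom (b i) i)"

lemma lag_op_one: "lag_op 1 x k = x k"
  using lag_op_monom[of 1 0 x k] by (simp add: monom_0 one_pCons)

lemma lag_op_ar_poly: "lag_op (ar_poly p a) x k = x k - (\<Sum>i=1..p. a i * x (k - int i))"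
  by (simp add: ar_poly_def lag_op_diff lag_op_sum lag_op_monom lag_op_one)

lemma lag_op_ma_poly: "lag_op (ma_poly q b) x k = (\<Sum>i=1..q. b i * x (k - int i))"
  by (simp add: ma_poly_def lag_op_sum lag_op_monom)

section \<open>Passage to the characteristic polynomials\<close>

lemma poly_P_poly:
  assumes "x \<noteq> 0"
  shows "poly (P_poly p a) (of_real x) = of_real (x ^ p * poly (ar_poly p a) (inverse x))"
proof -
  have "x ^ (p - k) = x ^ p * inverse x ^ k" if "k \<in> {1..p}" for k
  proof -
    have "x ^ p = x ^ (p - k) * x ^ k" using that by (simp flip: power_add)
    then show ?thesis using assms by (simp add: power_inverse)
  qed
  then have "x ^ p - (\<Sum>k=1..p. a k * x ^ (p - k)) = x ^ p * poly (ar_poly p a) (inverse x)"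
    by (simp add: ar_poly_def poly_sum poly_monom right_diff_distrib sum_distrib_left mult.left_commute)
  moreover have "poly (P_poly p a) (of_real x) = of_real (x ^ p - (\<Sum>k=1..p. a k * x ^ (p - k)))"
    by (simp add: P_poly_def poly_sum poly_monom)
  ultimately show ?thesis by simp
qed

lemma poly_Q_poly:
  assumes "x \<noteq> 0"
  shows "poly (Q_poly q b) (of_real x) = of_real (x ^ q * poly (ma_poly q b) (inverse x))"
proof -
  have "poly (Q_poly q b) (of_real x) = of_real (\<Sum>k<q. b (k + 1) * x ^ (q - 1 - k))"
    by (simp add: Q_poly_def poly_sum poly_monom)
  also have "(\<Sum>k<q. b (k + 1) * x ^ (q - 1 - k)) = (\<Sum>i=1..q. b i * x ^ (q - i))"
    by (rule sum.reindex_bij_witness[of _ "\<lambda>i. i - 1" Suc]) auto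
  also have "\<dots> = (\<Sum>i=1..q. x ^ q * (b i * inverse x ^ i))"
  proof (rule sum.cong[OF refl])
    fix i assume "i \<in> {1..q}"
    then have "x ^ q = x ^ (q - i) * x ^ i" by (simp flip: power_add)
    then show "b i * x ^ (q - i) = x ^ q * (b i * inverse x ^ i)" using assms by (simp add: power_inverse)
  qed
  also have "\<dots> = x ^ q * poly (ma_poly q b) (inverse x)"
    by (simp add: ma_poly_def poly_sum poly_monom sum_distrib_left)
  finally show ?thesis .
qed

lemma coeff_P_poly: "coeff (P_poly p a) (p - i) = (if i = 0 then 1 else - of_real (a i))" if "i \<le> p"
proof -
  have "coeff (\<Sum>k=1..p. monom (of_real (a k) :: complex) (p - k)) (p - i) =
      (\<Sum>k=1..p. if k = i then of_real (a k) else 0)"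
    unfolding coeff_sum using that by (intro sum.cong) auto
  also have "\<dots> = (if i = 0 then 0 else of_real (a i))" using that by simp
  finally show ?thesis using that by (auto simp: P_poly_def)
qed

lemma degree_P_poly: "degree (P_poly p a) = p"
proof (rule antisym)
  show "degree (P_poly p a) \<le> p"
    unfolding P_poly_def
    by (intro degree_diff_le degree_sum_le order_trans[OF degree_monom_le]) auto
  show "p \<le> degree (P_poly p a)" using coeff_P_poly[of 0 p a] by (intro le_degree) simp
qed

lemma coeff_Q_poly: "coeff (Q_poly q b) (q - i) = of_real (b i)" if "i \<in> {1..q}"
proof -
  have "coeff (Q_poly q b) (q - i) = (\<Sum>k<q. if k = i - 1 then of_real (b (k + 1)) else 0)"
    unfolding Q_poly_def coeff_sum using that by (intro sum.cong) auto
  also have "\<dots> = of_real (b i)" using that by (cases i) auto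
  finally show ?thesis .
qed

text \<open>A root of \<open>P\<close> is not a root of \<open>Q\<close>, hence it is one of
  \<open>R\<close>; its linear factor is cancelled from both and the degree of \<open>P\<close>
  drops.\<close>

lemma dvd_of_no_common_root:
  fixes P R Q :: "complex poly"
  assumes "P dvd R * Q" "P \<noteq> 0" "\<nexists>z. poly P z = 0 \<and> poly Q z = 0"
  shows "P dvd R"
  using assms
proof (induction "degree P" arbitrary: P R)
  case 0
  then show ?case by (auto simp: is_unit_iff_degree intro: unit_imp_dvd)
next
  case (Suc n)
  obtain z where z: "poly P z = 0"
    using fundamental_theorem_of_algebra[of P] Suc.hyps(2) by (auto simp: constant_degree)
  obtain P1 where P1: "P = [:- z, 1:] * P1" using z by (auto simp: poly_eq_0_iff_dvd)
  obtain k where "R * Q = P * k" using Suc.prems(1) by (auto simp: dvd_def)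
  then have "poly (R * Q) z = poly (P * k) z" by simp
  moreover have "poly Q z \<noteq> 0" using Suc.prems(3) z by blast
  ultimately have "poly R z = 0" using z by simp
  then obtain R1 where R1: "R = [:- z, 1:] * R1" by (auto simp: poly_eq_0_iff_dvd)
  have P10: "P1 \<noteq> 0" using Suc.prems(2) P1 by auto
  have "degree P = Suc (degree P1)" unfolding P1 using P10 by (subst degree_mult_eq) auto
  then have "n = degree P1" using Suc.hyps(2) by simp
  moreover have "P1 dvd R1 * Q"
  proof -
    have "[:- z, 1:] * P1 dvd [:- z, 1:] * (R1 * Q)" using Suc.prems(1) by (simp only: P1 R1 mult.assoc)
    then show ?thesis unfolding dvd_mult_cancel_left by auto
  qed
  moreover have "\<nexists>z. poly P1 z = 0 \<and> poly Q z = 0" using Suc.prems(3) by (auto simp: P1)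
  ultimately have "P1 dvd R1" using Suc.hyps(1) P10 by blast
  then show ?case unfolding P1 R1 by (rule mult_dvd_mono[OF dvd_refl])
qed

lemma transfer_function_determines_coefficients:
  assumes eq: "ar_poly p a' * ma_poly q b = ar_poly p a * ma_poly q b'"
    and nc: "\<nexists>z. poly (P_poly p a) z = 0 \<and> poly (Q_poly q b) z = 0"
  shows "(\<forall>i\<in>{1..p}. a' i = a i) \<and> (\<forall>i\<in>{1..q}. b' i = b i)"
proof -
  \<comment> \<open>At a real x different from 0 the identity of reciprocal polynomials at 1/x,
    multiplied by powers of x, makes \<open>D\<close> vanish. A polynomial with infinitely many
    roots is zero.\<close>
  define D where "D = P_poly p a' * Q_poly q b - P_poly p a * Q_poly q b'"
  have "poly D (of_real x) = 0" if x: "x \<noteq> 0" for x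
  proof -
    have "poly (ar_poly p a') (inverse x) * poly (ma_poly q b) (inverse x) =
        poly (ar_poly p a) (inverse x) * poly (ma_poly q b') (inverse x)"
      using arg_cong[OF eq, of "\<lambda>c. poly c (inverse x)"] by simp
    then have "(x ^ p * poly (ar_poly p a') (inverse x)) * (x ^ q * poly (ma_poly q b) (inverse x)) =
        (x ^ p * poly (ar_poly p a) (inverse x)) * (x ^ q * poly (ma_poly q b') (inverse x))"
      by (simp add: mult_ac)
    then show ?thesis
      by (simp only: D_def poly_diff poly_mult poly_P_poly[OF x] poly_Q_poly[OF x] of_real_mult[symmetric] diff_self)
  qed
  then have "of_real ` (UNIV - {0}) \<subseteq> {z. poly D z = 0}" by auto
  moreover have "infinite (of_real ` (UNIV - {0::real}) :: complex set)"
  proof -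
    have "infinite (UNIV - {0::real})" using infinite_UNIV_char_0 by (intro Diff_infinite_finite) auto
    moreover have "inj_on (of_real :: real \<Rightarrow> complex) (UNIV - {0})" by (auto simp: inj_on_def)
    ultimately show ?thesis using finite_imageD by blast
  qed
  ultimately have "infinite {z. poly D z = 0}" using finite_subset by blast
  then have "D = 0" using poly_roots_finite by blast
  then have PQ: "P_poly p a' * Q_poly q b = P_poly p a * Q_poly q b'" by (simp add: D_def)
  have P0: "P_poly p a \<noteq> 0" "P_poly p a' \<noteq> 0"
    using coeff_P_poly[of 0 p a] coeff_P_poly[of 0 p a'] by auto
  have "P_poly p a dvd P_poly p a'"
    by (rule dvd_of_no_common_root[OF _ P0(1) nc]) (simp add: PQ)
  then obtain S where S: "P_poly p a' = P_poly p a * S" by (auto simp: dvd_def)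
  have S0: "S \<noteq> 0" using S P0 by auto
  \<comment> \<open>Both characteristic polynomials have degree p, so the quotient is a constant,
    and both are monic, so the constant is 1.\<close>
  have "degree S = 0" using degree_mult_eq[OF P0(1) S0] S degree_P_poly[of p a] degree_P_poly[of p a'] by simp
  then obtain s where s: "S = [:s:]" by (rule degree_eq_zeroE)
  have "coeff (P_poly p a') p = s * coeff (P_poly p a) p" by (simp add: S s mult.commute)
  then have "s = 1" using coeff_P_poly[of 0 p a] coeff_P_poly[of 0 p a'] by simp
  then have PP: "P_poly p a' = P_poly p a" by (simp add: S s)
  then have QQ: "Q_poly q b' = Q_poly q b" using PQ P0 by simp
  have "a' i = a i" if "i \<in> {1..p}" for i
    using coeff_P_poly[of i p a] coeff_P_poly[of i p a'] that PP by simp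
  moreover have "b' i = b i" if "i \<in> {1..q}" for i
    using coeff_Q_poly[OF that, of b] coeff_Q_poly[OF that, of b'] QQ by simp
  ultimately show ?thesis by blast
qed

section \<open>No observation is a function of its past; uniqueness of the intensity\<close>

context obs_process
begin

text \<open>Given the past, \<open>y 0\<close> takes both values 0 and 1 with positive probability, so the last
  observation is not a function of the previous ones.\<close>

lemma not_predictable:
  assumes [measurable]: "\<psi> \<in> borel_measurable obs_space"
  shows "\<not> (AE y in Q. lnobs y 0 = \<psi> (trunc 0 y))"
proof
  assume pred: "AE y in Q. lnobs y 0 = \<psi> (trunc 0 y)"
  have val: "AE y in Q. \<psi> (trunc 0 y) = ln (1 + real n)" for n
  proof -
    define N where "N = {z. \<psi> z \<noteq> ln (1 + real n)}"
    have "{z \<in> space obs_space. \<psi> z \<noteq> ln (1 + real n)} \<in> sets obs_space" by measurable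
    then have [measurable]: "N \<in> sets obs_space" by (simp add: N_def)
    have "(\<integral>\<^sup>+y. indicator N (trunc 0 y) * indicator {y. y 0 = n} y \<partial>Q) = (\<integral>\<^sup>+y. 0 \<partial>Q)"
    proof (rule nn_integral_cong_AE)
      show "AE y in Q. indicator N (trunc 0 y) * indicator {y. y 0 = n} y = (0::ennreal)"
        using pred by eventually_elim (auto simp: N_def indicator_def lnobs_def)
    qed
    moreover have "(\<integral>\<^sup>+y. indicator N (trunc 0 y) * indicator {y. y 0 = n} y \<partial>Q) =
        (\<integral>\<^sup>+y. indicator N (trunc 0 y) * ennreal (g_dens (filt p \<theta> 0 y) n) \<partial>Q)"
      by (rule one_step_indicator) measurable
    ultimately have "(\<integral>\<^sup>+y. indicator N (trunc 0 y) * ennreal (g_dens (filt p \<theta> 0 y) n) \<partial>Q) = 0" by simp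
    moreover have "(\<lambda>y. indicator N (trunc 0 y) * ennreal (g_dens (filt p \<theta> 0 y) n)) \<in> borel_measurable Q"
      by measurable
    ultimately have "AE y in Q. indicator N (trunc 0 y) * ennreal (g_dens (filt p \<theta> 0 y) n) = 0"
      by (simp only: nn_integral_0_iff_AE)
    then show ?thesis
    proof eventually_elim
      case (elim y)
      then show ?case using g_dens_pos[of "filt p \<theta> 0 y" n] by (auto simp: N_def indicator_def split: if_splits)
    qed
  qed
  have "AE y in Q. False" using val[of 0] val[of 1] by eventually_elim simp
  then show False by simp
qed

text \<open>The lowest non-zero coefficient belongs to the most recent observation that occurs. A
  shift places it at time 0, and the relation can be solved for it in terms of earlier
  observations.\<close>

lemma lag_op_not_constant:
  assumes ae: "AE y in Q. lag_op c (lnobs y) 0 = K"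
  shows "c = 0"
proof (rule ccontr)
  assume "c \<noteq> 0"
  then have ex: "\<exists>i. coeff c i \<noteq> 0" using leading_coeff_neq_0 by blast
  define m where "m = (LEAST i. coeff c i \<noteq> 0)"
  have m: "coeff c m \<noteq> 0" unfolding m_def using LeastI_ex[OF ex] .
  have below: "coeff c i = 0" if "i < m" for i using not_less_Least[of i "\<lambda>i. coeff c i \<noteq> 0"] that by (auto simp: m_def)
  have md: "m \<le> degree c" using m by (rule le_degree)
  define \<psi> where "\<psi> y = (K - (\<Sum>i\<in>{m<..degree c}. coeff c i * lnobs y (int m - int i))) / coeff c m" for y
  have [measurable]: "\<psi> \<in> borel_measurable obs_space" unfolding \<psi>_def by measurable
  have "AE y in Q. lag_op c (lnobs (shift (int m) y)) 0 = K" by (rule AE_shift[OF ae])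
  then have "AE y in Q. lnobs y 0 = \<psi> (trunc 0 y)"
  proof eventually_elim
    case (elim y)
    have "K = (\<Sum>i\<le>degree c. coeff c i * lnobs y (int m - int i))"
      using elim by (simp add: lag_op_def lnobs_shift algebra_simps)
    also have "\<dots> = (\<Sum>i\<in>{m..degree c}. coeff c i * lnobs y (int m - int i))"
      by (rule sum.mono_neutral_right) (auto simp: below)
    also have "\<dots> = coeff c m * lnobs y 0 + (\<Sum>i\<in>{m<..degree c}. coeff c i * lnobs y (int m - int i))"
      using md by (simp add: sum.head)
    also have "(\<Sum>i\<in>{m<..degree c}. coeff c i * lnobs y (int m - int i)) =
        (\<Sum>i\<in>{m<..degree c}. coeff c i * lnobs (trunc 0 y) (int m - int i))"
      by (intro sum.cong) (auto simp: lnobs_def trunc_def)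
    finally show ?case using m by (simp add: \<psi>_def)
  qed
  then show False using not_predictable[of \<psi>] by simp
qed

text \<open>Both parameters assign the same conditional probability to \<open>y 0 = 0\<close>,
  namely exp(-exp x), which is strictly decreasing in x. On the event where the inequality fails the
  two integrals would differ. Exchanging the parameters gives the reverse inequality.\<close>

lemma conditional_intensity_unique:
  assumes "obs_law p \<theta>' Q"
  shows "AE y in Q. filt p \<theta> 0 y \<ge> filt p \<theta>' 0 y"
proof -
  interpret O: obs_process p \<theta>' Q by unfold_locales fact
  define A where "A = {z. filt p \<theta> 0 z < filt p \<theta>' 0 z}"
  have "{z \<in> space obs_space. filt p \<theta> 0 z < filt p \<theta>' 0 z} \<in> sets obs_space" by measurable
  then have [measurable]: "A \<in> sets obs_space" by (simp add: A_def)
  have A: "indicator A (trunc 0 y) = (indicator A y :: real)" "indicator A (trunc 0 y) = (indicator A y :: ennreal)" for y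
    by (auto simp: A_def indicator_def filt_trunc)
  define g h where "g y = indicator A y * g_dens (filt p \<theta> 0 y) 0" and "h y = indicator A y * g_dens (filt p \<theta>' 0 y) 0" for y
  have gh [measurable]: "g \<in> borel_measurable Q" "h \<in> borel_measurable Q" unfolding g_def h_def by measurable
  have gi: "integrable Q g" "integrable Q h"
    by (rule integrable_const_bound[where B = 1]; auto simp: g_def h_def indicator_def g_dens_le_1)+
  have "(\<integral>\<^sup>+y. indicator A (trunc 0 y) * ennreal (g_dens (filt p \<theta> 0 y) 0) \<partial>Q) =
      (\<integral>\<^sup>+y. indicator A (trunc 0 y) * ennreal (g_dens (filt p \<theta>' 0 y) 0) \<partial>Q)"
    by (rule trans[OF one_step_indicator[symmetric] O.one_step_indicator]) measurable
  then have "(\<integral>\<^sup>+y. ennreal (g y) \<partial>Q) = (\<integral>\<^sup>+y. ennreal (h y) \<partial>Q)"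
    by (simp add: A g_def h_def ennreal_mult' ennreal_indicator)
  then have "expectation g = expectation h"
    using gi by (simp add: integral_eq_nn_integral g_def h_def)
  then have "expectation (\<lambda>y. g y - h y) = 0" using gi by simp
  moreover have gh0: "0 \<le> g y - h y" "y \<in> A \<Longrightarrow> 0 < g y - h y" for y
  proof -
    have "g_dens (filt p \<theta>' 0 y) 0 < g_dens (filt p \<theta> 0 y) 0" if "y \<in> A"
      using that by (simp add: A_def g_dens_def)
    then show "0 \<le> g y - h y" "y \<in> A \<Longrightarrow> 0 < g y - h y" by (auto simp: g_def h_def indicator_def)
  qed
  ultimately have "AE y in Q. g y - h y = 0"
    using integral_nonneg_eq_0_iff_AE[of Q "\<lambda>y. g y - h y"] gi by simp
  then show ?thesis
  proof eventually_elim
    case (elim y)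
    then have "y \<notin> A" using gh0(2)[of y] by auto
    then show ?case by (simp add: A_def not_less)
  qed
qed

end

lemma identifiable:
  assumes "model p q \<theta> B C \<rho>" "model p q \<theta>' B' C' \<rho>'"
    and Q: "obs_law p \<theta> Q" "obs_law p \<theta>' Q"
    and nc: "\<nexists>z. poly (P_poly p (ca \<theta>)) z = 0 \<and> poly (Q_poly q (cb \<theta>)) z = 0"
  shows "\<theta>' = \<theta>"
proof -
  interpret m: model p q \<theta> B C \<rho> by fact
  interpret m': model p q \<theta>' B' C' \<rho>' by fact
  interpret O: obs_process p \<theta> Q by unfold_locales fact
  interpret O': obs_process p \<theta>' Q by unfold_locales fact
  have "AE y in Q. filt p \<theta> 0 y = filt p \<theta>' 0 y"
    using O.conditional_intensity_unique[OF Q(2)] O'.conditional_intensity_unique[OF Q(1)]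
    by eventually_elim simp
  then have "AE y in Q. filt p \<theta> 0 (shift k y) = filt p \<theta>' 0 (shift k y)" for k by (rule O.AE_shift)
  then have X: "AE y in Q. \<forall>k. filt p \<theta> k y = filt p \<theta>' k y"
    unfolding AE_all_countable by (simp add: filt_shift)
  define \<alpha> \<beta> where "\<alpha> = ar_poly p (ca \<theta>)" and "\<beta> = ma_poly q (cb \<theta>)"
  define \<alpha>' \<beta>' where "\<alpha>' = ar_poly p (ca \<theta>')" and "\<beta>' = ma_poly q (cb \<theta>')"
  have rec: "AE y in Q. (\<forall>k. lag_op \<alpha> (\<lambda>k. filt p \<theta> k y) k = om \<theta> + lag_op \<beta> (lnobs y) k) \<and>
     (\<forall>k. lag_op \<alpha>' (\<lambda>k. filt p \<theta> k y) k = om \<theta>' + lag_op \<beta>' (lnobs y) k)"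
    using X O.AE_tempered[OF m.\<rho>] O.AE_tempered[OF m'.\<rho>]
  proof eventually_elim
    case (elim y)
    have 1: "lag_op \<alpha> (\<lambda>k. filt p \<theta> k y) k = om \<theta> + lag_op \<beta> (lnobs y) k" for k
      unfolding \<alpha>_def \<beta>_def lag_op_ar_poly lag_op_ma_poly
      using m.filt_recursion[OF elim(2), of k] by simp
    have "lag_op \<alpha>' (\<lambda>k. filt p \<theta>' k y) k = om \<theta>' + lag_op \<beta>' (lnobs y) k" for k
      unfolding \<alpha>'_def \<beta>'_def lag_op_ar_poly lag_op_ma_poly
      using m'.filt_recursion[OF elim(3), of k] by simp
    then show ?case using 1 elim(1) by simp
  qed
  \<comment> \<open>Apply \<alpha>' to the recursion of \<theta> and \<alpha> to that of \<theta>'.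
    The operators commute, so the terms in the filter cancel; each intercept is multiplied by the
    value at 1 of the other polynomial.\<close>
  have "AE y in Q. lag_op (\<alpha>' * \<beta> - \<alpha> * \<beta>') (lnobs y) 0 = om \<theta>' * poly \<alpha> 1 - om \<theta> * poly \<alpha>' 1"
    using rec
  proof eventually_elim
    case (elim y)
    define x where "x k = filt p \<theta> k y" for k
    have 1: "lag_op \<alpha> x = (\<lambda>k. om \<theta> + lag_op \<beta> (lnobs y) k)" "lag_op \<alpha>' x = (\<lambda>k. om \<theta>' + lag_op \<beta>' (lnobs y) k)"
      using elim by (auto simp: fun_eq_iff x_def[abs_def])
    have "lag_op (\<alpha>' * \<alpha>) x 0 = om \<theta> * poly \<alpha>' 1 + lag_op (\<alpha>' * \<beta>) (lnobs y) 0"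
      unfolding lag_op_mult 1 lag_op_fun_add lag_op_const ..
    moreover have "lag_op (\<alpha> * \<alpha>') x 0 = om \<theta>' * poly \<alpha> 1 + lag_op (\<alpha> * \<beta>') (lnobs y) 0"
      unfolding lag_op_mult 1 lag_op_fun_add lag_op_const ..
    ultimately show ?case by (simp add: lag_op_diff mult.commute[of \<alpha>'])
  qed
  then have "\<alpha>' * \<beta> - \<alpha> * \<beta>' = 0" by (rule O.lag_op_not_constant)
  then have "\<alpha>' * \<beta> = \<alpha> * \<beta>'" by simp
  from transfer_function_determines_coefficients[OF this[unfolded \<alpha>_def \<beta>_def \<alpha>'_def \<beta>'_def] nc]
  have ab: "\<And>i. i \<in> {1..p} \<Longrightarrow> ca \<theta>' i = ca \<theta> i" "\<And>i. i \<in> {1..q} \<Longrightarrow> cb \<theta>' i = cb \<theta> i" by auto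
  have a: "ca \<theta>' = ca \<theta>"
    using ab(1) param_space_ca[OF m.\<theta>] param_space_ca[OF m'.\<theta>] by (metis ext)
  have b: "cb \<theta>' = cb \<theta>"
    using ab(2) param_space_cb[OF m.\<theta>] param_space_cb[OF m'.\<theta>] by (metis ext)
  \<comment> \<open>With equal coefficients the two recursions for the common filter differ only in
    their intercepts.\<close>
  have "AE y in Q. om \<theta>' = om \<theta>"
    using rec
  proof eventually_elim
    case (elim y)
    have "lag_op \<alpha> (\<lambda>k. filt p \<theta> k y) 0 = om \<theta> + lag_op \<beta> (lnobs y) 0"
      "lag_op \<alpha>' (\<lambda>k. filt p \<theta> k y) 0 = om \<theta>' + lag_op \<beta>' (lnobs y) 0" using elim by blast+
    moreover have "\<alpha>' = \<alpha>" by (simp only: \<alpha>_def \<alpha>'_def a)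
    ultimately have "om \<theta> + lag_op \<beta> (lnobs y) 0 = om \<theta>' + lag_op \<beta>' (lnobs y) 0" by simp
    then show ?case using b by (simp add: \<beta>_def \<beta>'_def)
  qed
  then have "om \<theta>' = om \<theta>" by simp
  then show ?thesis using a b by (simp add: prod_eq_iff)
qed

section \<open>Existence, uniqueness and moments of the stationary law\<close>

context model
begin

lemma stationary_law_unique:
  assumes "stationary_law p q \<theta> P1" "stationary_law p q \<theta> P2"
  shows "P1 = P2"
proof -
  interpret S1: stationary_model p q \<theta> B C \<rho> P1 by unfold_locales fact
  interpret S2: stationary_model p q \<theta> B C \<rho> P2 by unfold_locales fact
  interpret O1: obs_model p q \<theta> B C \<rho> "distr P1 obs_space obs" by unfold_locales (rule S1.obs_law_obs)
  interpret O2: obs_model p q \<theta> B C \<rho> "distr P2 obs_space obs" by unfold_locales (rule S2.obs_law_obs)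
  interpret T: two_laws p q \<theta> B C \<rho> "distr P1 obs_space obs" "distr P2 obs_space obs" ..
  show ?thesis using S1.P_eq_lift S2.P_eq_lift T.unique by metis
qed

lemma ex1_stationary_law: "\<exists>!P. stationary_law p q \<theta> P"
proof -
  obtain Q where "obs_law p \<theta> Q" using obs_law_exists by blast
  then interpret O: obs_model p q \<theta> B C \<rho> Q by unfold_locales
  show ?thesis using O.stationary_law_L stationary_law_unique by blast
qed

lemma stationary_law_XY: "stationary_law p q \<theta> (law_XY p q \<theta>)"
  unfolding law_XY_def by (rule theI'[OF ex1_stationary_law])

lemma law_Y_eq: "law_Y p q \<theta> = distr (law_XY p q \<theta>) obs_space obs"
  by (simp add: law_Y_def obs_def[abs_def])

lemma obs_law_Y: "obs_law p \<theta> (law_Y p q \<theta>)"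
proof -
  interpret S: stationary_model p q \<theta> B C \<rho> "law_XY p q \<theta>" by unfold_locales (rule stationary_law_XY)
  show ?thesis unfolding law_Y_eq by (rule S.obs_law_obs)
qed

lemma law_Y_unique:
  assumes "obs_law p \<theta> Q"
  shows "law_Y p q \<theta> = Q"
proof -
  interpret O1: obs_model p q \<theta> B C \<rho> Q by unfold_locales fact
  interpret O2: obs_model p q \<theta> B C \<rho> "law_Y p q \<theta>" by unfold_locales (rule obs_law_Y)
  interpret T: two_laws p q \<theta> B C \<rho> "law_Y p q \<theta>" Q ..
  show ?thesis by (rule T.unique)
qed

lemma law_X0_moment:
  assumes "0 < \<tau>"
  shows "(\<integral>\<^sup>+x. ennreal (exp (\<tau> * \<bar>x\<bar>)) \<partial>law_X0 p q \<theta>) < \<infinity>"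
proof -
  interpret S: stationary_model p q \<theta> B C \<rho> "law_XY p q \<theta>" by unfold_locales (rule stationary_law_XY)
  have "(\<integral>\<^sup>+x. ennreal (exp (\<tau> * \<bar>x\<bar>)) \<partial>law_X0 p q \<theta>) = (\<integral>\<^sup>+w. ennreal (exp (\<tau> * \<bar>fst (w 0)\<bar>)) \<partial>law_XY p q \<theta>)"
    unfolding law_X0_def by (rule nn_integral_distr) measurable
  then show ?thesis using S.X_moment[OF assms, of 0] by simp
qed

end

text \<open>The parameter enters the notion of observation law only through its filter at time 0.
  This turns agreement of filters into membership in the equivalence class.\<close>

lemma obs_law_cong:
  assumes Q: "obs_law p \<theta> Q" and eq: "AE y in Q. filt p \<theta>' 0 y = filt p \<theta> 0 y"
  shows "obs_law p \<theta>' Q"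
  unfolding obs_law_def
proof (intro conjI allI ballI)
  fix n and \<phi> :: "(int \<Rightarrow> nat) \<Rightarrow> ennreal" assume "\<phi> \<in> borel_measurable obs_space"
  then have "(\<integral>\<^sup>+y. \<phi> (trunc 0 y) * indicator {y. y 0 = n} y \<partial>Q) =
      (\<integral>\<^sup>+y. \<phi> (trunc 0 y) * ennreal (g_dens (filt p \<theta> 0 y) n) \<partial>Q)" by (rule obs_lawD(5)[OF Q])
  also have "\<dots> = (\<integral>\<^sup>+y. \<phi> (trunc 0 y) * ennreal (g_dens (filt p \<theta>' 0 y) n) \<partial>Q)"
    by (rule nn_integral_cong_AE) (use eq in \<open>eventually_elim, simp\<close>)
  finally show "(\<integral>\<^sup>+y. \<phi> (trunc 0 y) * indicator {y. y 0 = n} y \<partial>Q) =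
      (\<integral>\<^sup>+y. \<phi> (trunc 0 y) * ennreal (g_dens (filt p \<theta>' 0 y) n) \<partial>Q)" .
qed (fact obs_lawD[OF Q])+

text \<open>The \<epsilon>-neighbourhood of the class is a union of \<Delta>-balls. As \<Delta>
  induces the subspace topology, it is the trace on \<Theta> of an ambient open set, to which the
  almost sure statement about maximisers applies; \<epsilon> then runs through 1/(i + 1).\<close>

lemma mle_class_consistent:
  assumes pq: "p \<ge> 1" "q \<ge> 1" and Theta: "\<Theta> \<subseteq> param_space p q" "compact \<Theta>"
    and metric: "Metric_space \<Theta> \<Delta>" and top: "Metric_space.mtopology \<Theta> \<Delta> = top_of_set \<Theta>"
    and con: "\<And>\<theta>. \<theta> \<in> \<Theta> \<Longrightarrow> contracting p q \<theta>"
    and mle: "is_cond_mle p q \<Theta> (const_init x1 y1) \<theta>hat" and \<theta>s: "\<theta>s \<in> \<Theta>"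
  shows "AE y in law_Y p q \<theta>s. (\<lambda>n. dist_to_set \<Delta> (\<theta>hat n y) (equiv_params p q \<Theta> \<theta>s)) \<longlonglongrightarrow> 0"
proof -
  interpret M: Metric_space \<Theta> \<Delta> by fact
  obtain B C \<rho>0 \<rho> where "compact_params p q \<Theta> B C \<rho>0 \<rho>" by (rule compact_params_exists[OF pq Theta con])
  then interpret cp: compact_params p q \<Theta> B C \<rho>0 \<rho> .
  have mod: "\<exists>B C \<rho>. model p q \<theta> B C \<rho>" if "\<theta> \<in> \<Theta>" for \<theta>
  proof -
    have "\<theta> \<in> param_space p q" using Theta(1) that by blast
    from model_exists[OF pq this con[OF that]] show ?thesis by blast
  qed
  obtain B' C' \<rho>' where "model p q \<theta>s B' C' \<rho>'" using mod[OF \<theta>s] by blast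
  then interpret m: model p q \<theta>s B' C' \<rho>' .
  interpret om: obs_model p q \<theta>s B' C' \<rho>' "law_Y p q \<theta>s" by unfold_locales (rule m.obs_law_Y)
  interpret mm: mle_model p q \<Theta> B C \<rho>0 \<rho> \<theta>s "law_Y p q \<theta>s"
    by (intro mle_model.intro mle_model_axioms.intro)
      (fact cp.compact_params_axioms om.obs_process_axioms \<theta>s om.lnobs_exp_moment om.ergodic_map_shift)+
  define E where "E = equiv_params p q \<Theta> \<theta>s"
  have E: "\<theta>s \<in> E" "E \<subseteq> \<Theta>" using \<theta>s by (auto simp: E_def equiv_params_def)
  have near: "AE y in law_Y p q \<theta>s. eventually (\<lambda>n. dist_to_set \<Delta> (\<theta>hat n y) E < \<epsilon>) sequentially" if \<epsilon>: "0 < \<epsilon>" for \<epsilon>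
  proof -
    define O' where "O' = (\<Union>t\<in>E. M.mball t \<epsilon>)"
    have "openin M.mtopology O'" unfolding O'_def by (intro openin_Union) auto
    then have "openin (top_of_set \<Theta>) O'" by (simp only: top)
    then obtain U where U: "open U" "O' = \<Theta> \<inter> U" by (auto simp: openin_open)
    have "AE y in law_Y p q \<theta>s. eventually (\<lambda>n. \<theta>hat n y \<in> \<Theta> \<inter> U) sequentially"
    proof (rule mm.mle_eventually_in_neighbourhood[OF mle U(1)])
      fix \<theta> assume \<theta>: "\<theta> \<in> \<Theta>" and eq: "AE y in law_Y p q \<theta>s. filt p \<theta> 0 y = filt p \<theta>s 0 y"
      have ol: "obs_law p \<theta> (law_Y p q \<theta>s)" by (rule obs_law_cong[OF m.obs_law_Y eq])
      obtain B1 C1 \<rho>1 where "model p q \<theta> B1 C1 \<rho>1" using mod[OF \<theta>] by blast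
      then interpret m1: model p q \<theta> B1 C1 \<rho>1 .
      \<comment> \<open>The law under \<theta>s is also an observation law for \<theta>, and the
        latter has only one.\<close>
      have "\<theta> \<in> E" using m1.law_Y_unique[OF ol] \<theta> by (simp add: E_def equiv_params_def)
      then have "\<theta> \<in> O'" unfolding O'_def using \<theta> \<epsilon> by (intro UN_I[of \<theta>]) auto
      then show "\<theta> \<in> U" by (simp add: U(2))
    qed
    then show ?thesis
    proof (rule AE_mp, intro AE_I2 impI)
      fix y assume "eventually (\<lambda>n. \<theta>hat n y \<in> \<Theta> \<inter> U) sequentially"
      then show "eventually (\<lambda>n. dist_to_set \<Delta> (\<theta>hat n y) E < \<epsilon>) sequentially"
      proof eventually_elim
        case (elim n)
        then obtain t where t: "t \<in> E" "\<theta>hat n y \<in> M.mball t \<epsilon>" unfolding U(2)[symmetric] O'_def by blast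
        have "bdd_below (\<Delta> (\<theta>hat n y) ` E)" by (rule bdd_belowI2[of _ 0]) simp
        then have "dist_to_set \<Delta> (\<theta>hat n y) E \<le> \<Delta> (\<theta>hat n y) t"
          unfolding dist_to_set_def using t(1) by (rule cINF_lower)
        also have "\<dots> < \<epsilon>" using t(2) by (simp add: M.commute)
        finally show ?case .
      qed
    qed
  qed
  have "AE y in law_Y p q \<theta>s. \<forall>i. eventually (\<lambda>n. dist_to_set \<Delta> (\<theta>hat n y) E < 1 / real (Suc i)) sequentially"
    unfolding AE_all_countable by (intro allI near) simp
  then show ?thesis
  proof (rule AE_mp, intro AE_I2 impI)
    fix y assume *: "\<forall>i. eventually (\<lambda>n. dist_to_set \<Delta> (\<theta>hat n y) E < 1 / real (Suc i)) sequentially"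
    have nn: "0 \<le> dist_to_set \<Delta> t E" for t
      unfolding dist_to_set_def using E(1) by (intro cINF_greatest) auto
    have "(\<lambda>n. dist_to_set \<Delta> (\<theta>hat n y) E) \<longlonglongrightarrow> 0"
    proof (rule tendstoI)
      fix e :: real assume "0 < e"
      then obtain i where i: "1 / real (Suc i) < e" using nat_approx_posE by blast
      show "eventually (\<lambda>n. dist (dist_to_set \<Delta> (\<theta>hat n y) E) 0 < e) sequentially"
        using *[rule_format, of i] by eventually_elim (use i nn in \<open>simp add: dist_real_def\<close>)
    qed
    then show "(\<lambda>n. dist_to_set \<Delta> (\<theta>hat n y) (equiv_params p q \<Theta> \<theta>s)) \<longlonglongrightarrow> 0" by (simp add: E_def)
  qed
qed

theorem theorem4:
  fixes p q :: nat and \<Theta> :: "param set" and \<Delta> :: "param \<Rightarrow> param \<Rightarrow> real"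
  assumes p: "p \<ge> 1" and q: "q \<ge> 1"
    and Theta_sub: "\<Theta> \<subseteq> param_space p q"
    and Theta_compact: "compact \<Theta>"
    and Delta_metric: "Metric_space \<Theta> \<Delta>"
    and Delta_topology: "Metric_space.mtopology \<Theta> \<Delta> = top_of_set \<Theta>"
    and contraction: "\<And>\<theta> x. \<theta> \<in> \<Theta> \<Longrightarrow>
      (\<lambda>m. Max ((\<lambda>w. \<bar>psi_hat p q \<theta> m w x\<bar>) ` binary_words q m)) \<longlonglongrightarrow> 0"
  shows
    "(\<forall>\<theta>\<in>\<Theta>. (\<exists>!P. stationary_law p q \<theta> P) \<and>
        (\<forall>\<tau>>0. (\<integral>\<^sup>+ x. ennreal (exp (\<tau> * \<bar>x\<bar>)) \<partial>law_X0 p q \<theta>) < \<infinity>)) \<and>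
     (\<forall>x1 y1 \<theta>hat. is_cond_mle p q \<Theta> (const_init x1 y1) \<theta>hat \<longrightarrow>
        (\<forall>\<theta>\<^sub>s\<in>\<Theta>. AE y in law_Y p q \<theta>\<^sub>s.
           (\<lambda>n. dist_to_set \<Delta> (\<theta>hat n y) (equiv_params p q \<Theta> \<theta>\<^sub>s)) \<longlonglongrightarrow> 0)) \<and>
     (\<forall>x1 y1 \<theta>hat. is_cond_mle p q \<Theta> (const_init x1 y1) \<theta>hat \<longrightarrow>
        (\<forall>\<theta>\<^sub>s\<in>\<Theta>. (\<nexists>z. poly (P_poly p (ca \<theta>\<^sub>s)) z = 0 \<and> poly (Q_poly q (cb \<theta>\<^sub>s)) z = 0) \<longrightarrow>
           (AE y in law_Y p q \<theta>\<^sub>s. (\<lambda>n. \<Delta> (\<theta>hat n y) \<theta>\<^sub>s) \<longlonglongrightarrow> 0)))"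
proof (intro conjI ballI allI impI)
  have con: "contracting p q \<theta>" if "\<theta> \<in> \<Theta>" for \<theta>
    unfolding contracting_def using contraction[OF that] by blast
  have mod: "\<exists>B C \<rho>. model p q \<theta> B C \<rho>" if "\<theta> \<in> \<Theta>" for \<theta>
  proof -
    have "\<theta> \<in> param_space p q" using Theta_sub that by blast
    from model_exists[OF p q this con[OF that]] show ?thesis by blast
  qed
  note consistent = mle_class_consistent[OF p q Theta_sub Theta_compact Delta_metric Delta_topology con]
  show "\<exists>!P. stationary_law p q \<theta> P" if "\<theta> \<in> \<Theta>" for \<theta>
    using mod[OF that] model.ex1_stationary_law by blast
  show "(\<integral>\<^sup>+ x. ennreal (exp (\<tau> * \<bar>x\<bar>)) \<partial>law_X0 p q \<theta>) < \<infinity>" if "\<theta> \<in> \<Theta>" "0 < \<tau>" for \<theta> \<tau>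
    using mod[OF that(1)] model.law_X0_moment[OF _ that(2)] by blast
  show "AE y in law_Y p q \<theta>s. (\<lambda>n. dist_to_set \<Delta> (\<theta>hat n y) (equiv_params p q \<Theta> \<theta>s)) \<longlonglongrightarrow> 0"
    if "is_cond_mle p q \<Theta> (const_init x1 y1) \<theta>hat" "\<theta>s \<in> \<Theta>" for x1 y1 \<theta>hat \<theta>s
    using consistent that by blast
  show "AE y in law_Y p q \<theta>s. (\<lambda>n. \<Delta> (\<theta>hat n y) \<theta>s) \<longlonglongrightarrow> 0"
    if mle: "is_cond_mle p q \<Theta> (const_init x1 y1) \<theta>hat" and \<theta>s: "\<theta>s \<in> \<Theta>"
      and nc: "\<nexists>z. poly (P_poly p (ca \<theta>s)) z = 0 \<and> poly (Q_poly q (cb \<theta>s)) z = 0" for x1 y1 \<theta>hat \<theta>s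
  proof -
    obtain B C \<rho> where m: "model p q \<theta>s B C \<rho>" using mod[OF \<theta>s] by blast
    \<comment> \<open>Equality of the laws puts both parameters on one and the same observation law,
      the setting in which \<open>identifiable\<close> compares their filters.\<close>
    have "\<theta> = \<theta>s" if \<theta>: "\<theta> \<in> \<Theta>" and eq: "law_Y p q \<theta> = law_Y p q \<theta>s" for \<theta>
    proof -
      obtain B1 C1 \<rho>1 where m1: "model p q \<theta> B1 C1 \<rho>1" using mod[OF \<theta>] by blast
      show ?thesis
        by (rule identifiable[OF m m1 model.obs_law_Y[OF m] _ nc]) (use model.obs_law_Y[OF m1] eq in simp)
    qed
    \<comment> \<open>For a singleton class the distance to the set is \<Delta> to its only point,
      so class consistency is consistency.\<close>
    then have "equiv_params p q \<Theta> \<theta>s = {\<theta>s}" using \<theta>s by (auto simp: equiv_params_def)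
    then show ?thesis using consistent[OF _ mle \<theta>s] by (simp add: dist_to_set_def)
  qed
qed

end
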